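(* Let $0\le\alpha<1/2$ and $-3<\gamma\le1$. Let $$s_{2,\gamma}:=\begin{cases}1/2,&-2<\gamma\le1,\\ 1/2-\epsilon,&\gamma=-2,\\ (3+\gamma)/2,&-3<\gamma<-2,\end{cases}$$ with $0<\epsilon<1/2$. Then the operator $$SK_\alpha: L^2_{0,\gamma/2}(\mathbb{R}^3;\tilde H^s(\mathbb{R}^3))\to L^2_{0,\gamma/2}(\mathbb{R}^3;\tilde H^{s+s_{2,\gamma}}(\mathbb{R}^3))$$ is bounded for any $s\ge0$.
   Context: Fix a measurable function $b$ with $0<b(\cos\theta)\le C_b\cos\theta$ for $0<\theta<\pi/2$ and some $C_b>0$. Let $B_0=2\pi\int_0^{\pi/2}b(\cos\theta)\sin\theta\,d\theta$, $\nu(|v|)=\pi^{-3/2}B_0\int_{\mathbb{R}^3}|v-v_*|^\gamma e^{-|v_*|^2}dv_*$, and for $v\ne v^*$ let $k=k_2-k_1$, $k_1(v,v^* )=\pi^{-3/2}B_0|v-v^*|^\gamma e^{-\frac12(|v|^2+|v^*|^2)}$, $$k_2(v,v^* )=\frac{\pi^{-3/2}}{|v-v^*|}e^{-\frac14|v-v^*|^2-|V_1|^2}\int_{W}e^{-|w+V_2|^2}\frac{(|v-v^*|^2+|w|^2)^{\gamma/2}}{|w||v-v^*|}\big(b(\cos\theta)|w|+b(\sin\theta)|v-v^*|\big)dw,$$ $W=\{w\in\mathbb{R}^3: w\perp v-v^*\}$ (2-dimensional Lebesgue measure), $\cos\theta=|v-v^*|(|v-v^*|^2+|w|^2)^{-1/2}$,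 $\sin\theta=|w|(|v-v^*|^2+|w|^2)^{-1/2}$, $V_1=\frac12\frac{|v|^2-|v^*|^2}{|v-v^*|^2}(v-v^* )$, $V_2=\frac{\{(v-v^* )\cdot v\}v^*-\{(v-v^* )\cdot v^*\}v}{|v-v^*|^2}$. $K_\alpha h(x,v)=\int_{\mathbb{R}^3}k_\alpha(v,v^* )h(x,v^* )dv^*$ with $k_\alpha(v,v^* )=e^{\alpha|v|^2}k(v,v^* )e^{-\alpha|v^*|^2}$. For functions $h$ on $\mathbb{R}^3\times\mathbb{R}^3$, $Sh(x,v)=\int_0^\infty e^{-\nu(|v|)t}h(x-tv,v)\,dt$. For $s\ge0$, $\|u\|_{\tilde H^s(\mathbb{R}^3)}^2=\int_{\mathbb{R}^3}(1+|\xi|^2)^s|\mathcal{F}u(\xi)|^2d\xi$ with $\mathcal{F}$ the Fourier transform, and $\|f\|_{L^2_{0,\gamma/2}(\mathbb{R}^3;\tilde H^s(\mathbb{R}^3))}^2=\int_{\mathbb{R}^3}\|f(\cdot,v)\|_{\tilde H^s(\mathbb{R}^3)}^2(1+|v|)^{\gamma}dv$ (Sobolev regularity is in $x$, the outer variable is $v$). *)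

theory Defs
  imports "HOL-Analysis.Analysis"
begin

type_synonym r3 = "real ^ 3"

text \<open>The angular function \<open>b\<close> only matters on the open interval from 0 to 1.\<close>

definition B0 :: "(real \<Rightarrow> real) \<Rightarrow> real" where
  "B0 b = 2 * pi * (LINT \<theta>:{0<..<pi/2}|lebesgue. b (cos \<theta>) * sin \<theta>)"

definition nu :: "(real \<Rightarrow> real) \<Rightarrow> real \<Rightarrow> r3 \<Rightarrow> real" where
  "nu b \<gamma> v = pi powr (-3/2) * B0 b *
     (LINT u|lebesgue. norm (v - u) powr \<gamma> * exp (- (norm u)\<^sup>2))"

definition k1 :: "(real \<Rightarrow> real) \<Rightarrow> real \<Rightarrow> r3 \<Rightarrow> r3 \<Rightarrow> real" where
  "k1 b \<gamma> v u = pi powr (-3/2) * B0 b * norm (v - u) powr \<gamma> *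
     exp (- (1/2) * ((norm v)\<^sup>2 + (norm u)\<^sup>2))"

text \<open>Integration over the plane through the origin orthogonal to \<open>n \<noteq> 0\<close> with respect to its
  two-dimensional Lebesgue measure, which is the image of Lebesgue measure on the Euclidean plane
  under a linear isometry onto that plane. The choice of the isometry is immaterial because
  Lebesgue measure is invariant under orthogonal maps.\<close>

definition plane_isometry :: "r3 \<Rightarrow> real ^ 2 \<Rightarrow> r3" where
  "plane_isometry n =
     (SOME L. linear L \<and> (\<forall>y. norm (L y) = norm y) \<and> range L = {w. w \<bullet> n = 0})"

definition plane_integral :: "r3 \<Rightarrow> (r3 \<Rightarrow> real) \<Rightarrow> real" where
  "plane_integral n f = (LINT y|lebesgue. f (plane_isometry n y))"

definition V1 :: "r3 \<Rightarrow> r3 \<Rightarrow> r3" where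
  "V1 v u = (1/2 * (((norm v)\<^sup>2 - (norm u)\<^sup>2) / (norm (v - u))\<^sup>2)) *\<^sub>R (v - u)"

definition V2 :: "r3 \<Rightarrow> r3 \<Rightarrow> r3" where
  "V2 v u = (1 / (norm (v - u))\<^sup>2) *\<^sub>R
     (((v - u) \<bullet> v) *\<^sub>R u - ((v - u) \<bullet> u) *\<^sub>R v)"

definition cos_theta :: "r3 \<Rightarrow> r3 \<Rightarrow> real" where
  "cos_theta z w = norm z * ((norm z)\<^sup>2 + (norm w)\<^sup>2) powr (-1/2)"

definition sin_theta :: "r3 \<Rightarrow> r3 \<Rightarrow> real" where
  "sin_theta z w = norm w * ((norm z)\<^sup>2 + (norm w)\<^sup>2) powr (-1/2)"

definition k2 :: "(real \<Rightarrow> real) \<Rightarrow> real \<Rightarrow> r3 \<Rightarrow> r3 \<Rightarrow> real" where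
  "k2 b \<gamma> v u =
     pi powr (-3/2) / norm (v - u) * exp (- (1/4) * (norm (v - u))\<^sup>2 - (norm (V1 v u))\<^sup>2) *
     plane_integral (v - u) (\<lambda>w.
       exp (- (norm (w + V2 v u))\<^sup>2) *
       (((norm (v - u))\<^sup>2 + (norm w)\<^sup>2) powr (\<gamma>/2) / (norm w * norm (v - u))) *
       (b (cos_theta (v - u) w) * norm w + b (sin_theta (v - u) w) * norm (v - u)))"

text \<open>The kernel is meaningful for \<open>v \<noteq> u\<close>; the values on the diagonal are irrelevant, since
  the kernel is only used under an integral in \<open>u\<close>.\<close>

definition k_alpha :: "(real \<Rightarrow> real) \<Rightarrow> real \<Rightarrow> real \<Rightarrow> r3 \<Rightarrow> r3 \<Rightarrow> real" where
  "k_alpha b \<gamma> \<alpha> v u =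
     exp (\<alpha> * (norm v)\<^sup>2) * (k2 b \<gamma> v u - k1 b \<gamma> v u) * exp (- \<alpha> * (norm u)\<^sup>2)"

definition K_integrand ::
  "(real \<Rightarrow> real) \<Rightarrow> real \<Rightarrow> real \<Rightarrow> (r3 \<times> r3 \<Rightarrow> complex) \<Rightarrow> r3 \<times> r3 \<Rightarrow> r3 \<Rightarrow> complex" where
  "K_integrand b \<gamma> \<alpha> h = (\<lambda>(x, v) u. complex_of_real (k_alpha b \<gamma> \<alpha> v u) * h (x, u))"

definition K_op ::
  "(real \<Rightarrow> real) \<Rightarrow> real \<Rightarrow> real \<Rightarrow> (r3 \<times> r3 \<Rightarrow> complex) \<Rightarrow> r3 \<times> r3 \<Rightarrow> complex" where
  "K_op b \<gamma> \<alpha> h p = (LINT u|lebesgue. K_integrand b \<gamma> \<alpha> h p u)"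

definition S_integrand ::
  "(real \<Rightarrow> real) \<Rightarrow> real \<Rightarrow> (r3 \<times> r3 \<Rightarrow> complex) \<Rightarrow> r3 \<times> r3 \<Rightarrow> real \<Rightarrow> complex" where
  "S_integrand b \<gamma> h = (\<lambda>(x, v) t. complex_of_real (exp (- nu b \<gamma> v * t)) * h (x - t *\<^sub>R v, v))"

definition S_op ::
  "(real \<Rightarrow> real) \<Rightarrow> real \<Rightarrow> (r3 \<times> r3 \<Rightarrow> complex) \<Rightarrow> r3 \<times> r3 \<Rightarrow> complex" where
  "S_op b \<gamma> h p = (LINT t:{0<..}|lebesgue. S_integrand b \<gamma> h p t)"

definition L2_fun :: "(r3 \<Rightarrow> complex) set" where
  "L2_fun = {u. u \<in> borel_measurable lebesgue \<and>
                (\<integral>\<^sup>+ x. ennreal ((norm (u x))\<^sup>2) \<partial>lebesgue) < \<infinity>}"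

definition fourier_L1 :: "(r3 \<Rightarrow> complex) \<Rightarrow> r3 \<Rightarrow> complex" where
  "fourier_L1 u \<xi> = complex_of_real ((2 * pi) powr (-3/2)) *
     (LINT x|lebesgue. cis (- (x \<bullet> \<xi>)) * u x)"

text \<open>Plancherel extension to square-integrable functions: the limit in the mean of the transforms
  of the truncations to balls. It is determined almost everywhere.\<close>

definition fourier_L2 :: "(r3 \<Rightarrow> complex) \<Rightarrow> r3 \<Rightarrow> complex" where
  "fourier_L2 u = (SOME g. g \<in> borel_measurable lebesgue \<and>
     (\<lambda>n. \<integral>\<^sup>+ \<xi>. ennreal ((norm (fourier_L1 (\<lambda>x. indicator (cball 0 (real n)) x * u x) \<xi> - g \<xi>))\<^sup>2)
            \<partial>lebesgue) \<longlonglongrightarrow> 0)"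

text \<open>Squared Sobolev norm for \<open>s \<ge> 0\<close>, infinite outside the Sobolev space.\<close>

definition Hs_norm2 :: "real \<Rightarrow> (r3 \<Rightarrow> complex) \<Rightarrow> ennreal" where
  "Hs_norm2 s u = (if u \<in> L2_fun
     then \<integral>\<^sup>+ \<xi>. ennreal ((1 + (norm \<xi>)\<^sup>2) powr s * (norm (fourier_L2 u \<xi>))\<^sup>2) \<partial>lebesgue
     else \<infinity>)"

text \<open>The first argument of \<open>f\<close> is the position, in which Sobolev regularity is measured; the
  second is the velocity, which carries the weight. Elements of the space are represented by
  functions, identified when they agree almost everywhere.\<close>

definition L2Hs_norm2 :: "real \<Rightarrow> real \<Rightarrow> (r3 \<times> r3 \<Rightarrow> complex) \<Rightarrow> ennreal" where
  "L2Hs_norm2 \<gamma> s f =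
     (\<integral>\<^sup>+ v. Hs_norm2 s (\<lambda>x. f (x, v)) * ennreal ((1 + norm v) powr \<gamma>) \<partial>lebesgue)"

definition L2Hs_norm :: "real \<Rightarrow> real \<Rightarrow> (r3 \<times> r3 \<Rightarrow> complex) \<Rightarrow> real" where
  "L2Hs_norm \<gamma> s f = sqrt (enn2real (L2Hs_norm2 \<gamma> s f))"

definition L2Hs :: "real \<Rightarrow> real \<Rightarrow> (r3 \<times> r3 \<Rightarrow> complex) set" where
  "L2Hs \<gamma> s = {f. f \<in> borel_measurable lebesgue \<and> L2Hs_norm2 \<gamma> s f < \<infinity>}"

text \<open>Linearity is required modulo null sets. Together with the bound, it implies that \<open>T\<close>
  respects equality almost everywhere.\<close>

definition bounded_L2Hs_operator ::
  "real \<Rightarrow> real \<Rightarrow> real \<Rightarrow> ((r3 \<times> r3 \<Rightarrow> complex) \<Rightarrow> r3 \<times> r3 \<Rightarrow> complex) \<Rightarrow> bool" where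
  "bounded_L2Hs_operator \<gamma> s s' T \<longleftrightarrow>
     (\<forall>f\<in>L2Hs \<gamma> s. \<forall>g\<in>L2Hs \<gamma> s. \<forall>a c.
        AE p in lebesgue. T (\<lambda>q. a * f q + c * g q) p = a * T f p + c * T g p) \<and>
     (\<exists>C. \<forall>f\<in>L2Hs \<gamma> s. T f \<in> L2Hs \<gamma> s' \<and> L2Hs_norm \<gamma> s' (T f) \<le> C * L2Hs_norm \<gamma> s f)"

definition s2 :: "real \<Rightarrow> real \<Rightarrow> real" where
  "s2 \<epsilon> \<gamma> = (if -2 < \<gamma> then 1/2 else if \<gamma> = -2 then 1/2 - \<epsilon> else (3 + \<gamma>) / 2)"

end

theory Submission
  imports Defs "HOL-Probability.Probability"
begin

text \<open>The partial Fourier transform in \<open>x\<close> turns \<open>S\<close> into division by \<open>\<nu> + i (v \<bullet> \<xi>)\<close> and leaves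
  \<open>K\<^sub>\<alpha>\<close> unchanged, so the claim becomes the weighted estimate
  \[ \int \frac{(1+|v|)^\gamma}{\nu(v)^2+(v\cdot\xi)^2} \Big(\int |k_\alpha(v,u)|\, g(u)\, du\Big)^2 dv
     \le C (1+|\xi|^2)^{-s_2} \int (1+|u|)^\gamma g(u)^2\, du \]
  for every frequency \<open>\<xi>\<close> separately. The kernel satisfies
  \<open>\<bar>k\<^sub>\<alpha>(v,u)\<bar> \<le> C (1+|v|)\<close>$^{\gamma-1}|v-u|^{-\beta}(1+|v-u|)^{-8}$ with a suitable $\beta \in (1,3)$, and
  $\nu(v) \ge c\min(1,(1+|v|)^\gamma)$. By the Cauchy-Schwarz inequality everything reduces to
  \[ \int |v-u|^{-\beta}(1+|v-u|)^{-4} \frac{dv}{1+(v\cdot\xi)^2} \le C (1+|\xi|)^{-\min(1,3-\beta)}, \]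
  which follows from the layer-cake formula, since the ball of radius \<open>r\<close> around \<open>u\<close> contributes at
  most a constant times $\min(r^3, r^2/|\xi|)$ to the integral of $1/(1+(v\cdot\xi)^2)$.

  Fubini's theorem gives the formula for the transform of \<open>SK\<^sub>\<alpha>h\<close> only for \<open>h\<close> integrable in \<open>x\<close>;
  truncation in \<open>x\<close> and Plancherel's theorem, which is proved by Gaussian regularization, extend
  the estimate to the \<open>L\<^sup>2\<close> transform. Since only boundedness is claimed, the triangle inequality in
  \<open>L\<^sup>2\<close> is replaced by $|a+b|^2 \le 2|a|^2+2|b|^2$ throughout.\<close>

subsection \<open>Square-integrable functions\<close>

text \<open>The factor (1+|v|)^(\<gamma>-1) in the kernel bound answers the degeneracy of \<nu>,
  which may tend to 0 at infinity when \<gamma> < 0. That factor is at most 1 and at most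
  (1+|v|)^\<gamma>, hence at most a multiple of \<nu>, so its square turns 1/(\<nu>^2+(v.\<xi>)^2)
  into a multiple of 1/(1+(v.\<xi>)^2). Of the eight powers of 1+|v-u|, four pay for moving the
  velocity weight from v to u and four make the averaging integral converge. The obstacle that
  shapes the proof is measurability. \<open>fourier_L2\<close> is chosen separately on each section,
  so Sobolev norms of sections are not known to be measurable in v; \<open>nn_integral\<close> is
  still monotone on them, but additivity and monotone convergence cannot be invoked. They are
  therefore only compared with measurable functions, made from L1 transforms of truncations. The
  unbounded Sobolev weight is cut to a ball of radius R while the truncation is removed, and R tends
  to infinity afterwards. Likewise b is only Lebesgue measurable and the isometries onto the planes
  are arbitrary; both are exchanged for Borel objects before Tonelli's theorem is applied to the
  kernel.\<close>

definition sqint :: "'a measure \<Rightarrow> ('a \<Rightarrow> 'b::real_normed_vector) \<Rightarrow> ennreal" where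
  "sqint M f = (\<integral>\<^sup>+x. ennreal ((norm (f x))\<^sup>2) \<partial>M)"

lemma norm_add_sq_le:
  fixes a b :: "'a::real_normed_vector"
  shows "(norm (a + b))\<^sup>2 \<le> 2 * (norm a)\<^sup>2 + 2 * (norm b)\<^sup>2"
proof -
  have "(norm (a + b))\<^sup>2 \<le> (norm a + norm b)\<^sup>2"
    by (simp add: norm_triangle_ineq power_mono)
  also have "\<dots> \<le> 2 * (norm a)\<^sup>2 + 2 * (norm b)\<^sup>2"
    using sum_squares_bound[of "norm a" "norm b"] by (simp add: power2_sum)
  finally show ?thesis .
qed

lemma sqint_mono:
  assumes "\<And>x. norm (f x) \<le> norm (g x)"
  shows "sqint M f \<le> sqint M g"
  unfolding sqint_def by (intro nn_integral_mono ennreal_leI power_mono assms) auto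

lemma sqint_cong_AE:
  assumes "AE x in M. f x = g x"
  shows "sqint M f = sqint M g"
  unfolding sqint_def by (rule nn_integral_cong_AE) (use assms in auto)

lemma sqint_add_le:
  fixes f g :: "'a \<Rightarrow> 'b::{real_normed_vector, second_countable_topology}"
  assumes [measurable]: "f \<in> borel_measurable M" "g \<in> borel_measurable M"
  shows "sqint M (\<lambda>x. f x + g x) \<le> 2 * sqint M f + 2 * sqint M g"
proof -
  have "sqint M (\<lambda>x. f x + g x) \<le> (\<integral>\<^sup>+x. 2 * ennreal ((norm (f x))\<^sup>2) + 2 * ennreal ((norm (g x))\<^sup>2) \<partial>M)"
    unfolding sqint_def
  proof (intro nn_integral_mono)
    fix x
    have "ennreal ((norm (f x + g x))\<^sup>2) \<le> ennreal (2 * (norm (f x))\<^sup>2 + 2 * (norm (g x))\<^sup>2)"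
      by (intro ennreal_leI norm_add_sq_le)
    also have "\<dots> = 2 * ennreal ((norm (f x))\<^sup>2) + 2 * ennreal ((norm (g x))\<^sup>2)"
      by (simp add: ennreal_plus ennreal_mult)
    finally show "ennreal ((norm (f x + g x))\<^sup>2) \<le> 2 * ennreal ((norm (f x))\<^sup>2) + 2 * ennreal ((norm (g x))\<^sup>2)" .
  qed
  also have "\<dots> = 2 * sqint M f + 2 * sqint M g"
    unfolding sqint_def by (simp add: nn_integral_add nn_integral_cmult)
  finally show ?thesis .
qed

lemma sqint_diff_triangle:
  fixes f g h :: "'a \<Rightarrow> 'b::{real_normed_vector, second_countable_topology}"
  assumes [measurable]: "f \<in> borel_measurable M" "g \<in> borel_measurable M" "h \<in> borel_measurable M"
  shows "sqint M (\<lambda>x. f x - h x) \<le> 2 * sqint M (\<lambda>x. f x - g x) + 2 * sqint M (\<lambda>x. g x - h x)"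
  using sqint_add_le[of "\<lambda>x. f x - g x" M "\<lambda>x. g x - h x"] by simp

lemma sqint_diff_commute:
  "sqint M (\<lambda>x. f x - g x) = sqint M (\<lambda>x. g x - f x)"
  unfolding sqint_def by (simp add: norm_minus_commute)

text \<open>Riesz-Fischer. Along a subsequence the squared distances are at most 4^-k, so they stay
  summable after multiplication by 2^k; then 2 |d| <= 2^-k + 2^k |d|^2 gives absolute summability of
  the increments at almost every point.\<close>

theorem L2_complete:
  fixes u :: "nat \<Rightarrow> 'a \<Rightarrow> 'b::{banach, second_countable_topology}"
  assumes meas[measurable]: "\<And>n. u n \<in> borel_measurable M"
    and Cauchy: "\<And>e. e > 0 \<Longrightarrow> \<exists>N. \<forall>m\<ge>N. \<forall>n\<ge>N. sqint M (\<lambda>x. u m x - u n x) < ennreal e"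
  shows "\<exists>v\<in>borel_measurable M. (\<lambda>n. sqint M (\<lambda>x. u n x - v x)) \<longlonglongrightarrow> 0"
proof -
  have "\<forall>k. \<exists>N. \<forall>m\<ge>N. \<forall>n\<ge>N. sqint M (\<lambda>x. u m x - u n x) < ennreal ((1/4) ^ k)"
    using Cauchy by simp
  then obtain N where N: "\<And>k m n. m \<ge> N k \<Longrightarrow> n \<ge> N k \<Longrightarrow> sqint M (\<lambda>x. u m x - u n x) < ennreal ((1/4) ^ k)"
    by metis
  \<comment> \<open>Adding \<open>k\<close> and summing all thresholds up to \<open>k\<close> makes
    \<open>r\<close> increasing, at least \<open>k\<close>, and at least \<open>N k\<close> at
    once.\<close>
  define r where "r k = k + (\<Sum>i\<le>k. N i)" for k
  have rN: "N k \<le> r k" for k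
    unfolding r_def by (metis atMost_iff finite_atMost le_refl member_le_sum trans_le_add2 zero_le)
  have rmono: "r k \<le> r (Suc k)" for k unfolding r_def by simp
  have rge: "k \<le> r k" for k unfolding r_def by simp
  define d where "d k x = u (r (Suc k)) x - u (r k) x" for k x
  have [measurable]: "d k \<in> borel_measurable M" for k unfolding d_def by measurable
  have dk: "sqint M (d k) \<le> ennreal ((1/4) ^ k)" for k
    unfolding d_def using N[of k "r (Suc k)" "r k"] rN[of k] rmono[of k] by (simp add: less_imp_le)
  have "(\<integral>\<^sup>+x. (\<Sum>k. ennreal (2 ^ k * (norm (d k x))\<^sup>2)) \<partial>M) = (\<Sum>k. ennreal (2^k) * sqint M (d k))"
    unfolding sqint_def by (simp add: nn_integral_suminf nn_integral_cmult ennreal_mult)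
  also have "\<dots> \<le> (\<Sum>k. ennreal ((1/2) ^ k))"
  proof (intro suminf_le)
    fix k
    have "ennreal (2^k) * sqint M (d k) \<le> ennreal (2^k) * ennreal ((1/4) ^ k)"
      by (intro mult_left_mono dk) auto
    also have "\<dots> = ennreal (2^k * (1/4)^k)" by (simp add: ennreal_mult)
    also have "(2::real)^k * (1/4)^k = (1/2)^k" by (simp add: power_mult_distrib[symmetric])
    finally show "ennreal (2^k) * sqint M (d k) \<le> ennreal ((1/2) ^ k)" .
  qed auto
  also have "\<dots> < \<infinity>"
    by (subst suminf_ennreal2) (auto intro!: summable_geometric)
  finally have "(\<integral>\<^sup>+x. (\<Sum>k. ennreal (2 ^ k * (norm (d k x))\<^sup>2)) \<partial>M) \<noteq> \<infinity>" by simp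
  then have "AE x in M. (\<Sum>k. ennreal (2 ^ k * (norm (d k x))\<^sup>2)) \<noteq> \<infinity>"
    by (intro nn_integral_PInf_AE) auto
  then have conv: "AE x in M. convergent (\<lambda>k. u (r k) x)"
  proof eventually_elim
    case (elim x)
    have s1: "summable (\<lambda>k. 2 ^ k * (norm (d k x))\<^sup>2)"
      using elim by (intro summable_suminf_not_top) auto
    have "summable (\<lambda>k. norm (d k x))"
    proof (rule summable_comparison_test')
      show "summable (\<lambda>k. (1/2)^k + 2 ^ k * (norm (d k x))\<^sup>2)"
        by (intro summable_add s1 summable_geometric) auto
      fix k :: nat
      have "2 * norm (d k x) = 2 * ((1/2)^k) * (2^k * norm (d k x))"
        by (simp add: power_one_over)
      also have "\<dots> \<le> (1/2)^k * (1 + (2^k * norm (d k x))\<^sup>2)"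
        using sum_squares_bound[of 1 "2^k * norm (d k x)"]
        by (simp add: mult.assoc mult_left_mono)
      also have "\<dots> = (1/2)^k + 2 ^ k * (norm (d k x))\<^sup>2"
        by (simp add: power_mult_distrib power2_eq_square algebra_simps power_one_over)
      finally show "norm (norm (d k x)) \<le> (1/2)^k + 2 ^ k * (norm (d k x))\<^sup>2"
        by simp (smt (verit) norm_ge_zero)
    qed
    then have "summable (\<lambda>k. d k x)" by (rule summable_norm_cancel)
    then have "convergent (\<lambda>k. \<Sum>i<k. d i x)"
      by (simp add: summable_iff_convergent)
    moreover have "(\<Sum>i<k. d i x) = u (r k) x - u (r 0) x" for k
      unfolding d_def by (rule sum_lessThan_telescope)
    ultimately have "convergent (\<lambda>k. u (r k) x - u (r 0) x)" by simp
    then have "convergent (\<lambda>k. (u (r k) x - u (r 0) x) + u (r 0) x)"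
      by (intro convergent_add convergent_const)
    then show "convergent (\<lambda>k. u (r k) x)" by simp
  qed
  define v where "v x = lim (\<lambda>k. u (r k) x)" for x
  have [measurable]: "v \<in> borel_measurable M"
    unfolding v_def by (intro borel_measurable_lim_metric) auto
  have lim: "AE x in M. (\<lambda>k. u (r k) x) \<longlonglongrightarrow> v x"
    using conv by eventually_elim (simp add: v_def convergent_LIMSEQ_iff)
  have "(\<lambda>n. sqint M (\<lambda>x. u n x - v x)) \<longlonglongrightarrow> 0"
  proof (rule tendsto_zero_ennreal)
    fix e :: real assume e: "0 < e"
    obtain K where K: "\<And>m n. m \<ge> K \<Longrightarrow> n \<ge> K \<Longrightarrow> sqint M (\<lambda>x. u m x - u n x) < ennreal (e/2)"
      using Cauchy[of "e/2"] e by auto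
    have "sqint M (\<lambda>x. u n x - v x) < ennreal e" if n: "n \<ge> K" for n
    proof -
      \<comment> \<open>Fatou's lemma passes to the limit in the second function, which turns the
        Cauchy property into convergence of the whole sequence.\<close>
      have "sqint M (\<lambda>x. u n x - v x) = (\<integral>\<^sup>+x. liminf (\<lambda>k. ennreal ((norm (u n x - u (r k) x))\<^sup>2)) \<partial>M)"
        unfolding sqint_def
      proof (intro nn_integral_cong_AE)
        show "AE x in M. ennreal ((norm (u n x - v x))\<^sup>2) = liminf (\<lambda>k. ennreal ((norm (u n x - u (r k) x))\<^sup>2))"
          using lim
        proof eventually_elim
          case (elim x)
          have "(\<lambda>k. ennreal ((norm (u n x - u (r k) x))\<^sup>2)) \<longlonglongrightarrow> ennreal ((norm (u n x - v x))\<^sup>2)"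
            by (intro tendsto_intros elim)
          from lim_imp_Liminf[OF _ this] show ?case by simp
        qed
      qed
      also have "\<dots> \<le> liminf (\<lambda>k. sqint M (\<lambda>x. u n x - u (r k) x))"
        unfolding sqint_def by (intro nn_integral_liminf) auto
      also have "\<dots> \<le> ennreal (e/2)"
      proof -
        have "\<forall>\<^sub>F k in sequentially. sqint M (\<lambda>x. u n x - u (r k) x) \<le> ennreal (e/2)"
          using eventually_ge_at_top[of K]
        proof eventually_elim
          case (elim k)
          then show ?case using K[of n "r k"] rge[of k] n by (simp add: less_imp_le)
        qed
        from Liminf_mono[OF this] show ?thesis
          by (simp add: Liminf_const)
      qed
      also have "\<dots> < ennreal e" using e by (simp add: ennreal_less_iff)
      finally show ?thesis .
    qed
    then show "\<forall>\<^sub>F n in sequentially. sqint M (\<lambda>x. u n x - v x) < ennreal e"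
      by (rule eventually_sequentiallyI)
  qed
  then show ?thesis by (intro bexI[of _ v]) auto
qed

lemma tendsto_sqint_dominated:
  fixes u :: "nat \<Rightarrow> 'a \<Rightarrow> 'b::{real_normed_vector, second_countable_topology}" and w :: "'a \<Rightarrow> real"
  assumes [measurable]: "\<And>n. u n \<in> borel_measurable M" "v \<in> borel_measurable M" "w \<in> borel_measurable M"
    and lim: "AE x in M. (\<lambda>n. u n x) \<longlonglongrightarrow> v x"
    and bound: "\<And>n. AE x in M. norm (u n x - v x) \<le> w x"
    and w: "sqint M w < \<infinity>"
  shows "(\<lambda>n. sqint M (\<lambda>x. u n x - v x)) \<longlonglongrightarrow> 0"
proof -
  have "(\<lambda>n. \<integral>\<^sup>+x. ennreal ((norm (u n x - v x))\<^sup>2) \<partial>M) \<longlonglongrightarrow> (\<integral>\<^sup>+x. 0 \<partial>M)"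
  proof (rule nn_integral_dominated_convergence[where w="\<lambda>x. ennreal ((w x)\<^sup>2)"])
    show "AE x in M. ennreal ((norm (u n x - v x))\<^sup>2) \<le> ennreal ((w x)\<^sup>2)" for n
      using bound[of n] by eventually_elim (auto intro!: ennreal_leI power_mono)
    show "(\<integral>\<^sup>+x. ennreal ((w x)\<^sup>2) \<partial>M) < \<infinity>" using w by (simp add: sqint_def)
    show "AE x in M. (\<lambda>n. ennreal ((norm (u n x - v x))\<^sup>2)) \<longlonglongrightarrow> 0"
      using lim
    proof eventually_elim
      case (elim x)
      then have "(\<lambda>n. ennreal ((norm (u n x - v x))\<^sup>2)) \<longlonglongrightarrow> ennreal ((norm (v x - v x))\<^sup>2)"
        by (intro tendsto_intros)
      then show ?case by simp
    qed
  qed auto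
  then show ?thesis by (simp add: sqint_def)
qed

section \<open>Approximation by continuous functions and continuity of translations in L2\<close>

lemma sqint_const_on_cball:
  fixes m R :: real
  shows "sqint lborel (\<lambda>x::'a::euclidean_space. m * indicator (cball 0 R) x) < \<infinity>"
proof -
  have "sqint lborel (\<lambda>x::'a. m * indicator (cball 0 R) x) = (\<integral>\<^sup>+x. ennreal (m\<^sup>2) * indicator (cball 0 R) (x::'a) \<partial>lborel)"
    unfolding sqint_def by (intro nn_integral_cong) (auto split: split_indicator)
  also have "\<dots> < \<infinity>"
    using emeasure_lborel_cball_finite[of "0::'a" R]
    by (simp add: nn_integral_cmult_indicator ennreal_mult_less_top)
  finally show ?thesis .
qed

text \<open>After reduction to a bounded function with bounded support, an almost everywhere limit
  of continuous functions is clipped in size and in support. The clipping does not change the limit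
  and supplies the dominating function for convergence in L2.\<close>

lemma L2_dense_continuous:
  fixes u :: "'a::euclidean_space \<Rightarrow> complex"
  assumes [measurable]: "u \<in> borel_measurable borel" and fin: "sqint lborel u < \<infinity>" and e: "e > 0"
  obtains g M R where "continuous_on UNIV g" "\<And>x. norm (g x) \<le> M * indicator (cball 0 R) x"
    "sqint lborel (\<lambda>x. u x - g x) < ennreal e"
proof -
  define U where "U n x = (if norm x \<le> real n \<and> norm (u x) \<le> real n then u x else 0)" for n x
  have [measurable]: "U n \<in> borel_measurable borel" for n unfolding U_def by measurable
  have "(\<lambda>n. sqint lborel (\<lambda>x. U n x - u x)) \<longlonglongrightarrow> 0"
  proof (rule tendsto_sqint_dominated[where w="\<lambda>x. norm (u x)"])
    show "AE x in lborel. (\<lambda>n. U n x) \<longlonglongrightarrow> u x"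
    proof (intro AE_I2 tendsto_eventually)
      fix x
      show "\<forall>\<^sub>F n in sequentially. U n x = u x"
        using eventually_ge_at_top[of "nat \<lceil>max (norm x) (norm (u x))\<rceil>"]
        by eventually_elim (auto simp: U_def nat_le_iff ceiling_le_iff)
    qed
    show "sqint lborel (\<lambda>x. norm (u x)) < \<infinity>" using fin by (simp add: sqint_def)
  qed (auto simp: U_def)
  then obtain m where m: "sqint lborel (\<lambda>x. U m x - u x) < ennreal (e/4)"
    using e order_tendstoD(2)[of _ 0 sequentially "ennreal (e/4)"]
    by (metis (no_types, lifting) divide_pos_pos ennreal_less_zero_iff eventually_sequentially order_refl zero_less_numeral)
  \<comment> \<open>This yields continuous functions converging off a negligible set, but with no
    control of their size or support; \<open>c\<close> and \<open>cut\<close> add that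
    control.\<close>
  have "U m measurable_on UNIV"
    by (intro lebesgue_measurable_imp_measurable_on measurable_completion) auto
  then obtain N g where N: "negligible N" and g: "\<And>n. continuous_on UNIV (g n)"
    and lim: "\<And>x. x \<notin> N \<Longrightarrow> (\<lambda>n. g n x) \<longlonglongrightarrow> U m x"
    unfolding measurable_on_def by auto
  \<comment> \<open>Radial retraction onto the disc of radius \<open>m\<close>. It is the identity
    on the values of \<open>U m\<close>, and \<open>cut\<close> is 1 on the ball of radius
    \<open>m\<close> outside which \<open>U m\<close> vanishes.\<close>
  define c where "c z = (real m / max (real m) (norm z)) *\<^sub>R z" for z :: complex
  define cut where "cut x = max 0 (min 1 (real m + 1 - norm x))" for x :: 'a
  define G where "G n x = cut x *\<^sub>R c (g n x)" for n x
  have c_norm: "norm (c z) \<le> real m" for z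
  proof (cases "norm z \<le> real m")
    case True
    then show ?thesis by (cases "real m = 0") (auto simp: c_def)
  next
    case False
    then show ?thesis by (auto simp: c_def max_def)
  qed
  have c_cont: "isCont c z" if "m > 0" for z
    unfolding c_def using that by (intro continuous_intros) auto
  have cut_cont: "continuous_on UNIV cut" unfolding cut_def by (intro continuous_intros)
  show ?thesis
  proof (cases "m = 0")
    \<comment> \<open>For \<open>m = 0\<close> the retraction is not continuous at 0, but then
      \<open>U m\<close> vanishes identically and the zero function is the approximation.\<close>
    case True
    have "sqint lborel (\<lambda>x. U m x - u x) = sqint lborel (\<lambda>x. u x - 0)"
      using True unfolding sqint_def U_def by (intro nn_integral_cong) (auto simp: norm_minus_commute)
    then have "sqint lborel (\<lambda>x. u x - 0) < ennreal e"
      using m e by (simp add: order_less_le_trans[of _ "ennreal (e/4)"] ennreal_leI)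
    then show ?thesis by (intro that[of "\<lambda>_. 0" 0 0]) auto
  next
    case False
    then have m0: "m > 0" by simp
    have "continuous_on UNIV c"
      by (simp add: continuous_at_imp_continuous_on c_cont m0)
    then have Gcont: "continuous_on UNIV (G n)" for n
      unfolding G_def
      by (intro continuous_intros cut_cont continuous_on_compose2[OF _ g[of n], of UNIV c]) auto
    then have [measurable]: "G n \<in> borel_measurable borel" for n
      by (rule borel_measurable_continuous_onI)
    have Gb: "norm (G n x) \<le> real m * indicator (cball 0 (real m + 1)) x" for n x
    proof (cases "norm x \<le> real m + 1")
      case True
      have "norm (G n x) \<le> 1 * real m" unfolding G_def norm_scaleR
        by (intro mult_mono c_norm) (auto simp: cut_def)
      then show ?thesis using True by simp
    next
      case False
      then show ?thesis by (simp add: G_def cut_def)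
    qed
    have Ub: "norm (U m x) \<le> real m * indicator (cball 0 (real m + 1)) x" for x
      by (auto simp: U_def)
    have "(\<lambda>n. sqint lborel (\<lambda>x. G n x - U m x)) \<longlonglongrightarrow> 0"
    proof (rule tendsto_sqint_dominated[where w="\<lambda>x. (2 * real m) * indicator (cball 0 (real m + 1)) x"])
      show "AE x in lborel. norm (G n x - U m x) \<le> 2 * real m * indicator (cball 0 (real m + 1)) x" for n
      proof (intro AE_I2)
        fix x
        show "norm (G n x - U m x) \<le> 2 * real m * indicator (cball 0 (real m + 1)) x"
          using norm_triangle_ineq4[of "G n x" "U m x"] Gb[of n x] Ub[of x] by linarith
      qed
      have "AE x in lebesgue. x \<notin> N" using N by (simp add: AE_not_in negligible_iff_null_sets)
      then have "AE x in lborel. x \<notin> N" by (simp add: AE_completion_iff)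
      then show "AE x in lborel. (\<lambda>n. G n x) \<longlonglongrightarrow> U m x"
      proof eventually_elim
        case (elim x)
        have "(\<lambda>n. cut x *\<^sub>R c (g n x)) \<longlonglongrightarrow> cut x *\<^sub>R c (U m x)"
          by (intro tendsto_intros isCont_tendsto_compose[OF c_cont[OF m0]] lim elim)
        also have "cut x *\<^sub>R c (U m x) = U m x"
          using m0 by (auto simp: cut_def c_def U_def)
        finally show ?case by (simp add: G_def)
      qed
    qed (use sqint_const_on_cball[of "2 * real m" "real m + 1"] in \<open>auto simp: mult.assoc intro!: borel_measurable_times borel_measurable_indicator borel_closed\<close>)
    then obtain n where n: "sqint lborel (\<lambda>x. G n x - U m x) < ennreal (e/4)"
      using e order_tendstoD(2)[of _ 0 sequentially "ennreal (e/4)"]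
      by (metis (no_types, lifting) divide_pos_pos ennreal_less_zero_iff eventually_sequentially order_refl zero_less_numeral)
    have "sqint lborel (\<lambda>x. u x - G n x) \<le> 2 * sqint lborel (\<lambda>x. u x - U m x) + 2 * sqint lborel (\<lambda>x. U m x - G n x)"
      by (rule sqint_diff_triangle) auto
    also have "\<dots> = 2 * (sqint lborel (\<lambda>x. U m x - u x) + sqint lborel (\<lambda>x. G n x - U m x))"
      by (simp add: sqint_diff_commute[of _ u] sqint_diff_commute[of _ "U m" "G n"] distrib_left)
    also have "\<dots> < 2 * (ennreal (e/4) + ennreal (e/4))"
      by (intro ennreal_mult_strict_left_mono add_strict_mono m n) auto
    also have "\<dots> = ennreal e"
      using e by (simp flip: ennreal_plus ennreal_numeral ennreal_mult)
    finally show ?thesis using Gcont[of n] Gb[of n] by (intro that) auto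
  qed
qed

lemma sqint_shift:
  fixes u :: "'a::euclidean_space \<Rightarrow> 'b::{real_normed_vector, second_countable_topology}"
  assumes [measurable]: "u \<in> borel_measurable borel"
  shows "sqint lborel (\<lambda>x. u (x + h)) = sqint lborel u"
proof -
  have "sqint lborel u = sqint (distr lborel borel ((+) h)) u" by (simp add: lborel_distr_plus)
  also have "\<dots> = sqint lborel (\<lambda>x. u (x + h))"
    unfolding sqint_def by (subst nn_integral_distr) (auto simp: add.commute)
  finally show ?thesis by simp
qed

text \<open>By density it suffices to move a continuous function supported in a ball. Its translates
  by the bounded sequence \<open>h\<close> all live in one larger ball, so dominated convergence
  applies.\<close>

lemma L2_translation_continuous:
  fixes u :: "'a::euclidean_space \<Rightarrow> complex"
  assumes [measurable]: "u \<in> borel_measurable borel" and fin: "sqint lborel u < \<infinity>"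
    and h: "h \<longlonglongrightarrow> 0"
  shows "(\<lambda>n. sqint lborel (\<lambda>x. u (x + h n) - u x)) \<longlonglongrightarrow> 0"
proof (rule tendsto_zero_ennreal)
  fix e :: real assume e: "0 < e"
  \<comment> \<open>The three-term comparison through \<open>g\<close> costs 2 + 2 (2 + 2) = 10
    times this tolerance, that is \<open>e/2\<close>.\<close>
  obtain g M R where g: "continuous_on UNIV g" and gb: "\<And>x. norm (g x) \<le> M * indicator (cball 0 R) x"
    and ug: "sqint lborel (\<lambda>x. u x - g x) < ennreal (e/20)"
    using L2_dense_continuous[of u "e/20"] e fin assms(1) by auto
  have [measurable]: "g \<in> borel_measurable borel" using g by (rule borel_measurable_continuous_onI)
  obtain B where B: "\<And>n. norm (h n) \<le> B"
    using convergent_imp_Bseq[of h] h unfolding convergent_def Bseq_def by auto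
  have gh: "norm (g (x + h n)) \<le> \<bar>M\<bar> * indicator (cball 0 (R + B)) x" for x n
  proof (cases "norm x \<le> R + B")
    case True
    have "norm (g (x + h n)) \<le> \<bar>M\<bar>" using gb[of "x + h n"] by (auto split: split_indicator_asm)
    then show ?thesis using True by simp
  next
    case False
    then have "norm (x + h n) > R" using norm_triangle_ineq4[of "x + h n" "h n"] B[of n] by simp
    then show ?thesis using gb[of "x + h n"] by simp
  qed
  have B0: "B \<ge> 0" using B[of 0] norm_ge_zero[of "h 0"] by linarith
  have g0: "norm (g x) \<le> \<bar>M\<bar> * indicator (cball 0 (R + B)) x" for x
    using gb[of x] B0 by (auto split: split_indicator split_indicator_asm)
  have "(\<lambda>n. sqint lborel (\<lambda>x. g (x + h n) - g x)) \<longlonglongrightarrow> 0"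
  proof (rule tendsto_sqint_dominated[where w="\<lambda>x. (2 * \<bar>M\<bar>) * indicator (cball 0 (R + B)) x"])
    show "AE x in lborel. (\<lambda>n. g (x + h n)) \<longlonglongrightarrow> g x"
    proof (intro AE_I2)
      fix x
      have "isCont g x" using g by (simp add: continuous_on_eq_continuous_at)
      moreover have "(\<lambda>n. x + h n) \<longlonglongrightarrow> x" using tendsto_add[OF tendsto_const h, of x] by simp
      ultimately show "(\<lambda>n. g (x + h n)) \<longlonglongrightarrow> g x" by (rule isCont_tendsto_compose)
    qed
    show "AE x in lborel. norm (g (x + h n) - g x) \<le> 2 * \<bar>M\<bar> * indicator (cball 0 (R + B)) x" for n
    proof (intro AE_I2)
      fix x
      show "norm (g (x + h n) - g x) \<le> 2 * \<bar>M\<bar> * indicator (cball 0 (R + B)) x"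
        using norm_triangle_ineq4[of "g (x + h n)" "g x"] gh[of x n] g0[of x] by linarith
    qed
  qed (use sqint_const_on_cball[of "2 * \<bar>M\<bar>" "R + B"] in \<open>auto simp: mult.assoc intro!: borel_measurable_times borel_measurable_indicator borel_closed\<close>)
  then have "\<forall>\<^sub>F n in sequentially. sqint lborel (\<lambda>x. g (x + h n) - g x) < ennreal (e/20)"
    using e by (intro order_tendstoD(2)) auto
  then show "\<forall>\<^sub>F n in sequentially. sqint lborel (\<lambda>x. u (x + h n) - u x) < ennreal e"
  proof eventually_elim
    case (elim n)
    have s: "sqint lborel (\<lambda>x. u (x + h n) - g (x + h n)) = sqint lborel (\<lambda>x. u x - g x)"
      using sqint_shift[of "\<lambda>x. u x - g x" "h n"] by simp
    have "sqint lborel (\<lambda>x. u (x + h n) - u x)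
        \<le> 2 * sqint lborel (\<lambda>x. u (x + h n) - g (x + h n)) + 2 * sqint lborel (\<lambda>x. g (x + h n) - u x)"
      by (rule sqint_diff_triangle) auto
    also have "sqint lborel (\<lambda>x. g (x + h n) - u x)
        \<le> 2 * sqint lborel (\<lambda>x. g (x + h n) - g x) + 2 * sqint lborel (\<lambda>x. g x - u x)"
      by (rule sqint_diff_triangle) auto
    finally have "sqint lborel (\<lambda>x. u (x + h n) - u x)
        \<le> 2 * sqint lborel (\<lambda>x. u x - g x) + 2 * (2 * sqint lborel (\<lambda>x. g (x + h n) - g x) + 2 * sqint lborel (\<lambda>x. u x - g x))"
      by (simp add: s sqint_diff_commute[of _ g u] add_left_mono mult_left_mono)
    also have "\<dots> \<le> 2 * ennreal (e/20) + 2 * (2 * ennreal (e/20) + 2 * ennreal (e/20))"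
      using ug elim by (intro add_mono mult_left_mono) (auto simp: less_imp_le)
    also have "\<dots> = ennreal (e/2)"
      using e by (simp flip: ennreal_plus ennreal_numeral ennreal_mult)
    also have "\<dots> < ennreal e" using e by (simp add: ennreal_less_iff)
    finally show ?case .
  qed
qed

subsection \<open>Plancherel's theorem\<close>

text \<open>The transform without normalizing factor, in any dimension and over
  \<open>lborel\<close>; on \<open>r3\<close> and for Borel functions \<open>fourier_L1\<close> is a
  constant multiple of it.\<close>

definition ft :: "('a::euclidean_space \<Rightarrow> complex) \<Rightarrow> 'a \<Rightarrow> complex" where
  "ft u \<xi> = (LINT x|lborel. cis (- (x \<bullet> \<xi>)) * u x)"

lemma continuous_on_cis' [continuous_intros]:
  "continuous_on S f \<Longrightarrow> continuous_on S (\<lambda>x. cis (f x))"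
  unfolding cis_conv_exp by (intro continuous_intros)

lemma borel_measurable_cis [measurable (raw)]:
  "f \<in> borel_measurable M \<Longrightarrow> (\<lambda>x. cis (f x)) \<in> borel_measurable M"
  by (rule measurable_compose[OF _ borel_measurable_continuous_onI[OF continuous_on_cis'[OF continuous_on_id]]])

section \<open>Gaussian functions and their transforms\<close>

lemma integral_lborel_prod:
  fixes f :: "'a::euclidean_space \<Rightarrow> real \<Rightarrow> complex"
  assumes f: "\<And>b. b \<in> Basis \<Longrightarrow> integrable lborel (f b)"
  shows "(LINT x|lborel. (\<Prod>b\<in>Basis. f b (x \<bullet> b))) = (\<Prod>b\<in>Basis. LINT x|lborel. f b x)"
proof -
  interpret product_sigma_finite "\<lambda>_::'a. lborel :: real measure" ..
  have [measurable]: "f b \<in> borel_measurable borel" if "b \<in> Basis" for b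
    using f[OF that] by simp
  have "(LINT x|lborel. (\<Prod>b\<in>Basis. f b (x \<bullet> b)))
      = (LINT x|distr (\<Pi>\<^sub>M b\<in>Basis. lborel) borel (\<lambda>f. \<Sum>b\<in>Basis. f b *\<^sub>R b). (\<Prod>b\<in>Basis. f b (x \<bullet> b)))"
    by (simp flip: lborel_eq)
  also have "\<dots> = (LINT x|(\<Pi>\<^sub>M b\<in>Basis. lborel). (\<Prod>b\<in>Basis. f b (x b)))"
    by (subst integral_distr) (auto intro!: Bochner_Integration.integral_cong prod.cong)
  also have "\<dots> = (\<Prod>b\<in>Basis. LINT x|lborel. f b x)"
    by (rule product_integral_prod) (auto intro: f)
  finally show ?thesis .
qed

text \<open>Read off from the characteristic function of the standard normal distribution.\<close>

lemma std_normal_FT: 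
  "(LINT x|lborel. cis (t * x) * complex_of_real (exp (- x\<^sup>2 / 2))) = complex_of_real (sqrt (2 * pi) * exp (- t\<^sup>2 / 2))"
  "integrable lborel (\<lambda>x. cis (t * x) * complex_of_real (exp (- x\<^sup>2 / 2)))"
proof -
  have "complex_of_real (exp (- t\<^sup>2 / 2)) = char std_normal_distribution t"
    by (simp add: char_std_normal_distribution)
  also have "\<dots> = (LINT x|lborel. std_normal_density x *\<^sub>R iexp (t * x))"
    unfolding char_def by (subst integral_density) auto
  also have "\<dots> = (LINT x|lborel. complex_of_real (1 / sqrt (2 * pi)) * (cis (t * x) * complex_of_real (exp (- x\<^sup>2 / 2))))"
    by (intro Bochner_Integration.integral_cong) (auto simp: std_normal_density_def cis_conv_exp scaleR_conv_of_real)
  also have "\<dots> = complex_of_real (1 / sqrt (2 * pi)) * (LINT x|lborel. cis (t * x) * complex_of_real (exp (- x\<^sup>2 / 2)))"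
    by simp
  finally show "(LINT x|lborel. cis (t * x) * complex_of_real (exp (- x\<^sup>2 / 2))) = complex_of_real (sqrt (2 * pi) * exp (- t\<^sup>2 / 2))"
    by (simp add: field_simps)
  have "integrable lborel (\<lambda>x. sqrt (2 * pi) * std_normal_density x)"
    by (intro integrable_mult_right integrable_normal_density) simp
  then have "integrable lborel (\<lambda>x::real. exp (- x\<^sup>2 / 2))"
    by (simp add: std_normal_density_def)
  then show "integrable lborel (\<lambda>x. cis (t * x) * complex_of_real (exp (- x\<^sup>2 / 2)))"
    by (rule Bochner_Integration.integrable_bound) (auto simp: norm_mult)
qed

lemma gauss_prod:
  fixes z \<xi> :: "'a::euclidean_space"
  shows "exp (- (norm \<xi>)\<^sup>2 / 2) = (\<Prod>b\<in>Basis. exp (- (\<xi> \<bullet> b)\<^sup>2 / 2))"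
    "cis (- (\<xi> \<bullet> z)) = (\<Prod>b\<in>Basis. cis (- (z \<bullet> b) * (\<xi> \<bullet> b)))"
proof -
  have n: "(norm \<xi>)\<^sup>2 = (\<Sum>b\<in>Basis. (\<xi> \<bullet> b)\<^sup>2)"
    by (simp add: norm_eq_sqrt_inner euclidean_inner[of \<xi> \<xi>] power2_eq_square sum_nonneg)
  show "exp (- (norm \<xi>)\<^sup>2 / 2) = (\<Prod>b\<in>Basis. exp (- (\<xi> \<bullet> b)\<^sup>2 / 2))"
    by (simp add: n exp_sum[symmetric] sum_negf sum_divide_distrib[symmetric])
  have "(\<Prod>b\<in>Basis. cis (- (z \<bullet> b) * (\<xi> \<bullet> b))) = exp (\<Sum>b\<in>Basis. \<i> * complex_of_real (- (z \<bullet> b) * (\<xi> \<bullet> b)))"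
    by (simp add: cis_conv_exp exp_sum)
  also have "(\<Sum>b\<in>Basis. \<i> * complex_of_real (- (z \<bullet> b) * (\<xi> \<bullet> b))) = \<i> * complex_of_real (- (\<xi> \<bullet> z))"
    by (simp add: euclidean_inner[of \<xi> z] sum_distrib_left[symmetric] sum_negf mult.commute)
  finally show "cis (- (\<xi> \<bullet> z)) = (\<Prod>b\<in>Basis. cis (- (z \<bullet> b) * (\<xi> \<bullet> b)))"
    by (simp add: cis_conv_exp)
qed

text \<open>Both the Gaussian and the character are products over coordinates, so the integral
  factors into one-dimensional ones.\<close>

lemma ft_gauss:
  fixes z :: "'a::euclidean_space"
  shows "ft (\<lambda>\<xi>. complex_of_real (exp (- (norm \<xi>)\<^sup>2 / 2))) z
    = complex_of_real (sqrt (2 * pi) ^ DIM('a) * exp (- (norm z)\<^sup>2 / 2))"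
proof -
  have "ft (\<lambda>\<xi>. complex_of_real (exp (- (norm \<xi>)\<^sup>2 / 2))) z
    = (LINT \<xi>|lborel. (\<Prod>b\<in>Basis. cis (- (z \<bullet> b) * (\<xi> \<bullet> b)) * complex_of_real (exp (- (\<xi> \<bullet> b)\<^sup>2 / 2))))"
    unfolding ft_def gauss_prod(2) gauss_prod(1) by (simp add: prod.distrib)
  also have "\<dots> = (\<Prod>b\<in>Basis. LINT x|lborel. cis (- (z \<bullet> b) * x) * complex_of_real (exp (- x\<^sup>2 / 2)))"
    by (rule integral_lborel_prod) (rule std_normal_FT(2))
  also have "\<dots> = (\<Prod>b\<in>Basis. complex_of_real (sqrt (2 * pi) * exp (- (- (z \<bullet> b))\<^sup>2 / 2)))"
    unfolding std_normal_FT(1) ..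
  also have "\<dots> = complex_of_real (sqrt (2 * pi) ^ DIM('a) * exp (- (norm z)\<^sup>2 / 2))"
    unfolding gauss_prod(1) by (simp add: prod.distrib)
  finally show ?thesis .
qed

lemma integrable_gauss: "integrable lborel (\<lambda>\<xi>::'a::euclidean_space. exp (- (norm \<xi>)\<^sup>2 / 2))"
proof (rule integrableI_bounded)
  have "(\<integral>\<^sup>+ x. ennreal (norm (exp (- (norm (x::'a))\<^sup>2 / 2))) \<partial>lborel)
    = (\<integral>\<^sup>+ x. (\<Prod>b\<in>Basis. ennreal (exp (- ((x::'a) \<bullet> b)\<^sup>2 / 2))) \<partial>lborel)"
    unfolding gauss_prod(1) by (simp add: prod_ennreal prod_nonneg)
  also have "\<dots> = (\<Prod>b\<in>(Basis::'a set). (\<integral>\<^sup>+ x. ennreal (exp (- x\<^sup>2 / 2)) \<partial>lborel))"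
    by (intro nn_integral_lborel_prod) auto
  also have "\<dots> < \<infinity>"
  proof -
    have "(\<integral>\<^sup>+ x. ennreal (exp (- x\<^sup>2 / 2)) \<partial>lborel) < \<infinity>"
      using std_normal_FT(2)[of 0] by (simp add: integrable_iff_bounded)
    then show ?thesis by (simp add: power_less_top_ennreal)
  qed
  finally show "(\<integral>\<^sup>+ x. ennreal (norm (exp (- (norm (x::'a))\<^sup>2 / 2))) \<partial>lborel) < \<infinity>" .
qed auto

lemma integral_gauss: "(LINT \<xi>::'a::euclidean_space|lborel. exp (- (norm \<xi>)\<^sup>2 / 2)) = sqrt (2 * pi) ^ DIM('a)"
proof -
  have "complex_of_real (LINT \<xi>::'a|lborel. exp (- (norm \<xi>)\<^sup>2 / 2)) = ft (\<lambda>\<xi>. complex_of_real (exp (- (norm \<xi>)\<^sup>2 / 2))) (0::'a)"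
    unfolding ft_def by simp
  also have "\<dots> = complex_of_real (sqrt (2 * pi) ^ DIM('a))"
    unfolding ft_gauss by simp
  finally show ?thesis by (simp only: of_real_eq_iff)
qed

lemma integrable_pair_bounded_mult:
  fixes u :: "'a::euclidean_space \<Rightarrow> complex" and w :: "'b::euclidean_space \<Rightarrow> complex" and h :: "'a \<Rightarrow> 'b \<Rightarrow> complex"
  assumes u: "integrable lborel u" and w: "integrable lborel w"
    and [measurable]: "(\<lambda>(x, y). h x y) \<in> borel_measurable (lborel \<Otimes>\<^sub>M lborel)" and h: "\<And>x y. norm (h x y) \<le> 1"
  shows "integrable (lborel \<Otimes>\<^sub>M lborel) (\<lambda>(x, y). h x y * (u x * w y))"
proof (rule integrableI_bounded)
  have [measurable]: "u \<in> borel_measurable borel" "w \<in> borel_measurable borel" using u w by simp_all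
  show "(\<lambda>(x, y). h x y * (u x * w y)) \<in> borel_measurable (lborel \<Otimes>\<^sub>M lborel)" by measurable
  have "(\<integral>\<^sup>+p. ennreal (norm (case p of (x, y) \<Rightarrow> h x y * (u x * w y))) \<partial>(lborel \<Otimes>\<^sub>M lborel))
    \<le> (\<integral>\<^sup>+p. ennreal (norm (u (fst p))) * ennreal (norm (w (snd p))) \<partial>(lborel \<Otimes>\<^sub>M lborel))"
  proof (intro nn_integral_mono)
    fix p :: "'a \<times> 'b"
    have "norm (h (fst p) (snd p)) * (norm (u (fst p)) * norm (w (snd p))) \<le> 1 * (norm (u (fst p)) * norm (w (snd p)))"
      by (intro mult_right_mono h) auto
    then show "ennreal (norm (case p of (x, y) \<Rightarrow> h x y * (u x * w y))) \<le> ennreal (norm (u (fst p))) * ennreal (norm (w (snd p)))"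
      by (auto simp: norm_mult split_beta ennreal_mult[symmetric] intro!: ennreal_leI)
  qed
  also have "\<dots> = (\<integral>\<^sup>+x. \<integral>\<^sup>+y. ennreal (norm (u x)) * ennreal (norm (w y)) \<partial>lborel \<partial>lborel)"
    by (subst lborel.nn_integral_fst[symmetric]) auto
  also have "\<dots> = (\<integral>\<^sup>+x. ennreal (norm (u x)) \<partial>lborel) * (\<integral>\<^sup>+y. ennreal (norm (w y)) \<partial>lborel)"
    by (simp add: nn_integral_cmult nn_integral_multc)
  also have "\<dots> < \<infinity>"
    using u w by (simp add: integrable_iff_bounded ennreal_mult_less_top)
  finally show "(\<integral>\<^sup>+p. ennreal (norm (case p of (x, y) \<Rightarrow> h x y * (u x * w y))) \<partial>(lborel \<Otimes>\<^sub>M lborel)) < \<infinity>" .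
qed

text \<open>Multiplication formula: the character has modulus 1, so \<open>u x * w \<xi>\<close>
  dominates the double integrand and Fubini moves the transform from one factor to the
  other.\<close>

lemma ft_multiplication:
  fixes u w :: "'a::euclidean_space \<Rightarrow> complex"
  assumes u: "integrable lborel u" and w: "integrable lborel w"
  shows "(LINT \<xi>|lborel. ft u \<xi> * w \<xi>) = (LINT x|lborel. u x * ft w x)"
proof -
  have [measurable]: "u \<in> borel_measurable borel" "w \<in> borel_measurable borel" using u w by simp_all
  have "integrable (lborel \<Otimes>\<^sub>M lborel) (\<lambda>(x, \<xi>). cis (- (x \<bullet> \<xi>)) * (u x * w \<xi>))"
    by (rule integrable_pair_bounded_mult[OF u w]) auto
  from lborel_pair.Fubini_integral[OF this]
  have "(LINT \<xi>|lborel. LINT x|lborel. cis (- (x \<bullet> \<xi>)) * (u x * w \<xi>)) = (LINT x|lborel. LINT \<xi>|lborel. cis (- (x \<bullet> \<xi>)) * (u x * w \<xi>))" .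
  moreover have "(LINT x|lborel. cis (- (x \<bullet> \<xi>)) * (u x * w \<xi>)) = ft u \<xi> * w \<xi>" for \<xi>
  proof -
    have "(LINT x|lborel. cis (- (x \<bullet> \<xi>)) * (u x * w \<xi>)) = (LINT x|lborel. (cis (- (x \<bullet> \<xi>)) * u x) * w \<xi>)"
      by (simp add: mult.assoc)
    then show ?thesis by (simp add: ft_def)
  qed
  moreover have "(LINT \<xi>|lborel. cis (- (x \<bullet> \<xi>)) * (u x * w \<xi>)) = u x * ft w x" for x
  proof -
    have "(LINT \<xi>|lborel. cis (- (x \<bullet> \<xi>)) * (u x * w \<xi>)) = (LINT \<xi>|lborel. u x * (cis (- (\<xi> \<bullet> x)) * w \<xi>))"
      by (intro Bochner_Integration.integral_cong) (auto simp: inner_commute)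
    then show ?thesis by (simp add: ft_def)
  qed
  ultimately show ?thesis by simp
qed

lemma borel_measurable_ft [measurable]:
  assumes [measurable]: "u \<in> borel_measurable borel"
  shows "ft u \<in> borel_measurable borel"
  unfolding ft_def by measurable

lemma integrable_cis_mult:
  assumes "integrable lborel u"
  shows "integrable lborel (\<lambda>x. cis (- (x \<bullet> \<xi>)) * u x)"
  using assms by (rule Bochner_Integration.integrable_bound) (use assms in \<open>auto simp: norm_mult\<close>)

lemma norm_ft_le: "norm (ft u \<xi>) \<le> (LINT x|lborel. norm (u x))"
proof -
  have "norm (ft u \<xi>) \<le> (LINT x|lborel. norm (cis (- (x \<bullet> \<xi>)) * u x))"
    unfolding ft_def by (rule integral_norm_bound)
  then show ?thesis by (simp add: norm_mult)
qed

lemma ft_diff: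
  assumes "integrable lborel u" "integrable lborel w"
  shows "ft (\<lambda>x. u x - w x) \<xi> = ft u \<xi> - ft w \<xi>"
  unfolding ft_def
  using Bochner_Integration.integral_diff[OF integrable_cis_mult[OF assms(1)] integrable_cis_mult[OF assms(2)]]
  by (simp add: right_diff_distrib)

section \<open>Cauchy-Schwarz inequality for square-integrable functions\<close>

lemma ennreal_power2_le_imp_le:
  fixes a b :: ennreal
  assumes "a\<^sup>2 \<le> b\<^sup>2"
  shows "a \<le> b"
proof (cases a b rule: ennreal2_cases)
  case (real_real r q)
  then show ?thesis using assms
    by (simp add: ennreal_power ennreal_le_iff)
next
  case (top_real q)
  then show ?thesis using assms by (simp add: ennreal_power top_power_ennreal top_unique)
qed auto

lemma Cauchy_Schwarz_sqint:
  fixes f g :: "'a \<Rightarrow> complex"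
  assumes [measurable]: "f \<in> borel_measurable M" "g \<in> borel_measurable M"
  shows "(\<integral>\<^sup>+x. ennreal (norm (f x * g x)) \<partial>M)\<^sup>2 \<le> sqint M f * sqint M g"
  using Cauchy_Schwarz_nn_integral[of "\<lambda>x. ennreal (norm (f x))" M "\<lambda>x. ennreal (norm (g x))"]
  by (simp add: sqint_def norm_mult ennreal_mult ennreal_power)

lemma integrable_L2_mult:
  fixes f g :: "'a \<Rightarrow> complex"
  assumes [measurable]: "f \<in> borel_measurable M" "g \<in> borel_measurable M"
    and "sqint M f < \<infinity>" "sqint M g < \<infinity>"
  shows "integrable M (\<lambda>x. f x * g x)"
proof (rule integrableI_bounded)
  have "(\<integral>\<^sup>+x. ennreal (norm (f x * g x)) \<partial>M)\<^sup>2 < \<infinity>"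
    using Cauchy_Schwarz_sqint[OF assms(1,2)] assms(3,4)
    by (simp add: order_le_less_trans ennreal_mult_less_top)
  then show "(\<integral>\<^sup>+x. ennreal (norm (f x * g x)) \<partial>M) < \<infinity>"
    by (simp add: power_less_top_ennreal)
qed auto

text \<open>No finiteness is assumed: the Bochner integral of a function that is not integrable is
  0, for which the bound is trivial.\<close>

lemma norm_integral_L2_mult_le:
  fixes f g :: "'a \<Rightarrow> complex"
  assumes [measurable]: "f \<in> borel_measurable M" "g \<in> borel_measurable M"
  shows "ennreal ((norm (LINT x|M. f x * g x))\<^sup>2) \<le> sqint M f * sqint M g"
proof (cases "integrable M (\<lambda>x. f x * g x)")
  case True
  have "ennreal ((norm (LINT x|M. f x * g x))\<^sup>2) = (ennreal (norm (LINT x|M. f x * g x)))\<^sup>2"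
    by (simp add: ennreal_power)
  also have "\<dots> \<le> (\<integral>\<^sup>+x. ennreal (norm (f x * g x)) \<partial>M)\<^sup>2"
    by (intro power_mono integral_norm_bound_ennreal True) auto
  also have "\<dots> \<le> sqint M f * sqint M g" by (rule Cauchy_Schwarz_sqint) auto
  finally show ?thesis .
next
  case False
  then show ?thesis by (simp add: not_integrable_integral_eq)
qed

section \<open>Changes of variables, autocorrelation and Gaussian regularization\<close>

lemma lborel_integral_scale:
  fixes f :: "'a::euclidean_space \<Rightarrow> complex"
  assumes [measurable]: "f \<in> borel_measurable borel" and c: "c > 0"
  shows "(LINT x|lborel. f x) = c ^ DIM('a) *\<^sub>R (LINT x|lborel. f (c *\<^sub>R x))"
proof -
  have "(LINT x|lborel. f x) = (LINT x|density (distr lborel borel (\<lambda>x. 0 + c *\<^sub>R x)) (\<lambda>_. ennreal (\<bar>c\<bar> ^ DIM('a))). f x)"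
    using lborel_affine[of c "0::'a"] c by simp
  also have "\<dots> = c ^ DIM('a) *\<^sub>R (LINT x|lborel. f (c *\<^sub>R x))"
    using c by (simp add: integral_density integral_distr)
  finally show ?thesis .
qed

lemma lborel_integral_shift_reflect:
  fixes f :: "'a::euclidean_space \<Rightarrow> complex"
  assumes [measurable]: "f \<in> borel_measurable borel"
  shows "(LINT x|lborel. f x) = (LINT x|lborel. f (a - x))"
proof -
  have "(LINT x|lborel. f x) = (LINT x|density (distr lborel borel (\<lambda>x. a + (-1) *\<^sub>R x)) (\<lambda>_. ennreal (\<bar>-1\<bar> ^ DIM('a))). f x)"
    using lborel_affine[of "-1" "a"] by simp
  also have "\<dots> = (LINT x|lborel. f (a - x))"
    by (simp add: density_1 integral_distr)
  finally show ?thesis .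
qed

lemma nn_integral_shift_reflect:
  fixes f :: "'a::euclidean_space \<Rightarrow> ennreal"
  assumes [measurable]: "f \<in> borel_measurable borel"
  shows "(\<integral>\<^sup>+x. f (a - x) \<partial>lborel) = (\<integral>\<^sup>+x. f x \<partial>lborel)"
proof -
  have "(\<integral>\<^sup>+x. f x \<partial>lborel) = (\<integral>\<^sup>+x. f x \<partial>density (distr lborel borel (\<lambda>x. a + (-1) *\<^sub>R x)) (\<lambda>_. ennreal (\<bar>-1\<bar> ^ DIM('a))))"
    using lborel_affine[of "-1" "a"] by simp
  also have "\<dots> = (\<integral>\<^sup>+x. f (a - x) \<partial>lborel)"
    by (simp add: nn_integral_density nn_integral_distr)
  finally show ?thesis by simp
qed

text \<open>The convolution of \<open>u\<close> with its reflected conjugate. For integrable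
  \<open>u\<close> its transform is the squared modulus of \<open>ft u\<close>, and its value at 0
  is the squared L2 norm, so Plancherel's identity is Fourier inversion for it at the
  origin.\<close>

definition autocorr :: "('a::euclidean_space \<Rightarrow> complex) \<Rightarrow> 'a \<Rightarrow> complex" where
  "autocorr u h = (LINT x|lborel. u x * cnj (u (x - h)))"

lemma borel_measurable_cnj' [measurable (raw)]:
  "f \<in> borel_measurable M \<Longrightarrow> (\<lambda>x. cnj (f x)) \<in> borel_measurable M"
  by (rule measurable_compose[OF _ borel_measurable_continuous_onI[of cnj]]) (auto intro: continuous_intros)

lemma sqint_cnj_shift:
  fixes u :: "'a::euclidean_space \<Rightarrow> complex"
  assumes "u \<in> borel_measurable borel"
  shows "sqint lborel (\<lambda>x. cnj (u (x - h))) = sqint lborel u"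
  using sqint_shift[OF assms, of "-h"] by (simp add: sqint_def)

lemma norm_autocorr_le:
  fixes u :: "'a::euclidean_space \<Rightarrow> complex"
  assumes [measurable]: "u \<in> borel_measurable borel"
  shows "ennreal (norm (autocorr u h)) \<le> sqint lborel u"
proof -
  have "(ennreal (norm (autocorr u h)))\<^sup>2 \<le> (sqint lborel u)\<^sup>2"
    using norm_integral_L2_mult_le[of u lborel "\<lambda>x. cnj (u (x - h))"] assms
    by (simp add: sqint_cnj_shift autocorr_def power2_eq_square ennreal_mult)
  then show ?thesis by (rule ennreal_power2_le_imp_le)
qed

text \<open>Cauchy-Schwarz bounds the difference by the L2 distance between \<open>u\<close> and its
  translate.\<close>

lemma autocorr_tendsto:
  fixes u :: "'a::euclidean_space \<Rightarrow> complex"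
  assumes [measurable]: "u \<in> borel_measurable borel" and fin: "sqint lborel u < \<infinity>" and h: "h \<longlonglongrightarrow> 0"
  shows "(\<lambda>n. autocorr u (h n)) \<longlonglongrightarrow> autocorr u 0"
proof -
  have "(\<lambda>n. sqint lborel u * sqint lborel (\<lambda>x. u (x + - h n) - u x)) \<longlonglongrightarrow> sqint lborel u * 0"
    using fin h tendsto_minus[OF h]
    by (intro tendsto_mult_ennreal tendsto_const L2_translation_continuous) auto
  then have lim: "(\<lambda>n. sqint lborel u * sqint lborel (\<lambda>x. u (x + - h n) - u x)) \<longlonglongrightarrow> 0" by simp
  have "ennreal ((norm (autocorr u (h n) - autocorr u 0))\<^sup>2) \<le> sqint lborel u * sqint lborel (\<lambda>x. u (x + - h n) - u x)" for n
  proof -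
    have "autocorr u (h n) - autocorr u 0 = (LINT x|lborel. u x * cnj (u (x - h n)) - u x * cnj (u x))"
      unfolding autocorr_def
      using sqint_cnj_shift[of u] fin
      by (subst Bochner_Integration.integral_diff) (auto intro!: integrable_L2_mult simp: sqint_def)
    also have "\<dots> = (LINT x|lborel. u x * cnj (u (x - h n) - u x))"
      by (simp add: right_diff_distrib)
    finally have "autocorr u (h n) - autocorr u 0 = (LINT x|lborel. u x * cnj (u (x - h n) - u x))" .
    moreover have "sqint lborel (\<lambda>x. cnj (u (x - h n) - u x)) = sqint lborel (\<lambda>x. u (x + - h n) - u x)"
      unfolding sqint_def complex_mod_cnj by simp
    ultimately show ?thesis
      using norm_integral_L2_mult_le[of u lborel "\<lambda>x. cnj (u (x - h n) - u x)"] by simp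
  qed
  then have "(\<lambda>n. ennreal ((norm (autocorr u (h n) - autocorr u 0))\<^sup>2)) \<longlonglongrightarrow> 0"
    by (intro tendsto_sandwich[OF _ _ tendsto_const lim]) auto
  then have "(\<lambda>n. enn2real (ennreal ((norm (autocorr u (h n) - autocorr u 0))\<^sup>2))) \<longlonglongrightarrow> enn2real 0"
    by (intro tendsto_enn2real) auto
  then have "(\<lambda>n. (norm (autocorr u (h n) - autocorr u 0))\<^sup>2) \<longlonglongrightarrow> 0" by simp
  then have "(\<lambda>n. sqrt ((norm (autocorr u (h n) - autocorr u 0))\<^sup>2)) \<longlonglongrightarrow> sqrt 0"
    by (rule tendsto_real_sqrt)
  then have "(\<lambda>n. norm (autocorr u (h n) - autocorr u 0)) \<longlonglongrightarrow> 0" by simp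
  then show ?thesis by (simp add: tendsto_norm_zero_iff Lim_null[symmetric])
qed

lemma ft_scaled_gauss:
  fixes x :: "'a::euclidean_space"
  assumes m: "m > 0"
  shows "ft (\<lambda>\<xi>. complex_of_real (exp (- (norm (\<xi> /\<^sub>R m))\<^sup>2 / 2))) x
    = complex_of_real (m ^ DIM('a) * (sqrt (2 * pi) ^ DIM('a) * exp (- (norm (m *\<^sub>R x))\<^sup>2 / 2)))"
proof -
  have "ft (\<lambda>\<xi>. complex_of_real (exp (- (norm (\<xi> /\<^sub>R m))\<^sup>2 / 2))) x
    = m ^ DIM('a) *\<^sub>R ft (\<lambda>\<xi>. complex_of_real (exp (- (norm \<xi>)\<^sup>2 / 2))) (m *\<^sub>R x)"
    unfolding ft_def using m by (subst lborel_integral_scale[OF _ m]) (auto simp: mult_ac)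
  then show ?thesis unfolding ft_gauss by (simp add: scaleR_conv_of_real)
qed

lemma integrable_scaled_gauss:
  assumes m: "m > 0"
  shows "integrable lborel (\<lambda>\<xi>::'a::euclidean_space. exp (- (norm (\<xi> /\<^sub>R m))\<^sup>2 / 2))"
proof -
  have "integrable (density (distr lborel borel (\<lambda>x. 0 + m *\<^sub>R x)) (\<lambda>_. ennreal (\<bar>m\<bar> ^ DIM('a)))) (\<lambda>\<xi>::'a. exp (- (norm (\<xi> /\<^sub>R m))\<^sup>2 / 2))"
    using m integrable_gauss by (subst integrable_density) (auto simp: integrable_distr_eq simp del: norm_scaleR)
  then show ?thesis using lborel_affine[of m "0::'a"] m by simp
qed

text \<open>The squared modulus is written as \<open>ft u\<close> times its conjugate, and the
  multiplication formula is applied with the conjugate times the Gaussian as second factor.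
  Transforming that factor produces conjugated translates of \<open>u\<close> averaged against a
  narrow Gaussian; Fubini then collects the autocorrelation.\<close>

lemma ft_sq_gauss:
  fixes u :: "'a::euclidean_space \<Rightarrow> complex"
  assumes u: "integrable lborel u" and m: "m > 0"
  shows "(LINT \<xi>|lborel. complex_of_real ((norm (ft u \<xi>))\<^sup>2 * exp (- (norm (\<xi> /\<^sub>R m))\<^sup>2 / 2)))
    = sqrt (2 * pi) ^ DIM('a) * (LINT z|lborel. complex_of_real (exp (- (norm z)\<^sup>2 / 2)) * autocorr u (z /\<^sub>R m))"
proof -
  define G where "G \<xi> = complex_of_real (exp (- (norm (\<xi> /\<^sub>R m))\<^sup>2 / 2))" for \<xi> :: 'a
  define s where "s = complex_of_real (sqrt (2 * pi) ^ DIM('a))"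
  have [measurable]: "u \<in> borel_measurable borel" using u by simp
  have [measurable]: "G \<in> borel_measurable borel" unfolding G_def by measurable
  have G: "integrable lborel G" unfolding G_def by (intro integrable_of_real integrable_scaled_gauss m)
  define w where "w \<xi> = cnj (ft u \<xi>) * G \<xi>" for \<xi>
  have [measurable]: "w \<in> borel_measurable borel" unfolding w_def by measurable
  have w: "integrable lborel w"
  proof (rule Bochner_Integration.integrable_bound)
    show "integrable lborel (\<lambda>\<xi>. complex_of_real (LINT x|lborel. norm (u x)) * G \<xi>)"
      using G by simp
    show "AE x in lborel. norm (w x) \<le> norm (complex_of_real (LINT x|lborel. norm (u x)) * G x)"
      unfolding w_def norm_mult complex_mod_cnj norm_of_real
      by (intro AE_I2 mult_right_mono order_trans[OF norm_ft_le abs_ge_self]) auto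
  qed simp
  \<comment> \<open>The reflected conjugate of \<open>u\<close>, whose transform is the conjugate of
    \<open>ft u\<close>; it lets the multiplication formula be used a second time, in the
    computation of \<open>ft w\<close>.\<close>
  define u' where "u' y = cnj (u (0 - y))" for y
  have u'm [measurable]: "u' \<in> borel_measurable borel" unfolding u'_def by measurable
  have u': "integrable lborel u'"
  proof (rule integrableI_bounded)
    have "(\<integral>\<^sup>+x. ennreal (norm (u' x)) \<partial>lborel) = (\<integral>\<^sup>+x. ennreal (norm (u x)) \<partial>lborel)"
      unfolding u'_def complex_mod_cnj by (rule nn_integral_shift_reflect) auto
    then show "(\<integral>\<^sup>+x. ennreal (norm (u' x)) \<partial>lborel) < \<infinity>" using u by (simp add: integrable_iff_bounded)
  qed auto
  have ftu': "ft u' \<xi> = cnj (ft u \<xi>)" for \<xi>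
  proof -
    have "ft u' \<xi> = (LINT x|lborel. cnj (cis (- ((0 - x) \<bullet> \<xi>)) * u (0 - x)))"
      unfolding ft_def u'_def by (intro Bochner_Integration.integral_cong) (auto simp: cis_cnj)
    also have "\<dots> = (LINT x|lborel. cnj (cis (- (x \<bullet> \<xi>)) * u x))"
      by (rule lborel_integral_shift_reflect[symmetric]) auto
    also have "\<dots> = cnj (ft u \<xi>)" unfolding ft_def by (rule Bochner_Integration.integral_cnj[where f="\<lambda>x. cis (- (x \<bullet> \<xi>)) * u x"])
    finally show ?thesis .
  qed
  have Gs: "ft G h = m ^ DIM('a) * s * complex_of_real (exp (- (norm (m *\<^sub>R h))\<^sup>2 / 2))" for h
    unfolding G_def ft_scaled_gauss[OF m] s_def by simp
  have ftG_bound: "norm (ft G h) \<le> m ^ DIM('a) * norm s" for h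
    unfolding Gs using m by (simp add: norm_mult norm_power mult_left_le)
  have ftw: "ft w x = (LINT h|lborel. cnj (u (x - h)) * ft G h)" for x
  proof -
    have "ft w x = (LINT \<xi>|lborel. ft u' \<xi> * (cis (- (\<xi> \<bullet> x)) * G \<xi>))"
      unfolding ft_def[of w] w_def ftu' by (simp add: mult_ac)
    also have "\<dots> = (LINT y|lborel. u' y * ft (\<lambda>\<xi>. cis (- (\<xi> \<bullet> x)) * G \<xi>) y)"
      by (rule ft_multiplication[OF u' integrable_cis_mult[OF G]])
    also have "\<dots> = (LINT y|lborel. cnj (u (x - (x + y))) * ft G (x + y))"
    proof -
      have "ft (\<lambda>\<xi>. cis (- (\<xi> \<bullet> x)) * G \<xi>) y = ft G (x + y)" for y
        unfolding ft_def by (simp add: mult.assoc[symmetric] cis_mult inner_add_right add.commute)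
      then show ?thesis by (simp add: u'_def)
    qed
    also have "\<dots> = (LINT h|distr lborel borel ((+) x). cnj (u (x - h)) * ft G h)"
      by (subst integral_distr) auto
    finally show ?thesis by (simp add: lborel_distr_plus)
  qed
  have int2: "integrable (lborel \<Otimes>\<^sub>M lborel) (\<lambda>(x, h). u x * (cnj (u (x - h)) * ft G h))"
  proof (rule integrableI_bounded)
    have "(\<integral>\<^sup>+p. ennreal (norm (case p of (x, h) \<Rightarrow> u x * (cnj (u (x - h)) * ft G h))) \<partial>(lborel \<Otimes>\<^sub>M lborel))
      = (\<integral>\<^sup>+x. \<integral>\<^sup>+h. ennreal (norm (u x * (cnj (u (x - h)) * ft G h))) \<partial>lborel \<partial>lborel)"
      by (subst lborel.nn_integral_fst[symmetric]) auto
    also have "\<dots> \<le> (\<integral>\<^sup>+x. \<integral>\<^sup>+h. ennreal (norm (u x)) * (ennreal (m ^ DIM('a) * norm s) * ennreal (norm (u (x - h)))) \<partial>lborel \<partial>lborel)"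
    proof (intro nn_integral_mono)
      fix x h
      have "norm (u x) * (norm (u (x - h)) * norm (ft G h)) \<le> norm (u x) * (norm (u (x - h)) * (m ^ DIM('a) * norm s))"
        by (intro mult_left_mono ftG_bound) auto
      then show "ennreal (norm (u x * (cnj (u (x - h)) * ft G h))) \<le> ennreal (norm (u x)) * (ennreal (m ^ DIM('a) * norm s) * ennreal (norm (u (x - h))))"
        using m by (simp add: norm_mult ennreal_mult[symmetric] mult_ac ennreal_leI)
    qed
    also have "\<dots> = (\<integral>\<^sup>+x. ennreal (norm (u x)) * (ennreal (m ^ DIM('a) * norm s) * (\<integral>\<^sup>+h. ennreal (norm (u h)) \<partial>lborel)) \<partial>lborel)"
      by (simp add: nn_integral_cmult nn_integral_shift_reflect[where f="\<lambda>h. ennreal (norm (u h))"])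
    also have "\<dots> < \<infinity>"
      using u by (simp add: nn_integral_multc integrable_iff_bounded ennreal_mult_less_top)
    finally show "(\<integral>\<^sup>+p. ennreal (norm (case p of (x, h) \<Rightarrow> u x * (cnj (u (x - h)) * ft G h))) \<partial>(lborel \<Otimes>\<^sub>M lborel)) < \<infinity>" .
  qed auto
  have "(LINT \<xi>|lborel. complex_of_real ((norm (ft u \<xi>))\<^sup>2 * exp (- (norm (\<xi> /\<^sub>R m))\<^sup>2 / 2))) = (LINT \<xi>|lborel. ft u \<xi> * w \<xi>)"
    unfolding w_def G_def
    by (intro Bochner_Integration.integral_cong refl) (simp add: mult.assoc[symmetric] complex_norm_square[symmetric] del: power2_minus)
  also have "\<dots> = (LINT x|lborel. u x * ft w x)" by (rule ft_multiplication[OF u w])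
  also have "\<dots> = (LINT x|lborel. LINT h|lborel. u x * (cnj (u (x - h)) * ft G h))"
    unfolding ftw by simp
  also have "\<dots> = (LINT h|lborel. LINT x|lborel. u x * (cnj (u (x - h)) * ft G h))"
    by (rule lborel_pair.Fubini_integral[OF int2, symmetric])
  also have "\<dots> = (LINT h|lborel. autocorr u h * ft G h)"
    unfolding autocorr_def by (simp flip: mult.assoc)
  \<comment> \<open>The substitution h = z / m makes the Gaussian factor independent of
    \<open>m\<close>; its Jacobian cancels the power of \<open>m\<close> in
    \<open>Gs\<close>.\<close>
  also have "\<dots> = (inverse m) ^ DIM('a) *\<^sub>R (LINT z|lborel. autocorr u (inverse m *\<^sub>R z) * ft G (inverse m *\<^sub>R z))"
    using m by (intro lborel_integral_scale) (auto simp: autocorr_def)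
  also have "\<dots> = (inverse m) ^ DIM('a) *\<^sub>R (LINT z|lborel. (m ^ DIM('a) * s) * (complex_of_real (exp (- (norm z)\<^sup>2 / 2)) * autocorr u (z /\<^sub>R m)))"
    using m unfolding Gs by (simp add: mult_ac)
  also have "\<dots> = s * (LINT z|lborel. complex_of_real (exp (- (norm z)\<^sup>2 / 2)) * autocorr u (z /\<^sub>R m))"
    using m by (simp add: scaleR_conv_of_real power_inverse)
  finally show ?thesis by (simp add: s_def)
qed

text \<open>The limit of \<open>ft_sq_gauss\<close> as \<open>m\<close> tends to infinity. The left
  side increases to the integral of the squared transform; on the right the autocorrelation tends to
  its value at 0 and is bounded by the squared L2 norm, so the Gaussian dominates. One factor sqrt(2
  pi)^n is already present in \<open>ft_sq_gauss\<close>, the other is the Gaussian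
  integral.\<close>

theorem plancherel_L1_L2:
  fixes u :: "'a::euclidean_space \<Rightarrow> complex"
  assumes u: "integrable lborel u" and fin: "sqint lborel u < \<infinity>"
  shows "sqint lborel (ft u) = ennreal ((2 * pi) ^ DIM('a)) * sqint lborel u"
proof -
  have [measurable]: "u \<in> borel_measurable borel" using u by simp
  define g where "g n \<xi> = (norm (ft u \<xi>))\<^sup>2 * exp (- (norm (\<xi> /\<^sub>R real (Suc n)))\<^sup>2 / 2)" for n \<xi>
  have [measurable]: "g n \<in> borel_measurable borel" for n unfolding g_def by measurable
  have g_int: "integrable lborel (g n)" for n
  proof (rule Bochner_Integration.integrable_bound)
    show "integrable lborel (\<lambda>\<xi>. (LINT x|lborel. norm (u x))\<^sup>2 * exp (- (norm (\<xi> /\<^sub>R real (Suc n)))\<^sup>2 / 2))"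
      by (intro integrable_mult_right integrable_scaled_gauss) simp
    show "AE x in lborel. norm (g n x) \<le> norm ((LINT x|lborel. norm (u x))\<^sup>2 * exp (- (norm (x /\<^sub>R real (Suc n)))\<^sup>2 / 2))"
      unfolding g_def norm_mult by (intro AE_I2 mult_right_mono) (auto intro!: power_mono norm_ft_le)
  qed auto
  have g_mono: "incseq (\<lambda>n. ennreal (g n \<xi>))" for \<xi>
  proof (intro incseq_SucI ennreal_leI)
    fix n
    have "norm (\<xi> /\<^sub>R real (Suc (Suc n))) \<le> norm (\<xi> /\<^sub>R real (Suc n))"
      by (auto intro!: mult_right_mono simp: field_simps)
    then have "(norm (\<xi> /\<^sub>R real (Suc (Suc n))))\<^sup>2 \<le> (norm (\<xi> /\<^sub>R real (Suc n)))\<^sup>2"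
      by (intro power_mono) auto
    then show "g n \<xi> \<le> g (Suc n) \<xi>"
      unfolding g_def by (intro mult_left_mono) auto
  qed
  have g_lim: "(\<lambda>n. ennreal (g n \<xi>)) \<longlonglongrightarrow> ennreal ((norm (ft u \<xi>))\<^sup>2)" for \<xi>
  proof -
    have "(\<lambda>n. \<xi> /\<^sub>R real (Suc n)) \<longlonglongrightarrow> 0 *\<^sub>R \<xi>"
      by (intro tendsto_scaleR LIMSEQ_inverse_real_of_nat tendsto_const)
    then have "(\<lambda>n. g n \<xi>) \<longlonglongrightarrow> (norm (ft u \<xi>))\<^sup>2 * exp (- (norm (0 *\<^sub>R \<xi>))\<^sup>2 / 2)"
      unfolding g_def by (intro tendsto_intros LIMSEQ_inverse_real_of_nat) simp_all
    then show ?thesis by (intro tendsto_ennrealI) simp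
  qed
  have "(\<lambda>n. \<integral>\<^sup>+\<xi>. ennreal (g n \<xi>) \<partial>lborel) \<longlonglongrightarrow> (\<integral>\<^sup>+\<xi>. ennreal ((norm (ft u \<xi>))\<^sup>2) \<partial>lborel)"
  proof -
    have "(SUP n. ennreal (g n \<xi>)) = ennreal ((norm (ft u \<xi>))\<^sup>2)" for \<xi>
      using LIMSEQ_unique[OF LIMSEQ_SUP[OF g_mono] g_lim] .
    moreover have "incseq (\<lambda>n \<xi>. ennreal (g n \<xi>))"
      using g_mono unfolding mono_def le_fun_def by blast
    ultimately have "(\<integral>\<^sup>+\<xi>. ennreal ((norm (ft u \<xi>))\<^sup>2) \<partial>lborel) = (SUP n. \<integral>\<^sup>+\<xi>. ennreal (g n \<xi>) \<partial>lborel)"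
      by (subst nn_integral_monotone_convergence_SUP[symmetric]) auto
    moreover have "incseq (\<lambda>n. \<integral>\<^sup>+\<xi>. ennreal (g n \<xi>) \<partial>lborel)"
      using g_mono unfolding mono_def by (auto intro!: nn_integral_mono)
    ultimately show ?thesis using LIMSEQ_SUP by metis
  qed
  then have lim1: "(\<lambda>n. ennreal (LINT \<xi>|lborel. g n \<xi>)) \<longlonglongrightarrow> sqint lborel (ft u)"
    unfolding sqint_def by (subst (asm) nn_integral_eq_integral) (auto simp: g_int, simp add: g_def)
  define S where "S = enn2real (sqint lborel u)"
  have S: "ennreal S = sqint lborel u" unfolding S_def using fin by simp
  have "(\<lambda>n. LINT z|lborel. complex_of_real (exp (- (norm z)\<^sup>2 / 2)) * autocorr u (z /\<^sub>R real (Suc n)))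
     \<longlonglongrightarrow> (LINT z|lborel. complex_of_real (exp (- (norm (z::'a))\<^sup>2 / 2)) * autocorr u 0)"
  proof (rule integral_dominated_convergence)
    show "integrable lborel (\<lambda>z::'a. exp (- (norm z)\<^sup>2 / 2) * S)"
      by (intro integrable_mult_left integrable_gauss)
    show "AE z in lborel. (\<lambda>n. complex_of_real (exp (- (norm (z::'a))\<^sup>2 / 2)) * autocorr u (z /\<^sub>R real (Suc n)))
      \<longlonglongrightarrow> complex_of_real (exp (- (norm z)\<^sup>2 / 2)) * autocorr u 0"
    proof (intro AE_I2 tendsto_mult tendsto_const autocorr_tendsto fin)
      fix z :: 'a
      have "(\<lambda>n. z /\<^sub>R real (Suc n)) \<longlonglongrightarrow> 0 *\<^sub>R z"
        by (intro tendsto_scaleR LIMSEQ_inverse_real_of_nat tendsto_const)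
      then show "(\<lambda>n. z /\<^sub>R real (Suc n)) \<longlonglongrightarrow> 0" by simp
    qed auto
    show "AE z in lborel. norm (complex_of_real (exp (- (norm (z::'a))\<^sup>2 / 2)) * autocorr u (z /\<^sub>R real (Suc n))) \<le> exp (- (norm z)\<^sup>2 / 2) * S" for n
    proof (intro AE_I2)
      fix z :: 'a
      have "ennreal (norm (autocorr u (z /\<^sub>R real (Suc n)))) \<le> ennreal S"
        unfolding S by (rule norm_autocorr_le) measurable
      then have "norm (autocorr u (z /\<^sub>R real (Suc n))) \<le> S"
        by (simp add: ennreal_le_iff S_def)
      then show "norm (complex_of_real (exp (- (norm (z::'a))\<^sup>2 / 2)) * autocorr u (z /\<^sub>R real (Suc n))) \<le> exp (- (norm z)\<^sup>2 / 2) * S"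
        unfolding norm_mult norm_of_real by (intro mult_mono) auto
    qed
  qed (auto simp: autocorr_def)
  also have "(LINT z|lborel. complex_of_real (exp (- (norm (z::'a))\<^sup>2 / 2)) * autocorr u 0) = complex_of_real (sqrt (2 * pi) ^ DIM('a)) * autocorr u 0"
    unfolding integral_gauss[symmetric] by simp
  finally have lim2: "(\<lambda>n. sqrt (2 * pi) ^ DIM('a) * (LINT z|lborel. complex_of_real (exp (- (norm z)\<^sup>2 / 2)) * autocorr u (z /\<^sub>R real (Suc n))))
     \<longlonglongrightarrow> sqrt (2 * pi) ^ DIM('a) * (complex_of_real (sqrt (2 * pi) ^ DIM('a)) * autocorr u 0)"
    by (intro tendsto_mult tendsto_const)
  have gn: "sqrt (2 * pi) ^ DIM('a) * (LINT z|lborel. complex_of_real (exp (- (norm z)\<^sup>2 / 2)) * autocorr u (z /\<^sub>R real (Suc n)))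
     = complex_of_real (LINT \<xi>|lborel. g n \<xi>)" for n
    unfolding g_def integral_complex_of_real[symmetric] by (rule ft_sq_gauss[OF u, symmetric]) simp
  have ac0: "autocorr u 0 = complex_of_real S"
  proof -
    have "autocorr u 0 = (LINT x|lborel. complex_of_real ((norm (u x))\<^sup>2))"
      unfolding autocorr_def by (simp add: complex_norm_square[symmetric])
    also have "\<dots> = complex_of_real (LINT x|lborel. (norm (u x))\<^sup>2)" by (rule integral_complex_of_real)
    also have "(LINT x|lborel. (norm (u x))\<^sup>2) = S"
      unfolding S_def sqint_def by (subst integral_eq_nn_integral) auto
    finally show ?thesis .
  qed
  have "(\<lambda>n. complex_of_real (LINT \<xi>|lborel. g n \<xi>)) \<longlonglongrightarrow> complex_of_real ((2 * pi) ^ DIM('a) * S)"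
  proof -
    have "sqrt (2 * pi) ^ DIM('a) * sqrt (2 * pi) ^ DIM('a) = (2 * pi) ^ DIM('a)"
      by (subst power_mult_distrib[symmetric]) simp
    then have "sqrt (2 * pi) ^ DIM('a) * (complex_of_real (sqrt (2 * pi) ^ DIM('a)) * complex_of_real S) = complex_of_real ((2 * pi) ^ DIM('a) * S)"
      by (simp only: of_real_mult[symmetric] mult.assoc[symmetric])
    then show ?thesis using lim2 unfolding gn ac0 by (simp only:)
  qed
  then have "(\<lambda>n. LINT \<xi>|lborel. g n \<xi>) \<longlonglongrightarrow> (2 * pi) ^ DIM('a) * S"
    by (simp only: tendsto_of_real_iff)
  then have "(\<lambda>n. ennreal (LINT \<xi>|lborel. g n \<xi>)) \<longlonglongrightarrow> ennreal ((2 * pi) ^ DIM('a) * S)"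
    by (rule tendsto_ennrealI)
  from LIMSEQ_unique[OF lim1 this] show ?thesis
    by (simp add: ennreal_mult' flip: S)
qed

subsection \<open>The Fourier transform on the space of square-integrable functions\<close>

lemma ex_borel_AE_eq_complex:
  fixes f :: "'a::euclidean_space \<Rightarrow> complex"
  assumes "f \<in> borel_measurable lebesgue"
  obtains f' where "f' \<in> borel_measurable borel" "AE x in lborel. f x = f' x"
proof -
  have "(\<lambda>x. Re (f x)) \<in> borel_measurable lebesgue" "(\<lambda>x. Im (f x)) \<in> borel_measurable lebesgue"
    using assms by (simp_all add: borel_measurable_complex_iff)
  then obtain r i where [measurable]: "r \<in> borel_measurable lborel" "i \<in> borel_measurable lborel"
    and ri: "AE x in lborel. Re (f x) = r x" "AE x in lborel. Im (f x) = i x"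
    using completion_ex_borel_measurable_real by blast
  show ?thesis
  proof
    show "(\<lambda>x. Complex (r x) (i x)) \<in> borel_measurable borel"
      by (subst borel_measurable_complex_iff) simp
    show "AE x in lborel. f x = Complex (r x) (i x)"
      using ri by eventually_elim (simp add: complex_eq_iff)
  qed
qed

lemma borel_imp_lebesgue: "f \<in> borel_measurable borel \<Longrightarrow> f \<in> borel_measurable lebesgue"
  by (rule measurable_completion) simp

lemma AE_lebesgue_iff: "(AE x in lebesgue. P x) \<longleftrightarrow> (AE x in lborel. P x)"
  by (rule AE_completion_iff)

lemma sqint_lebesgue: "sqint lebesgue f = sqint lborel f"
  by (simp add: sqint_def nn_integral_completion)

lemma fourier_L1_eq_ft:
  assumes "u \<in> borel_measurable borel"
  shows "fourier_L1 u \<xi> = complex_of_real ((2 * pi) powr (-3/2)) * ft u \<xi>"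
  unfolding fourier_L1_def ft_def using assms by (subst integral_completion) auto

lemma fourier_L1_cong_AE:
  assumes "u \<in> borel_measurable lebesgue" "w \<in> borel_measurable lebesgue" "AE x in lborel. u x = w x"
  shows "fourier_L1 u = fourier_L1 w"
proof
  fix \<xi> :: r3
  have [measurable]: "(\<lambda>x. cis (- (x \<bullet> \<xi>))) \<in> borel_measurable lebesgue" by (rule borel_imp_lebesgue) measurable
  have "(LINT x|lebesgue. cis (- (x \<bullet> \<xi>)) * u x) = (LINT x|lebesgue. cis (- (x \<bullet> \<xi>)) * w x)"
    using assms by (intro integral_cong_AE) (auto simp: AE_lebesgue_iff)
  then show "fourier_L1 u \<xi> = fourier_L1 w \<xi>" unfolding fourier_L1_def by simp
qed

lemma borel_measurable_fourier_L1:
  assumes [measurable]: "u \<in> borel_measurable borel"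
  shows "fourier_L1 u \<in> borel_measurable borel"
  using fourier_L1_eq_ft[OF assms] by (simp add: fun_eq_iff[symmetric] cong: measurable_cong)

text \<open>The square of the normalizing constant is exactly the inverse of the factor (2 pi)^3 in
  \<open>plancherel_L1_L2\<close>.\<close>

lemma sqint_fourier_L1:
  assumes u: "integrable lborel u" and fin: "sqint lborel u < \<infinity>"
  shows "sqint lborel (fourier_L1 u) = sqint lborel u"
proof -
  have [measurable]: "u \<in> borel_measurable borel" using u by simp
  have c: "((2 * pi) powr (-3/2))\<^sup>2 * (2 * pi) ^ 3 = 1"
  proof -
    have "((2 * pi) powr (-3/2))\<^sup>2 = (2 * pi) powr (-3)"
      by (simp add: powr_power)
    also have "\<dots> = inverse ((2 * pi) ^ 3)"
      unfolding powr_minus by (subst powr_numeral) simp_all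
    finally have e: "((2 * pi) powr (-3/2))\<^sup>2 = inverse ((2 * pi) ^ 3)" .
    show ?thesis unfolding e by (rule left_inverse) simp
  qed
  have "sqint lborel (fourier_L1 u) = (\<integral>\<^sup>+\<xi>. ennreal (((2 * pi) powr (-3/2))\<^sup>2) * ennreal ((norm (ft u \<xi>))\<^sup>2) \<partial>lborel)"
    unfolding sqint_def
    by (simp add: fourier_L1_eq_ft norm_mult power_mult_distrib ennreal_mult)
  also have "\<dots> = ennreal (((2 * pi) powr (-3/2))\<^sup>2) * (ennreal ((2 * pi) ^ 3) * sqint lborel u)"
    using plancherel_L1_L2[OF u fin] by (simp add: nn_integral_cmult sqint_def)
  also have "\<dots> = ennreal (((2 * pi) powr (-3/2))\<^sup>2 * (2 * pi) ^ 3) * sqint lborel u"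
    by (simp add: ennreal_mult mult.assoc)
  finally show ?thesis unfolding c by simp
qed

lemma fourier_L1_diff:
  assumes "integrable lborel u" "integrable lborel w"
  shows "fourier_L1 (\<lambda>x. u x - w x) \<xi> = fourier_L1 u \<xi> - fourier_L1 w \<xi>"
  using assms by (simp add: fourier_L1_eq_ft ft_diff right_diff_distrib)

lemma sqint_diff_finite:
  fixes f g :: "'a \<Rightarrow> complex"
  assumes "f \<in> borel_measurable M" "g \<in> borel_measurable M" "sqint M f < \<infinity>" "sqint M g < \<infinity>"
  shows "sqint M (\<lambda>x. f x - g x) < \<infinity>"
proof -
  have "sqint M (\<lambda>x. f x - g x) \<le> 2 * sqint M (\<lambda>x. f x - 0) + 2 * sqint M (\<lambda>x. 0 - g x)"
    using assms by (intro sqint_diff_triangle) auto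
  also have "\<dots> < \<infinity>"
    using assms by (simp add: sqint_def ennreal_mult_less_top)
  finally show ?thesis .
qed

lemma sqint_fourier_L1_diff:
  assumes "integrable lborel u" "integrable lborel w" "sqint lborel u < \<infinity>" "sqint lborel w < \<infinity>"
  shows "sqint lborel (\<lambda>\<xi>. fourier_L1 u \<xi> - fourier_L1 w \<xi>) = sqint lborel (\<lambda>x. u x - w x)"
proof -
  have "sqint lborel (\<lambda>x. u x - w x) < \<infinity>"
    using assms by (intro sqint_diff_finite) auto
  then show ?thesis
    using sqint_fourier_L1[of "\<lambda>x. u x - w x"] assms by (simp add: fourier_L1_diff[OF assms(1,2), abs_def])
qed

text \<open>The truncation that occurs inside \<open>fourier_L2\<close>, named so that the limit
  defining the L2 transform can be stated with \<open>sqint\<close>.\<close>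

definition trunc :: "nat \<Rightarrow> (r3 \<Rightarrow> complex) \<Rightarrow> r3 \<Rightarrow> complex" where
  "trunc n u x = indicator (cball 0 (real n)) x * u x"

lemma borel_measurable_trunc [measurable]:
  assumes [measurable]: "u \<in> borel_measurable borel"
  shows "trunc n u \<in> borel_measurable borel"
proof -
  have [measurable]: "cball (0::r3) (real n) \<in> sets borel" by simp
  show ?thesis unfolding trunc_def[abs_def] by measurable
qed

lemma norm_trunc_diff_le: "norm (trunc n u x - u x) \<le> norm (u x)"
  by (simp add: trunc_def split: split_indicator)

lemma sqint_trunc_le: "sqint M (trunc n u) \<le> sqint M u"
  by (rule sqint_mono) (simp add: trunc_def split: split_indicator)

lemma integrable_trunc:
  assumes [measurable]: "u \<in> borel_measurable borel" and fin: "sqint lborel u < \<infinity>"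
  shows "integrable lborel (trunc n u)"
proof -
  have [measurable]: "cball (0::r3) (real n) \<in> sets borel" by simp
  have "sqint lborel (\<lambda>x. indicator (cball 0 (real n)) (x::r3) :: complex) = sqint lborel (\<lambda>x. 1 * indicator (cball 0 (real n)) (x::r3) :: real)"
    unfolding sqint_def by (intro nn_integral_cong) (auto split: split_indicator)
  also have "\<dots> < \<infinity>" by (rule sqint_const_on_cball)
  finally have "sqint lborel (\<lambda>x. indicator (cball 0 (real n)) (x::r3) :: complex) < \<infinity>" .
  then show ?thesis unfolding trunc_def[abs_def] using fin by (intro integrable_L2_mult) auto
qed

lemma trunc_tendsto:
  assumes [measurable]: "u \<in> borel_measurable borel" and fin: "sqint lborel u < \<infinity>"
  shows "(\<lambda>n. sqint lborel (\<lambda>x. trunc n u x - u x)) \<longlonglongrightarrow> 0"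
proof (rule tendsto_sqint_dominated[where w="\<lambda>x. norm (u x)"])
  show "AE x in lborel. (\<lambda>n. trunc n u x) \<longlonglongrightarrow> u x"
  proof (intro AE_I2 tendsto_eventually)
    fix x
    show "\<forall>\<^sub>F n in sequentially. trunc n u x = u x"
      using eventually_ge_at_top[of "nat \<lceil>norm x\<rceil>"]
      by eventually_elim (auto simp: trunc_def nat_le_iff ceiling_le_iff)
  qed
  show "sqint lborel (\<lambda>x. norm (u x)) < \<infinity>" using fin by (simp add: sqint_def)
qed (auto simp: norm_trunc_diff_le)

text \<open>The choice in \<open>fourier_L2\<close> is made from a nonempty set: truncations are
  integrable, Plancherel turns their L2 convergence into the Cauchy property of their transforms,
  and \<open>L2_complete\<close> supplies a limit.\<close>

lemma fourier_L2_spec_borel: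
  assumes [measurable]: "u \<in> borel_measurable borel" and fin: "sqint lborel u < \<infinity>"
  shows "fourier_L2 u \<in> borel_measurable lebesgue"
    "(\<lambda>n. sqint lebesgue (\<lambda>\<xi>. fourier_L1 (trunc n u) \<xi> - fourier_L2 u \<xi>)) \<longlonglongrightarrow> 0"
proof -
  note lim0 = trunc_tendsto[OF assms]
  have [measurable]: "fourier_L1 (trunc n u) \<in> borel_measurable borel" for n
    by (rule borel_measurable_fourier_L1) measurable
  have tf: "sqint lborel (trunc n u) < \<infinity>" for n using sqint_trunc_le[of lborel n u] fin by simp
  have "\<exists>v\<in>borel_measurable lborel. (\<lambda>n. sqint lborel (\<lambda>\<xi>. fourier_L1 (trunc n u) \<xi> - v \<xi>)) \<longlonglongrightarrow> 0"
  proof (rule L2_complete)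
    fix e :: real assume e: "e > 0"
    then have "\<forall>\<^sub>F n in sequentially. sqint lborel (\<lambda>x. trunc n u x - u x) < ennreal (e/4)"
      using lim0 by (intro order_tendstoD(2)) auto
    then obtain N where N: "\<And>n. n \<ge> N \<Longrightarrow> sqint lborel (\<lambda>x. trunc n u x - u x) < ennreal (e/4)"
      by (auto simp: eventually_sequentially)
    have "sqint lborel (\<lambda>\<xi>. fourier_L1 (trunc m u) \<xi> - fourier_L1 (trunc n u) \<xi>) < ennreal e"
      if "m \<ge> N" "n \<ge> N" for m n
    proof -
      have "sqint lborel (\<lambda>\<xi>. fourier_L1 (trunc m u) \<xi> - fourier_L1 (trunc n u) \<xi>) = sqint lborel (\<lambda>x. trunc m u x - trunc n u x)"
        by (intro sqint_fourier_L1_diff integrable_trunc assms tf)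
      also have "\<dots> \<le> 2 * sqint lborel (\<lambda>x. trunc m u x - u x) + 2 * sqint lborel (\<lambda>x. u x - trunc n u x)"
        by (rule sqint_diff_triangle) auto
      also have "\<dots> = 2 * (sqint lborel (\<lambda>x. trunc m u x - u x) + sqint lborel (\<lambda>x. trunc n u x - u x))"
        by (simp add: sqint_diff_commute[of _ u] distrib_left)
      also have "\<dots> < 2 * (ennreal (e/4) + ennreal (e/4))"
        by (intro ennreal_mult_strict_left_mono add_strict_mono N that) auto
      also have "\<dots> = ennreal e"
        using e by (simp flip: ennreal_plus ennreal_numeral ennreal_mult)
      finally show ?thesis .
    qed
    then show "\<exists>N. \<forall>m\<ge>N. \<forall>n\<ge>N. sqint lborel (\<lambda>x. fourier_L1 (trunc m u) x - fourier_L1 (trunc n u) x) < ennreal e"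
      by blast
  qed auto
  then obtain v where v: "v \<in> borel_measurable lborel" "(\<lambda>n. sqint lborel (\<lambda>\<xi>. fourier_L1 (trunc n u) \<xi> - v \<xi>)) \<longlonglongrightarrow> 0"
    by blast
  let ?P = "\<lambda>g. g \<in> borel_measurable lebesgue \<and>
     (\<lambda>n. \<integral>\<^sup>+ \<xi>. ennreal ((norm (fourier_L1 (\<lambda>x. indicator (cball 0 (real n)) x * u x) \<xi> - g \<xi>))\<^sup>2) \<partial>lebesgue) \<longlonglongrightarrow> 0"
  have Pv: "?P v"
  proof
    show "v \<in> borel_measurable lebesgue" using v(1) by (rule measurable_completion)
    show "(\<lambda>n. \<integral>\<^sup>+ \<xi>. ennreal ((norm (fourier_L1 (\<lambda>x. indicator (cball 0 (real n)) x * u x) \<xi> - v \<xi>))\<^sup>2) \<partial>lebesgue) \<longlonglongrightarrow> 0"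
      using v(2) by (simp only: sqint_lebesgue[symmetric]) (simp only: sqint_def trunc_def[abs_def])
  qed
  have "?P (fourier_L2 u)" unfolding fourier_L2_def by (rule someI[where P="?P", OF Pv])
  then show "fourier_L2 u \<in> borel_measurable lebesgue"
    "(\<lambda>n. sqint lebesgue (\<lambda>\<xi>. fourier_L1 (trunc n u) \<xi> - fourier_L2 u \<xi>)) \<longlonglongrightarrow> 0"
    unfolding sqint_def trunc_def[abs_def] by auto
qed

text \<open>Equality holds as functions, not just almost everywhere: the defining property sees
  \<open>u\<close> only through transforms of its truncations, and these are integrals. Both choices
  are made from one and the same predicate.\<close>

lemma fourier_L2_cong_AE:
  assumes "u \<in> borel_measurable lebesgue" "w \<in> borel_measurable lebesgue" "AE x in lborel. u x = w x"
  shows "fourier_L2 u = fourier_L2 w"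
proof -
  have "fourier_L1 (\<lambda>x. indicator (cball 0 (real n)) x * u x) = fourier_L1 (\<lambda>x. indicator (cball 0 (real n)) x * w x)" for n
    using assms by (intro fourier_L1_cong_AE borel_measurable_times borel_measurable_indicator) auto
  then show ?thesis unfolding fourier_L2_def by simp
qed

text \<open>Plancherel passed through the truncations. The constant 4 comes from using |a+b|^2 <=
  2|a|^2 + 2|b|^2 once on each side of the isometry. Its purpose is to recover finite L2 norms from
  finite Sobolev norms.\<close>

lemma sqint_le_fourier_L2:
  assumes [measurable]: "u \<in> borel_measurable borel" and fin: "sqint lborel u < \<infinity>"
  shows "sqint lborel u \<le> 4 * sqint lebesgue (fourier_L2 u)"
proof -
  have [measurable]: "fourier_L1 (trunc n u) \<in> borel_measurable lebesgue" for n
    by (intro borel_imp_lebesgue borel_measurable_fourier_L1) measurable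
  note [measurable] = fourier_L2_spec_borel(1)[OF assms]
  have tf: "sqint lborel (trunc n u) < \<infinity>" for n using sqint_trunc_le[of lborel n u] fin by simp
  \<comment> \<open>The total truncation error on both sides, which tends to 0.\<close>
  define a where "a n = 2 * sqint lborel (\<lambda>x. trunc n u x - u x) + 4 * sqint lebesgue (\<lambda>\<xi>. fourier_L1 (trunc n u) \<xi> - fourier_L2 u \<xi>)" for n
  have "a \<longlonglongrightarrow> 2 * 0 + 4 * 0"
    unfolding a_def by (intro tendsto_add tendsto_mult_ennreal tendsto_const trunc_tendsto fourier_L2_spec_borel(2) assms) auto
  then have "(\<lambda>n. a n + 4 * sqint lebesgue (fourier_L2 u)) \<longlonglongrightarrow> 0 + 4 * sqint lebesgue (fourier_L2 u)"
    by (intro tendsto_add tendsto_const) simp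
  moreover have "sqint lborel u \<le> a n + 4 * sqint lebesgue (fourier_L2 u)" for n
  proof -
    have "sqint lborel u \<le> 2 * sqint lborel (\<lambda>x. u x - trunc n u x) + 2 * sqint lborel (trunc n u)"
      using sqint_diff_triangle[of u lborel "trunc n u" "\<lambda>_. 0"] by simp
    also have "sqint lborel (trunc n u) = sqint lebesgue (fourier_L1 (trunc n u))"
      using sqint_fourier_L1[OF integrable_trunc[OF assms] tf, of n] by (simp add: sqint_lebesgue)
    also have "\<dots> \<le> 2 * sqint lebesgue (\<lambda>\<xi>. fourier_L1 (trunc n u) \<xi> - fourier_L2 u \<xi>) + 2 * sqint lebesgue (fourier_L2 u)"
      using sqint_diff_triangle[of "fourier_L1 (trunc n u)" lebesgue "fourier_L2 u" "\<lambda>_. 0"] by simp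
    finally show ?thesis unfolding a_def sqint_diff_commute[of _ u "trunc n u"]
      by (simp add: add_left_mono mult_left_mono distrib_left mult.assoc[symmetric] add.assoc)
  qed
  ultimately have "sqint lborel u \<le> 0 + 4 * sqint lebesgue (fourier_L2 u)"
    by (intro LIMSEQ_le_const) auto
  then show ?thesis by simp
qed

text \<open>The function \<open>w\<close> has an absolutely convergent transform and stands for an
  approximation of \<open>u\<close>. The comparison goes through truncations of \<open>u\<close>,
  where \<open>fourier_L1\<close> is linear and isometric, instead of through linearity of the
  chosen \<open>fourier_L2\<close>.\<close>

lemma sqint_fourier_L2_diff_le:
  assumes [measurable]: "u \<in> borel_measurable borel" and fin: "sqint lborel u < \<infinity>"
    and w: "integrable lborel w" "sqint lborel w < \<infinity>"
  shows "sqint lebesgue (\<lambda>\<xi>. fourier_L2 u \<xi> - fourier_L1 w \<xi>) \<le> 4 * sqint lborel (\<lambda>x. u x - w x)"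
proof -
  have [measurable]: "w \<in> borel_measurable borel" using w by simp
  have [measurable]: "fourier_L1 (trunc n u) \<in> borel_measurable lebesgue" "fourier_L1 w \<in> borel_measurable lebesgue" for n
    by (intro borel_imp_lebesgue borel_measurable_fourier_L1; measurable)+
  note [measurable] = fourier_L2_spec_borel(1)[OF assms(1,2)]
  have tf: "sqint lborel (trunc n u) < \<infinity>" for n using sqint_trunc_le[of lborel n u] fin by simp
  define a where "a n = 2 * sqint lebesgue (\<lambda>\<xi>. fourier_L1 (trunc n u) \<xi> - fourier_L2 u \<xi>) + 4 * sqint lborel (\<lambda>x. trunc n u x - u x)" for n
  have "a \<longlonglongrightarrow> 2 * 0 + 4 * 0"
    unfolding a_def by (intro tendsto_add tendsto_mult_ennreal tendsto_const trunc_tendsto fourier_L2_spec_borel(2) assms) auto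
  then have "(\<lambda>n. a n + 4 * sqint lborel (\<lambda>x. u x - w x)) \<longlonglongrightarrow> 0 + 4 * sqint lborel (\<lambda>x. u x - w x)"
    by (intro tendsto_add tendsto_const) simp
  moreover have "sqint lebesgue (\<lambda>\<xi>. fourier_L2 u \<xi> - fourier_L1 w \<xi>) \<le> a n + 4 * sqint lborel (\<lambda>x. u x - w x)" for n
  proof -
    have "sqint lebesgue (\<lambda>\<xi>. fourier_L2 u \<xi> - fourier_L1 w \<xi>)
      \<le> 2 * sqint lebesgue (\<lambda>\<xi>. fourier_L2 u \<xi> - fourier_L1 (trunc n u) \<xi>) + 2 * sqint lebesgue (\<lambda>\<xi>. fourier_L1 (trunc n u) \<xi> - fourier_L1 w \<xi>)"
      by (rule sqint_diff_triangle) auto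
    also have "sqint lebesgue (\<lambda>\<xi>. fourier_L1 (trunc n u) \<xi> - fourier_L1 w \<xi>) = sqint lborel (\<lambda>x. trunc n u x - w x)"
      unfolding sqint_lebesgue by (intro sqint_fourier_L1_diff integrable_trunc assms tf)
    also have "\<dots> \<le> 2 * sqint lborel (\<lambda>x. trunc n u x - u x) + 2 * sqint lborel (\<lambda>x. u x - w x)"
      by (rule sqint_diff_triangle) auto
    finally show ?thesis unfolding a_def sqint_diff_commute[of _ "fourier_L2 u" "fourier_L1 (trunc n u)"]
      by (simp add: add_left_mono mult_left_mono distrib_left mult.assoc[symmetric] add.assoc)
  qed
  ultimately have "sqint lebesgue (\<lambda>\<xi>. fourier_L2 u \<xi> - fourier_L1 w \<xi>) \<le> 0 + 4 * sqint lborel (\<lambda>x. u x - w x)"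
    by (intro LIMSEQ_le_const) auto
  then show ?thesis by simp
qed

text \<open>The bound \<open>W\<close> on the weight lets the error be measured in the unweighted L2
  norm. The Sobolev weight itself is unbounded for a positive exponent and must be cut off before
  this applies.\<close>

lemma weighted_sq_le:
  fixes f g :: "'a \<Rightarrow> complex" and wgt :: "'a \<Rightarrow> real"
  assumes [measurable]: "f \<in> borel_measurable M" "g \<in> borel_measurable M" "wgt \<in> borel_measurable M"
    and wgt: "\<And>x. 0 \<le> wgt x" "\<And>x. wgt x \<le> W"
  shows "(\<integral>\<^sup>+x. ennreal (wgt x * (norm (f x))\<^sup>2) \<partial>M)
    \<le> 2 * (\<integral>\<^sup>+x. ennreal (wgt x * (norm (g x))\<^sup>2) \<partial>M) + ennreal (2 * W) * sqint M (\<lambda>x. f x - g x)"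
proof -
  have W: "0 \<le> W" using wgt order_trans by blast
  have "(\<integral>\<^sup>+x. ennreal (wgt x * (norm (f x))\<^sup>2) \<partial>M)
    \<le> (\<integral>\<^sup>+x. 2 * ennreal (wgt x * (norm (g x))\<^sup>2) + ennreal (2 * W) * ennreal ((norm (f x - g x))\<^sup>2) \<partial>M)"
  proof (intro nn_integral_mono)
    fix x
    have "wgt x * (norm (f x))\<^sup>2 \<le> wgt x * (2 * (norm (g x))\<^sup>2 + 2 * (norm (f x - g x))\<^sup>2)"
      using norm_add_sq_le[of "g x" "f x - g x"] wgt by (intro mult_left_mono) auto
    also have "\<dots> = 2 * (wgt x * (norm (g x))\<^sup>2) + 2 * wgt x * (norm (f x - g x))\<^sup>2"
      by (simp add: algebra_simps)
    also have "\<dots> \<le> 2 * (wgt x * (norm (g x))\<^sup>2) + 2 * W * (norm (f x - g x))\<^sup>2"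
      using wgt by (intro add_left_mono mult_right_mono) auto
    finally have "ennreal (wgt x * (norm (f x))\<^sup>2) \<le> ennreal (2 * (wgt x * (norm (g x))\<^sup>2) + 2 * W * (norm (f x - g x))\<^sup>2)"
      by (rule ennreal_leI)
    also have "\<dots> = 2 * ennreal (wgt x * (norm (g x))\<^sup>2) + ennreal (2 * W) * ennreal ((norm (f x - g x))\<^sup>2)"
      using wgt(1) W by (simp add: ennreal_plus ennreal_mult mult.assoc)
    finally show "ennreal (wgt x * (norm (f x))\<^sup>2) \<le> 2 * ennreal (wgt x * (norm (g x))\<^sup>2) + ennreal (2 * W) * ennreal ((norm (f x - g x))\<^sup>2)" .
  qed
  also have "\<dots> = 2 * (\<integral>\<^sup>+x. ennreal (wgt x * (norm (g x))\<^sup>2) \<partial>M) + ennreal (2 * W) * sqint M (\<lambda>x. f x - g x)"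
    unfolding sqint_def by (simp add: nn_integral_add nn_integral_cmult)
  finally show ?thesis .
qed

text \<open>Both directions are used: one replaces the transform of the output by that of a
  truncated output, the other returns from the truncated input to the input. The constant 8 is the 2
  of \<open>weighted_sq_le\<close> times the 4 of \<open>sqint_fourier_L2_diff_le\<close>.\<close>

lemma weighted_fourier_L2_L1:
  fixes wgt :: "r3 \<Rightarrow> real"
  assumes u: "u \<in> borel_measurable borel" and fin: "sqint lborel u < \<infinity>"
    and w: "integrable lborel w" "sqint lborel w < \<infinity>"
    and wgt[measurable]: "wgt \<in> borel_measurable borel" and "\<And>x. 0 \<le> wgt x" "\<And>x. wgt x \<le> W"
  shows "(\<integral>\<^sup>+\<xi>. ennreal (wgt \<xi> * (norm (fourier_L2 u \<xi>))\<^sup>2) \<partial>lebesgue)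
     \<le> 2 * (\<integral>\<^sup>+\<xi>. ennreal (wgt \<xi> * (norm (fourier_L1 w \<xi>))\<^sup>2) \<partial>lborel) + ennreal (8 * W) * sqint lborel (\<lambda>x. u x - w x)" (is ?A)
   and "(\<integral>\<^sup>+\<xi>. ennreal (wgt \<xi> * (norm (fourier_L1 w \<xi>))\<^sup>2) \<partial>lborel)
     \<le> 2 * (\<integral>\<^sup>+\<xi>. ennreal (wgt \<xi> * (norm (fourier_L2 u \<xi>))\<^sup>2) \<partial>lebesgue) + ennreal (8 * W) * sqint lborel (\<lambda>x. u x - w x)" (is ?B)
proof -
  have W: "0 \<le> W" using assms order_trans by blast
  have [measurable]: "fourier_L1 w \<in> borel_measurable lebesgue" "wgt \<in> borel_measurable lebesgue"
    using w by (auto intro!: borel_imp_lebesgue borel_measurable_fourier_L1)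
  note [measurable] = fourier_L2_spec_borel(1)[OF u fin]
  have "ennreal (2 * W) * sqint lebesgue (\<lambda>\<xi>. fourier_L2 u \<xi> - fourier_L1 w \<xi>) \<le> ennreal (2 * W) * (4 * sqint lborel (\<lambda>x. u x - w x))"
    by (intro mult_left_mono sqint_fourier_L2_diff_le u fin w) simp
  also have "\<dots> = ennreal (8 * W) * sqint lborel (\<lambda>x. u x - w x)"
    using W by (simp add: ennreal_mult mult_ac flip: ennreal_numeral) (simp add: mult.assoc[symmetric] flip: ennreal_mult)
  finally have *: "ennreal (2 * W) * sqint lebesgue (\<lambda>\<xi>. fourier_L2 u \<xi> - fourier_L1 w \<xi>) \<le> ennreal (8 * W) * sqint lborel (\<lambda>x. u x - w x)" .
  have "(\<integral>\<^sup>+\<xi>. ennreal (wgt \<xi> * (norm (fourier_L2 u \<xi>))\<^sup>2) \<partial>lebesgue)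
     \<le> 2 * (\<integral>\<^sup>+\<xi>. ennreal (wgt \<xi> * (norm (fourier_L1 w \<xi>))\<^sup>2) \<partial>lebesgue) + ennreal (2 * W) * sqint lebesgue (\<lambda>\<xi>. fourier_L2 u \<xi> - fourier_L1 w \<xi>)"
    by (rule weighted_sq_le) (auto simp: assms)
  then show ?A using * unfolding nn_integral_completion by (meson add_left_mono order_trans)
  have "(\<integral>\<^sup>+\<xi>. ennreal (wgt \<xi> * (norm (fourier_L1 w \<xi>))\<^sup>2) \<partial>lebesgue)
     \<le> 2 * (\<integral>\<^sup>+\<xi>. ennreal (wgt \<xi> * (norm (fourier_L2 u \<xi>))\<^sup>2) \<partial>lebesgue) + ennreal (2 * W) * sqint lebesgue (\<lambda>\<xi>. fourier_L1 w \<xi> - fourier_L2 u \<xi>)"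
    by (rule weighted_sq_le) (auto simp: assms)
  then show ?B using * unfolding nn_integral_completion sqint_diff_commute[of _ "fourier_L1 w"] by (meson add_left_mono order_trans)
qed

subsection \<open>Free transport with damping\<close>

lemma nn_integral_exp_decay:
  fixes \<nu> :: real
  assumes "\<nu> > 0"
  shows "(\<integral>\<^sup>+t. ennreal (indicator {0<..} t * exp (- \<nu> * t)) \<partial>lborel) = ennreal (1 / \<nu>)"
proof -
  have "(\<integral>\<^sup>+t. ennreal (indicator {0<..} t * exp (- \<nu> * t)) \<partial>lborel) = (\<integral>\<^sup>+t. ennreal (exp (- \<nu> * t)) * indicator {0..} t \<partial>lborel)"
    using AE_lborel_singleton[of 0]
    by (intro nn_integral_cong_AE) (auto split: split_indicator elim!: eventually_mono)
  also have "\<dots> = ennreal (0 - (- exp (- \<nu> * 0) / \<nu>))"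
  proof (rule nn_integral_FTC_atLeast)
    show "((\<lambda>t. - exp (- \<nu> * t) / \<nu>) has_field_derivative exp (- \<nu> * t)) (at t)" for t
      using assms by (auto intro!: derivative_eq_intros)
    have "((\<lambda>t. exp (- \<nu> * t)) \<longlongrightarrow> 0) at_top"
      using assms by (intro filterlim_compose[OF exp_at_bot] filterlim_tendsto_neg_mult_at_bot[OF tendsto_const _ filterlim_ident]) auto
    then have "((\<lambda>t. - exp (- \<nu> * t) / \<nu>) \<longlongrightarrow> - 0 / \<nu>) at_top"
      by (intro tendsto_intros) (use assms in auto)
    then show "((\<lambda>t. - exp (- \<nu> * t) / \<nu>) \<longlongrightarrow> 0) at_top" by simp
  qed auto
  finally show ?thesis by simp
qed

lemma integrable_exp_decay:
  fixes \<nu> :: real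
  assumes "\<nu> > 0"
  shows "integrable lborel (\<lambda>t::real. indicator {0<..} t * exp (- \<nu> * t))"
  using nn_integral_exp_decay[OF assms]
  by (intro integrableI_bounded) (auto simp: abs_mult)

text \<open>The integrand is exp(-t z) with z = \<nu> + i a. The antiderivative gives the integral
  over [0, n], and dominated convergence lets n tend to infinity.\<close>

lemma integral_exp_decay_cis:
  fixes \<nu> a :: real
  assumes \<nu>: "\<nu> > 0"
  shows "(LINT t|lborel. complex_of_real (indicator {0<..} t * exp (- \<nu> * t)) * cis (- (t * a))) = 1 / Complex \<nu> a"
proof -
  define z where "z = Complex \<nu> a"
  have z: "z \<noteq> 0" using \<nu> by (auto simp: z_def complex_eq_iff)
  have ez: "complex_of_real (exp (- \<nu> * t)) * cis (- (t * a)) = exp (- (t *\<^sub>R z))" for t :: real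
    by (auto simp: z_def complex_eq_iff Re_exp Im_exp)
  have fin: "(LINT t|lborel. indicator {0..real n} t *\<^sub>R exp (- (t *\<^sub>R z))) = - exp (- (real n *\<^sub>R z)) / z + 1 / z" for n :: nat
  proof -
    have "has_bochner_integral lborel (\<lambda>t. indicator {0..real n} t *\<^sub>R exp (- (t *\<^sub>R z))) (- exp (- (real n *\<^sub>R z)) / z - (- exp (- (0 *\<^sub>R z)) / z))"
    proof (rule has_bochner_integral_FTC_Icc)
      fix t :: real
      have "((\<lambda>w. - exp (- (w * z)) / z) has_field_derivative exp (- (complex_of_real t * z))) (at (complex_of_real t))"
        using z by (auto intro!: derivative_eq_intros)
      from has_vector_derivative_real_field[OF this]
      show "((\<lambda>t. - exp (- (t *\<^sub>R z)) / z) has_vector_derivative exp (- (t *\<^sub>R z))) (at t within {0..real n})"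
        by (simp add: scaleR_conv_of_real)
      show "continuous_on {0..real n} (\<lambda>t. exp (- (t *\<^sub>R z)))" by (intro continuous_intros)
    qed auto
    then show ?thesis by (simp add: has_bochner_integral_integral_eq)
  qed
  have "(\<lambda>n. LINT t|lborel. indicator {0..real n} t *\<^sub>R exp (- (t *\<^sub>R z)))
    \<longlonglongrightarrow> (LINT t|lborel. indicator {0<..} t *\<^sub>R exp (- (t *\<^sub>R z)))"
  proof (rule integral_dominated_convergence)
    show "integrable lborel (\<lambda>t::real. indicator {0<..} t * exp (- \<nu> * t))" by (rule integrable_exp_decay[OF \<nu>])
    have nz: "AE t::real in lborel. t \<noteq> 0" by (rule AE_lborel_singleton)
    then show "AE t in lborel. (\<lambda>n. indicator {0..real n} t *\<^sub>R exp (- (t *\<^sub>R z))) \<longlonglongrightarrow> indicator {0<..} t *\<^sub>R exp (- (t *\<^sub>R z))"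
    proof eventually_elim
      case (elim t)
      have "\<forall>\<^sub>F n in sequentially. indicator {0..real n} t *\<^sub>R exp (- (t *\<^sub>R z)) = indicator {0<..} t *\<^sub>R exp (- (t *\<^sub>R z))"
        using eventually_ge_at_top[of "nat \<lceil>\<bar>t\<bar>\<rceil>"]
        by eventually_elim (use elim in \<open>auto split: split_indicator simp: nat_le_iff ceiling_le_iff\<close>)
      then show ?case by (rule tendsto_eventually)
    qed
    show "AE t in lborel. norm (indicator {0..real n} t *\<^sub>R exp (- (t *\<^sub>R z))) \<le> indicator {0<..} t * exp (- \<nu> * t)" for n
      using nz by eventually_elim (auto split: split_indicator simp: z_def mult.commute)
  qed auto
  moreover have "(\<lambda>n. - exp (- (real n *\<^sub>R z)) / z + 1 / z) \<longlonglongrightarrow> - 0 / z + 1 / z"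
  proof (intro tendsto_intros z)
    have "filterlim (\<lambda>n. - \<nu> * real n) at_bot sequentially"
      using \<nu> by (intro filterlim_tendsto_neg_mult_at_bot[OF tendsto_const _ filterlim_real_sequentially]) auto
    then have "(\<lambda>n. exp (- \<nu> * real n)) \<longlonglongrightarrow> 0"
      by (rule filterlim_compose[OF exp_at_bot])
    then have "(\<lambda>n. norm (exp (- (real n *\<^sub>R z)))) \<longlonglongrightarrow> 0" by (simp add: z_def mult.commute)
    then show "(\<lambda>n. exp (- (real n *\<^sub>R z))) \<longlonglongrightarrow> 0" by (rule tendsto_norm_zero_cancel)
  qed
  ultimately have "(LINT t|lborel. indicator {0<..} t *\<^sub>R exp (- (t *\<^sub>R z))) = 1 / z"
    unfolding fin by (simp add: LIMSEQ_unique)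
  moreover have "complex_of_real (indicator {0<..} t * exp (- \<nu> * t)) * cis (- (t * a)) = indicator {0<..} t *\<^sub>R exp (- (t *\<^sub>R z))" for t :: real
    by (simp only: of_real_mult mult.assoc ez) (simp only: scaleR_conv_of_real)
  ultimately show ?thesis by (simp add: z_def)
qed

text \<open>The operator S at one fixed velocity: \<open>v\<close> and the damping rate are
  constants, and the half-line enters through an indicator, so that Fubini can be used with
  \<open>lborel\<close> in both variables.\<close>

definition transport_integral :: "real \<Rightarrow> r3 \<Rightarrow> (r3 \<Rightarrow> complex) \<Rightarrow> r3 \<Rightarrow> complex" where
  "transport_integral \<nu> v \<kappa> x = (LINT t|lborel. complex_of_real (indicator {0<..} t * exp (- \<nu> * t)) * \<kappa> (x - t *\<^sub>R v))"

lemma nn_integral_lborel_translate: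
  fixes f :: "'a::euclidean_space \<Rightarrow> ennreal"
  assumes [measurable]: "f \<in> borel_measurable borel"
  shows "(\<integral>\<^sup>+x. f (x - a) \<partial>lborel) = (\<integral>\<^sup>+x. f x \<partial>lborel)"
proof -
  have "(\<integral>\<^sup>+x. f x \<partial>lborel) = (\<integral>\<^sup>+x. f x \<partial>distr lborel borel ((+) (- a)))" by (simp add: lborel_distr_plus)
  also have "\<dots> = (\<integral>\<^sup>+x. f (x - a) \<partial>lborel)" by (subst nn_integral_distr) auto
  finally show ?thesis by simp
qed

lemma lborel_integral_translate:
  fixes f :: "'a::euclidean_space \<Rightarrow> complex"
  assumes [measurable]: "f \<in> borel_measurable borel"
  shows "(LINT x|lborel. f (x - a)) = (LINT x|lborel. f x)"
proof -
  have "(LINT x|lborel. f x) = (LINT x|distr lborel borel ((+) (- a)). f x)" by (simp add: lborel_distr_plus)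
  also have "\<dots> = (LINT x|lborel. f (x - a))" by (subst integral_distr) auto
  finally show ?thesis by simp
qed

text \<open>Translation by \<open>t *\<^sub>R v\<close> multiplies the transform by the character
  with phase -t (v.\<xi>), and only the scalar integral of \<open>integral_exp_decay_cis\<close>
  remains. The double integral converges absolutely because translations preserve the L1
  norm.\<close>

lemma ft_transport_integral:
  assumes \<nu>: "\<nu> > 0" and \<kappa>: "integrable lborel \<kappa>"
  shows "integrable lborel (transport_integral \<nu> v \<kappa>)"
    and "ft (transport_integral \<nu> v \<kappa>) \<xi> = ft \<kappa> \<xi> / Complex \<nu> (v \<bullet> \<xi>)"
proof -
  have [measurable]: "\<kappa> \<in> borel_measurable borel" using \<kappa> by simp
  define e where "e t = complex_of_real (indicator {0<..} t * exp (- \<nu> * t))" for t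
  have [measurable]: "e \<in> borel_measurable borel" unfolding e_def[abs_def] by measurable
  have e_int: "integrable lborel e" unfolding e_def[abs_def] using integrable_exp_decay[OF \<nu>] by (rule integrable_of_real)
  have int: "integrable (lborel \<Otimes>\<^sub>M lborel) (\<lambda>(x, t). cis (- (x \<bullet> \<xi>)) * (e t * \<kappa> (x - t *\<^sub>R v)))" for \<xi> :: r3
  proof (rule integrableI_bounded)
    have "(\<integral>\<^sup>+p. ennreal (norm (case p of (x, t) \<Rightarrow> cis (- (x \<bullet> \<xi>)) * (e t * \<kappa> (x - t *\<^sub>R v)))) \<partial>(lborel \<Otimes>\<^sub>M lborel))
      = (\<integral>\<^sup>+t. \<integral>\<^sup>+x. ennreal (norm (cis (- (x \<bullet> \<xi>)) * (e t * \<kappa> (x - t *\<^sub>R v)))) \<partial>lborel \<partial>lborel)"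
      by (subst lborel_pair.nn_integral_snd[symmetric]) auto
    also have "\<dots> = (\<integral>\<^sup>+t. ennreal (norm (e t)) * (\<integral>\<^sup>+x. ennreal (norm (\<kappa> x)) \<partial>lborel) \<partial>lborel)"
      by (simp add: norm_mult ennreal_mult nn_integral_cmult nn_integral_lborel_translate[where f="\<lambda>x. ennreal (norm (\<kappa> x))"])
    also have "\<dots> = (\<integral>\<^sup>+t. ennreal (norm (e t)) \<partial>lborel) * (\<integral>\<^sup>+x. ennreal (norm (\<kappa> x)) \<partial>lborel)"
      by (simp add: nn_integral_multc)
    also have "\<dots> < \<infinity>" using e_int \<kappa> by (simp add: integrable_iff_bounded ennreal_mult_less_top)
    finally show "(\<integral>\<^sup>+p. ennreal (norm (case p of (x, t) \<Rightarrow> cis (- (x \<bullet> \<xi>)) * (e t * \<kappa> (x - t *\<^sub>R v)))) \<partial>(lborel \<Otimes>\<^sub>M lborel)) < \<infinity>" .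
  qed measurable
  have T: "transport_integral \<nu> v \<kappa> x = (LINT t|lborel. e t * \<kappa> (x - t *\<^sub>R v))" for x
    unfolding transport_integral_def e_def ..
  show "integrable lborel (transport_integral \<nu> v \<kappa>)"
    using lborel_pair.integrable_fst'[OF int[of 0]] by (simp add: T[abs_def])
  have "ft (transport_integral \<nu> v \<kappa>) \<xi> = (LINT x|lborel. LINT t|lborel. cis (- (x \<bullet> \<xi>)) * (e t * \<kappa> (x - t *\<^sub>R v)))"
    unfolding ft_def T by simp
  also have "\<dots> = (LINT t|lborel. LINT x|lborel. cis (- (x \<bullet> \<xi>)) * (e t * \<kappa> (x - t *\<^sub>R v)))"
    by (rule lborel_pair.Fubini_integral[OF int, symmetric])
  also have "\<dots> = (LINT t|lborel. e t * cis (- (t * (v \<bullet> \<xi>))) * ft \<kappa> \<xi>)"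
  proof (intro Bochner_Integration.integral_cong refl)
    fix t
    have "(LINT x|lborel. cis (- (x \<bullet> \<xi>)) * (e t * \<kappa> (x - t *\<^sub>R v)))
       = (LINT x|lborel. (e t * cis (- (t * (v \<bullet> \<xi>)))) * (cis (- ((x - t *\<^sub>R v) \<bullet> \<xi>)) * \<kappa> (x - t *\<^sub>R v)))"
    proof (intro Bochner_Integration.integral_cong refl)
      fix x :: r3
      have c: "cis (- (x \<bullet> \<xi>)) = cis (- (t * (v \<bullet> \<xi>))) * cis (- ((x - t *\<^sub>R v) \<bullet> \<xi>))"
        by (simp add: cis_mult inner_diff_left)
      show "cis (- (x \<bullet> \<xi>)) * (e t * \<kappa> (x - t *\<^sub>R v)) = (e t * cis (- (t * (v \<bullet> \<xi>)))) * (cis (- ((x - t *\<^sub>R v) \<bullet> \<xi>)) * \<kappa> (x - t *\<^sub>R v))"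
        by (subst c) (simp only: mult_ac)
    qed
    also have "\<dots> = (e t * cis (- (t * (v \<bullet> \<xi>)))) * (LINT x|lborel. cis (- ((x - t *\<^sub>R v) \<bullet> \<xi>)) * \<kappa> (x - t *\<^sub>R v))"
      by simp
    also have "(LINT x|lborel. cis (- ((x - t *\<^sub>R v) \<bullet> \<xi>)) * \<kappa> (x - t *\<^sub>R v)) = ft \<kappa> \<xi>"
      unfolding ft_def by (rule lborel_integral_translate) measurable
    finally show "(LINT x|lborel. cis (- (x \<bullet> \<xi>)) * (e t * \<kappa> (x - t *\<^sub>R v))) = e t * cis (- (t * (v \<bullet> \<xi>))) * ft \<kappa> \<xi>" .
  qed
  also have "\<dots> = (LINT t|lborel. e t * cis (- (t * (v \<bullet> \<xi>)))) * ft \<kappa> \<xi>" by simp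
  also have "(LINT t|lborel. e t * cis (- (t * (v \<bullet> \<xi>)))) = 1 / Complex \<nu> (v \<bullet> \<xi>)"
    unfolding e_def by (rule integral_exp_decay_cis[OF \<nu>])
  finally show "ft (transport_integral \<nu> v \<kappa>) \<xi> = ft \<kappa> \<xi> / Complex \<nu> (v \<bullet> \<xi>)" by simp
qed

text \<open>Only \<open>f\<close> and \<open>h\<close> are assumed measurable: below, \<open>g\<close> is a Sobolev norm built from
  \<open>fourier_L2\<close>, which is chosen separately on each section.\<close>

lemma nn_integral_le_add_finite:
  fixes f g h :: "'a \<Rightarrow> ennreal"
  assumes [measurable]: "f \<in> borel_measurable M" "h \<in> borel_measurable M"
    and le: "AE x in M. f x \<le> g x + h x" and fin: "(\<integral>\<^sup>+x. h x \<partial>M) < \<infinity>"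
  shows "(\<integral>\<^sup>+x. f x \<partial>M) \<le> (\<integral>\<^sup>+x. g x \<partial>M) + (\<integral>\<^sup>+x. h x \<partial>M)"
proof -
  have hf: "AE x in M. h x \<noteq> \<infinity>" using fin by (intro nn_integral_PInf_AE) auto
  have "(\<integral>\<^sup>+x. f x \<partial>M) \<le> (\<integral>\<^sup>+x. (f x - h x) + h x \<partial>M)"
    by (intro nn_integral_mono) (metis add.commute diff_add_cancel_ennreal ennreal_minus_le_iff linear order_refl)
  also have "\<dots> = (\<integral>\<^sup>+x. f x - h x \<partial>M) + (\<integral>\<^sup>+x. h x \<partial>M)"
    by (rule nn_integral_add) auto
  also have "(\<integral>\<^sup>+x. f x - h x \<partial>M) \<le> (\<integral>\<^sup>+x. g x \<partial>M)"
  proof (rule nn_integral_mono_AE)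
    show "AE x in M. f x - h x \<le> g x"
      using le hf by eventually_elim (simp add: ennreal_minus_le_iff add.commute)
  qed
  finally show ?thesis by (simp add: add_right_mono)
qed

subsection \<open>From the averaging estimate to Sobolev regularity\<close>

definition vweight :: "real \<Rightarrow> r3 \<Rightarrow> real" where
  "vweight \<gamma> v = (1 + norm v) powr \<gamma>"

lemma vweight_pos: "0 < vweight \<gamma> v"
  unfolding vweight_def by (simp add: add_pos_nonneg add_nonneg_eq_0_iff)

lemma borel_measurable_vweight [measurable]: "vweight \<gamma> \<in> borel_measurable borel"
  unfolding vweight_def[abs_def] by measurable

text \<open>The abstract setting for the passage to Sobolev norms: kernel and frequency are Borel on
  the whole space, and \<open>averaging\<close> is the estimate at one frequency. At \<xi> = 0 it is
  a weighted L2 bound, which is what makes the integrals defining K and SK converge.\<close>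

locale averaging_kernel =
  fixes k :: "r3 \<Rightarrow> r3 \<Rightarrow> real" and N :: "r3 \<Rightarrow> real" and \<gamma> \<sigma> C :: real
  assumes k_borel: "(\<lambda>p. k (fst p) (snd p)) \<in> borel_measurable (borel \<Otimes>\<^sub>M borel)"
    and N_borel [measurable]: "N \<in> borel_measurable borel"
    and N_pos: "\<And>v. 0 < N v"
    and \<sigma>_nonneg: "0 \<le> \<sigma>" and C_nonneg: "0 \<le> C"
    and averaging: "\<And>\<xi> g. g \<in> borel_measurable borel \<Longrightarrow>
      (\<integral>\<^sup>+v. ennreal (vweight \<gamma> v / ((N v)\<^sup>2 + (v \<bullet> \<xi>)\<^sup>2)) * (\<integral>\<^sup>+u. ennreal \<bar>k v u\<bar> * g u \<partial>lborel)\<^sup>2 \<partial>lborel)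
      \<le> ennreal (C * (1 + (norm \<xi>)\<^sup>2) powr (- \<sigma>)) * (\<integral>\<^sup>+u. ennreal (vweight \<gamma> u) * (g u)\<^sup>2 \<partial>lborel)"
begin

lemma k_measurable [measurable (raw)]:
  assumes "f \<in> M \<rightarrow>\<^sub>M borel" "g \<in> M \<rightarrow>\<^sub>M borel"
  shows "(\<lambda>x. k (f x) (g x)) \<in> borel_measurable M"
  using measurable_compose[OF measurable_Pair[OF assms] k_borel] by simp

text \<open>The integral of absolute values, in \<open>ennreal\<close>. Its finiteness, and that of
  \<open>SK_abs\<close>, decides where the Bochner integrals \<open>K\<close> and \<open>SK\<close>
  converge and behave linearly.\<close>

definition K_abs :: "(r3 \<times> r3 \<Rightarrow> complex) \<Rightarrow> r3 \<Rightarrow> r3 \<Rightarrow> ennreal" where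
  "K_abs h x v = (\<integral>\<^sup>+u. ennreal \<bar>k v u\<bar> * ennreal (norm (h (x, u))) \<partial>lborel)"

definition SK_abs :: "(r3 \<times> r3 \<Rightarrow> complex) \<Rightarrow> r3 \<Rightarrow> r3 \<Rightarrow> ennreal" where
  "SK_abs h x v = (\<integral>\<^sup>+t. ennreal (indicator {0<..} t * exp (- N v * t)) * K_abs h (x - t *\<^sub>R v) v \<partial>lborel)"

definition K :: "(r3 \<times> r3 \<Rightarrow> complex) \<Rightarrow> r3 \<Rightarrow> r3 \<Rightarrow> complex" where
  "K h x v = (LINT u|lborel. complex_of_real (k v u) * h (x, u))"

definition SK :: "(r3 \<times> r3 \<Rightarrow> complex) \<Rightarrow> r3 \<Rightarrow> r3 \<Rightarrow> complex" where
  "SK h x v = transport_integral (N v) v (\<lambda>x. K h x v) x"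

lemma K_abs_measurable [measurable (raw)]:
  assumes [measurable]: "h \<in> borel_measurable (borel \<Otimes>\<^sub>M borel)" "f \<in> M \<rightarrow>\<^sub>M borel" "g \<in> M \<rightarrow>\<^sub>M borel"
  shows "(\<lambda>x. K_abs h (f x) (g x)) \<in> borel_measurable M"
  unfolding K_abs_def by measurable

lemma SK_abs_measurable [measurable (raw)]:
  assumes [measurable]: "h \<in> borel_measurable (borel \<Otimes>\<^sub>M borel)" "f \<in> M \<rightarrow>\<^sub>M borel" "g \<in> M \<rightarrow>\<^sub>M borel"
  shows "(\<lambda>x. SK_abs h (f x) (g x)) \<in> borel_measurable M"
  unfolding SK_abs_def by measurable

lemma K_measurable [measurable (raw)]:
  assumes [measurable]: "h \<in> borel_measurable (borel \<Otimes>\<^sub>M borel)" "f \<in> M \<rightarrow>\<^sub>M borel" "g \<in> M \<rightarrow>\<^sub>M borel"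
  shows "(\<lambda>x. K h (f x) (g x)) \<in> borel_measurable M"
  unfolding K_def by measurable

lemma SK_measurable [measurable (raw)]:
  assumes [measurable]: "h \<in> borel_measurable (borel \<Otimes>\<^sub>M borel)" "f \<in> M \<rightarrow>\<^sub>M borel" "g \<in> M \<rightarrow>\<^sub>M borel"
  shows "(\<lambda>x. SK h (f x) (g x)) \<in> borel_measurable M"
  unfolding SK_def transport_integral_def by measurable

text \<open>The damping factor is split into two square roots, \<open>r\<close> and
  \<open>r\<close>. Cauchy-Schwarz yields one factor 1/N from the mass of the exponential; the
  second arises when the remaining time integral is computed after translation invariance in
  x.\<close>

lemma SK_abs_sq_le:
  assumes [measurable]: "h \<in> borel_measurable (borel \<Otimes>\<^sub>M borel)"
  shows "(\<integral>\<^sup>+x. (SK_abs h x v)\<^sup>2 \<partial>lborel) \<le> ennreal (1 / (N v)\<^sup>2) * (\<integral>\<^sup>+x. (K_abs h x v)\<^sup>2 \<partial>lborel)"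
proof -
  define e where "e t = ennreal (indicator {0<..} t * exp (- N v * t))" for t
  define r where "r t = ennreal (indicator {0<..} t * exp (- N v * t / 2))" for t
  have [measurable]: "e \<in> borel_measurable borel" "r \<in> borel_measurable borel"
    unfolding e_def[abs_def] r_def[abs_def] by measurable
  have rr: "(r t)\<^sup>2 = e t" for t
    unfolding r_def e_def by (auto simp: ennreal_power power2_eq_square ennreal_mult[symmetric] exp_add[symmetric] split: split_indicator)
  have e1: "(\<integral>\<^sup>+t. e t \<partial>lborel) = ennreal (1 / N v)"
    unfolding e_def by (rule nn_integral_exp_decay[OF N_pos])
  have "(SK_abs h x v)\<^sup>2 \<le> ennreal (1 / N v) * (\<integral>\<^sup>+t. e t * (K_abs h (x - t *\<^sub>R v) v)\<^sup>2 \<partial>lborel)" for x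
  proof -
    have "SK_abs h x v = (\<integral>\<^sup>+t. r t * (r t * K_abs h (x - t *\<^sub>R v) v) \<partial>lborel)"
      unfolding SK_abs_def e_def[symmetric] rr[symmetric] by (simp add: power2_eq_square mult.assoc)
    also have "(\<dots>)\<^sup>2 \<le> (\<integral>\<^sup>+t. (r t)\<^sup>2 \<partial>lborel) * (\<integral>\<^sup>+t. (r t * K_abs h (x - t *\<^sub>R v) v)\<^sup>2 \<partial>lborel)"
      by (rule Cauchy_Schwarz_nn_integral) measurable
    finally show ?thesis by (simp add: power_mult_distrib rr e1)
  qed
  then have "(\<integral>\<^sup>+x. (SK_abs h x v)\<^sup>2 \<partial>lborel) \<le> (\<integral>\<^sup>+x. ennreal (1 / N v) * (\<integral>\<^sup>+t. e t * (K_abs h (x - t *\<^sub>R v) v)\<^sup>2 \<partial>lborel) \<partial>lborel)"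
    by (intro nn_integral_mono)
  also have "\<dots> = ennreal (1 / N v) * (\<integral>\<^sup>+x. \<integral>\<^sup>+t. e t * (K_abs h (x - t *\<^sub>R v) v)\<^sup>2 \<partial>lborel \<partial>lborel)"
    by (rule nn_integral_cmult) measurable
  also have "(\<integral>\<^sup>+x. \<integral>\<^sup>+t. e t * (K_abs h (x - t *\<^sub>R v) v)\<^sup>2 \<partial>lborel \<partial>lborel)
      = (\<integral>\<^sup>+t. \<integral>\<^sup>+x. e t * (K_abs h (x - t *\<^sub>R v) v)\<^sup>2 \<partial>lborel \<partial>lborel)"
    by (rule lborel_pair.Fubini') measurable
  also have "\<dots> = (\<integral>\<^sup>+t. e t * (\<integral>\<^sup>+x. (K_abs h x v)\<^sup>2 \<partial>lborel) \<partial>lborel)"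
    by (simp add: nn_integral_cmult nn_integral_lborel_translate[where f="\<lambda>x. (K_abs h x v)\<^sup>2"])
  also have "\<dots> = ennreal (1 / N v) * (\<integral>\<^sup>+x. (K_abs h x v)\<^sup>2 \<partial>lborel)"
    by (simp add: nn_integral_multc e1)
  finally show ?thesis
    using N_pos[of v] by (simp add: mult.assoc[symmetric] ennreal_mult[symmetric] power2_eq_square)
qed

text \<open>The averaging estimate at frequency 0, applied for each fixed position to the modulus of
  \<open>h\<close>, then integrated in x.\<close>

lemma weighted_K_abs_le:
  assumes [measurable]: "h \<in> borel_measurable (borel \<Otimes>\<^sub>M borel)"
  shows "(\<integral>\<^sup>+v. ennreal (vweight \<gamma> v / (N v)\<^sup>2) * (\<integral>\<^sup>+x. (K_abs h x v)\<^sup>2 \<partial>lborel) \<partial>lborel)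
    \<le> ennreal C * (\<integral>\<^sup>+u. ennreal (vweight \<gamma> u) * sqint lborel (\<lambda>x. h (x, u)) \<partial>lborel)"
proof -
  have "(\<integral>\<^sup>+v. ennreal (vweight \<gamma> v / (N v)\<^sup>2) * (\<integral>\<^sup>+x. (K_abs h x v)\<^sup>2 \<partial>lborel) \<partial>lborel)
     = (\<integral>\<^sup>+v. \<integral>\<^sup>+x. ennreal (vweight \<gamma> v / (N v)\<^sup>2) * (K_abs h x v)\<^sup>2 \<partial>lborel \<partial>lborel)"
    by (simp add: nn_integral_cmult)
  also have "\<dots> = (\<integral>\<^sup>+x. \<integral>\<^sup>+v. ennreal (vweight \<gamma> v / (N v)\<^sup>2) * (K_abs h x v)\<^sup>2 \<partial>lborel \<partial>lborel)"
    by (rule lborel_pair.Fubini') measurable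
  also have "\<dots> \<le> (\<integral>\<^sup>+x. ennreal C * (\<integral>\<^sup>+u. ennreal (vweight \<gamma> u) * (ennreal (norm (h (x, u))))\<^sup>2 \<partial>lborel) \<partial>lborel)"
  proof (intro nn_integral_mono)
    fix x
    show "(\<integral>\<^sup>+v. ennreal (vweight \<gamma> v / (N v)\<^sup>2) * (K_abs h x v)\<^sup>2 \<partial>lborel) \<le> ennreal C * (\<integral>\<^sup>+u. ennreal (vweight \<gamma> u) * (ennreal (norm (h (x, u))))\<^sup>2 \<partial>lborel)"
      using averaging[of "\<lambda>u. ennreal (norm (h (x, u)))" 0] by (simp add: K_abs_def)
  qed
  also have "\<dots> = ennreal C * (\<integral>\<^sup>+x. (\<integral>\<^sup>+u. ennreal (vweight \<gamma> u) * (ennreal (norm (h (x, u))))\<^sup>2 \<partial>lborel) \<partial>lborel)"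
    by (rule nn_integral_cmult) measurable
  also have "(\<integral>\<^sup>+x. (\<integral>\<^sup>+u. ennreal (vweight \<gamma> u) * (ennreal (norm (h (x, u))))\<^sup>2 \<partial>lborel) \<partial>lborel)
     = (\<integral>\<^sup>+u. \<integral>\<^sup>+x. ennreal (vweight \<gamma> u) * (ennreal (norm (h (x, u))))\<^sup>2 \<partial>lborel \<partial>lborel)"
    by (rule lborel_pair.Fubini') measurable
  also have "\<dots> = (\<integral>\<^sup>+u. ennreal (vweight \<gamma> u) * sqint lborel (\<lambda>x. h (x, u)) \<partial>lborel)"
    by (simp add: nn_integral_cmult sqint_def ennreal_power)
  finally show ?thesis .
qed

lemma weighted_SK_abs_le:
  assumes [measurable]: "h \<in> borel_measurable (borel \<Otimes>\<^sub>M borel)"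
  shows "(\<integral>\<^sup>+v. ennreal (vweight \<gamma> v) * (\<integral>\<^sup>+x. (SK_abs h x v)\<^sup>2 \<partial>lborel) \<partial>lborel)
    \<le> ennreal C * (\<integral>\<^sup>+u. ennreal (vweight \<gamma> u) * sqint lborel (\<lambda>x. h (x, u)) \<partial>lborel)"
proof -
  have "(\<integral>\<^sup>+v. ennreal (vweight \<gamma> v) * (\<integral>\<^sup>+x. (SK_abs h x v)\<^sup>2 \<partial>lborel) \<partial>lborel)
     \<le> (\<integral>\<^sup>+v. ennreal (vweight \<gamma> v / (N v)\<^sup>2) * (\<integral>\<^sup>+x. (K_abs h x v)\<^sup>2 \<partial>lborel) \<partial>lborel)"
  proof (intro nn_integral_mono)
    fix v
    have "ennreal (vweight \<gamma> v) * (\<integral>\<^sup>+x. (SK_abs h x v)\<^sup>2 \<partial>lborel) \<le> ennreal (vweight \<gamma> v) * (ennreal (1 / (N v)\<^sup>2) * (\<integral>\<^sup>+x. (K_abs h x v)\<^sup>2 \<partial>lborel))"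
      by (intro mult_left_mono SK_abs_sq_le) auto
    also have "\<dots> = ennreal (vweight \<gamma> v / (N v)\<^sup>2) * (\<integral>\<^sup>+x. (K_abs h x v)\<^sup>2 \<partial>lborel)"
      using vweight_pos[of \<gamma> v] by (simp add: mult.assoc[symmetric] ennreal_mult[symmetric])
    finally show "ennreal (vweight \<gamma> v) * (\<integral>\<^sup>+x. (SK_abs h x v)\<^sup>2 \<partial>lborel) \<le> ennreal (vweight \<gamma> v / (N v)\<^sup>2) * (\<integral>\<^sup>+x. (K_abs h x v)\<^sup>2 \<partial>lborel)" .
  qed
  also note weighted_K_abs_le[OF assms]
  finally show ?thesis .
qed

lemma AE_K_abs_sq_finite:
  assumes [measurable]: "h \<in> borel_measurable (borel \<Otimes>\<^sub>M borel)"
    and fin: "(\<integral>\<^sup>+u. ennreal (vweight \<gamma> u) * sqint lborel (\<lambda>x. h (x, u)) \<partial>lborel) < \<infinity>"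
  shows "AE v in lborel. (\<integral>\<^sup>+x. (K_abs h x v)\<^sup>2 \<partial>lborel) < \<infinity> \<and> (\<integral>\<^sup>+x. (SK_abs h x v)\<^sup>2 \<partial>lborel) < \<infinity>"
proof -
  have "(\<integral>\<^sup>+v. ennreal (vweight \<gamma> v / (N v)\<^sup>2) * (\<integral>\<^sup>+x. (K_abs h x v)\<^sup>2 \<partial>lborel) \<partial>lborel) < \<infinity>"
    using weighted_K_abs_le[OF assms(1)] fin by (simp add: ennreal_mult_less_top order_le_less_trans)
  then have "AE v in lborel. ennreal (vweight \<gamma> v / (N v)\<^sup>2) * (\<integral>\<^sup>+x. (K_abs h x v)\<^sup>2 \<partial>lborel) \<noteq> \<infinity>"
    by (intro nn_integral_PInf_AE) auto
  then show ?thesis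
  proof eventually_elim
    case (elim v)
    have "0 < vweight \<gamma> v / (N v)\<^sup>2" using vweight_pos[of \<gamma> v] N_pos[of v] by simp
    then have f: "(\<integral>\<^sup>+x. (K_abs h x v)\<^sup>2 \<partial>lborel) < \<infinity>"
      using elim by (auto simp: ennreal_mult_eq_top_iff less_top)
    have "(\<integral>\<^sup>+x. (SK_abs h x v)\<^sup>2 \<partial>lborel) < \<infinity>"
      using SK_abs_sq_le[OF assms(1), of v] f by (simp add: ennreal_mult_less_top order_le_less_trans)
    with f show ?case by simp
  qed
qed

lemma integrable_K:
  assumes [measurable]: "h \<in> borel_measurable (borel \<Otimes>\<^sub>M borel)" and "K_abs h x v < \<infinity>"
  shows "integrable lborel (\<lambda>u. complex_of_real (k v u) * h (x, u))"
  using assms(2) by (intro integrableI_bounded) (auto simp: K_abs_def norm_mult ennreal_mult)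

lemma norm_K_le: "ennreal (norm (K h x v)) \<le> K_abs h x v"
proof (cases "integrable lborel (\<lambda>u. complex_of_real (k v u) * h (x, u))")
  case True
  from integral_norm_bound_ennreal[OF this] show ?thesis
    by (simp add: K_def K_abs_def norm_mult ennreal_mult)
qed (simp add: K_def not_integrable_integral_eq)

lemma nn_integral_norm_SK_le:
  "(\<integral>\<^sup>+t. ennreal (norm (complex_of_real (indicator {0<..} t * exp (- N v * t)) * K h (x - t *\<^sub>R v) v)) \<partial>lborel) \<le> SK_abs h x v"
  unfolding SK_abs_def
proof (intro nn_integral_mono)
  fix t :: real
  have "ennreal (norm (complex_of_real (indicator {0<..} t * exp (- N v * t)) * K h (x - t *\<^sub>R v) v))
    = ennreal (indicator {0<..} t * exp (- N v * t)) * ennreal (norm (K h (x - t *\<^sub>R v) v))"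
    by (simp add: norm_mult ennreal_mult abs_mult)
  also have "\<dots> \<le> ennreal (indicator {0<..} t * exp (- N v * t)) * K_abs h (x - t *\<^sub>R v) v"
    by (intro mult_left_mono norm_K_le) auto
  finally show "ennreal (norm (complex_of_real (indicator {0<..} t * exp (- N v * t)) * K h (x - t *\<^sub>R v) v)) \<le> \<dots>" .
qed

lemma integrable_SK:
  assumes [measurable]: "h \<in> borel_measurable (borel \<Otimes>\<^sub>M borel)" and fin: "SK_abs h x v < \<infinity>"
  shows "integrable lborel (\<lambda>t. complex_of_real (indicator {0<..} t * exp (- N v * t)) * K h (x - t *\<^sub>R v) v)"
  using nn_integral_norm_SK_le[of v h x] fin by (intro integrableI_bounded) auto

lemma norm_SK_le: "ennreal (norm (SK h x v)) \<le> SK_abs h x v"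
proof (cases "integrable lborel (\<lambda>t. complex_of_real (indicator {0<..} t * exp (- N v * t)) * K h (x - t *\<^sub>R v) v)")
  case True
  from integral_norm_bound_ennreal[OF this] nn_integral_norm_SK_le[of v h x] show ?thesis
    by (simp add: SK_def transport_integral_def)
qed (simp add: SK_def transport_integral_def not_integrable_integral_eq)

lemma SK_abs_AE_finite:
  assumes [measurable]: "h \<in> borel_measurable (borel \<Otimes>\<^sub>M borel)" and fin: "SK_abs h x v < \<infinity>"
  shows "AE t in lborel. t > 0 \<longrightarrow> K_abs h (x - t *\<^sub>R v) v < \<infinity>"
proof -
  have "AE t in lborel. ennreal (indicator {0<..} t * exp (- N v * t)) * K_abs h (x - t *\<^sub>R v) v \<noteq> \<infinity>"
    using fin unfolding SK_abs_def by (intro nn_integral_PInf_AE) auto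
  then show ?thesis
    by eventually_elim (auto simp: ennreal_mult_eq_top_iff less_top split: split_indicator_asm)
qed

lemma K_linear:
  assumes [measurable]: "h \<in> borel_measurable (borel \<Otimes>\<^sub>M borel)" "g \<in> borel_measurable (borel \<Otimes>\<^sub>M borel)"
    and "K_abs h x v < \<infinity>" "K_abs g x v < \<infinity>"
  shows "K (\<lambda>q. a * h q + c * g q) x v = a * K h x v + c * K g x v"
proof -
  have "K (\<lambda>q. a * h q + c * g q) x v = (LINT u|lborel. a * (complex_of_real (k v u) * h (x, u)) + c * (complex_of_real (k v u) * g (x, u)))"
    unfolding K_def by (intro Bochner_Integration.integral_cong refl) (simp add: algebra_simps)
  also have "\<dots> = a * K h x v + c * K g x v"
    unfolding K_def using integrable_K[OF assms(1,3)] integrable_K[OF assms(2,4)]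
    by (subst Bochner_Integration.integral_add) simp_all
  finally show ?thesis .
qed

text \<open>A finite \<open>SK_abs\<close> gives convergence of the inner velocity integral for
  almost every t > 0 only, which suffices under the time integral; for t <= 0 the indicator
  vanishes.\<close>

lemma SK_linear:
  assumes [measurable]: "h \<in> borel_measurable (borel \<Otimes>\<^sub>M borel)" "g \<in> borel_measurable (borel \<Otimes>\<^sub>M borel)"
    and fin: "SK_abs h x v < \<infinity>" "SK_abs g x v < \<infinity>"
  shows "SK (\<lambda>q. a * h q + c * g q) x v = a * SK h x v + c * SK g x v"
proof -
  let ?e = "\<lambda>t. complex_of_real (indicator {0<..} t * exp (- N v * t))"
  have "SK (\<lambda>q. a * h q + c * g q) x v
    = (LINT t|lborel. a * (?e t * K h (x - t *\<^sub>R v) v) + c * (?e t * K g (x - t *\<^sub>R v) v))"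
    unfolding SK_def transport_integral_def
  proof (intro integral_cong_AE)
    have "AE t in lborel. t > 0 \<longrightarrow> K_abs h (x - t *\<^sub>R v) v < \<infinity>" "AE t in lborel. t > 0 \<longrightarrow> K_abs g (x - t *\<^sub>R v) v < \<infinity>"
      by (rule SK_abs_AE_finite[OF assms(1) fin(1)], rule SK_abs_AE_finite[OF assms(2) fin(2)])
    then show "AE t in lborel. ?e t * K (\<lambda>q. a * h q + c * g q) (x - t *\<^sub>R v) v
       = a * (?e t * K h (x - t *\<^sub>R v) v) + c * (?e t * K g (x - t *\<^sub>R v) v)"
    proof eventually_elim
      case (elim t)
      then show ?case
        by (cases "t > 0") (auto simp: K_linear algebra_simps)
    qed
  qed measurable
  also have "\<dots> = a * SK h x v + c * SK g x v"
    unfolding SK_def transport_integral_def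
    using integrable_SK[OF assms(1) fin(1)] integrable_SK[OF assms(2) fin(2)]
    by (subst Bochner_Integration.integral_add) (simp_all del: of_real_mult)
  finally show ?thesis .
qed

end

section \<open>The transform of SK h for functions truncated in position\<close>

lemma norm_integral_le_nn:
  fixes f :: "'a \<Rightarrow> complex"
  shows "ennreal (norm (LINT x|M. f x)) \<le> (\<integral>\<^sup>+x. ennreal (norm (f x)) \<partial>M)"
  by (cases "integrable M f") (auto simp: integral_norm_bound_ennreal not_integrable_integral_eq)

lemma fourier_L1_measurable_pair [measurable (raw)]:
  assumes [measurable]: "h \<in> borel_measurable (borel \<Otimes>\<^sub>M borel)" "f \<in> M \<rightarrow>\<^sub>M borel" "g \<in> M \<rightarrow>\<^sub>M borel"
  shows "(\<lambda>y. fourier_L1 (\<lambda>x. h (x, g y)) (f y)) \<in> borel_measurable M"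
proof -
  have "fourier_L1 (\<lambda>x. h (x, g y)) (f y) = complex_of_real ((2 * pi) powr (-3/2)) * (LINT x|lborel. cis (- (x \<bullet> f y)) * h (x, g y))" for y
    by (subst fourier_L1_eq_ft) (auto simp: ft_def)
  then show ?thesis by simp
qed

definition cut :: "nat \<Rightarrow> (r3 \<times> r3 \<Rightarrow> complex) \<Rightarrow> r3 \<times> r3 \<Rightarrow> complex" where
  "cut n h p = indicator (cball 0 (real n)) (fst p) * h p"

lemma cut_measurable [measurable]:
  assumes [measurable]: "h \<in> borel_measurable (borel \<Otimes>\<^sub>M borel)"
  shows "cut n h \<in> borel_measurable (borel \<Otimes>\<^sub>M borel)"
proof -
  have [measurable]: "cball (0::r3) (real n) \<in> sets borel" by simp
  show ?thesis unfolding cut_def[abs_def] by measurable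
qed

lemma cut_section: "(\<lambda>x. cut n h (x, u)) = trunc n (\<lambda>x. h (x, u))"
  by (simp add: fun_eq_iff cut_def trunc_def)

context averaging_kernel
begin

text \<open>The hypothesis is absolute integrability of \<open>k v u * h (x, u)\<close> in
  \<open>(x, u)\<close> for the given \<open>v\<close>, as Fubini requires. It may fail for
  square-integrable \<open>h\<close>; \<open>nn_integral_K_abs_cut\<close> provides it for
  truncations. The denominator is the squared modulus of
  \<open>Complex (N v) (v \<bullet> \<xi>)\<close>.\<close>

lemma fourier_SK:
  assumes [measurable]: "h \<in> borel_measurable (borel \<Otimes>\<^sub>M borel)" and fin: "(\<integral>\<^sup>+x. K_abs h x v \<partial>lborel) < \<infinity>"
  shows "integrable lborel (\<lambda>x. SK h x v)"
    and "ennreal ((norm (fourier_L1 (\<lambda>x. SK h x v) \<xi>))\<^sup>2)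
      \<le> ennreal (1 / ((N v)\<^sup>2 + (v \<bullet> \<xi>)\<^sup>2)) * (\<integral>\<^sup>+u. ennreal \<bar>k v u\<bar> * ennreal (norm (fourier_L1 (\<lambda>x. h (x, u)) \<xi>)) \<partial>lborel)\<^sup>2"
proof -
  define c where "c = complex_of_real ((2 * pi) powr (-3/2))"
  have \<kappa>: "integrable lborel (\<lambda>x. K h x v)"
  proof (rule integrableI_bounded)
    have "(\<integral>\<^sup>+x. ennreal (norm (K h x v)) \<partial>lborel) \<le> (\<integral>\<^sup>+x. K_abs h x v \<partial>lborel)"
      by (intro nn_integral_mono norm_K_le)
    then show "(\<integral>\<^sup>+x. ennreal (norm (K h x v)) \<partial>lborel) < \<infinity>" using fin by simp
  qed measurable
  have SK: "(\<lambda>x. SK h x v) = transport_integral (N v) v (\<lambda>x. K h x v)"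
    by (simp add: SK_def fun_eq_iff)
  show "integrable lborel (\<lambda>x. SK h x v)"
    unfolding SK by (rule ft_transport_integral[OF N_pos \<kappa>])
  have int: "integrable (lborel \<Otimes>\<^sub>M lborel) (\<lambda>(x, u). cis (- (x \<bullet> \<xi>)) * (complex_of_real (k v u) * h (x, u)))"
  proof (rule integrableI_bounded)
    have "(\<integral>\<^sup>+p. ennreal (norm (case p of (x, u) \<Rightarrow> cis (- (x \<bullet> \<xi>)) * (complex_of_real (k v u) * h (x, u)))) \<partial>(lborel \<Otimes>\<^sub>M lborel))
      = (\<integral>\<^sup>+x. \<integral>\<^sup>+u. ennreal (norm (cis (- (x \<bullet> \<xi>)) * (complex_of_real (k v u) * h (x, u)))) \<partial>lborel \<partial>lborel)"
      by (subst lborel.nn_integral_fst[symmetric]) auto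
    also have "\<dots> = (\<integral>\<^sup>+x. K_abs h x v \<partial>lborel)"
      by (simp add: norm_mult ennreal_mult K_abs_def)
    finally show "(\<integral>\<^sup>+p. ennreal (norm (case p of (x, u) \<Rightarrow> cis (- (x \<bullet> \<xi>)) * (complex_of_real (k v u) * h (x, u)))) \<partial>(lborel \<Otimes>\<^sub>M lborel)) < \<infinity>"
      using fin by simp
  qed measurable
  have "ft (\<lambda>x. K h x v) \<xi> = (LINT x|lborel. LINT u|lborel. cis (- (x \<bullet> \<xi>)) * (complex_of_real (k v u) * h (x, u)))"
    unfolding ft_def K_def by simp
  also have "\<dots> = (LINT u|lborel. LINT x|lborel. cis (- (x \<bullet> \<xi>)) * (complex_of_real (k v u) * h (x, u)))"
    by (rule lborel_pair.Fubini_integral[OF int, symmetric])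
  also have "\<dots> = (LINT u|lborel. complex_of_real (k v u) * ft (\<lambda>x. h (x, u)) \<xi>)"
    unfolding ft_def by (simp add: mult.left_commute[of "cis _"])
  finally have "c * ft (\<lambda>x. K h x v) \<xi> = (LINT u|lborel. complex_of_real (k v u) * fourier_L1 (\<lambda>x. h (x, u)) \<xi>)"
    by (simp add: fourier_L1_eq_ft c_def mult.left_commute[of _ "complex_of_real (_ powr _)"])
  then have le: "ennreal (norm (c * ft (\<lambda>x. K h x v) \<xi>)) \<le> (\<integral>\<^sup>+u. ennreal \<bar>k v u\<bar> * ennreal (norm (fourier_L1 (\<lambda>x. h (x, u)) \<xi>)) \<partial>lborel)"
    using norm_integral_le_nn[of lborel "\<lambda>u. complex_of_real (k v u) * fourier_L1 (\<lambda>x. h (x, u)) \<xi>"]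
    by (simp add: norm_mult ennreal_mult)
  have "fourier_L1 (\<lambda>x. SK h x v) \<xi> = c * ft (\<lambda>x. K h x v) \<xi> / Complex (N v) (v \<bullet> \<xi>)"
  proof -
    have m: "(\<lambda>x. SK h x v) \<in> borel_measurable borel" by measurable
    show ?thesis
      unfolding fourier_L1_eq_ft[OF m] by (simp only: SK ft_transport_integral(2)[OF N_pos \<kappa>] c_def times_divide_eq_right)
  qed
  then have "(norm (fourier_L1 (\<lambda>x. SK h x v) \<xi>))\<^sup>2 = 1 / ((N v)\<^sup>2 + (v \<bullet> \<xi>)\<^sup>2) * (norm (c * ft (\<lambda>x. K h x v) \<xi>))\<^sup>2"
    by (simp add: norm_divide power_divide complex_norm)
  then have "ennreal ((norm (fourier_L1 (\<lambda>x. SK h x v) \<xi>))\<^sup>2)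
    = ennreal (1 / ((N v)\<^sup>2 + (v \<bullet> \<xi>)\<^sup>2)) * (ennreal (norm (c * ft (\<lambda>x. K h x v) \<xi>)))\<^sup>2"
    by (simp only: ennreal_power norm_ge_zero) (subst ennreal_mult[symmetric], auto)
  also have "\<dots> \<le> ennreal (1 / ((N v)\<^sup>2 + (v \<bullet> \<xi>)\<^sup>2)) * (\<integral>\<^sup>+u. ennreal \<bar>k v u\<bar> * ennreal (norm (fourier_L1 (\<lambda>x. h (x, u)) \<xi>)) \<partial>lborel)\<^sup>2"
    by (intro mult_left_mono power_mono le) auto
  finally show "ennreal ((norm (fourier_L1 (\<lambda>x. SK h x v) \<xi>))\<^sup>2) \<le> \<dots>" .
qed

lemma K_abs_cut: "K_abs (cut n h) x v = indicator (cball 0 (real n)) x * K_abs h x v"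
  unfolding K_abs_def cut_def by (auto split: split_indicator)

lemma K_abs_mono: "(\<And>u. norm (g (x, u)) \<le> norm (h (x, u))) \<Longrightarrow> K_abs g x v \<le> K_abs h x v"
  unfolding K_abs_def by (intro nn_integral_mono mult_left_mono ennreal_leI) auto

lemma SK_abs_mono: "(\<And>p. norm (g p) \<le> norm (h p)) \<Longrightarrow> SK_abs g x v \<le> SK_abs h x v"
  unfolding SK_abs_def by (intro nn_integral_mono mult_left_mono K_abs_mono) auto

text \<open>\<open>K_abs\<close> commutes with truncation in x, and on a ball of finite volume
  Cauchy-Schwarz bounds the L1 norm by the L2 norm.\<close>

lemma nn_integral_K_abs_cut:
  assumes [measurable]: "h \<in> borel_measurable (borel \<Otimes>\<^sub>M borel)" and fin: "(\<integral>\<^sup>+x. (K_abs h x v)\<^sup>2 \<partial>lborel) < \<infinity>"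
  shows "(\<integral>\<^sup>+x. K_abs (cut n h) x v \<partial>lborel) < \<infinity>"
proof -
  have [measurable]: "cball (0::r3) (real n) \<in> sets borel" by simp
  have "(\<integral>\<^sup>+x. K_abs (cut n h) x v \<partial>lborel)\<^sup>2
    \<le> (\<integral>\<^sup>+x. (indicator (cball 0 (real n)) (x::r3))\<^sup>2 \<partial>lborel) * (\<integral>\<^sup>+x. (K_abs h x v)\<^sup>2 \<partial>lborel)"
    unfolding K_abs_cut by (rule Cauchy_Schwarz_nn_integral) measurable
  also have "(\<integral>\<^sup>+x. (indicator (cball 0 (real n)) (x::r3))\<^sup>2 \<partial>lborel) = (\<integral>\<^sup>+x. indicator (cball 0 (real n)) (x::r3) \<partial>lborel)"
    by (intro nn_integral_cong) (auto split: split_indicator)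
  also have "\<dots> = emeasure lborel (cball (0::r3) (real n))" by simp
  finally have "(\<integral>\<^sup>+x. K_abs (cut n h) x v \<partial>lborel)\<^sup>2 < \<infinity>"
    using fin emeasure_lborel_cball_finite[of "0::r3" "real n"] by (auto simp: ennreal_mult_less_top elim!: order_le_less_trans)
  then show ?thesis by (simp add: power_less_top_ennreal)
qed

lemma SK_diff_cut_le:
  assumes [measurable]: "h \<in> borel_measurable (borel \<Otimes>\<^sub>M borel)" and fin: "(\<integral>\<^sup>+x. (SK_abs h x v)\<^sup>2 \<partial>lborel) < \<infinity>"
  shows "sqint lborel (\<lambda>x. SK h x v - SK (cut n h) x v) \<le> (\<integral>\<^sup>+x. (SK_abs (\<lambda>p. h p - cut n h p) x v)\<^sup>2 \<partial>lborel)"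
  unfolding sqint_def
proof (rule nn_integral_mono_AE)
  have "AE x in lborel. (SK_abs h x v)\<^sup>2 \<noteq> \<infinity>"
    using fin by (intro nn_integral_PInf_AE) auto
  then show "AE x in lborel. ennreal ((norm (SK h x v - SK (cut n h) x v))\<^sup>2) \<le> (SK_abs (\<lambda>p. h p - cut n h p) x v)\<^sup>2"
  proof eventually_elim
    case (elim x)
    then have f: "SK_abs h x v < \<infinity>" by (simp add: less_top power_eq_top_ennreal)
    have "SK_abs (cut n h) x v \<le> SK_abs h x v"
      by (rule SK_abs_mono) (auto simp: cut_def split: split_indicator)
    with f have f': "SK_abs (cut n h) x v < \<infinity>" by simp
    have "SK (\<lambda>q. 1 * h q + (- 1) * cut n h q) x v = 1 * SK h x v + (- 1) * SK (cut n h) x v"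
      by (rule SK_linear) (use f f' in auto)
    then have "SK h x v - SK (cut n h) x v = SK (\<lambda>q. h q - cut n h q) x v" by simp
    then have "ennreal ((norm (SK h x v - SK (cut n h) x v))\<^sup>2) = (ennreal (norm (SK (\<lambda>q. h q - cut n h q) x v)))\<^sup>2"
      by (simp add: ennreal_power)
    also have "\<dots> \<le> (SK_abs (\<lambda>p. h p - cut n h p) x v)\<^sup>2"
      by (intro power_mono norm_SK_le) auto
    finally show ?case .
  qed
qed

lemma sqint_SK_finite:
  assumes "(\<integral>\<^sup>+x. (SK_abs h x v)\<^sup>2 \<partial>lborel) < \<infinity>"
  shows "sqint lborel (\<lambda>x. SK h x v) < \<infinity>"
proof -
  have "sqint lborel (\<lambda>x. SK h x v) \<le> (\<integral>\<^sup>+x. (SK_abs h x v)\<^sup>2 \<partial>lborel)"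
    unfolding sqint_def
    by (intro nn_integral_mono) (simp add: ennreal_power[symmetric] power_mono norm_SK_le)
  then show ?thesis using assms by simp
qed

text \<open>The Sobolev integral without the membership test of \<open>Hs_norm2\<close>; it is
  meaningful where square integrability is known separately.\<close>

definition Hsq :: "real \<Rightarrow> (r3 \<Rightarrow> complex) \<Rightarrow> ennreal" where
  "Hsq r u = (\<integral>\<^sup>+\<xi>. ennreal ((1 + (norm \<xi>)\<^sup>2) powr r * (norm (fourier_L2 u \<xi>))\<^sup>2) \<partial>lebesgue)"

text \<open>The Sobolev weight cut to a ball, hence bounded as \<open>weighted_fourier_L2_L1\<close>
  requires, and increasing in \<open>R\<close> for monotone convergence at the end.\<close>

definition cweight :: "real \<Rightarrow> nat \<Rightarrow> r3 \<Rightarrow> real" where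
  "cweight r R \<xi> = indicator (cball 0 (real R)) \<xi> * (1 + (norm \<xi>)\<^sup>2) powr r"

lemma cweight_measurable [measurable]: "cweight r R \<in> borel_measurable borel"
proof -
  have [measurable]: "cball (0::r3) (real R) \<in> sets borel" by simp
  show ?thesis unfolding cweight_def[abs_def] by measurable
qed

lemma cweight_bounds:
  assumes "0 \<le> r"
  shows "0 \<le> cweight r R \<xi>" "cweight r R \<xi> \<le> (1 + (real R)\<^sup>2) powr r" "cweight r R \<xi> \<le> (1 + (norm \<xi>)\<^sup>2) powr r"
    "cweight r R \<xi> \<le> cweight r (Suc R) \<xi>"
  using assms by (auto simp: cweight_def split: split_indicator intro!: powr_mono2 add_left_mono power_mono)

text \<open>The order of limits is what matters. For fixed \<open>R\<close> the weight is bounded,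
  and L2 transforms can be exchanged for L1 transforms of truncations with errors that vanish as n
  grows; the error constants depend on \<open>R\<close>, so \<open>R\<close> tends to infinity only
  afterwards. The factor 4 consists of a 2 for the exchange on the output and a 2 for the exchange
  on the input.\<close>

theorem SK_Hs_bound:
  assumes h [measurable]: "h \<in> borel_measurable (borel \<Otimes>\<^sub>M borel)"
    and fin: "(\<integral>\<^sup>+u. ennreal (vweight \<gamma> u) * sqint lborel (\<lambda>x. h (x, u)) \<partial>lborel) < \<infinity>"
    and s: "0 \<le> s"
  shows "(\<integral>\<^sup>+v. ennreal (vweight \<gamma> v) * Hsq (s + \<sigma>) (\<lambda>x. SK h x v) \<partial>lborel)
    \<le> ennreal (4 * C) * (\<integral>\<^sup>+u. ennreal (vweight \<gamma> u) * Hsq s (\<lambda>x. h (x, u)) \<partial>lborel)" (is "?L \<le> ennreal (4 * C) * ?H")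
proof -
  define w where "w v = ennreal (vweight \<gamma> v)" for v
  have [measurable]: "w \<in> borel_measurable borel" unfolding w_def[abs_def] by measurable
  define d where "d n p = h p - cut n h p" for n p
  have [measurable]: "d n \<in> borel_measurable (borel \<Otimes>\<^sub>M borel)" for n unfolding d_def[abs_def] by measurable
  define b where "b n v = (\<integral>\<^sup>+x. (SK_abs (d n) x v)\<^sup>2 \<partial>lborel)" for n v
  have [measurable]: "b n \<in> borel_measurable borel" for n unfolding b_def[abs_def] by measurable
  define D where "D n = (\<integral>\<^sup>+u. w u * sqint lborel (\<lambda>x. d n (x, u)) \<partial>lborel)" for n
  define W where "W R r = (1 + (real R)\<^sup>2) powr r" for R :: nat and r
  define F where "F n \<xi> u = fourier_L1 (\<lambda>x. cut n h (x, u)) \<xi>" for n \<xi> u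
  have F_meas [measurable (raw)]: "f \<in> M \<rightarrow>\<^sub>M borel \<Longrightarrow> g \<in> M \<rightarrow>\<^sub>M borel \<Longrightarrow> (\<lambda>y. F n (f y) (g y)) \<in> borel_measurable M"
    for n f g and M :: "'x measure" unfolding F_def by measurable
  define T where "T n \<xi> v = (\<integral>\<^sup>+u. ennreal \<bar>k v u\<bar> * ennreal (norm (F n \<xi> u)) \<partial>lborel)" for n \<xi> v
  define A where "A n R v = (\<integral>\<^sup>+\<xi>. ennreal (cweight (s + \<sigma>) R \<xi>) * (ennreal (1 / ((N v)\<^sup>2 + (v \<bullet> \<xi>)\<^sup>2)) * (T n \<xi> v)\<^sup>2) \<partial>lborel)" for n R v
  define X where "X n R u = (\<integral>\<^sup>+\<xi>. ennreal (cweight s R \<xi> * (norm (F n \<xi> u))\<^sup>2) \<partial>lborel)" for n R u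
  \<comment> \<open>A measurable function of v lying above the cut-off Sobolev integral of
    \<open>SK h\<close>. The errors \<open>b n\<close> are controlled only after integration in v,
    so no limit in n is taken at fixed v; the infimum is countable, hence measurable, and lies below
    every term.\<close>
  define J where "J R v = (INF n. 2 * A n R v + ennreal (8 * W R (s + \<sigma>)) * b n v)" for R v
  have Tm1 [measurable]: "(\<lambda>p. T n (snd p) (fst p)) \<in> borel_measurable (borel \<Otimes>\<^sub>M borel)" for n
    unfolding T_def F_def by measurable
  have Tm2 [measurable]: "(\<lambda>v. T n \<xi> v) \<in> borel_measurable borel" for n \<xi>
    unfolding T_def F_def by measurable
  have Am [measurable]: "A n R \<in> borel_measurable borel" for n R
    unfolding A_def[abs_def] T_def F_def by measurable
  have Xm [measurable]: "X n R \<in> borel_measurable borel" for n R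
    unfolding X_def[abs_def] F_def by measurable
  have Jm [measurable]: "J R \<in> borel_measurable borel" for R
    unfolding J_def[abs_def] by measurable
  have cutle: "norm (cut n h p) \<le> norm (h p)" for n p by (auto simp: cut_def split: split_indicator)
  have dsec: "sqint lborel (\<lambda>x. d n (x, u)) = sqint lborel (\<lambda>x. trunc n (\<lambda>x. h (x, u)) x - h (x, u))" for n u
    unfolding d_def by (subst sqint_diff_commute) (simp add: fun_cong[OF cut_section])
  have hsec: "AE u in lborel. sqint lborel (\<lambda>x. h (x, u)) < \<infinity>"
  proof -
    have "AE u in lborel. w u * sqint lborel (\<lambda>x. h (x, u)) \<noteq> \<infinity>"
      using fin unfolding w_def[symmetric] sqint_def by (intro nn_integral_PInf_AE) auto
    then show ?thesis
    proof eventually_elim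
      case (elim u)
      then show ?case using vweight_pos[of \<gamma> u]
        by (auto simp: w_def ennreal_mult_eq_top_iff less_top ennreal_eq_0_iff)
    qed
  qed
  \<comment> \<open>For almost every velocity the section is square integrable and its truncations
    converge; the full weighted norm dominates.\<close>
  have D0: "D \<longlonglongrightarrow> 0"
  proof -
    have "(\<lambda>n. D n) \<longlonglongrightarrow> (\<integral>\<^sup>+u. 0 \<partial>(lborel :: r3 measure))"
      unfolding D_def
    proof (rule nn_integral_dominated_convergence[where w="\<lambda>u. w u * sqint lborel (\<lambda>x. h (x, u))"])
      show "(\<lambda>u. w u * sqint lborel (\<lambda>x. d n (x, u))) \<in> borel_measurable lborel" for n
        unfolding sqint_def by measurable
      show "(\<lambda>u. w u * sqint lborel (\<lambda>x. h (x, u))) \<in> borel_measurable lborel"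
        unfolding sqint_def by measurable
      show "AE u in lborel. w u * sqint lborel (\<lambda>x. d n (x, u)) \<le> w u * sqint lborel (\<lambda>x. h (x, u))" for n
        by (intro AE_I2 mult_left_mono sqint_mono) (auto simp: d_def cut_def split: split_indicator)
      show "(\<integral>\<^sup>+u. w u * sqint lborel (\<lambda>x. h (x, u)) \<partial>lborel) < \<infinity>" using fin by (simp add: w_def)
      show "AE u in lborel. (\<lambda>n. w u * sqint lborel (\<lambda>x. d n (x, u))) \<longlonglongrightarrow> 0"
        using hsec
      proof eventually_elim
        case (elim u)
        have "(\<lambda>n. w u * sqint lborel (\<lambda>x. d n (x, u))) \<longlonglongrightarrow> w u * 0"
          unfolding dsec using elim
          by (intro tendsto_mult_ennreal tendsto_const trunc_tendsto) (auto simp: w_def)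
        then show ?case by simp
      qed
    qed simp
    then show ?thesis by simp
  qed
  have D_fin: "D n < \<infinity>" for n
  proof -
    have "D n \<le> (\<integral>\<^sup>+u. w u * sqint lborel (\<lambda>x. h (x, u)) \<partial>lborel)"
      unfolding D_def by (intro nn_integral_mono mult_left_mono sqint_mono) (auto simp: d_def cut_def split: split_indicator)
    then show ?thesis using fin by (simp add: w_def)
  qed
  have wb: "(\<integral>\<^sup>+v. w v * b n v \<partial>lborel) \<le> ennreal C * D n" for n
    unfolding w_def b_def D_def by (rule weighted_SK_abs_le) measurable
  have wX: "(\<integral>\<^sup>+u. w u * X n R u \<partial>lborel) \<le> 2 * ?H + ennreal (8 * W R s) * D n" for n R
  proof -
    \<comment> \<open>The factor 2 in front of the Sobolev integral of \<open>h\<close> cannot be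
      pulled out of the integral in u, since measurability there is not known. It is moved as 1/2 to
      the measurable side and removed from that integral.\<close>
    have "ennreal (1/2) * ennreal 2 = ennreal (1/2 * 2)"
      by (rule ennreal_mult[symmetric]) auto
    then have half1: "ennreal (1/2) * 2 = 1"
      by simp
    have half: "ennreal (1/2) * (2 * a) = a" for a
      unfolding mult.assoc[symmetric] half1 by simp
    have "(\<integral>\<^sup>+u. ennreal (1/2) * (w u * X n R u) \<partial>lborel) \<le> (\<integral>\<^sup>+u. w u * Hsq s (\<lambda>x. h (x, u)) \<partial>lborel) + (\<integral>\<^sup>+u. ennreal (4 * W R s) * (w u * sqint lborel (\<lambda>x. d n (x, u))) \<partial>lborel)"
    proof (rule nn_integral_le_add_finite)
      show "(\<lambda>u. ennreal (4 * W R s) * (w u * sqint lborel (\<lambda>x. d n (x, u)))) \<in> borel_measurable lborel"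
        unfolding sqint_def by measurable
      have "(\<integral>\<^sup>+u. ennreal (4 * W R s) * (w u * sqint lborel (\<lambda>x. d n (x, u))) \<partial>lborel) = ennreal (4 * W R s) * D n"
        unfolding D_def sqint_def by (rule nn_integral_cmult) measurable
      then show "(\<integral>\<^sup>+u. ennreal (4 * W R s) * (w u * sqint lborel (\<lambda>x. d n (x, u))) \<partial>lborel) < \<infinity>"
        using D_fin[of n] by (simp add: ennreal_mult_less_top)
      show "AE u in lborel. ennreal (1/2) * (w u * X n R u) \<le> w u * Hsq s (\<lambda>x. h (x, u)) + ennreal (4 * W R s) * (w u * sqint lborel (\<lambda>x. d n (x, u)))"
        using hsec
      proof eventually_elim
        case (elim u)
        have hm: "(\<lambda>x. h (x, u)) \<in> borel_measurable borel" by measurable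
        have tf: "sqint lborel (trunc n (\<lambda>x. h (x, u))) < \<infinity>" using sqint_trunc_le[of lborel n "\<lambda>x. h (x, u)"] elim by simp
        have "X n R u \<le> 2 * (\<integral>\<^sup>+\<xi>. ennreal (cweight s R \<xi> * (norm (fourier_L2 (\<lambda>x. h (x, u)) \<xi>))\<^sup>2) \<partial>lebesgue)
          + ennreal (8 * W R s) * sqint lborel (\<lambda>x. h (x, u) - trunc n (\<lambda>x. h (x, u)) x)"
          unfolding X_def F_def cut_section W_def
          by (rule weighted_fourier_L2_L1(2)[OF hm elim integrable_trunc[OF hm elim] tf]) (use cweight_bounds s in auto)
        also have "(\<integral>\<^sup>+\<xi>. ennreal (cweight s R \<xi> * (norm (fourier_L2 (\<lambda>x. h (x, u)) \<xi>))\<^sup>2) \<partial>lebesgue) \<le> Hsq s (\<lambda>x. h (x, u))"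
          unfolding Hsq_def by (intro nn_integral_mono ennreal_leI mult_right_mono cweight_bounds s) auto
        finally have "X n R u \<le> 2 * Hsq s (\<lambda>x. h (x, u)) + ennreal (8 * W R s) * sqint lborel (\<lambda>x. d n (x, u))"
          unfolding dsec sqint_diff_commute[of _ "trunc n (\<lambda>x. h (x, u))"] by (simp add: add_right_mono mult_left_mono)
        also have "ennreal (8 * W R s) = 2 * ennreal (4 * W R s)"
          by (simp add: W_def flip: ennreal_numeral ennreal_mult)
        finally have "ennreal (1/2) * (w u * X n R u) \<le> ennreal (1/2) * (w u * (2 * Hsq s (\<lambda>x. h (x, u)) + 2 * ennreal (4 * W R s) * sqint lborel (\<lambda>x. d n (x, u))))"
          by (intro mult_left_mono) simp_all
        also have "\<dots> = ennreal (1/2) * (2 * (w u * Hsq s (\<lambda>x. h (x, u)) + ennreal (4 * W R s) * (w u * sqint lborel (\<lambda>x. d n (x, u)))))"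
          by (simp only: distrib_left mult_ac)
        finally show ?case unfolding half .
      qed
    qed measurable
    also have "(\<integral>\<^sup>+u. ennreal (4 * W R s) * (w u * sqint lborel (\<lambda>x. d n (x, u))) \<partial>lborel) = ennreal (4 * W R s) * D n"
      unfolding D_def sqint_def by (rule nn_integral_cmult) measurable
    finally have "2 * (\<integral>\<^sup>+u. ennreal (1/2) * (w u * X n R u) \<partial>lborel) \<le> 2 * (?H + ennreal (4 * W R s) * D n)"
      unfolding w_def by (rule mult_left_mono) simp
    moreover have "2 * (\<integral>\<^sup>+u. ennreal (1/2) * (w u * X n R u) \<partial>lborel) = (\<integral>\<^sup>+u. w u * X n R u \<partial>lborel)"
    proof -
      have h2: "2 * (ennreal (1/2) * a) = a" for a
        using half[of a] by (simp only: mult.left_commute)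
      have "2 * (\<integral>\<^sup>+u. ennreal (1/2) * (w u * X n R u) \<partial>lborel) = (\<integral>\<^sup>+u. 2 * (ennreal (1/2) * (w u * X n R u)) \<partial>lborel)"
        by (rule nn_integral_cmult[symmetric]) measurable
      then show ?thesis unfolding h2 .
    qed
    moreover have "ennreal (8 * W R s) = 2 * ennreal (4 * W R s)"
      by (simp add: W_def flip: ennreal_numeral ennreal_mult)
    ultimately show ?thesis by (simp add: distrib_left mult.assoc)
  qed
  have wA: "(\<integral>\<^sup>+v. w v * A n R v \<partial>lborel) \<le> ennreal C * (\<integral>\<^sup>+u. w u * X n R u \<partial>lborel)" for n R
  proof -
    have "(\<integral>\<^sup>+v. w v * A n R v \<partial>lborel)
      = (\<integral>\<^sup>+v. \<integral>\<^sup>+\<xi>. w v * (ennreal (cweight (s + \<sigma>) R \<xi>) * (ennreal (1 / ((N v)\<^sup>2 + (v \<bullet> \<xi>)\<^sup>2)) * (T n \<xi> v)\<^sup>2)) \<partial>lborel \<partial>lborel)"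
      unfolding A_def by (intro nn_integral_cong nn_integral_cmult[symmetric]) (auto simp: T_def)
    \<comment> \<open>With the frequency outermost, the averaging estimate applies to each \<xi>
      separately, with the modulus of the transformed section as input.\<close>
    also have "\<dots> = (\<integral>\<^sup>+\<xi>. \<integral>\<^sup>+v. w v * (ennreal (cweight (s + \<sigma>) R \<xi>) * (ennreal (1 / ((N v)\<^sup>2 + (v \<bullet> \<xi>)\<^sup>2)) * (T n \<xi> v)\<^sup>2)) \<partial>lborel \<partial>lborel)"
      by (rule lborel_pair.Fubini') (unfold T_def F_def, measurable)
    also have "\<dots> \<le> (\<integral>\<^sup>+\<xi>. ennreal C * (\<integral>\<^sup>+u. w u * ennreal (cweight s R \<xi> * (norm (F n \<xi> u))\<^sup>2) \<partial>lborel) \<partial>lborel)"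
    proof (intro nn_integral_mono)
      fix \<xi> :: r3
      have "(\<integral>\<^sup>+v. w v * (ennreal (cweight (s + \<sigma>) R \<xi>) * (ennreal (1 / ((N v)\<^sup>2 + (v \<bullet> \<xi>)\<^sup>2)) * (T n \<xi> v)\<^sup>2)) \<partial>lborel)
        = (\<integral>\<^sup>+v. ennreal (cweight (s + \<sigma>) R \<xi>) * (ennreal (vweight \<gamma> v / ((N v)\<^sup>2 + (v \<bullet> \<xi>)\<^sup>2)) * (T n \<xi> v)\<^sup>2) \<partial>lborel)"
      proof (intro nn_integral_cong)
        fix v
        have "ennreal (vweight \<gamma> v / ((N v)\<^sup>2 + (v \<bullet> \<xi>)\<^sup>2)) = w v * ennreal (1 / ((N v)\<^sup>2 + (v \<bullet> \<xi>)\<^sup>2))"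
          unfolding w_def using vweight_pos[of \<gamma> v] by (subst ennreal_mult[symmetric]) auto
        then show "w v * (ennreal (cweight (s + \<sigma>) R \<xi>) * (ennreal (1 / ((N v)\<^sup>2 + (v \<bullet> \<xi>)\<^sup>2)) * (T n \<xi> v)\<^sup>2))
          = ennreal (cweight (s + \<sigma>) R \<xi>) * (ennreal (vweight \<gamma> v / ((N v)\<^sup>2 + (v \<bullet> \<xi>)\<^sup>2)) * (T n \<xi> v)\<^sup>2)"
          by (simp only: mult_ac)
      qed
      also have "\<dots> = ennreal (cweight (s + \<sigma>) R \<xi>) * (\<integral>\<^sup>+v. ennreal (vweight \<gamma> v / ((N v)\<^sup>2 + (v \<bullet> \<xi>)\<^sup>2)) * (T n \<xi> v)\<^sup>2 \<partial>lborel)"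
        by (rule nn_integral_cmult) measurable
      also have "\<dots> \<le> ennreal (cweight (s + \<sigma>) R \<xi>) * (ennreal (C * (1 + (norm \<xi>)\<^sup>2) powr (- \<sigma>)) * (\<integral>\<^sup>+u. w u * (ennreal (norm (F n \<xi> u)))\<^sup>2 \<partial>lborel))"
        unfolding T_def w_def by (intro mult_left_mono averaging) (auto simp: F_def)
      also have "\<dots> = (ennreal C * ennreal (cweight s R \<xi>)) * (\<integral>\<^sup>+u. w u * (ennreal (norm (F n \<xi> u)))\<^sup>2 \<partial>lborel)"
      proof -
        \<comment> \<open>Here the gain is used: the decay in \<xi> reduces the Sobolev weight of
          order s + \<sigma> to that of order s.\<close>
        have "(1 + (norm \<xi>)\<^sup>2) powr (s + \<sigma>) * (1 + (norm \<xi>)\<^sup>2) powr (- \<sigma>) = (1 + (norm \<xi>)\<^sup>2) powr s"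
          by (simp add: powr_add[symmetric])
        then have e: "cweight (s + \<sigma>) R \<xi> * (C * (1 + (norm \<xi>)\<^sup>2) powr (- \<sigma>)) = C * cweight s R \<xi>"
          by (simp add: cweight_def mult.left_commute[of _ C] mult.assoc)
        have c: "0 \<le> cweight (s + \<sigma>) R \<xi>" "0 \<le> cweight s R \<xi>" using s \<sigma>_nonneg by (auto intro: cweight_bounds)
        have "ennreal (cweight (s + \<sigma>) R \<xi>) * ennreal (C * (1 + (norm \<xi>)\<^sup>2) powr (- \<sigma>)) = ennreal (C * cweight s R \<xi>)"
          unfolding e[symmetric] by (rule ennreal_mult[symmetric]) (use c C_nonneg in auto)
        also have "\<dots> = ennreal C * ennreal (cweight s R \<xi>)"
          by (rule ennreal_mult) (use c C_nonneg in auto)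
        finally show ?thesis by (simp only: mult.assoc[symmetric])
      qed
      also have "\<dots> = ennreal C * (\<integral>\<^sup>+u. w u * ennreal (cweight s R \<xi> * (norm (F n \<xi> u))\<^sup>2) \<partial>lborel)"
      proof -
        have "0 \<le> cweight s R \<xi>" using s by (auto intro: cweight_bounds)
        then show ?thesis
          by (simp add: mult.assoc ennreal_mult ennreal_power mult.left_commute[of _ "ennreal (cweight _ _ _)"] nn_integral_cmult F_meas)
      qed
      finally show "(\<integral>\<^sup>+v. w v * (ennreal (cweight (s + \<sigma>) R \<xi>) * (ennreal (1 / ((N v)\<^sup>2 + (v \<bullet> \<xi>)\<^sup>2)) * (T n \<xi> v)\<^sup>2)) \<partial>lborel)
        \<le> ennreal C * (\<integral>\<^sup>+u. w u * ennreal (cweight s R \<xi> * (norm (F n \<xi> u))\<^sup>2) \<partial>lborel)" .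
    qed
    also have "\<dots> = ennreal C * (\<integral>\<^sup>+\<xi>. \<integral>\<^sup>+u. w u * ennreal (cweight s R \<xi> * (norm (F n \<xi> u))\<^sup>2) \<partial>lborel \<partial>lborel)"
      by (rule nn_integral_cmult) (unfold F_def, measurable)
    also have "(\<integral>\<^sup>+\<xi>. \<integral>\<^sup>+u. w u * ennreal (cweight s R \<xi> * (norm (F n \<xi> u))\<^sup>2) \<partial>lborel \<partial>lborel)
      = (\<integral>\<^sup>+u. \<integral>\<^sup>+\<xi>. w u * ennreal (cweight s R \<xi> * (norm (F n \<xi> u))\<^sup>2) \<partial>lborel \<partial>lborel)"
      by (rule lborel_pair.Fubini') (unfold F_def, measurable)
    also have "\<dots> = (\<integral>\<^sup>+u. w u * X n R u \<partial>lborel)"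
      unfolding X_def by (intro nn_integral_cong nn_integral_cmult) (unfold F_def, measurable)
    finally show ?thesis .
  qed
  have wJ: "(\<integral>\<^sup>+v. w v * J R v \<partial>lborel) \<le> ennreal (4 * C) * ?H" for R
  proof -
    \<comment> \<open>The coefficient of the truncation error after collecting terms: it depends on
      \<open>R\<close> but not on \<open>n\<close>, and it is finite, so \<open>q * D n\<close>
      tends to 0.\<close>
    define q where "q = 2 * ennreal C * ennreal (8 * W R s) + ennreal (8 * W R (s + \<sigma>)) * ennreal C"
    have q: "q \<noteq> \<top>" by (simp add: q_def ennreal_mult_eq_top_iff)
    have alg: "2 * (a * (2 * x + y * z)) + r * (a * z) = 4 * (a * x) + (2 * a * y + r * a) * z" for a x y z r :: ennreal
      by (simp add: distrib_left distrib_right mult_ac add_ac)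
    let ?B = "\<lambda>n. 4 * (ennreal C * ?H) + q * D n"
    have "(\<integral>\<^sup>+v. w v * J R v \<partial>lborel) \<le> ?B n" for n
    proof -
      have "(\<integral>\<^sup>+v. w v * J R v \<partial>lborel) \<le> (\<integral>\<^sup>+v. 2 * (w v * A n R v) + ennreal (8 * W R (s + \<sigma>)) * (w v * b n v) \<partial>lborel)"
      proof (intro nn_integral_mono)
        fix v
        have "w v * J R v \<le> w v * (2 * A n R v + ennreal (8 * W R (s + \<sigma>)) * b n v)"
          unfolding J_def by (intro mult_left_mono INF_lower) auto
        then show "w v * J R v \<le> 2 * (w v * A n R v) + ennreal (8 * W R (s + \<sigma>)) * (w v * b n v)"
          by (simp add: distrib_left mult.left_commute)
      qed
      also have "\<dots> = 2 * (\<integral>\<^sup>+v. w v * A n R v \<partial>lborel) + ennreal (8 * W R (s + \<sigma>)) * (\<integral>\<^sup>+v. w v * b n v \<partial>lborel)"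
        by (simp add: nn_integral_add nn_integral_cmult)
      also have "\<dots> \<le> 2 * (ennreal C * (2 * ?H + ennreal (8 * W R s) * D n)) + ennreal (8 * W R (s + \<sigma>)) * (ennreal C * D n)"
        by (intro add_mono mult_left_mono order_trans[OF wA] wX wb) auto
      also have "\<dots> = ?B n"
        unfolding alg q_def ..
      finally show ?thesis .
    qed
    moreover have "?B \<longlonglongrightarrow> 4 * (ennreal C * ?H) + q * 0"
      using q by (intro tendsto_add tendsto_const tendsto_mult_ennreal D0) auto
    ultimately have "(\<integral>\<^sup>+v. w v * J R v \<partial>lborel) \<le> 4 * (ennreal C * ?H) + q * 0"
      by (intro LIMSEQ_le_const) auto
    then show ?thesis using C_nonneg by (simp add: ennreal_mult mult.assoc)
  qed
  \<comment> \<open>The quantifier over \<open>R\<close> stands inside, so one null set of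
    velocities serves all cut-offs.\<close>
  have IJ: "AE v in lborel. \<forall>R. (\<integral>\<^sup>+\<xi>. ennreal (cweight (s + \<sigma>) R \<xi> * (norm (fourier_L2 (\<lambda>x. SK h x v) \<xi>))\<^sup>2) \<partial>lebesgue) \<le> J R v"
    using AE_K_abs_sq_finite[OF h fin]
  proof eventually_elim
    case (elim v)
    show ?case
    proof
      fix R
      have m1: "(\<lambda>x. SK h x v) \<in> borel_measurable borel" by measurable
      show "(\<integral>\<^sup>+\<xi>. ennreal (cweight (s + \<sigma>) R \<xi> * (norm (fourier_L2 (\<lambda>x. SK h x v) \<xi>))\<^sup>2) \<partial>lebesgue) \<le> J R v"
        unfolding J_def
      proof (rule INF_greatest)
        fix n
        have cutfin: "(\<integral>\<^sup>+x. K_abs (cut n h) x v \<partial>lborel) < \<infinity>"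
          using elim by (intro nn_integral_K_abs_cut h) auto
        have i: "integrable lborel (\<lambda>x. SK (cut n h) x v)"
          by (rule fourier_SK(1)[OF cut_measurable[OF h] cutfin])
        have "(\<integral>\<^sup>+x. (SK_abs (cut n h) x v)\<^sup>2 \<partial>lborel) \<le> (\<integral>\<^sup>+x. (SK_abs h x v)\<^sup>2 \<partial>lborel)"
          by (intro nn_integral_mono power_mono SK_abs_mono cutle) auto
        then have f: "sqint lborel (\<lambda>x. SK (cut n h) x v) < \<infinity>"
          using elim by (intro sqint_SK_finite) auto
        have "(\<integral>\<^sup>+\<xi>. ennreal (cweight (s + \<sigma>) R \<xi> * (norm (fourier_L2 (\<lambda>x. SK h x v) \<xi>))\<^sup>2) \<partial>lebesgue)
          \<le> 2 * (\<integral>\<^sup>+\<xi>. ennreal (cweight (s + \<sigma>) R \<xi> * (norm (fourier_L1 (\<lambda>x. SK (cut n h) x v) \<xi>))\<^sup>2) \<partial>lborel)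
            + ennreal (8 * W R (s + \<sigma>)) * sqint lborel (\<lambda>x. SK h x v - SK (cut n h) x v)"
          unfolding W_def
          by (rule weighted_fourier_L2_L1(1)[OF m1 _ i f]) (use cweight_bounds[of "s + \<sigma>"] s \<sigma>_nonneg elim sqint_SK_finite in auto)
        also have "\<dots> \<le> 2 * A n R v + ennreal (8 * W R (s + \<sigma>)) * b n v"
        proof (intro add_mono mult_left_mono)
          show "sqint lborel (\<lambda>x. SK h x v - SK (cut n h) x v) \<le> b n v"
            unfolding b_def d_def by (rule SK_diff_cut_le[OF h]) (use elim in auto)
          show "(\<integral>\<^sup>+\<xi>. ennreal (cweight (s + \<sigma>) R \<xi> * (norm (fourier_L1 (\<lambda>x. SK (cut n h) x v) \<xi>))\<^sup>2) \<partial>lborel) \<le> A n R v"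
            unfolding A_def
          proof (intro nn_integral_mono)
            fix \<xi> :: r3
            have "0 \<le> cweight (s + \<sigma>) R \<xi>" using s \<sigma>_nonneg by (auto intro: cweight_bounds)
            then have "ennreal (cweight (s + \<sigma>) R \<xi> * (norm (fourier_L1 (\<lambda>x. SK (cut n h) x v) \<xi>))\<^sup>2)
              = ennreal (cweight (s + \<sigma>) R \<xi>) * ennreal ((norm (fourier_L1 (\<lambda>x. SK (cut n h) x v) \<xi>))\<^sup>2)"
              by (simp add: ennreal_mult)
            also have "\<dots> \<le> ennreal (cweight (s + \<sigma>) R \<xi>) * (ennreal (1 / ((N v)\<^sup>2 + (v \<bullet> \<xi>)\<^sup>2)) * (T n \<xi> v)\<^sup>2)"
              unfolding T_def F_def by (intro mult_left_mono fourier_SK(2) cutfin) auto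
            finally show "ennreal (cweight (s + \<sigma>) R \<xi> * (norm (fourier_L1 (\<lambda>x. SK (cut n h) x v) \<xi>))\<^sup>2) \<le> \<dots>" .
          qed
        qed auto
        finally show "(\<integral>\<^sup>+\<xi>. ennreal (cweight (s + \<sigma>) R \<xi> * (norm (fourier_L2 (\<lambda>x. SK h x v) \<xi>))\<^sup>2) \<partial>lebesgue)
          \<le> 2 * A n R v + ennreal (8 * W R (s + \<sigma>)) * b n v" .
      qed
    qed
  qed
  have Jinc: "J R v \<le> J (Suc R) v" for R v
    unfolding J_def A_def W_def using s \<sigma>_nonneg
    by (intro INF_mono' add_mono mult_left_mono mult_right_mono nn_integral_mono ennreal_leI cweight_bounds powr_mono2 power_mono) auto
  \<comment> \<open>Monotone convergence is used twice: in \<xi> at fixed v, where the transform is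
    measurable, and in v for the majorants \<open>J R\<close>, never for the Sobolev integrals as
    functions of v.\<close>
  have "?L \<le> (\<integral>\<^sup>+v. (SUP R. w v * J R v) \<partial>lborel)"
  proof (rule nn_integral_mono_AE)
    show "AE v in lborel. ennreal (vweight \<gamma> v) * Hsq (s + \<sigma>) (\<lambda>x. SK h x v) \<le> (SUP R. w v * J R v)"
      using IJ AE_K_abs_sq_finite[OF h fin]
    proof eventually_elim
      case (elim v)
      have m1: "(\<lambda>x. SK h x v) \<in> borel_measurable borel" by measurable
      have m2[measurable]: "fourier_L2 (\<lambda>x. SK h x v) \<in> borel_measurable lebesgue"
        by (rule fourier_L2_spec_borel(1)[OF m1]) (use elim sqint_SK_finite in auto)
      have [measurable]: "cweight r R \<in> borel_measurable lebesgue" for r R by (rule borel_imp_lebesgue) measurable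
      let ?f = "\<lambda>R \<xi>. ennreal (cweight (s + \<sigma>) R \<xi> * (norm (fourier_L2 (\<lambda>x. SK h x v) \<xi>))\<^sup>2)"
      have inc: "incseq ?f"
        using s \<sigma>_nonneg by (intro incseq_SucI le_funI ennreal_leI mult_right_mono cweight_bounds) auto
      have "Hsq (s + \<sigma>) (\<lambda>x. SK h x v) = (\<integral>\<^sup>+\<xi>. (SUP R. ?f R \<xi>) \<partial>lebesgue)"
        unfolding Hsq_def
      proof (intro nn_integral_cong)
        fix \<xi> :: r3
        show "ennreal ((1 + (norm \<xi>)\<^sup>2) powr (s + \<sigma>) * (norm (fourier_L2 (\<lambda>x. SK h x v) \<xi>))\<^sup>2) = (SUP R. ?f R \<xi>)"
        proof (rule antisym)
          have "\<xi> \<in> cball 0 (real (nat \<lceil>norm \<xi>\<rceil>))" by (simp add: real_nat_ceiling_ge)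
          then have "ennreal ((1 + (norm \<xi>)\<^sup>2) powr (s + \<sigma>) * (norm (fourier_L2 (\<lambda>x. SK h x v) \<xi>))\<^sup>2) = ?f (nat \<lceil>norm \<xi>\<rceil>) \<xi>"
            by (simp add: cweight_def)
          also have "\<dots> \<le> (SUP R. ?f R \<xi>)" by (rule SUP_upper) simp
          finally show "ennreal ((1 + (norm \<xi>)\<^sup>2) powr (s + \<sigma>) * (norm (fourier_L2 (\<lambda>x. SK h x v) \<xi>))\<^sup>2) \<le> (SUP R. ?f R \<xi>)" .
          show "(SUP R. ?f R \<xi>) \<le> ennreal ((1 + (norm \<xi>)\<^sup>2) powr (s + \<sigma>) * (norm (fourier_L2 (\<lambda>x. SK h x v) \<xi>))\<^sup>2)"
            using s \<sigma>_nonneg by (intro SUP_least ennreal_leI mult_right_mono cweight_bounds) auto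
        qed
      qed
      also have "\<dots> = (SUP R. \<integral>\<^sup>+\<xi>. ?f R \<xi> \<partial>lebesgue)"
        by (rule nn_integral_monotone_convergence_SUP[OF inc]) measurable
      also have "\<dots> \<le> (SUP R. J R v)"
        using elim by (intro SUP_mono') auto
      finally have "ennreal (vweight \<gamma> v) * Hsq (s + \<sigma>) (\<lambda>x. SK h x v) \<le> w v * (SUP R. J R v)"
        unfolding w_def by (intro mult_left_mono) auto
      then show ?case by (simp add: SUP_mult_left_ennreal)
    qed
  qed
  also have "\<dots> = (SUP R. \<integral>\<^sup>+v. w v * J R v \<partial>lborel)"
  proof (rule nn_integral_monotone_convergence_SUP)
    show "incseq (\<lambda>R v. w v * J R v)"
      by (intro incseq_SucI le_funI mult_left_mono Jinc) auto
  qed measurable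
  also have "\<dots> \<le> ennreal (4 * C) * ?H" by (intro SUP_least wJ)
  finally show ?thesis .
qed

end

section \<open>Null sets in products and along characteristics\<close>

lemma lebesgue_AE_eq_borel:
  fixes f g :: "'a::euclidean_space \<Rightarrow> complex"
  assumes g [measurable]: "g \<in> borel_measurable borel" and eq: "AE x in lborel. f x = g x"
  shows "f \<in> borel_measurable lebesgue"
    "(LINT x|lebesgue. f x) = (LINT x|lborel. g x)"
    "integrable lebesgue f \<longleftrightarrow> integrable lborel g"
proof -
  have gm: "g \<in> borel_measurable lebesgue" by (rule borel_imp_lebesgue[OF g])
  have eq': "AE x in lebesgue. g x = f x"
    unfolding AE_lebesgue_iff using eq by (auto elim: eventually_mono)
  show fm: "f \<in> borel_measurable lebesgue" by (rule borel_measurable_AE[OF gm eq'])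
  have "(LINT x|lebesgue. f x) = (LINT x|lebesgue. g x)"
    using eq' by (intro integral_cong_AE fm gm) (auto elim: eventually_mono)
  also have "\<dots> = (LINT x|lborel. g x)" by (rule integral_completion) simp
  finally show "(LINT x|lebesgue. f x) = (LINT x|lborel. g x)" .
  have "integrable lebesgue f \<longleftrightarrow> integrable lebesgue g"
    using eq' by (intro integrable_cong_AE fm gm) (auto elim: eventually_mono)
  also have "\<dots> \<longleftrightarrow> integrable lborel g" by (rule integrable_completion) simp
  finally show "integrable lebesgue f \<longleftrightarrow> integrable lborel g" .
qed

lemma AE_lborel_pairI:
  fixes P :: "'a::euclidean_space \<Rightarrow> 'b::euclidean_space \<Rightarrow> bool"
  assumes [measurable]: "Measurable.pred (borel \<Otimes>\<^sub>M borel) (\<lambda>p. P (fst p) (snd p))"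
    and "AE y in lborel. AE x in lborel. P x y"
  shows "AE p in lborel. P (fst p) (snd p)"
proof -
  have "AE x in lborel. AE y in lborel. P x y"
    by (subst lborel_pair.AE_commute) (use assms in \<open>auto simp: pred_def space_pair_measure split_beta'\<close>)
  then have "AE p in lborel \<Otimes>\<^sub>M lborel. P (fst p) (snd p)"
    by (intro lborel_pair.AE_pair_measure) (use assms(1) in \<open>auto simp: pred_def space_pair_measure\<close>)
  then show ?thesis unfolding lborel_prod .
qed

text \<open>\<open>P\<close> itself need not be measurable, so its failures are first enclosed in a
  null set of the product, and sections are taken of that set.\<close>

lemma AE_lborel_sections:
  fixes P :: "'a::euclidean_space \<times> 'b::euclidean_space \<Rightarrow> bool"
  assumes "AE p in lborel. P p"
  shows "AE x in lborel. AE y in lborel. P (x, y)" "AE y in lborel. AE x in lborel. P (x, y)"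
proof -
  have "AE p in lborel \<Otimes>\<^sub>M lborel. P p" unfolding lborel_prod by (rule assms)
  then obtain N where N: "N \<in> null_sets (lborel \<Otimes>\<^sub>M lborel)" "{p \<in> space (lborel \<Otimes>\<^sub>M lborel). \<not> P p} \<subseteq> N"
    by (auto simp: eventually_ae_filter)
  have [measurable]: "N \<in> sets (lborel \<Otimes>\<^sub>M lborel)" using N by auto
  have P: "P p" if "p \<notin> N" for p using N(2) that by (auto simp: space_pair_measure)
  have "AE p in lborel \<Otimes>\<^sub>M lborel. p \<notin> N" using N(1) by (rule AE_not_in)
  then have 1: "AE x in lborel. AE y in lborel. (x, y) \<notin> N" by (rule lborel_pair.AE_pair)
  then show "AE x in lborel. AE y in lborel. P (x, y)" using P by (auto elim!: eventually_mono)
  have "AE y in lborel. AE x in lborel. (x, y) \<notin> N"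
  proof (subst lborel_pair.AE_commute[symmetric])
    have "{p \<in> space (lborel \<Otimes>\<^sub>M lborel). p \<notin> N} \<in> sets (lborel \<Otimes>\<^sub>M lborel)" by measurable
    then show "{p \<in> space (lborel \<Otimes>\<^sub>M lborel). (fst p, snd p) \<notin> N} \<in> sets (lborel \<Otimes>\<^sub>M lborel)" by simp
  qed (rule 1)
  then show "AE y in lborel. AE x in lborel. P (x, y)" using P by (auto elim!: eventually_mono)
qed

text \<open>For each t a translation preserves null sets, and Tonelli exchanges the quantifiers. A
  null set of positions is therefore invisible along almost every characteristic, whatever the
  velocity.\<close>

lemma AE_transport_not_in:
  fixes v :: r3
  assumes N: "N \<in> null_sets lborel"
  shows "AE x in lborel. AE t::real in lborel. x - t *\<^sub>R v \<notin> N"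
proof -
  have [measurable]: "N \<in> sets borel" using N by auto
  have "AE x in lborel. x - t *\<^sub>R v \<notin> N" for t :: real
  proof -
    have "(\<integral>\<^sup>+x. indicator N (x - t *\<^sub>R v) \<partial>lborel) = (\<integral>\<^sup>+x. indicator N x \<partial>lborel)"
      by (rule nn_integral_lborel_translate) measurable
    also have "\<dots> = 0" using null_setsD1[OF N] by simp
    finally show ?thesis
      by (subst (asm) nn_integral_0_iff_AE) (auto simp: indicator_def split: if_splits)
  qed
  then have "AE t::real in lborel. AE x in lborel. x - t *\<^sub>R v \<notin> N" by simp
  moreover have "{p \<in> space (lborel \<Otimes>\<^sub>M lborel). fst p - (snd p :: real) *\<^sub>R v \<notin> N} \<in> sets (lborel \<Otimes>\<^sub>M lborel)"
    by measurable
  ultimately show ?thesis by (subst lborel_pair.AE_commute)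
qed

text \<open>Rewriting the quantifier over t as the vanishing of a parameter integral makes the
  condition measurable in (x, v).\<close>

lemma AE_transport_iff:
  fixes x v :: r3
  assumes [measurable]: "N \<in> sets borel"
  shows "(AE t::real in lborel. x - t *\<^sub>R v \<notin> N) \<longleftrightarrow> (\<integral>\<^sup>+t. indicator N (x - t *\<^sub>R v) \<partial>lborel) = (0::ennreal)"
proof (subst nn_integral_0_iff_AE)
  show "(\<lambda>t. indicator N (x - t *\<^sub>R v)) \<in> borel_measurable lborel" by measurable
qed (auto simp: indicator_def)

text \<open>Connects the abstract kernel, Borel on the whole space, with the kernel of the problem, which
  agrees with it off the diagonal only.\<close>

locale collision_kernel = averaging_kernel +
  fixes b :: "real \<Rightarrow> real" and \<alpha> :: real
  assumes k_alpha_eq: "\<And>v u. v \<noteq> u \<Longrightarrow> k_alpha b \<gamma> \<alpha> v u = k v u"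
    and nu_eq: "\<And>v. nu b \<gamma> v = N v"
begin

abbreviation "T h \<equiv> S_op b \<gamma> (K_op b \<gamma> \<alpha> h)"

text \<open>The exceptional set consists of positions only and does not depend on v, because
  changing \<open>v\<close> moves just the excluded diagonal point. This is what
  \<open>AE_transport_not_in\<close> can handle.\<close>

lemma K_integrand_AE:
  assumes eq: "AE p in lborel. h p = h' p"
  obtains N1 where "N1 \<in> null_sets lborel"
    "\<And>x v. x \<notin> N1 \<Longrightarrow> AE u in lborel. K_integrand b \<gamma> \<alpha> h (x, v) u = complex_of_real (k v u) * h' (x, u)"
proof -
  have "AE x in lborel. AE u in lborel. h (x, u) = h' (x, u)"
    using AE_lborel_sections(1)[OF eq] .
  then obtain N1 where N1: "N1 \<in> null_sets lborel" "{x. \<not> (AE u in lborel. h (x, u) = h' (x, u))} \<subseteq> N1"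
    by (auto simp: eventually_ae_filter)
  show ?thesis
  proof (rule that[OF N1(1)])
    fix x v :: r3 assume "x \<notin> N1"
    then have "AE u in lborel. h (x, u) = h' (x, u)" using N1(2) by auto
    moreover have "AE u in lborel. u \<noteq> v" by (rule AE_lborel_singleton)
    ultimately show "AE u in lborel. K_integrand b \<gamma> \<alpha> h (x, v) u = complex_of_real (k v u) * h' (x, u)"
      by eventually_elim (auto simp: K_integrand_def k_alpha_eq)
  qed
qed

lemma S_integrand_eq:
  assumes Kop: "\<And>x v. x \<notin> N1 \<Longrightarrow> K_op b \<gamma> \<alpha> h (x, v) = K h' x v"
    and good: "AE t::real in lborel. x - t *\<^sub>R v \<notin> N1"
  shows "AE t in lborel. indicator {0<..} t *\<^sub>R S_integrand b \<gamma> (K_op b \<gamma> \<alpha> h) (x, v) t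
     = complex_of_real (indicator {0<..} t * exp (- N v * t)) * K h' (x - t *\<^sub>R v) v"
  using good
proof eventually_elim
  case (elim t)
  then show ?case by (auto simp: S_integrand_def Kop nu_eq split: split_indicator)
qed

text \<open>Replaces the operators of the problem, with Lebesgue measurable input, by
  \<open>K\<close> and \<open>SK\<close> of a Borel representative. The first claim holds for every
  velocity, as needed for Sobolev norms of sections; the others concern almost every point of phase
  space.\<close>

lemma T_representative:
  assumes [measurable]: "h' \<in> borel_measurable (borel \<Otimes>\<^sub>M borel)" and eq: "AE p in lborel. h p = h' p"
  shows "\<And>v. AE x in lborel. T h (x, v) = SK h' x v"
    "AE p in lborel. T h p = SK h' (fst p) (snd p)"
    "AE p in lborel. K_abs h' (fst p) (snd p) < \<infinity> \<longrightarrow> integrable lebesgue (K_integrand b \<gamma> \<alpha> h p)"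
    "AE p in lborel. SK_abs h' (fst p) (snd p) < \<infinity> \<longrightarrow> set_integrable lebesgue {0<..} (S_integrand b \<gamma> (K_op b \<gamma> \<alpha> h) p)"
proof -
  obtain N1 where N1: "N1 \<in> null_sets lborel"
    and KI: "\<And>x v. x \<notin> N1 \<Longrightarrow> AE u in lborel. K_integrand b \<gamma> \<alpha> h (x, v) u = complex_of_real (k v u) * h' (x, u)"
    by (rule K_integrand_AE[OF eq]) blast
  have [measurable]: "N1 \<in> sets borel" using N1 by auto
  have Kop: "K_op b \<gamma> \<alpha> h (x, v) = K h' x v" if "x \<notin> N1" for x v
    unfolding K_op_def K_def by (rule lebesgue_AE_eq_borel(2)[OF _ KI[OF that]]) measurable
  let ?good = "\<lambda>x (v::r3). AE t::real in lborel. x - t *\<^sub>R v \<notin> N1"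
  have Top: "T h (x, v) = SK h' x v" if "?good x v" for x v
    unfolding S_op_def set_lebesgue_integral_def SK_def transport_integral_def
    by (rule lebesgue_AE_eq_borel(2)[OF _ S_integrand_eq[OF Kop that]]) measurable
  have Sint: "set_integrable lebesgue {0<..} (S_integrand b \<gamma> (K_op b \<gamma> \<alpha> h) (x, v))"
    if "?good x v" "SK_abs h' x v < \<infinity>" for x v
    unfolding set_integrable_def
    by (subst lebesgue_AE_eq_borel(3)[OF _ S_integrand_eq[OF Kop that(1)]]) (use integrable_SK[OF assms(1) that(2)] in auto)
  show "AE x in lborel. T h (x, v) = SK h' x v" for v
    using AE_transport_not_in[OF N1, of v] by eventually_elim (rule Top)
  have "AE v in lborel. AE x in lborel. ?good x v" using AE_transport_not_in[OF N1] by simp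
  then have good: "AE p in lborel. ?good (fst p) (snd p)"
    by (intro AE_lborel_pairI) (auto simp: AE_transport_iff)
  then show "AE p in lborel. T h p = SK h' (fst p) (snd p)"
    by eventually_elim (use Top in auto)
  show "AE p in lborel. SK_abs h' (fst p) (snd p) < \<infinity> \<longrightarrow> set_integrable lebesgue {0<..} (S_integrand b \<gamma> (K_op b \<gamma> \<alpha> h) p)"
    using good by eventually_elim (use Sint in auto)
  have "AE v::r3 in lborel. AE x in lborel. x \<notin> N1" using AE_not_in[OF N1] by simp
  then have "AE p::r3 \<times> r3 in lborel. fst p \<notin> N1"
    by (intro AE_lborel_pairI) auto
  then show "AE p in lborel. K_abs h' (fst p) (snd p) < \<infinity> \<longrightarrow> integrable lebesgue (K_integrand b \<gamma> \<alpha> h p)"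
  proof eventually_elim
    case (elim p)
    obtain x v where p: "p = (x, v)" by (cases p)
    show ?case
    proof
      assume "K_abs h' (fst p) (snd p) < \<infinity>"
      then have "integrable lborel (\<lambda>u. complex_of_real (k v u) * h' (x, u))"
        unfolding p by (intro integrable_K) auto
      then show "integrable lebesgue (K_integrand b \<gamma> \<alpha> h p)"
        using elim unfolding p by (subst lebesgue_AE_eq_borel(3)[OF _ KI]) auto
    qed
  qed
qed

lemma L2_fun_iff_sqint:
  assumes "u' \<in> borel_measurable borel" "AE x in lborel. u x = u' x"
  shows "u \<in> L2_fun \<longleftrightarrow> sqint lborel u' < \<infinity>"
proof -
  have "sqint lborel u = sqint lborel u'" by (rule sqint_cong_AE[OF assms(2)])
  then show ?thesis
    unfolding L2_fun_def using lebesgue_AE_eq_borel(1)[OF assms] by (simp add: nn_integral_completion sqint_def)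
qed

lemma Hs_norm2_eq:
  assumes "u' \<in> borel_measurable borel" "AE x in lborel. u x = u' x"
  shows "Hs_norm2 r u = (if sqint lborel u' < \<infinity> then Hsq r u' else \<infinity>)"
proof -
  have "fourier_L2 u = fourier_L2 u'"
    by (rule fourier_L2_cong_AE[OF lebesgue_AE_eq_borel(1)[OF assms] borel_imp_lebesgue[OF assms(1)] assms(2)])
  then show ?thesis by (simp add: Hs_norm2_def L2_fun_iff_sqint[OF assms] Hsq_def)
qed

lemma sqint_le_Hsq:
  assumes "u \<in> borel_measurable borel" "sqint lborel u < \<infinity>" "0 \<le> s"
  shows "sqint lborel u \<le> 4 * Hsq s u"
proof -
  have "sqint lborel u \<le> 4 * sqint lebesgue (fourier_L2 u)"
    by (rule sqint_le_fourier_L2[OF assms(1,2)])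
  also have "sqint lebesgue (fourier_L2 u) \<le> Hsq s u"
    unfolding sqint_def Hsq_def
  proof (intro nn_integral_mono ennreal_leI)
    fix \<xi> :: r3
    have "1 * (norm (fourier_L2 u \<xi>))\<^sup>2 \<le> (1 + (norm \<xi>)\<^sup>2) powr s * (norm (fourier_L2 u \<xi>))\<^sup>2"
      using assms(3) by (intro mult_right_mono ge_one_powr_ge_zero) auto
    then show "(norm (fourier_L2 u \<xi>))\<^sup>2 \<le> (1 + (norm \<xi>)\<^sup>2) powr s * (norm (fourier_L2 u \<xi>))\<^sup>2" by simp
  qed
  finally show ?thesis by (simp add: mult_left_mono)
qed

text \<open>The integrand of \<open>L2Hs_norm2\<close> is not known to be measurable in u, so its
  finite integral is not turned into pointwise finiteness. Instead a quarter of the measurable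
  weighted L2 norm is placed below it: by \<open>sqint_le_Hsq\<close> on square-integrable sections,
  and because \<open>Hs_norm2\<close> is infinite on the others.\<close>

lemma L2Hs_representative:
  assumes h: "h \<in> L2Hs \<gamma> s" and s: "0 \<le> s"
  obtains h' where "h' \<in> borel_measurable (borel \<Otimes>\<^sub>M borel)" "AE p in lborel. h p = h' p"
    "(\<integral>\<^sup>+u. ennreal (vweight \<gamma> u) * sqint lborel (\<lambda>x. h' (x, u)) \<partial>lborel) < \<infinity>"
    "(\<integral>\<^sup>+u. ennreal (vweight \<gamma> u) * Hsq s (\<lambda>x. h' (x, u)) \<partial>lborel) \<le> L2Hs_norm2 \<gamma> s h"
proof -
  have fin: "L2Hs_norm2 \<gamma> s h < \<infinity>" and "h \<in> borel_measurable lebesgue" using h by (auto simp: L2Hs_def)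
  then obtain h' where "h' \<in> borel_measurable borel" and eq: "AE p in lborel. h p = h' p"
    using ex_borel_AE_eq_complex by blast
  then have h' [measurable]: "h' \<in> borel_measurable (borel \<Otimes>\<^sub>M borel)" by (simp add: borel_prod)
  have eq2: "AE u in lborel. AE x in lborel. h (x, u) = h' (x, u)"
    using AE_lborel_sections(2)[OF eq] .
  have L: "L2Hs_norm2 \<gamma> s h = (\<integral>\<^sup>+u. Hs_norm2 s (\<lambda>x. h (x, u)) * ennreal (vweight \<gamma> u) \<partial>lborel)"
    by (simp add: L2Hs_norm2_def vweight_def nn_integral_completion)
  have sec: "(\<lambda>x. h' (x, u)) \<in> borel_measurable borel" for u by measurable
  have "(\<integral>\<^sup>+u. ennreal (1/4) * (ennreal (vweight \<gamma> u) * sqint lborel (\<lambda>x. h' (x, u))) \<partial>lborel) \<le> L2Hs_norm2 \<gamma> s h"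
    unfolding L
  proof (rule nn_integral_mono_AE)
    show "AE u in lborel. ennreal (1/4) * (ennreal (vweight \<gamma> u) * sqint lborel (\<lambda>x. h' (x, u))) \<le> Hs_norm2 s (\<lambda>x. h (x, u)) * ennreal (vweight \<gamma> u)"
      using eq2
    proof eventually_elim
      case (elim u)
      show ?case
      proof (cases "sqint lborel (\<lambda>x. h' (x, u)) < \<infinity>")
        case True
        have "ennreal (1/4) * (ennreal (vweight \<gamma> u) * sqint lborel (\<lambda>x. h' (x, u))) \<le> ennreal (1/4) * (ennreal (vweight \<gamma> u) * (4 * Hsq s (\<lambda>x. h' (x, u))))"
          by (intro mult_left_mono sqint_le_Hsq[OF sec True s]) auto
        also have "\<dots> = (ennreal (1/4) * ennreal 4) * (Hsq s (\<lambda>x. h' (x, u)) * ennreal (vweight \<gamma> u))"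
          by (simp add: mult_ac)
        also have "ennreal (1/4) * ennreal 4 = ennreal (1/4 * 4)" by (rule ennreal_mult[symmetric]) auto
        finally show ?thesis using True by (simp add: Hs_norm2_eq[OF sec elim])
      next
        case False
        then show ?thesis using vweight_pos[of \<gamma> u]
          by (simp add: Hs_norm2_eq[OF sec elim] ennreal_top_mult ennreal_eq_0_iff)
      qed
    qed
  qed
  also note fin
  also have "(\<integral>\<^sup>+u. ennreal (1/4) * (ennreal (vweight \<gamma> u) * sqint lborel (\<lambda>x. h' (x, u))) \<partial>lborel)
     = ennreal (1/4) * (\<integral>\<^sup>+u. ennreal (vweight \<gamma> u) * sqint lborel (\<lambda>x. h' (x, u)) \<partial>lborel)"
    unfolding sqint_def by (rule nn_integral_cmult) measurable
  finally have f: "(\<integral>\<^sup>+u. ennreal (vweight \<gamma> u) * sqint lborel (\<lambda>x. h' (x, u)) \<partial>lborel) < \<infinity>"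
    by (auto simp: ennreal_mult_less_top)
  have "(\<integral>\<^sup>+u. ennreal (vweight \<gamma> u) * Hsq s (\<lambda>x. h' (x, u)) \<partial>lborel) \<le> L2Hs_norm2 \<gamma> s h"
    unfolding L
  proof (rule nn_integral_mono_AE)
    show "AE u in lborel. ennreal (vweight \<gamma> u) * Hsq s (\<lambda>x. h' (x, u)) \<le> Hs_norm2 s (\<lambda>x. h (x, u)) * ennreal (vweight \<gamma> u)"
      using eq2
    proof eventually_elim
      case (elim u)
      show ?case using vweight_pos[of \<gamma> u]
        by (simp add: Hs_norm2_eq[OF sec elim] ennreal_top_mult ennreal_eq_0_iff mult.commute)
    qed
  qed
  with f show ?thesis using that h' eq by blast
qed

lemma AE_abs_finite:
  assumes [measurable]: "h' \<in> borel_measurable (borel \<Otimes>\<^sub>M borel)"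
    and fin: "(\<integral>\<^sup>+u. ennreal (vweight \<gamma> u) * sqint lborel (\<lambda>x. h' (x, u)) \<partial>lborel) < \<infinity>"
  shows "AE p in lborel. K_abs h' (fst p) (snd p) < \<infinity> \<and> SK_abs h' (fst p) (snd p) < \<infinity>"
proof (rule AE_lborel_pairI)
  show "AE v in lborel. AE x in lborel. K_abs h' x v < \<infinity> \<and> SK_abs h' x v < \<infinity>"
    using AE_K_abs_sq_finite[OF assms]
  proof eventually_elim
    case (elim v)
    have "AE x in lborel. (K_abs h' x v)\<^sup>2 \<noteq> \<infinity>" by (rule nn_integral_PInf_AE) (use elim in auto)
    moreover have "AE x in lborel. (SK_abs h' x v)\<^sup>2 \<noteq> \<infinity>" by (rule nn_integral_PInf_AE) (use elim in auto)
    ultimately show ?case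
      by eventually_elim (auto simp: less_top power_eq_top_ennreal)
  qed
qed measurable

theorem SK_bounded:
  assumes s: "0 \<le> s"
  shows "(\<forall>h\<in>L2Hs \<gamma> s.
        (AE p in lebesgue. integrable lebesgue (K_integrand b \<gamma> \<alpha> h p)) \<and>
        (AE p in lebesgue. set_integrable lebesgue {0<..} (S_integrand b \<gamma> (K_op b \<gamma> \<alpha> h) p))) \<and>
     bounded_L2Hs_operator \<gamma> s (s + \<sigma>) T"
proof (intro conjI ballI)
  fix h assume h: "h \<in> L2Hs \<gamma> s"
  obtain h' where h': "h' \<in> borel_measurable (borel \<Otimes>\<^sub>M borel)" "AE p in lborel. h p = h' p"
    "(\<integral>\<^sup>+u. ennreal (vweight \<gamma> u) * sqint lborel (\<lambda>x. h' (x, u)) \<partial>lborel) < \<infinity>"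
    by (rule L2Hs_representative[OF h s]) blast
  show "AE p in lebesgue. integrable lebesgue (K_integrand b \<gamma> \<alpha> h p)"
    unfolding AE_lebesgue_iff using T_representative(3)[OF h'(1,2)] AE_abs_finite[OF h'(1,3)] by eventually_elim auto
  show "AE p in lebesgue. set_integrable lebesgue {0<..} (S_integrand b \<gamma> (K_op b \<gamma> \<alpha> h) p)"
    unfolding AE_lebesgue_iff using T_representative(4)[OF h'(1,2)] AE_abs_finite[OF h'(1,3)] by eventually_elim auto
next
  show "bounded_L2Hs_operator \<gamma> s (s + \<sigma>) T"
    unfolding bounded_L2Hs_operator_def
  proof (intro conjI ballI allI)
    fix f g a c assume f: "f \<in> L2Hs \<gamma> s" and g: "g \<in> L2Hs \<gamma> s"
    obtain f' where f': "f' \<in> borel_measurable (borel \<Otimes>\<^sub>M borel)" "AE p in lborel. f p = f' p"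
      "(\<integral>\<^sup>+u. ennreal (vweight \<gamma> u) * sqint lborel (\<lambda>x. f' (x, u)) \<partial>lborel) < \<infinity>"
      by (rule L2Hs_representative[OF f s]) blast
    obtain g' where g': "g' \<in> borel_measurable (borel \<Otimes>\<^sub>M borel)" "AE p in lborel. g p = g' p"
      "(\<integral>\<^sup>+u. ennreal (vweight \<gamma> u) * sqint lborel (\<lambda>x. g' (x, u)) \<partial>lborel) < \<infinity>"
      by (rule L2Hs_representative[OF g s]) blast
    note [measurable] = f'(1) g'(1)
    have e: "AE p in lborel. a * f p + c * g p = a * f' p + c * g' p"
      using f'(2) g'(2) by eventually_elim simp
    have m: "(\<lambda>p. a * f' p + c * g' p) \<in> borel_measurable (borel \<Otimes>\<^sub>M borel)" by measurable
    show "AE p in lebesgue. T (\<lambda>q. a * f q + c * g q) p = a * T f p + c * T g p"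
      unfolding AE_lebesgue_iff
      using T_representative(2)[OF m e] T_representative(2)[OF f'(1,2)] T_representative(2)[OF g'(1,2)]
        AE_abs_finite[OF f'(1,3)] AE_abs_finite[OF g'(1,3)]
      by eventually_elim (simp add: SK_linear[OF f'(1) g'(1)])
  next
    have "T h \<in> L2Hs \<gamma> (s + \<sigma>) \<and> L2Hs_norm \<gamma> (s + \<sigma>) (T h) \<le> sqrt (4 * C) * L2Hs_norm \<gamma> s h" if h: "h \<in> L2Hs \<gamma> s" for h
    proof -
      obtain h' where h': "h' \<in> borel_measurable (borel \<Otimes>\<^sub>M borel)" "AE p in lborel. h p = h' p"
        "(\<integral>\<^sup>+u. ennreal (vweight \<gamma> u) * sqint lborel (\<lambda>x. h' (x, u)) \<partial>lborel) < \<infinity>"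
        "(\<integral>\<^sup>+u. ennreal (vweight \<gamma> u) * Hsq s (\<lambda>x. h' (x, u)) \<partial>lborel) \<le> L2Hs_norm2 \<gamma> s h"
        by (rule L2Hs_representative[OF h s]) blast
      note [measurable] = h'(1)
      have hfin: "L2Hs_norm2 \<gamma> s h < \<infinity>" using h by (simp add: L2Hs_def)
      have m: "(\<lambda>p. SK h' (fst p) (snd p)) \<in> borel_measurable borel"
        unfolding borel_prod[symmetric] by measurable
      have meas: "T h \<in> borel_measurable lebesgue"
        by (rule lebesgue_AE_eq_borel(1)[OF m T_representative(2)[OF h'(1,2)]])
      \<comment> \<open>An exact identity is available: sections of \<open>T h\<close> agree almost
        everywhere with those of \<open>SK h'\<close>, and \<open>fourier_L2\<close> takes the same
        value on both.\<close>
      have "L2Hs_norm2 \<gamma> (s + \<sigma>) (T h) = (\<integral>\<^sup>+v. ennreal (vweight \<gamma> v) * Hsq (s + \<sigma>) (\<lambda>x. SK h' x v) \<partial>lborel)"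
        unfolding L2Hs_norm2_def nn_integral_completion
      proof (rule nn_integral_cong_AE)
        show "AE v in lborel. Hs_norm2 (s + \<sigma>) (\<lambda>x. T h (x, v)) * ennreal ((1 + norm v) powr \<gamma>) = ennreal (vweight \<gamma> v) * Hsq (s + \<sigma>) (\<lambda>x. SK h' x v)"
          using AE_K_abs_sq_finite[OF h'(1,3)]
        proof eventually_elim
          case (elim v)
          have "sqint lborel (\<lambda>x. SK h' x v) < \<infinity>" using elim sqint_SK_finite by auto
          moreover have "Hs_norm2 (s + \<sigma>) (\<lambda>x. T h (x, v)) = (if sqint lborel (\<lambda>x. SK h' x v) < \<infinity> then Hsq (s + \<sigma>) (\<lambda>x. SK h' x v) else \<infinity>)"
            by (rule Hs_norm2_eq[OF _ T_representative(1)[OF h'(1,2)]]) measurable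
          ultimately show ?case by (simp add: vweight_def mult.commute)
        qed
      qed
      also have "\<dots> \<le> ennreal (4 * C) * (\<integral>\<^sup>+u. ennreal (vweight \<gamma> u) * Hsq s (\<lambda>x. h' (x, u)) \<partial>lborel)"
        by (rule SK_Hs_bound[OF h'(1,3) s])
      also have "\<dots> \<le> ennreal (4 * C) * L2Hs_norm2 \<gamma> s h" by (intro mult_left_mono h') simp
      finally have le: "L2Hs_norm2 \<gamma> (s + \<sigma>) (T h) \<le> ennreal (4 * C) * L2Hs_norm2 \<gamma> s h" .
      have rfin: "ennreal (4 * C) * L2Hs_norm2 \<gamma> s h < \<infinity>" using hfin by (simp add: ennreal_mult_less_top)
      have "L2Hs_norm2 \<gamma> (s + \<sigma>) (T h) < \<infinity>" using le rfin by (rule order_le_less_trans)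
      moreover have "enn2real (L2Hs_norm2 \<gamma> (s + \<sigma>) (T h)) \<le> 4 * C * enn2real (L2Hs_norm2 \<gamma> s h)"
        using enn2real_mono[OF le] rfin C_nonneg by (simp add: enn2real_mult)
      then have "L2Hs_norm \<gamma> (s + \<sigma>) (T h) \<le> sqrt (4 * C) * L2Hs_norm \<gamma> s h"
        unfolding L2Hs_norm_def real_sqrt_mult[symmetric] by (rule real_sqrt_le_mono)
      ultimately show ?thesis using meas by (simp add: L2Hs_def)
    qed
    then show "\<exists>C. \<forall>f\<in>L2Hs \<gamma> s. T f \<in> L2Hs \<gamma> (s + \<sigma>) \<and> L2Hs_norm \<gamma> (s + \<sigma>) (T f) \<le> C * L2Hs_norm \<gamma> s f"
      by blast
  qed
qed

end

subsection \<open>Velocity averaging\<close>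

lemma nn_integral_powr_0:
  assumes a: "a > 0" and \<rho>: "\<rho> \<ge> 0"
  shows "(\<integral>\<^sup>+r. ennreal (indicator {0..\<rho>} r * r powr (a - 1)) \<partial>lborel) = ennreal (\<rho> powr a / a)"
proof -
  have "((\<lambda>r. r powr (a - 1)) has_integral (\<rho> powr (a - 1 + 1) / (a - 1 + 1))) {0..\<rho>}"
    by (rule has_integral_powr_from_0) (use a \<rho> in auto)
  then have "((\<lambda>r. r powr (a - 1)) has_integral (\<rho> powr a / a)) {0..\<rho>}" by simp
  from nn_integral_has_integral_lebesgue[OF _ this]
  have "(\<integral>\<^sup>+r. ennreal (indicator {0..\<rho>} r * r powr (a - 1)) \<partial>lborel) = ennreal (\<rho> powr a / a)"
    by auto
  then show ?thesis .
qed

lemma nn_integral_powr_infinity: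
  assumes a: "a > 0" and \<rho>: "\<rho> > 0"
  shows "(\<integral>\<^sup>+r. ennreal (indicator {\<rho>..} r * r powr (- a - 1)) \<partial>lborel) = ennreal (\<rho> powr (- a) / a)"
proof -
  have "(\<integral>\<^sup>+r. ennreal (r powr (- a - 1)) * indicator {\<rho>..} r \<partial>lborel) = ennreal (0 - (- (\<rho> powr (- a)) / a))"
  proof (rule nn_integral_FTC_atLeast)
    show "((\<lambda>r. - (r powr (- a)) / a) has_field_derivative r powr (- a - 1)) (at r)" if "\<rho> \<le> r" for r
      using a \<rho> that by (auto intro!: derivative_eq_intros)
    have "((\<lambda>r. r powr (- a)) \<longlongrightarrow> 0) at_top"
      using a by (intro tendsto_neg_powr filterlim_ident) auto
    then have "((\<lambda>r. - (r powr (- a)) / a) \<longlongrightarrow> - 0 / a) at_top"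
      using a by (intro tendsto_intros) auto
    then show "((\<lambda>r. - (r powr (- a)) / a) \<longlongrightarrow> 0) at_top" by simp
  qed auto
  moreover have "(\<integral>\<^sup>+r. ennreal (indicator {\<rho>..} r * r powr (- a - 1)) \<partial>lborel) = (\<integral>\<^sup>+r. ennreal (r powr (- a - 1)) * indicator {\<rho>..} r \<partial>lborel)"
    by (intro nn_integral_cong) (auto split: split_indicator)
  ultimately show ?thesis by simp
qed

text \<open>Tonelli for a radial profile written as a superposition of indicators of the sets where
  \<open>g x < r\<close>; it reduces singular integrals to the mass that \<open>q\<close> gives to
  such sets.\<close>

lemma layer_cake:
  fixes \<theta> :: "real \<Rightarrow> ennreal" and q :: "'a::euclidean_space \<Rightarrow> ennreal" and g :: "'a \<Rightarrow> real"
  assumes [measurable]: "\<theta> \<in> borel_measurable borel" "q \<in> borel_measurable borel" "g \<in> borel_measurable borel"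
  shows "(\<integral>\<^sup>+x. (\<integral>\<^sup>+r. \<theta> r * indicator {g x<..} r \<partial>lborel) * q x \<partial>lborel)
    = (\<integral>\<^sup>+r. \<theta> r * (\<integral>\<^sup>+x. indicator {x. g x < r} x * q x \<partial>lborel) \<partial>lborel)"
proof -
  have [measurable]: "(\<lambda>p. indicator {g (fst p)<..} (snd p) :: ennreal) \<in> borel_measurable (borel \<Otimes>\<^sub>M borel)"
  proof -
    have "(\<lambda>p. indicator {p \<in> space (borel \<Otimes>\<^sub>M borel). g (fst p) < snd p} p :: ennreal) \<in> borel_measurable (borel \<Otimes>\<^sub>M borel)"
      by measurable
    then show ?thesis by (rule measurable_cong[THEN iffD1, rotated]) (auto split: split_indicator simp: space_pair_measure)
  qed
  have "(\<integral>\<^sup>+x. (\<integral>\<^sup>+r. \<theta> r * indicator {g x<..} r \<partial>lborel) * q x \<partial>lborel)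
    = (\<integral>\<^sup>+x. \<integral>\<^sup>+r. \<theta> r * indicator {g (fst (x, r))<..} (snd (x, r)) * q x \<partial>lborel \<partial>lborel)"
    by (intro nn_integral_cong) (simp add: nn_integral_multc)
  also have "\<dots> = (\<integral>\<^sup>+r. \<integral>\<^sup>+x. \<theta> r * indicator {g (fst (x, r))<..} (snd (x, r)) * q x \<partial>lborel \<partial>lborel)"
    by (rule lborel_pair.Fubini') measurable
  also have "\<dots> = (\<integral>\<^sup>+r. \<integral>\<^sup>+x. \<theta> r * (indicator {x. g x < r} x * q x) \<partial>lborel \<partial>lborel)"
    by (intro nn_integral_cong) (auto split: split_indicator)
  also have "\<dots> = (\<integral>\<^sup>+r. \<theta> r * (\<integral>\<^sup>+x. indicator {x. g x < r} x * q x \<partial>lborel) \<partial>lborel)"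
    by (intro nn_integral_cong nn_integral_cmult) measurable
  finally show ?thesis .
qed

text \<open>The profile is the integral of p r^(-p-1) over r >= max(|y-c|, \<rho>), and balls have
  volume proportional to r^n. It is used on the line for the resolvent factor and in dimension 2 for
  the integral over the plane.\<close>

lemma nn_integral_max_powr:
  fixes c :: "'a::euclidean_space"
  assumes p: "p > real DIM('a)" and \<rho>: "\<rho> > 0"
  shows "(\<integral>\<^sup>+y. ennreal (max (norm (y - c)) \<rho> powr (- p)) \<partial>lborel)
    \<le> ennreal (unit_ball_vol (real DIM('a)) * (p / (p - real DIM('a))) * \<rho> powr (real DIM('a) - p))"
proof -
  let ?n = "real DIM('a)"
  have p0: "p > 0" using p by (meson of_nat_0_le_iff order_le_less_trans)
  define \<theta> where "\<theta> r = ennreal (indicator {\<rho>..} r * (p * r powr (- p - 1)))" for r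
  have [measurable]: "\<theta> \<in> borel_measurable borel" unfolding \<theta>_def[abs_def] by measurable
  have eq: "ennreal (max (norm (y - c)) \<rho> powr (- p)) = (\<integral>\<^sup>+r. \<theta> r * indicator {norm (y - c)<..} r \<partial>lborel)" for y
  proof -
    let ?m = "max (norm (y - c)) \<rho>"
    have "(\<integral>\<^sup>+r. \<theta> r * indicator {norm (y - c)<..} r \<partial>lborel) = (\<integral>\<^sup>+r. ennreal p * ennreal (indicator {?m..} r * r powr (- p - 1)) \<partial>lborel)"
      using AE_lborel_singleton[of "norm (y - c)"] p0 unfolding \<theta>_def
      by (intro nn_integral_cong_AE) (auto elim!: eventually_mono split: split_indicator simp: ennreal_mult)
    also have "\<dots> = ennreal p * ennreal (?m powr (- p) / p)"
      using \<rho> by (simp add: nn_integral_cmult nn_integral_powr_infinity[OF p0])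
    also have "\<dots> = ennreal (?m powr (- p))"
      using p0 by (simp add: ennreal_mult[symmetric])
    finally show ?thesis by simp
  qed
  have "(\<integral>\<^sup>+y. ennreal (max (norm (y - c)) \<rho> powr (- p)) \<partial>lborel)
     = (\<integral>\<^sup>+y. (\<integral>\<^sup>+r. \<theta> r * indicator {norm (y - c)<..} r \<partial>lborel) * 1 \<partial>lborel)"
    unfolding eq by simp
  also have "\<dots> = (\<integral>\<^sup>+r. \<theta> r * (\<integral>\<^sup>+y. indicator {y. norm (y - c) < r} y * 1 \<partial>lborel) \<partial>lborel)"
    by (rule layer_cake) measurable
  also have "\<dots> = (\<integral>\<^sup>+r. ennreal (unit_ball_vol ?n * p) * ennreal (indicator {\<rho>..} r * r powr (- (p - ?n) - 1)) \<partial>lborel)"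
  proof (intro nn_integral_cong)
    fix r :: real
    show "\<theta> r * (\<integral>\<^sup>+y. indicator {y. norm (y - c) < r} y * 1 \<partial>lborel) = ennreal (unit_ball_vol ?n * p) * ennreal (indicator {\<rho>..} r * r powr (- (p - ?n) - 1))"
    proof (cases "r \<ge> \<rho>")
      case True
      then have r: "r > 0" using \<rho> by simp
      have "{y. norm (y - c) < r} = ball c r" by (auto simp: dist_norm norm_minus_commute)
      then have "(\<integral>\<^sup>+y. indicator {y. norm (y - c) < r} y * 1 \<partial>lborel) = emeasure lborel (ball c r)" by simp
      also have "\<dots> = ennreal (unit_ball_vol ?n * r ^ DIM('a))"
        using r by (intro emeasure_ball) auto
      finally have e: "(\<integral>\<^sup>+y. indicator {y. norm (y - c) < r} y * 1 \<partial>lborel) = ennreal (unit_ball_vol ?n * r ^ DIM('a))" .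
      have "r powr (- p - 1) * r ^ DIM('a) = r powr (- (p - ?n) - 1)"
        using r by (simp add: powr_realpow[symmetric] powr_add[symmetric] algebra_simps)
      then have "p * r powr (- p - 1) * (unit_ball_vol ?n * r ^ DIM('a)) = unit_ball_vol ?n * p * r powr (- (p - ?n) - 1)"
        by (simp add: mult_ac)
      then show ?thesis unfolding e \<theta>_def using True p0 r
        by (simp add: ennreal_mult[symmetric])
    qed (simp add: \<theta>_def)
  qed
  also have "\<dots> = ennreal (unit_ball_vol ?n * p) * ennreal (\<rho> powr (- (p - ?n)) / (p - ?n))"
    using p \<rho> by (simp add: nn_integral_cmult nn_integral_powr_infinity del: minus_diff_eq)
  also have "\<dots> = ennreal (unit_ball_vol ?n * (p / (p - ?n)) * \<rho> powr (?n - p))"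
    using p p0 by (simp add: ennreal_mult[symmetric] mult_ac)
  finally show ?thesis by simp
qed

section \<open>Orthogonal invariance and the mass of balls under the resolvent weight\<close>

lemma lborel_distr_orthogonal:
  fixes f :: "real^'n::{finite,wellorder} \<Rightarrow> real^'n::_"
  assumes f: "orthogonal_transformation f"
  shows "distr lborel borel f = lborel"
proof (rule lborel_eqI[symmetric])
  have lin: "linear f" using f by (rule orthogonal_transformation_linear)
  have [measurable]: "f \<in> borel_measurable borel"
    by (intro borel_measurable_continuous_onI linear_continuous_on linear_conv_bounded_linear[THEN iffD1] lin)
  have finv: "orthogonal_transformation (inv f)" by (rule orthogonal_transformation_inv[OF f])
  have bij: "bij f" by (rule orthogonal_transformation_bij[OF f])
  fix l u :: "real^'n::_"
  assume lu: "\<And>b. b \<in> Basis \<Longrightarrow> l \<bullet> b \<le> u \<bullet> b"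
  have v: "f -` box l u = inv f ` box l u" using bij by (simp add: bij_vimage_eq_inv_image)
  have m: "inv f ` box l u \<in> lmeasurable" "measure lebesgue (inv f ` box l u) = measure lebesgue (box l u)"
    using measurable_orthogonal_image[OF finv] measure_orthogonal_image[OF finv] by auto
  have s: "inv f ` box l u \<in> sets borel" unfolding v[symmetric]
    using measurable_sets[of f borel borel "box l u"] by simp
  have "emeasure (distr lborel borel f) (box l u) = emeasure lborel (inv f ` box l u)"
    by (subst emeasure_distr) (auto simp: v)
  also have "\<dots> = emeasure lebesgue (inv f ` box l u)" using s by simp
  also have "\<dots> = ennreal (measure lebesgue (inv f ` box l u))"
    using m(1) by (simp add: emeasure_eq_measure2)
  also have "\<dots> = emeasure lborel (box l u)"
    unfolding m(2) by (subst emeasure_eq_ennreal_measure) (use emeasure_lborel_box_finite[of l u] in auto)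
  also have "\<dots> = (\<Prod>b\<in>Basis. (u - l) \<bullet> b)" using lu by (subst emeasure_lborel_box) auto
  finally show "emeasure (distr lborel borel f) (box l u) = (\<Prod>b\<in>Basis. (u - l) \<bullet> b)" .
qed simp

lemma nn_integral_orthogonal:
  fixes f :: "real^'n::{finite,wellorder} \<Rightarrow> real^'n::_"
  assumes f: "orthogonal_transformation f" and [measurable]: "g \<in> borel_measurable borel"
  shows "(\<integral>\<^sup>+x. g (f x) \<partial>lborel) = (\<integral>\<^sup>+x. g x \<partial>lborel)"
proof -
  have "linear f" using f by (rule orthogonal_transformation_linear)
  then have [measurable]: "f \<in> borel_measurable borel"
    by (intro borel_measurable_continuous_onI linear_continuous_on linear_conv_bounded_linear[THEN iffD1])
  have "(\<integral>\<^sup>+x. g x \<partial>lborel) = (\<integral>\<^sup>+x. g x \<partial>distr lborel borel f)"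
    by (simp add: lborel_distr_orthogonal[OF f])
  also have "\<dots> = (\<integral>\<^sup>+x. g (f x) \<partial>lborel)" by (subst nn_integral_distr) auto
  finally show ?thesis by simp
qed

text \<open>After rotating \<xi> onto a coordinate axis, the ball is enclosed in a product: the
  whole line in the direction of \<xi>, intervals of length 2r in the other two. The line integral
  of 1/(1+(|\<xi>| t)^2) is at most 4/|\<xi>|, since the denominator dominates (|\<xi>| max(|t|,
  1/|\<xi>|))^2; hence 16 = 4 * 2 * 2.\<close>

lemma nn_integral_ball_slab:
  fixes \<xi> u :: r3
  assumes \<xi>: "\<xi> \<noteq> 0" and r: "r > 0"
  shows "(\<integral>\<^sup>+v. indicator {v. norm (v - u) < r} v * ennreal (1 / (1 + (v \<bullet> \<xi>)\<^sup>2)) \<partial>lborel) \<le> ennreal (16 * r\<^sup>2 / norm \<xi>)"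
proof -
  define e :: r3 where "e = axis 1 1"
  have eB: "e \<in> Basis" and ne: "norm e = 1" by (auto simp: e_def axis_in_Basis_iff)
  have "norm (norm \<xi> *\<^sub>R e) = norm \<xi>" by (simp add: ne)
  then obtain f where f: "orthogonal_transformation f" and fe: "f (norm \<xi> *\<^sub>R e) = \<xi>"
    by (rule orthogonal_transformation_exists)
  obtain u' where u': "f u' = u" using orthogonal_transformation_surj[OF f] by (metis surjD)
  have lin: "linear f" using f by (rule orthogonal_transformation_linear)
  define F where "F b t = (if b = e then ennreal (1 / (1 + (norm \<xi> * t)\<^sup>2)) else indicator {u' \<bullet> b - r..u' \<bullet> b + r} t)" for b t
  have "(\<integral>\<^sup>+v. indicator {v. norm (v - u) < r} v * ennreal (1 / (1 + (v \<bullet> \<xi>)\<^sup>2)) \<partial>lborel)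
    = (\<integral>\<^sup>+y. indicator {v. norm (v - u) < r} (f y) * ennreal (1 / (1 + (f y \<bullet> \<xi>)\<^sup>2)) \<partial>lborel)"
    by (rule nn_integral_orthogonal[OF f, symmetric]) measurable
  also have "\<dots> \<le> (\<integral>\<^sup>+y. (\<Prod>b\<in>Basis. F b (y \<bullet> b)) \<partial>lborel)"
  proof (intro nn_integral_mono)
    fix y :: r3
    have fy: "f y \<bullet> \<xi> = norm \<xi> * (y \<bullet> e)"
    proof -
      have "f y \<bullet> \<xi> = f y \<bullet> f (norm \<xi> *\<^sub>R e)" by (simp add: fe)
      also have "\<dots> = y \<bullet> (norm \<xi> *\<^sub>R e)" using f unfolding orthogonal_transformation_def by blast
      finally show ?thesis by simp
    qed
    have fd: "norm (f y - u) = norm (y - u')"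
      using orthogonal_transformation_norm[OF f, of "y - u'"] by (simp add: linear_diff[OF lin] u')
    show "indicator {v. norm (v - u) < r} (f y) * ennreal (1 / (1 + (f y \<bullet> \<xi>)\<^sup>2)) \<le> (\<Prod>b\<in>Basis. F b (y \<bullet> b))"
    proof (cases "norm (y - u') < r")
      case True
      have "F b (y \<bullet> b) = 1" if "b \<in> Basis - {e}" for b
      proof -
        have "\<bar>(y - u') \<bullet> b\<bar> \<le> norm (y - u')" using that by (intro Basis_le_norm) auto
        then have "y \<bullet> b \<in> {u' \<bullet> b - r..u' \<bullet> b + r}" using True by (auto simp: inner_diff_left)
        then show ?thesis using that by (auto simp: F_def)
      qed
      then have "(\<Prod>b\<in>Basis. F b (y \<bullet> b)) = F e (y \<bullet> e)"
        using eB by (subst prod.remove[of _ e]) auto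
      then show ?thesis by (auto simp: F_def fy split: split_indicator)
    qed (simp add: fd)
  qed
  also have "\<dots> = (\<Prod>b\<in>Basis. (\<integral>\<^sup>+t. F b t \<partial>lborel))"
    by (rule nn_integral_lborel_prod) (auto simp: F_def[abs_def])
  also have "\<dots> = (\<integral>\<^sup>+t. F e t \<partial>lborel) * (\<Prod>b\<in>Basis - {e}. (\<integral>\<^sup>+t. F b t \<partial>lborel))"
    using eB by (subst prod.remove[of _ e]) auto
  also have "(\<Prod>b\<in>Basis - {e}. (\<integral>\<^sup>+t. F b t \<partial>lborel)) = (\<Prod>b\<in>Basis - {e}. ennreal (2 * r))"
    using r by (intro prod.cong refl) (auto simp: F_def)
  also have "\<dots> = ennreal (4 * r\<^sup>2)"
    using eB r by (simp add: card_Diff_singleton power2_eq_square numeral_eq_Suc ennreal_mult[symmetric])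
  also have "(\<integral>\<^sup>+t. F e t \<partial>lborel) \<le> ennreal (4 / norm \<xi>)"
  proof -
    have "(\<integral>\<^sup>+t. F e t \<partial>lborel) \<le> (\<integral>\<^sup>+t. ennreal (1 / (norm \<xi>)\<^sup>2) * ennreal (max (norm ((t::real) - 0)) (1 / norm \<xi>) powr (- 2)) \<partial>lborel)"
    proof (intro nn_integral_mono)
      fix t :: real
      let ?m = "max (norm (t - 0)) (1 / norm \<xi>)"
      have m0: "?m > 0" using \<xi> by (simp add: less_max_iff_disj)
      have "(norm \<xi> * ?m)\<^sup>2 \<le> 1 + (norm \<xi> * t)\<^sup>2"
        using \<xi> by (auto simp: max_def power_mult_distrib power_divide)
      then have "1 / (1 + (norm \<xi> * t)\<^sup>2) \<le> 1 / (norm \<xi> * ?m)\<^sup>2"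
        using m0 \<xi> by (intro divide_left_mono) (auto intro!: mult_pos_pos add_pos_nonneg zero_less_power)
      also have "\<dots> = 1 / (norm \<xi>)\<^sup>2 * ?m powr (- 2)"
        using m0 by (simp add: powr_minus_divide power_mult_distrib)
      finally have "ennreal (1 / (1 + (norm \<xi> * t)\<^sup>2)) \<le> ennreal (1 / (norm \<xi>)\<^sup>2 * ?m powr (- 2))" by (rule ennreal_leI)
      also have "\<dots> = ennreal (1 / (norm \<xi>)\<^sup>2) * ennreal (?m powr (- 2))" by (rule ennreal_mult) auto
      finally show "F e t \<le> ennreal (1 / (norm \<xi>)\<^sup>2) * ennreal (?m powr (- 2))"
        by (simp only: F_def if_True refl)
    qed
    also have "\<dots> = ennreal (1 / (norm \<xi>)\<^sup>2) * (\<integral>\<^sup>+t. ennreal (max (norm ((t::real) - 0)) (1 / norm \<xi>) powr (- 2)) \<partial>lborel)"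
      by (rule nn_integral_cmult) measurable
    also have "\<dots> \<le> ennreal (1 / (norm \<xi>)\<^sup>2) * ennreal (unit_ball_vol (real DIM(real)) * (2 / (2 - real DIM(real))) * (1 / norm \<xi>) powr (real DIM(real) - 2))"
      using \<xi> by (intro mult_left_mono nn_integral_max_powr) auto
    also have "\<dots> = ennreal (1 / (norm \<xi>)\<^sup>2 * (4 * norm \<xi>))"
      using \<xi> by (simp add: unit_ball_vol_1 ennreal_mult powr_minus_divide flip: ennreal_mult)
    also have "1 / (norm \<xi>)\<^sup>2 * (4 * norm \<xi>) = 4 / norm \<xi>"
      using \<xi> by (simp add: power2_eq_square)
    finally show ?thesis .
  qed
  finally have "(\<integral>\<^sup>+v. indicator {v. norm (v - u) < r} v * ennreal (1 / (1 + (v \<bullet> \<xi>)\<^sup>2)) \<partial>lborel) \<le> ennreal (4 / norm \<xi>) * ennreal (4 * r\<^sup>2)"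
    by (simp add: mult_right_mono)
  then show ?thesis using \<xi> by (simp add: ennreal_mult[symmetric])
qed

text \<open>The model kernel: singularity of order \<beta> at the origin and decay of order \<beta>
  + m at infinity. Since \<open>0 powr _\<close> is 0, its value at the origin is 0, so bounds by
  \<open>sing\<close> that include the diagonal force the value 0 there.\<close>

definition sing :: "real \<Rightarrow> real \<Rightarrow> r3 \<Rightarrow> real" where
  "sing \<beta> m z = norm z powr (- \<beta>) * (1 + norm z) powr (- m)"

lemma sing_nonneg: "0 \<le> sing \<beta> m z"
  by (simp add: sing_def)

lemma borel_measurable_sing [measurable]: "sing \<beta> m \<in> borel_measurable borel"
  unfolding sing_def[abs_def] by measurable

text \<open>The profile in r is decreasing, so its integral over r > |z| is at least the length |z|
  of the interval from |z| to 2|z| times a lower bound at its right end. The constant undoes the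
  dilations by 2; an inequality of this kind is enough for the layer-cake argument.\<close>

lemma sing_layer:
  assumes \<beta>: "0 < \<beta>" and m: "0 \<le> m" and z: "z \<noteq> 0"
  shows "ennreal (sing \<beta> m z) \<le> ennreal (2 powr (\<beta> + m + 1)) *
    (\<integral>\<^sup>+r. ennreal (indicator {0<..} r * (r powr (- \<beta> - 1) * (1 + r) powr (- m))) * indicator {norm z<..} r \<partial>lborel)"
proof -
  let ?a = "norm z"
  have a: "?a > 0" using z by simp
  have e1: "ennreal (sing \<beta> m z) = ennreal (2 powr (\<beta> + m + 1)) * (ennreal ((2 * ?a) powr (- \<beta> - 1) * (2 * (1 + ?a)) powr (- m)) * ennreal ?a)"
  proof -
    have "2 powr (\<beta> + m + 1) * ((2 * ?a) powr (- \<beta> - 1) * (2 * (1 + ?a)) powr (- m) * ?a)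
      = (2 powr (\<beta> + m + 1) * (2 powr (- \<beta> - 1) * 2 powr (- m))) * ((?a powr (- \<beta> - 1) * ?a powr 1) * (1 + ?a) powr (- m))"
    proof -
      have "(2 * ?a) powr (- \<beta> - 1) = 2 powr (- \<beta> - 1) * ?a powr (- \<beta> - 1)"
        "(2 * (1 + ?a)) powr (- m) = 2 powr (- m) * (1 + ?a) powr (- m)"
        by (rule powr_mult)+
      moreover have "?a powr 1 = ?a" using a by simp
      ultimately show ?thesis by (simp only: mult_ac)
    qed
    also have "2 powr (\<beta> + m + 1) * (2 powr (- \<beta> - 1) * 2 powr (- m)) = (1::real)"
      by (simp add: powr_add[symmetric])
    also have "?a powr (- \<beta> - 1) * ?a powr 1 = ?a powr (- \<beta>)"
      by (simp only: powr_add[symmetric]) simp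
    finally show ?thesis by (simp add: sing_def ennreal_mult[symmetric])
  qed
  have e2: "ennreal ((2 * ?a) powr (- \<beta> - 1) * (2 * (1 + ?a)) powr (- m)) * ennreal ?a
     = (\<integral>\<^sup>+r. ennreal ((2 * ?a) powr (- \<beta> - 1) * (2 * (1 + ?a)) powr (- m)) * indicator {?a<..2 * ?a} r \<partial>lborel)"
    by (subst nn_integral_cmult_indicator) auto
  have le: "(\<integral>\<^sup>+r. ennreal ((2 * ?a) powr (- \<beta> - 1) * (2 * (1 + ?a)) powr (- m)) * indicator {?a<..2 * ?a} r \<partial>lborel) \<le> (\<integral>\<^sup>+r. ennreal (indicator {0<..} r * (r powr (- \<beta> - 1) * (1 + r) powr (- m))) * indicator {?a<..} r \<partial>lborel)"
  proof (intro nn_integral_mono)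
    fix r :: real
    show "ennreal ((2 * ?a) powr (- \<beta> - 1) * (2 * (1 + ?a)) powr (- m)) * indicator {?a<..2 * ?a} r
      \<le> ennreal (indicator {0<..} r * (r powr (- \<beta> - 1) * (1 + r) powr (- m))) * indicator {?a<..} r"
    proof (cases "r \<in> {?a<..2 * ?a}")
      case True
      then have r: "?a < r" "r \<le> 2 * ?a" "0 < r" using a by auto
      have "(2 * ?a) powr (- \<beta> - 1) \<le> r powr (- \<beta> - 1)"
        using r \<beta> by (intro powr_mono2') auto
      moreover have "(2 * (1 + ?a)) powr (- m) \<le> (1 + r) powr (- m)"
        using r m by (intro powr_mono2') auto
      ultimately have "(2 * ?a) powr (- \<beta> - 1) * (2 * (1 + ?a)) powr (- m) \<le> r powr (- \<beta> - 1) * (1 + r) powr (- m)"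
        by (intro mult_mono) auto
      then show ?thesis using r by (simp add: ennreal_leI)
    qed auto
  qed
  show ?thesis unfolding e1 e2 by (intro mult_left_mono le) simp
qed

text \<open>The function \<open>I\<close> bounds the mass of balls. For r <= 1 the decay factor is
  dropped; for r >= 1 it is at most r^-4, which explains the exponents -\<beta>-1 and
  -\<beta>-5.\<close>

lemma sing_integral_le:
  fixes q :: "r3 \<Rightarrow> real" and u :: r3
  assumes \<beta>: "0 < \<beta>" and m: "4 \<le> m"
    and [measurable]: "q \<in> borel_measurable borel"
    and I: "\<And>r. r > 0 \<Longrightarrow> (\<integral>\<^sup>+v. indicator {v. norm (v - u) < r} v * ennreal (q v) \<partial>lborel) \<le> ennreal (I r)"
    and [measurable]: "I \<in> borel_measurable borel" and I0: "\<And>r. 0 \<le> I r"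
  shows "(\<integral>\<^sup>+v. ennreal (sing \<beta> m (v - u)) * ennreal (q v) \<partial>lborel)
    \<le> ennreal (2 powr (\<beta> + m + 1)) * ((\<integral>\<^sup>+r. ennreal (indicator {0..1} r * r powr (- \<beta> - 1) * I r) \<partial>lborel)
       + (\<integral>\<^sup>+r. ennreal (indicator {1..} r * r powr (- \<beta> - 5) * I r) \<partial>lborel))"
proof -
  define \<theta> where "\<theta> r = ennreal (indicator {0<..} r * (r powr (- \<beta> - 1) * (1 + r) powr (- m)))" for r :: real
  have [measurable]: "\<theta> \<in> borel_measurable borel" unfolding \<theta>_def[abs_def] by measurable
  have "(\<integral>\<^sup>+v. ennreal (sing \<beta> m (v - u)) * ennreal (q v) \<partial>lborel)
    \<le> (\<integral>\<^sup>+v. ennreal (2 powr (\<beta> + m + 1)) * ((\<integral>\<^sup>+r. \<theta> r * indicator {norm (v - u)<..} r \<partial>lborel) * ennreal (q v)) \<partial>lborel)"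
  proof (rule nn_integral_mono_AE)
    show "AE v in lborel. ennreal (sing \<beta> m (v - u)) * ennreal (q v) \<le> ennreal (2 powr (\<beta> + m + 1)) * ((\<integral>\<^sup>+r. \<theta> r * indicator {norm (v - u)<..} r \<partial>lborel) * ennreal (q v))"
      using AE_lborel_singleton[of u]
    proof eventually_elim
      case (elim v)
      have "ennreal (sing \<beta> m (v - u)) \<le> ennreal (2 powr (\<beta> + m + 1)) * (\<integral>\<^sup>+r. \<theta> r * indicator {norm (v - u)<..} r \<partial>lborel)"
        unfolding \<theta>_def using elim m by (intro sing_layer \<beta>) auto
      then show ?case by (simp add: mult.assoc[symmetric] mult_right_mono)
    qed
  qed
  also have "\<dots> = ennreal (2 powr (\<beta> + m + 1)) * (\<integral>\<^sup>+v. (\<integral>\<^sup>+r. \<theta> r * indicator {norm (v - u)<..} r \<partial>lborel) * ennreal (q v) \<partial>lborel)"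
  proof (rule nn_integral_cmult)
    have "(\<lambda>p. indicator {p \<in> space (borel \<Otimes>\<^sub>M borel). norm (fst p - u) < snd p} p :: ennreal) \<in> borel_measurable (borel \<Otimes>\<^sub>M borel)"
      by measurable
    then have [measurable]: "(\<lambda>p. indicator {norm (fst p - u)<..} (snd p) :: ennreal) \<in> borel_measurable (borel \<Otimes>\<^sub>M borel)"
      by (rule measurable_cong[THEN iffD1, rotated]) (auto split: split_indicator simp: space_pair_measure)
    have "(\<lambda>v. (\<integral>\<^sup>+r. \<theta> r * indicator {norm (fst (v, r) - u)<..} (snd (v, r)) \<partial>lborel) * ennreal (q v)) \<in> borel_measurable lborel"
      by measurable
    then show "(\<lambda>v. (\<integral>\<^sup>+r. \<theta> r * indicator {norm (v - u)<..} r \<partial>lborel) * ennreal (q v)) \<in> borel_measurable lborel"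
      by simp
  qed
  also have "(\<integral>\<^sup>+v. (\<integral>\<^sup>+r. \<theta> r * indicator {norm (v - u)<..} r \<partial>lborel) * ennreal (q v) \<partial>lborel)
    = (\<integral>\<^sup>+r. \<theta> r * (\<integral>\<^sup>+v. indicator {v. norm (v - u) < r} v * ennreal (q v) \<partial>lborel) \<partial>lborel)"
    by (rule layer_cake) measurable
  also have "\<dots> \<le> (\<integral>\<^sup>+r. ennreal (indicator {0..1} r * r powr (- \<beta> - 1) * I r) + ennreal (indicator {1..} r * r powr (- \<beta> - 5) * I r) \<partial>lborel)"
  proof (intro nn_integral_mono)
    fix r :: real
    show "\<theta> r * (\<integral>\<^sup>+v. indicator {v. norm (v - u) < r} v * ennreal (q v) \<partial>lborel)
      \<le> ennreal (indicator {0..1} r * r powr (- \<beta> - 1) * I r) + ennreal (indicator {1..} r * r powr (- \<beta> - 5) * I r)"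
    proof (cases "r > 0")
      case True
      have "\<theta> r * (\<integral>\<^sup>+v. indicator {v. norm (v - u) < r} v * ennreal (q v) \<partial>lborel) \<le> ennreal (r powr (- \<beta> - 1) * (1 + r) powr (- m)) * ennreal (I r)"
        using True by (intro mult_mono I) (auto simp: \<theta>_def)
      also have "\<dots> = ennreal (r powr (- \<beta> - 1) * (1 + r) powr (- m) * I r)"
        using I0 by (simp add: ennreal_mult)
      also have "\<dots> \<le> ennreal (indicator {0..1} r * r powr (- \<beta> - 1) * I r + indicator {1..} r * r powr (- \<beta> - 5) * I r)"
      proof (intro ennreal_leI)
        show "r powr (- \<beta> - 1) * (1 + r) powr (- m) * I r \<le> indicator {0..1} r * r powr (- \<beta> - 1) * I r + indicator {1..} r * r powr (- \<beta> - 5) * I r"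
        proof (cases "r \<le> 1")
          case le: True
          have "(1 + r) powr (- m) \<le> 1 powr (- m)" using True m by (intro powr_mono2') auto
          then have "r powr (- \<beta> - 1) * (1 + r) powr (- m) \<le> r powr (- \<beta> - 1) * 1" by (intro mult_left_mono) auto
          then have "r powr (- \<beta> - 1) * (1 + r) powr (- m) * I r \<le> r powr (- \<beta> - 1) * I r"
            using I0[of r] by (simp add: mult_right_mono)
          moreover have "0 \<le> indicator {1..} r * r powr (- \<beta> - 5) * I r" using I0[of r] by simp
          moreover have i: "indicator {0..1} r = (1::real)" using le True by simp
          ultimately show ?thesis unfolding i mult_1_left by linarith
        next
          case False
          then have r: "r > 1" by simp
          have "(1 + r) powr (- m) \<le> r powr (- m)" using True m by (intro powr_mono2') auto
          also have "\<dots> \<le> r powr (- 4)" using r m by (intro powr_mono) auto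
          finally have "r powr (- \<beta> - 1) * (1 + r) powr (- m) \<le> r powr (- \<beta> - 1) * r powr (- 4)" by (intro mult_left_mono) auto
          also have "\<dots> = r powr (- \<beta> - 5)" by (simp add: powr_add[symmetric] algebra_simps)
          finally have "r powr (- \<beta> - 1) * (1 + r) powr (- m) * I r \<le> r powr (- \<beta> - 5) * I r" by (rule mult_right_mono) (rule I0)
          then show ?thesis using r by simp
        qed
      qed
      finally show ?thesis using I0[of r] by (simp add: ennreal_plus)
    qed (simp add: \<theta>_def)
  qed
  also have "\<dots> = (\<integral>\<^sup>+r. ennreal (indicator {0..1} r * r powr (- \<beta> - 1) * I r) \<partial>lborel)
       + (\<integral>\<^sup>+r. ennreal (indicator {1..} r * r powr (- \<beta> - 5) * I r) \<partial>lborel)"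
    by (rule nn_integral_add) measurable
  finally show ?thesis by (simp add: mult_left_mono)
qed

text \<open>Mass growth r^d with d above \<beta> makes the near part converge and d below \<beta> +
  4 the far part. It is used with d = 3, the volume bound, and with d = 2, the slab bound.\<close>

lemma sing_integral_powr:
  fixes q :: "r3 \<Rightarrow> real" and u :: r3
  assumes \<beta>: "0 < \<beta>" "\<beta> < d" "d \<le> 4" and m: "4 \<le> m" and A: "0 \<le> A"
    and [measurable]: "q \<in> borel_measurable borel"
    and I: "\<And>r. r > 0 \<Longrightarrow> (\<integral>\<^sup>+v. indicator {v. norm (v - u) < r} v * ennreal (q v) \<partial>lborel) \<le> ennreal (A * r powr d)"
  shows "(\<integral>\<^sup>+v. ennreal (sing \<beta> m (v - u)) * ennreal (q v) \<partial>lborel)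
    \<le> ennreal (2 powr (\<beta> + m + 1) * (1 / (d - \<beta>) + 1 / (\<beta> + 4 - d)) * A)"
proof -
  have 1: "(\<integral>\<^sup>+r. ennreal (indicator {0..1} r * r powr (- \<beta> - 1) * (A * r powr d)) \<partial>lborel) = ennreal (1 / (d - \<beta>) * A)"
  proof -
    have "(\<integral>\<^sup>+r. ennreal (indicator {0..1} r * r powr (- \<beta> - 1) * (A * r powr d)) \<partial>lborel)
      = (\<integral>\<^sup>+r. ennreal A * ennreal (indicator {0..1} r * r powr ((d - \<beta>) - 1)) \<partial>lborel)"
      using A by (intro nn_integral_cong) (auto simp: ennreal_mult[symmetric] powr_add[symmetric] algebra_simps split: split_indicator)
    also have "\<dots> = ennreal A * ennreal (1 powr (d - \<beta>) / (d - \<beta>))"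
      using \<beta> by (subst nn_integral_cmult, measurable) (simp add: nn_integral_powr_0 del: diff_diff_eq)
    finally show ?thesis using A \<beta> by (simp add: ennreal_mult[symmetric] mult.commute)
  qed
  have 2: "(\<integral>\<^sup>+r. ennreal (indicator {1..} r * r powr (- \<beta> - 5) * (A * r powr d)) \<partial>lborel) = ennreal (1 / (\<beta> + 4 - d) * A)"
  proof -
    have "(\<integral>\<^sup>+r. ennreal (indicator {1..} r * r powr (- \<beta> - 5) * (A * r powr d)) \<partial>lborel)
      = (\<integral>\<^sup>+r. ennreal A * ennreal (indicator {1..} r * r powr (- (\<beta> + 4 - d) - 1)) \<partial>lborel)"
      using A by (intro nn_integral_cong) (auto simp: ennreal_mult[symmetric] powr_add[symmetric] algebra_simps split: split_indicator)
    also have "\<dots> = ennreal A * ennreal (1 powr (- (\<beta> + 4 - d)) / (\<beta> + 4 - d))"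
      using \<beta> by (subst nn_integral_cmult, measurable) (subst nn_integral_powr_infinity, auto)
    finally show ?thesis using A \<beta> by (simp add: ennreal_mult[symmetric] mult.commute)
  qed
  have "(\<integral>\<^sup>+v. ennreal (sing \<beta> m (v - u)) * ennreal (q v) \<partial>lborel)
    \<le> ennreal (2 powr (\<beta> + m + 1)) * (ennreal (1 / (d - \<beta>) * A) + ennreal (1 / (\<beta> + 4 - d) * A))"
    unfolding 1[symmetric] 2[symmetric] using A I m \<beta> by (intro sing_integral_le) auto
  also have "\<dots> = ennreal (2 powr (\<beta> + m + 1) * (1 / (d - \<beta>) + 1 / (\<beta> + 4 - d)) * A)"
  proof -
    have "ennreal (1 / (d - \<beta>) * A) + ennreal (1 / (\<beta> + 4 - d) * A) = ennreal (1 / (d - \<beta>) * A + 1 / (\<beta> + 4 - d) * A)"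
      using A \<beta> by (intro ennreal_plus[symmetric]) auto
    also have "\<dots> = ennreal ((1 / (d - \<beta>) + 1 / (\<beta> + 4 - d)) * A)" by (simp only: distrib_right)
    also have "ennreal (2 powr (\<beta> + m + 1)) * \<dots> = ennreal (2 powr (\<beta> + m + 1) * ((1 / (d - \<beta>) + 1 / (\<beta> + 4 - d)) * A))"
      using A \<beta> by (intro ennreal_mult[symmetric]) (auto intro!: mult_nonneg_nonneg add_nonneg_nonneg)
    finally show ?thesis by (simp only: mult.assoc)
  qed
  finally show ?thesis .
qed

lemma ball_volume_bound:
  fixes u :: r3 and q :: "r3 \<Rightarrow> real"
  assumes r: "r > 0" and q: "\<And>v. 0 \<le> q v" "\<And>v. q v \<le> 1"
  shows "(\<integral>\<^sup>+v. indicator {v. norm (v - u) < r} v * ennreal (q v) \<partial>lborel) \<le> ennreal (unit_ball_vol 3 * r powr 3)"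
proof -
  have "(\<integral>\<^sup>+v. indicator {v. norm (v - u) < r} v * ennreal (q v) \<partial>lborel) \<le> (\<integral>\<^sup>+v. indicator (ball u r) v \<partial>lborel)"
    using q by (intro nn_integral_mono) (auto split: split_indicator simp: dist_norm norm_minus_commute ennreal_le_1)
  also have "\<dots> = emeasure lborel (ball u r)" by simp
  also have "\<dots> = ennreal (unit_ball_vol (real DIM(r3)) * r ^ DIM(r3))" using r by (intro emeasure_ball) auto
  finally show ?thesis using r by simp
qed

lemma one_div_one_plus_sq_le: "1 / (1 + x\<^sup>2) \<le> (1::real)"
  by (rule divide_le_eq_1_pos[THEN iffD2]) (auto intro: add_pos_nonneg)

text \<open>For \<beta> > 2 the slab bound r^2/|\<xi>| is not integrable near 0 against
  r^(-\<beta>-1), while the volume bound r^3 alone shows no decay in \<xi>. The first is used above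
  and the second below the radius \<rho> = 1/|\<xi>|, where they balance up to a constant; each part
  contributes a multiple of \<rho>^(3-\<beta>).\<close>

lemma sing_averaging_large_singularity:
  fixes \<xi> u :: r3
  assumes \<beta>: "2 < \<beta>" "\<beta> < 3" and m: "4 \<le> m" and \<xi>: "1 \<le> norm \<xi>"
  shows "(\<integral>\<^sup>+v. ennreal (sing \<beta> m (v - u)) * ennreal (1 / (1 + (v \<bullet> \<xi>)\<^sup>2)) \<partial>lborel)
    \<le> ennreal (2 powr (\<beta> + m + 1) * (unit_ball_vol 3 / (3 - \<beta>) + 16 / (\<beta> - 2) + 16 / (\<beta> + 2)) * (1 / norm \<xi>) powr (3 - \<beta>))"
proof -
  define \<rho> where "\<rho> = 1 / norm \<xi>"
  define \<omega> where "\<omega> = unit_ball_vol 3"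
  have n0: "0 < norm \<xi>" using \<xi> by linarith
  have \<rho>: "0 < \<rho>" "\<rho> \<le> 1" using \<xi> n0 by (simp_all add: \<rho>_def divide_le_eq)
  have \<omega>: "0 \<le> \<omega>" by (simp add: \<omega>_def)
  define I where "I r = min (\<omega> * r powr 3) (16 * \<rho> * r powr 2)" for r
  have [measurable]: "I \<in> borel_measurable borel" unfolding I_def[abs_def] by measurable
  have I0: "0 \<le> I r" for r using \<omega> \<rho> by (simp add: I_def)
  have I: "(\<integral>\<^sup>+v. indicator {v. norm (v - u) < r} v * ennreal (1 / (1 + (v \<bullet> \<xi>)\<^sup>2)) \<partial>lborel) \<le> ennreal (I r)" if r: "r > 0" for r
  proof -
    have "(\<integral>\<^sup>+v. indicator {v. norm (v - u) < r} v * ennreal (1 / (1 + (v \<bullet> \<xi>)\<^sup>2)) \<partial>lborel) \<le> ennreal (\<omega> * r powr 3)"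
      unfolding \<omega>_def by (rule ball_volume_bound[OF r]) (auto intro: one_div_one_plus_sq_le)
    moreover have "(\<integral>\<^sup>+v. indicator {v. norm (v - u) < r} v * ennreal (1 / (1 + (v \<bullet> \<xi>)\<^sup>2)) \<partial>lborel) \<le> ennreal (16 * r\<^sup>2 / norm \<xi>)"
      using \<xi> by (intro nn_integral_ball_slab r) auto
    moreover have "16 * r\<^sup>2 / norm \<xi> = 16 * \<rho> * r powr 2" using r by (simp add: \<rho>_def)
    ultimately show ?thesis by (simp add: I_def min_def)
  qed
  have p1: "(\<integral>\<^sup>+r. ennreal (indicator {0..1} r * r powr (- \<beta> - 1) * I r) \<partial>lborel)
     \<le> ennreal (\<omega> / (3 - \<beta>) * \<rho> powr (3 - \<beta>)) + ennreal (16 / (\<beta> - 2) * \<rho> powr (3 - \<beta>))"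
  proof -
    have "(\<integral>\<^sup>+r. ennreal (indicator {0..1} r * r powr (- \<beta> - 1) * I r) \<partial>lborel)
      \<le> (\<integral>\<^sup>+r. ennreal \<omega> * ennreal (indicator {0..\<rho>} r * r powr ((3 - \<beta>) - 1)) + ennreal (16 * \<rho>) * ennreal (indicator {\<rho>..} r * r powr (- (\<beta> - 2) - 1)) \<partial>lborel)"
    proof (intro nn_integral_mono)
      fix r :: real
      have a: "r powr (- \<beta> - 1) * r powr 3 = r powr ((3 - \<beta>) - 1)" "r powr (- \<beta> - 1) * r powr 2 = r powr (- (\<beta> - 2) - 1)"
        by (simp_all add: powr_add[symmetric] algebra_simps)
      show "ennreal (indicator {0..1} r * r powr (- \<beta> - 1) * I r)
        \<le> ennreal \<omega> * ennreal (indicator {0..\<rho>} r * r powr ((3 - \<beta>) - 1)) + ennreal (16 * \<rho>) * ennreal (indicator {\<rho>..} r * r powr (- (\<beta> - 2) - 1))"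
      proof (cases "r \<in> {0..1}")
        case True
        show ?thesis
        proof (cases "r \<le> \<rho>")
          case le: True
          have "r powr (- \<beta> - 1) * I r \<le> r powr (- \<beta> - 1) * (\<omega> * r powr 3)"
            by (intro mult_left_mono) (auto simp: I_def)
          also have "\<dots> = \<omega> * r powr ((3 - \<beta>) - 1)" unfolding a[symmetric] by simp
          finally have "ennreal (r powr (- \<beta> - 1) * I r) \<le> ennreal \<omega> * ennreal (r powr ((3 - \<beta>) - 1))"
            using \<omega> by (simp add: ennreal_mult[symmetric] ennreal_leI)
          then show ?thesis using True le by (simp add: add_increasing2)
        next
          case False
          have "r powr (- \<beta> - 1) * I r \<le> r powr (- \<beta> - 1) * (16 * \<rho> * r powr 2)"
            by (intro mult_left_mono) (auto simp: I_def)
          also have "\<dots> = 16 * \<rho> * r powr (- (\<beta> - 2) - 1)" unfolding a[symmetric] by simp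
          finally have "ennreal (r powr (- \<beta> - 1) * I r) \<le> ennreal (16 * \<rho>) * ennreal (r powr (- (\<beta> - 2) - 1))"
            using \<rho> by (simp add: ennreal_mult[symmetric] ennreal_leI)
          then show ?thesis using True False by simp
        qed
      qed auto
    qed
    also have "\<dots> = ennreal \<omega> * ennreal (\<rho> powr (3 - \<beta>) / (3 - \<beta>)) + ennreal (16 * \<rho>) * ennreal (\<rho> powr (- (\<beta> - 2)) / (\<beta> - 2))"
    proof -
      let ?f = "\<lambda>r. ennreal (indicator {0..\<rho>} r * r powr ((3 - \<beta>) - 1))"
      let ?g = "\<lambda>r. ennreal (indicator {\<rho>..} r * r powr (- (\<beta> - 2) - 1))"
      have "(\<integral>\<^sup>+r. ennreal \<omega> * ?f r + ennreal (16 * \<rho>) * ?g r \<partial>lborel) = (\<integral>\<^sup>+r. ennreal \<omega> * ?f r \<partial>lborel) + (\<integral>\<^sup>+r. ennreal (16 * \<rho>) * ?g r \<partial>lborel)"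
        by (rule nn_integral_add) measurable
      also have "(\<integral>\<^sup>+r. ennreal \<omega> * ?f r \<partial>lborel) = ennreal \<omega> * (\<integral>\<^sup>+r. ?f r \<partial>lborel)"
        by (rule nn_integral_cmult) measurable
      also have "(\<integral>\<^sup>+r. ?f r \<partial>lborel) = ennreal (\<rho> powr (3 - \<beta>) / (3 - \<beta>))"
        by (rule nn_integral_powr_0) (use \<beta> \<rho> in auto)
      also have "(\<integral>\<^sup>+r. ennreal (16 * \<rho>) * ?g r \<partial>lborel) = ennreal (16 * \<rho>) * (\<integral>\<^sup>+r. ?g r \<partial>lborel)"
        by (rule nn_integral_cmult) measurable
      also have "(\<integral>\<^sup>+r. ?g r \<partial>lborel) = ennreal (\<rho> powr (- (\<beta> - 2)) / (\<beta> - 2))"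
        by (rule nn_integral_powr_infinity) (use \<beta> \<rho> in auto)
      finally show ?thesis .
    qed
    also have "ennreal (16 * \<rho>) * ennreal (\<rho> powr (- (\<beta> - 2)) / (\<beta> - 2)) = ennreal (16 / (\<beta> - 2) * \<rho> powr (3 - \<beta>))"
    proof -
      have "\<rho> powr (3 - \<beta>) = \<rho> powr (1 + - (\<beta> - 2))" by (rule arg_cong[where f="\<lambda>x. \<rho> powr x"]) simp
      also have "\<dots> = \<rho> * \<rho> powr (- (\<beta> - 2))" using \<rho> by (simp only: powr_add) simp
      finally have "16 * \<rho> * (\<rho> powr (- (\<beta> - 2)) / (\<beta> - 2)) = 16 / (\<beta> - 2) * \<rho> powr (3 - \<beta>)" by simp
      then show ?thesis using \<rho> \<beta> by (subst ennreal_mult[symmetric]) auto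
    qed
    also have "ennreal \<omega> * ennreal (\<rho> powr (3 - \<beta>) / (3 - \<beta>)) = ennreal (\<omega> / (3 - \<beta>) * \<rho> powr (3 - \<beta>))"
      using \<omega> \<beta> by (subst ennreal_mult[symmetric]) auto
    finally show ?thesis .
  qed
  have p2: "(\<integral>\<^sup>+r. ennreal (indicator {1..} r * r powr (- \<beta> - 5) * I r) \<partial>lborel) \<le> ennreal (16 / (\<beta> + 2) * \<rho> powr (3 - \<beta>))"
  proof -
    have "(\<integral>\<^sup>+r. ennreal (indicator {1..} r * r powr (- \<beta> - 5) * I r) \<partial>lborel)
      \<le> (\<integral>\<^sup>+r. ennreal (16 * \<rho>) * ennreal (indicator {1..} r * r powr (- (\<beta> + 2) - 1)) \<partial>lborel)"
    proof (intro nn_integral_mono)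
      fix r :: real
      have "r powr (- \<beta> - 5) * I r \<le> r powr (- \<beta> - 5) * (16 * \<rho> * r powr 2)"
        by (intro mult_left_mono) (auto simp: I_def)
      also have "\<dots> = 16 * \<rho> * (r powr (- \<beta> - 5) * r powr 2)" by simp
      also have "r powr (- \<beta> - 5) * r powr 2 = r powr (- (\<beta> + 2) - 1)"
        by (simp add: powr_add[symmetric] algebra_simps)
      finally have "indicator {1..} r * (r powr (- \<beta> - 5) * I r) \<le> indicator {1..} r * (16 * \<rho> * r powr (- (\<beta> + 2) - 1))"
        by (rule mult_left_mono) simp
      then have "ennreal (indicator {1..} r * r powr (- \<beta> - 5) * I r) \<le> ennreal (16 * \<rho> * (indicator {1..} r * r powr (- (\<beta> + 2) - 1)))"
        by (intro ennreal_leI) (simp only: mult_ac)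
      also have "\<dots> = ennreal (16 * \<rho>) * ennreal (indicator {1..} r * r powr (- (\<beta> + 2) - 1))"
        using \<rho> by (intro ennreal_mult) auto
      finally show "ennreal (indicator {1..} r * r powr (- \<beta> - 5) * I r) \<le> ennreal (16 * \<rho>) * ennreal (indicator {1..} r * r powr (- (\<beta> + 2) - 1))" .
    qed
    also have "\<dots> = ennreal (16 * \<rho>) * ennreal (1 powr (- (\<beta> + 2)) / (\<beta> + 2))"
      using \<beta> by (subst nn_integral_cmult, measurable) (subst nn_integral_powr_infinity, auto)
    also have "\<dots> = ennreal (16 / (\<beta> + 2) * \<rho>)"
      using \<rho> \<beta> by (simp add: ennreal_mult[symmetric])
    \<comment> \<open>The far part carries the full factor \<rho>, which is smaller than required
      because \<rho> <= 1 and 3 - \<beta> <= 1.\<close>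
    also have "\<dots> \<le> ennreal (16 / (\<beta> + 2) * \<rho> powr (3 - \<beta>))"
    proof (intro ennreal_leI mult_left_mono)
      have "\<rho> powr 1 \<le> \<rho> powr (3 - \<beta>)" using \<rho> \<beta> by (intro powr_mono') auto
      then show "\<rho> \<le> \<rho> powr (3 - \<beta>)" using \<rho> by simp
    qed (use \<beta> in auto)
    finally show ?thesis .
  qed
  have "(\<integral>\<^sup>+v. ennreal (sing \<beta> m (v - u)) * ennreal (1 / (1 + (v \<bullet> \<xi>)\<^sup>2)) \<partial>lborel)
    \<le> ennreal (2 powr (\<beta> + m + 1)) * ((\<integral>\<^sup>+r. ennreal (indicator {0..1} r * r powr (- \<beta> - 1) * I r) \<partial>lborel)
       + (\<integral>\<^sup>+r. ennreal (indicator {1..} r * r powr (- \<beta> - 5) * I r) \<partial>lborel))"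
    by (rule sing_integral_le[OF _ m]) (use \<beta> I I0 in auto)
  also have "\<dots> \<le> ennreal (2 powr (\<beta> + m + 1)) * ((ennreal (\<omega> / (3 - \<beta>) * \<rho> powr (3 - \<beta>)) + ennreal (16 / (\<beta> - 2) * \<rho> powr (3 - \<beta>)))
       + ennreal (16 / (\<beta> + 2) * \<rho> powr (3 - \<beta>)))"
    by (intro mult_left_mono add_mono p1 p2) auto
  also have "\<dots> = ennreal (2 powr (\<beta> + m + 1) * ((\<omega> / (3 - \<beta>) * \<rho> powr (3 - \<beta>) + 16 / (\<beta> - 2) * \<rho> powr (3 - \<beta>)) + 16 / (\<beta> + 2) * \<rho> powr (3 - \<beta>)))"
    using \<omega> \<beta> by (simp add: ennreal_mult ennreal_plus add_nonneg_nonneg)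
  also have "2 powr (\<beta> + m + 1) * ((\<omega> / (3 - \<beta>) * \<rho> powr (3 - \<beta>) + 16 / (\<beta> - 2) * \<rho> powr (3 - \<beta>)) + 16 / (\<beta> + 2) * \<rho> powr (3 - \<beta>))
     = 2 powr (\<beta> + m + 1) * (\<omega> / (3 - \<beta>) + 16 / (\<beta> - 2) + 16 / (\<beta> + 2)) * \<rho> powr (3 - \<beta>)"
    by (simp only: distrib_right mult.assoc)
  finally show ?thesis by (simp add: \<omega>_def \<rho>_def)
qed

text \<open>Low frequencies need only the volume bound. For |\<xi>| >= 1 the slab bound alone gives
  1/|\<xi>| when \<beta> < 2, and the previous lemma covers \<beta> > 2; at \<beta> = 2 both
  constants blow up. The exponent is halved because the decay is stated in 1 + |\<xi>|^2.\<close>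

lemma sing_averaging:
  assumes \<beta>: "0 < \<beta>" "\<beta> < 3" "\<beta> \<noteq> 2" and m: "4 \<le> m"
    and \<sigma>: "\<sigma> = min (1/2) ((3 - \<beta>) / 2)"
  obtains C where "0 < C"
    "\<And>\<xi> u. (\<integral>\<^sup>+v. ennreal (sing \<beta> m (v - u)) * ennreal (1 / (1 + (v \<bullet> \<xi>)\<^sup>2)) \<partial>lborel) \<le> ennreal (C * (1 + (norm \<xi>)\<^sup>2) powr (- \<sigma>))"
proof -
  define C0 where "C0 = 2 powr (\<beta> + m + 1) * (1 / (3 - \<beta>) + 1 / (\<beta> + 4 - 3)) * unit_ball_vol 3"
  define C1 where "C1 = (if \<beta> < 2 then 2 powr (\<beta> + m + 1) * (1 / (2 - \<beta>) + 1 / (\<beta> + 4 - 2)) * 16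
     else 2 powr (\<beta> + m + 1) * (unit_ball_vol 3 / (3 - \<beta>) + 16 / (\<beta> - 2) + 16 / (\<beta> + 2)))"
  have C0: "0 \<le> C0" and C1: "0 \<le> C1" using \<beta> by (auto simp: C0_def C1_def intro!: mult_nonneg_nonneg add_nonneg_nonneg)
  have \<sigma>0: "0 \<le> \<sigma>" using \<beta> by (simp add: \<sigma>)
  let ?J = "\<lambda>\<xi> u. (\<integral>\<^sup>+v. ennreal (sing \<beta> m (v - u)) * ennreal (1 / (1 + (v \<bullet> \<xi>)\<^sup>2)) \<partial>lborel)"
  have small: "?J \<xi> u \<le> ennreal C0" for \<xi> u :: r3
    unfolding C0_def
  proof (rule sing_integral_powr)
    fix r :: real assume "r > 0"
    then show "(\<integral>\<^sup>+v. indicator {v. norm (v - u) < r} v * ennreal (1 / (1 + (v \<bullet> \<xi>)\<^sup>2)) \<partial>lborel) \<le> ennreal (unit_ball_vol 3 * r powr 3)"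
      by (rule ball_volume_bound) (auto intro: one_div_one_plus_sq_le)
  qed (use \<beta> m in auto)
  have large: "?J \<xi> u \<le> ennreal (C1 * ((norm \<xi>)\<^sup>2) powr (- \<sigma>))" if \<xi>: "1 \<le> norm \<xi>" for \<xi> u :: r3
  proof (cases "\<beta> < 2")
    case True
    have s: "((norm \<xi>)\<^sup>2) powr (- \<sigma>) = 1 / norm \<xi>"
    proof -
      have "((norm \<xi>)\<^sup>2) powr (- \<sigma>) = (norm \<xi> powr 2) powr (- (1/2))"
        using True \<xi> by (simp add: \<sigma>)
      also have "\<dots> = norm \<xi> powr (- 1)" by (simp add: powr_powr del: powr_numeral)
      also have "\<dots> = 1 / norm \<xi>" using \<xi> by (simp add: powr_minus_divide)
      finally show ?thesis .
    qed
    have "?J \<xi> u \<le> ennreal (2 powr (\<beta> + m + 1) * (1 / (2 - \<beta>) + 1 / (\<beta> + 4 - 2)) * (16 / norm \<xi>))"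
    proof (rule sing_integral_powr)
      fix r :: real assume r: "r > 0"
      have "(\<integral>\<^sup>+v. indicator {v. norm (v - u) < r} v * ennreal (1 / (1 + (v \<bullet> \<xi>)\<^sup>2)) \<partial>lborel) \<le> ennreal (16 * r\<^sup>2 / norm \<xi>)"
        using \<xi> by (intro nn_integral_ball_slab r) auto
      also have "16 * r\<^sup>2 / norm \<xi> = 16 / norm \<xi> * r powr 2" using r by simp
      finally show "(\<integral>\<^sup>+v. indicator {v. norm (v - u) < r} v * ennreal (1 / (1 + (v \<bullet> \<xi>)\<^sup>2)) \<partial>lborel) \<le> ennreal (16 / norm \<xi> * r powr 2)" .
    qed (use True \<beta> m in auto)
    also have "2 powr (\<beta> + m + 1) * (1 / (2 - \<beta>) + 1 / (\<beta> + 4 - 2)) * (16 / norm \<xi>) = C1 * ((norm \<xi>)\<^sup>2) powr (- \<sigma>)"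
      unfolding s C1_def using True by simp
    finally show ?thesis .
  next
    case False
    have s: "((norm \<xi>)\<^sup>2) powr (- \<sigma>) = (1 / norm \<xi>) powr (3 - \<beta>)"
    proof -
      have "((norm \<xi>)\<^sup>2) powr (- \<sigma>) = (norm \<xi> powr 2) powr (- ((3 - \<beta>) / 2))"
      proof -
        have sg: "\<sigma> = (3 - \<beta>) / 2" using False \<beta> by (simp add: \<sigma> min_def)
        show ?thesis unfolding sg using \<xi> by simp
      qed
      also have "\<dots> = norm \<xi> powr (2 * - ((3 - \<beta>) / 2))" by (rule powr_powr)
      also have "2 * - ((3 - \<beta>) / 2) = - (3 - \<beta>)" by (simp add: field_simps)
      also have "norm \<xi> powr (- (3 - \<beta>)) = 1 / norm \<xi> powr (3 - \<beta>)" by (rule powr_minus_divide)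
      also have "\<dots> = (1 / norm \<xi>) powr (3 - \<beta>)" using \<xi> by (simp add: powr_divide)
      finally show ?thesis .
    qed
    show ?thesis
      unfolding s C1_def using False sing_averaging_large_singularity[of \<beta> m \<xi> u] \<beta> m \<xi> by simp
  qed
  show ?thesis
  proof (rule that)
    \<comment> \<open>The factor 2^\<sigma> compares 1 + |\<xi>|^2 with 2|\<xi>|^2 at high and with
      2 at low frequency; the summand 1 makes the constant strictly positive.\<close>
    show "0 < 2 powr \<sigma> * (C0 + C1 + 1)" using C0 C1 by (intro mult_pos_pos) auto
    fix \<xi> u :: r3
    show "?J \<xi> u \<le> ennreal (2 powr \<sigma> * (C0 + C1 + 1) * (1 + (norm \<xi>)\<^sup>2) powr (- \<sigma>))"
    proof (cases "1 \<le> norm \<xi>")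
      case True
      have n: "1 \<le> (norm \<xi>)\<^sup>2" using True by simp
      have "(2 * (norm \<xi>)\<^sup>2) powr (- \<sigma>) \<le> (1 + (norm \<xi>)\<^sup>2) powr (- \<sigma>)"
        using n \<sigma>0 by (intro powr_mono2') auto
      then have "2 powr \<sigma> * (2 powr (- \<sigma>) * ((norm \<xi>)\<^sup>2) powr (- \<sigma>)) \<le> 2 powr \<sigma> * (1 + (norm \<xi>)\<^sup>2) powr (- \<sigma>)"
        by (simp add: powr_mult)
      then have "((norm \<xi>)\<^sup>2) powr (- \<sigma>) \<le> 2 powr \<sigma> * (1 + (norm \<xi>)\<^sup>2) powr (- \<sigma>)"
        by (simp add: mult.assoc[symmetric] powr_add[symmetric])
      then have "C1 * ((norm \<xi>)\<^sup>2) powr (- \<sigma>) \<le> (C0 + C1 + 1) * (2 powr \<sigma> * (1 + (norm \<xi>)\<^sup>2) powr (- \<sigma>))"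
        using C0 C1 by (intro mult_mono) auto
      then have "ennreal (C1 * ((norm \<xi>)\<^sup>2) powr (- \<sigma>)) \<le> ennreal (2 powr \<sigma> * (C0 + C1 + 1) * (1 + (norm \<xi>)\<^sup>2) powr (- \<sigma>))"
        by (intro ennreal_leI) (simp only: mult_ac)
      with large[OF True, of u] show ?thesis by (rule order_trans)
    next
      case False
      then have "(norm \<xi>)\<^sup>2 \<le> 1" by (simp add: power_le_one)
      then have "2 powr (- \<sigma>) \<le> (1 + (norm \<xi>)\<^sup>2) powr (- \<sigma>)"
        using \<sigma>0 by (intro powr_mono2') (auto simp: add_pos_nonneg)
      then have "2 powr \<sigma> * 2 powr (- \<sigma>) \<le> 2 powr \<sigma> * (1 + (norm \<xi>)\<^sup>2) powr (- \<sigma>)"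
        by (intro mult_left_mono) auto
      then have "1 \<le> 2 powr \<sigma> * (1 + (norm \<xi>)\<^sup>2) powr (- \<sigma>)" by (simp add: powr_add[symmetric])
      then have "C0 * 1 \<le> (C0 + C1 + 1) * (2 powr \<sigma> * (1 + (norm \<xi>)\<^sup>2) powr (- \<sigma>))"
        using C0 C1 by (intro mult_mono) auto
      then have "ennreal C0 \<le> ennreal (2 powr \<sigma> * (C0 + C1 + 1) * (1 + (norm \<xi>)\<^sup>2) powr (- \<sigma>))"
        by (intro ennreal_leI) (simp only: mult_ac)
      with small[of u \<xi>] show ?thesis by (rule order_trans)
    qed
  qed
qed

text \<open>Peetre's inequality, from 1 + |v| <= (1 + |u|) (1 + |v-u|) when \<gamma> >= 0 and from
  the same inequality with u and v exchanged when \<gamma> < 0.\<close>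

lemma vweight_le_shift:
  assumes "\<bar>\<gamma>\<bar> \<le> m"
  shows "vweight \<gamma> v \<le> vweight \<gamma> u * (1 + norm (v - u)) powr m"
proof -
  have "vweight \<gamma> v \<le> vweight \<gamma> u * (1 + norm (v - u)) powr \<bar>\<gamma>\<bar>"
  proof (cases "\<gamma> \<ge> 0")
    case True
    have "norm v \<le> norm u + norm (v - u)" using norm_triangle_ineq[of u "v - u"] by simp
    moreover have "(1 + norm u) * (1 + norm (v - u)) = 1 + norm u + norm (v - u) + norm u * norm (v - u)"
      by (simp add: algebra_simps)
    moreover have "0 \<le> norm u * norm (v - u)" by simp
    ultimately have "1 + norm v \<le> (1 + norm u) * (1 + norm (v - u))" by linarith
    then have "(1 + norm v) powr \<gamma> \<le> ((1 + norm u) * (1 + norm (v - u))) powr \<gamma>"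
      using True by (intro powr_mono2) auto
    then show ?thesis using True by (simp add: vweight_def powr_mult)
  next
    case False
    have "norm u \<le> norm v + norm (v - u)" using norm_triangle_ineq4[of v "v - u"] by simp
    moreover have "(1 + norm v) * (1 + norm (v - u)) = 1 + norm v + norm (v - u) + norm v * norm (v - u)"
      by (simp add: algebra_simps)
    moreover have "0 \<le> norm v * norm (v - u)" by simp
    ultimately have "1 + norm u \<le> (1 + norm v) * (1 + norm (v - u))" by linarith
    then have "((1 + norm v) * (1 + norm (v - u))) powr \<gamma> \<le> (1 + norm u) powr \<gamma>"
      using False by (intro powr_mono2') (auto simp: add_pos_nonneg)
    then have "(1 + norm v) powr \<gamma> * (1 + norm (v - u)) powr \<gamma> \<le> (1 + norm u) powr \<gamma>"
      by (simp add: powr_mult)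
    then have "(1 + norm v) powr \<gamma> * (1 + norm (v - u)) powr \<gamma> * (1 + norm (v - u)) powr (- \<gamma>) \<le> (1 + norm u) powr \<gamma> * (1 + norm (v - u)) powr (- \<gamma>)"
      by (rule mult_right_mono) simp
    moreover have "(1 + norm (v - u)) powr \<gamma> * (1 + norm (v - u)) powr (- \<gamma>) = 1"
    proof -
      have "1 + norm (v - u) > 0" by (simp add: add_pos_nonneg)
      then show ?thesis by (simp add: powr_add[symmetric])
    qed
    ultimately show ?thesis using False by (simp add: vweight_def mult.assoc)
  qed
  also have "\<dots> \<le> vweight \<gamma> u * (1 + norm (v - u)) powr m"
    using assms vweight_pos[of \<gamma> u] by (intro mult_left_mono powr_mono) auto
  finally show ?thesis .
qed

text \<open>Schur test with the kernel bound split into two square roots: one is integrated in u at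
  once, the other stays with the square of \<open>g\<close>. After Tonelli the v-integral is the one
  of \<open>sing_averaging\<close>.\<close>

lemma averaging_kernelI:
  fixes k :: "r3 \<Rightarrow> r3 \<Rightarrow> real" and N :: "r3 \<Rightarrow> real"
  assumes k_borel: "(\<lambda>p. k (fst p) (snd p)) \<in> borel_measurable (borel \<Otimes>\<^sub>M borel)"
    and N_borel [measurable]: "N \<in> borel_measurable borel"
    and \<beta>: "0 < \<beta>" "\<beta> < 3" "\<beta> \<noteq> 2" and \<gamma>: "-3 \<le> \<gamma>" "\<gamma> \<le> 1"
    and \<sigma>: "\<sigma> = min (1/2) ((3 - \<beta>) / 2)"
    and c: "0 < c" and N: "\<And>v. c * min 1 (vweight \<gamma> v) \<le> N v"
    and C1: "0 \<le> C1" and k: "\<And>v u. \<bar>k v u\<bar> \<le> C1 * vweight (\<gamma> - 1) v * sing \<beta> 8 (v - u)"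
  shows "\<exists>C. averaging_kernel k N \<gamma> \<sigma> C"
proof -
  have [measurable (raw)]: "(\<lambda>x. k (f x) (g x)) \<in> borel_measurable M" if "f \<in> M \<rightarrow>\<^sub>M borel" "g \<in> M \<rightarrow>\<^sub>M borel" for f g and M :: "r3 measure"
    using measurable_compose[OF measurable_Pair[OF that] k_borel] by simp
  have Npos: "0 < N v" for v
    using N[of v] c vweight_pos[of \<gamma> v] by (smt (verit) mult_pos_pos min_def)
  obtain C0 where C0: "0 < C0"
    "\<And>\<xi> u. (\<integral>\<^sup>+v. ennreal (sing \<beta> 4 (v - u)) * ennreal (1 / (1 + (v \<bullet> \<xi>)\<^sup>2)) \<partial>lborel) \<le> ennreal (C0 * (1 + (norm \<xi>)\<^sup>2) powr (- \<sigma>))"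
    using sing_averaging[OF \<beta>, of 4 \<sigma>] \<sigma> by auto
  \<comment> \<open>Four powers of decay are set aside to move the weight from v to u, which is
    possible because |\<gamma>| <= 3; the other four are what \<open>sing_averaging\<close>
    consumes.\<close>
  have sing84: "sing \<beta> 8 z * (1 + norm z) powr 4 = sing \<beta> 4 z" for z
  proof -
    have "(1 + norm z) powr (-8) * (1 + norm z) powr 4 = (1 + norm z) powr (-4)"
      by (simp only: powr_add[symmetric]) simp
    then show ?thesis unfolding sing_def by (simp only: mult.assoc)
  qed
  have sing8le4: "sing \<beta> 8 z \<le> sing \<beta> 4 z" for z
    unfolding sing_def by (intro mult_left_mono powr_mono) auto
  have A: "(\<integral>\<^sup>+u. ennreal (sing \<beta> 8 (v - u)) \<partial>lborel) \<le> ennreal C0" for v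
  proof -
    have "(\<integral>\<^sup>+u. ennreal (sing \<beta> 8 (v - u)) \<partial>lborel) \<le> (\<integral>\<^sup>+u. ennreal (sing \<beta> 4 (u - v)) * ennreal (1 / (1 + (u \<bullet> 0)\<^sup>2)) \<partial>lborel)"
    proof (intro nn_integral_mono)
      fix u
      have "sing \<beta> 8 (v - u) \<le> sing \<beta> 4 (u - v)"
        using sing8le4[of "u - v"] by (simp add: sing_def norm_minus_commute)
      then show "ennreal (sing \<beta> 8 (v - u)) \<le> ennreal (sing \<beta> 4 (u - v)) * ennreal (1 / (1 + (u \<bullet> 0)\<^sup>2))"
        by (simp add: ennreal_leI)
    qed
    also have "\<dots> \<le> ennreal (C0 * (1 + (norm (0::r3))\<^sup>2) powr (- \<sigma>))" by (rule C0)
    finally show ?thesis by simp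
  qed
  define K where "K = 1 / c\<^sup>2 + 1"
  have K0: "0 < K" using c by (simp add: K_def add_pos_pos)
  \<comment> \<open>The factor \<open>vweight (\<gamma> - 1) v\<close> is at most 1 and at most
    \<open>vweight \<gamma> v\<close>, hence at most \<open>N v / c\<close>. Its square therefore
    compensates a vanishing \<open>N\<close> and leaves the uniform resolvent weight.\<close>
  have weight: "(vweight (\<gamma> - 1) v)\<^sup>2 / ((N v)\<^sup>2 + x\<^sup>2) \<le> K / (1 + x\<^sup>2)" for v and x :: real
  proof -
    let ?w = "vweight (\<gamma> - 1) v"
    have "?w \<le> vweight \<gamma> v" unfolding vweight_def by (intro powr_mono) auto
    moreover have "?w \<le> 1"
    proof -
      have "?w \<le> (1 + norm v) powr 0" unfolding vweight_def using \<gamma> by (intro powr_mono) auto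
      then show ?thesis by (simp add: add_nonneg_eq_0_iff split: if_splits)
    qed
    ultimately have w: "?w \<le> min 1 (vweight \<gamma> v)" by simp
    have w0: "0 < ?w" by (rule vweight_pos)
    have "c * ?w \<le> N v" using mult_left_mono[OF w, of c] N[of v] c by linarith
    then have "(c * ?w)\<^sup>2 \<le> (N v)\<^sup>2" using c w0 by (intro power_mono) auto
    then have 1: "?w\<^sup>2 \<le> 1 / c\<^sup>2 * (N v)\<^sup>2" using c by (simp add: power_mult_distrib field_simps)
    have "?w\<^sup>2 * x\<^sup>2 \<le> 1 * x\<^sup>2" using \<open>?w \<le> 1\<close> w0 by (intro mult_right_mono) (auto simp: power_le_one)
    then have "?w\<^sup>2 * (1 + x\<^sup>2) \<le> 1 / c\<^sup>2 * (N v)\<^sup>2 + x\<^sup>2" using 1 by (simp add: distrib_left)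
    also have "\<dots> \<le> K * ((N v)\<^sup>2 + x\<^sup>2)" unfolding K_def by (simp add: distrib_left distrib_right)
    finally have "?w\<^sup>2 * (1 + x\<^sup>2) \<le> K * ((N v)\<^sup>2 + x\<^sup>2)" .
    moreover have "0 < (N v)\<^sup>2 + x\<^sup>2" "0 < 1 + x\<^sup>2" using Npos[of v] by (auto intro!: add_pos_nonneg)
    ultimately show ?thesis by (simp add: divide_le_eq le_divide_eq mult.commute)
  qed
  \<comment> \<open>One \<open>C0\<close> comes from the integral in u of the Schur test, the other
    from averaging in v.\<close>
  define C where "C = C1\<^sup>2 * C0 * K * C0"
  have avg: "(\<integral>\<^sup>+v. ennreal (vweight \<gamma> v / ((N v)\<^sup>2 + (v \<bullet> \<xi>)\<^sup>2)) * (\<integral>\<^sup>+u. ennreal \<bar>k v u\<bar> * g u \<partial>lborel)\<^sup>2 \<partial>lborel)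
      \<le> ennreal (C * (1 + (norm \<xi>)\<^sup>2) powr (- \<sigma>)) * (\<integral>\<^sup>+u. ennreal (vweight \<gamma> u) * (g u)\<^sup>2 \<partial>lborel)"
    if [measurable]: "g \<in> borel_measurable borel" for \<xi> g
  proof -
    let ?S = "\<lambda>v u. ennreal (sing \<beta> 8 (v - u))"
    have cs: "(\<integral>\<^sup>+u. ennreal \<bar>k v u\<bar> * g u \<partial>lborel)\<^sup>2 \<le> ennreal (C1\<^sup>2 * (vweight (\<gamma> - 1) v)\<^sup>2 * C0) * (\<integral>\<^sup>+u. ?S v u * (g u)\<^sup>2 \<partial>lborel)" for v
    proof -
      let ?b = "C1 * vweight (\<gamma> - 1) v"
      have b0: "0 \<le> ?b" using C1 vweight_pos[of "\<gamma> - 1" v] by simp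
      let ?r = "\<lambda>u. ennreal (sqrt (sing \<beta> 8 (v - u)))"
      have rr: "(?r u)\<^sup>2 = ?S v u" for u by (simp add: ennreal_power sing_nonneg)
      have "(\<integral>\<^sup>+u. ennreal \<bar>k v u\<bar> * g u \<partial>lborel) \<le> (\<integral>\<^sup>+u. ennreal ?b * (?r u * (?r u * g u)) \<partial>lborel)"
      proof (intro nn_integral_mono)
        fix u
        have "ennreal \<bar>k v u\<bar> * g u \<le> ennreal (?b * sing \<beta> 8 (v - u)) * g u"
          by (intro mult_right_mono ennreal_leI k) auto
        also have "\<dots> = ennreal ?b * (?r u * (?r u * g u))"
          unfolding ennreal_mult[OF b0 sing_nonneg] rr[symmetric] by (simp only: power2_eq_square mult.assoc)
        finally show "ennreal \<bar>k v u\<bar> * g u \<le> ennreal ?b * (?r u * (?r u * g u))" .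
      qed
      also have "\<dots> = ennreal ?b * (\<integral>\<^sup>+u. ?r u * (?r u * g u) \<partial>lborel)"
        by (rule nn_integral_cmult) measurable
      finally have "(\<integral>\<^sup>+u. ennreal \<bar>k v u\<bar> * g u \<partial>lborel)\<^sup>2 \<le> (ennreal ?b * (\<integral>\<^sup>+u. ?r u * (?r u * g u) \<partial>lborel))\<^sup>2"
        by (intro power_mono) auto
      also have "\<dots> = (ennreal ?b)\<^sup>2 * (\<integral>\<^sup>+u. ?r u * (?r u * g u) \<partial>lborel)\<^sup>2" by (rule power_mult_distrib)
      also have "\<dots> \<le> (ennreal ?b)\<^sup>2 * ((\<integral>\<^sup>+u. (?r u)\<^sup>2 \<partial>lborel) * (\<integral>\<^sup>+u. (?r u * g u)\<^sup>2 \<partial>lborel))"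
        by (intro mult_left_mono Cauchy_Schwarz_nn_integral) auto
      also have "\<dots> \<le> (ennreal ?b)\<^sup>2 * (ennreal C0 * (\<integral>\<^sup>+u. ?S v u * (g u)\<^sup>2 \<partial>lborel))"
        unfolding power_mult_distrib rr by (intro mult_left_mono mult_right_mono A) auto
      also have "(ennreal ?b)\<^sup>2 = ennreal (C1\<^sup>2 * (vweight (\<gamma> - 1) v)\<^sup>2)"
        using b0 by (simp add: ennreal_power power_mult_distrib)
      also have "ennreal (C1\<^sup>2 * (vweight (\<gamma> - 1) v)\<^sup>2) * (ennreal C0 * (\<integral>\<^sup>+u. ?S v u * (g u)\<^sup>2 \<partial>lborel))
         = ennreal (C1\<^sup>2 * (vweight (\<gamma> - 1) v)\<^sup>2 * C0) * (\<integral>\<^sup>+u. ?S v u * (g u)\<^sup>2 \<partial>lborel)"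
        using C0(1) by (subst ennreal_mult[of "C1\<^sup>2 * (vweight (\<gamma> - 1) v)\<^sup>2" C0]) (auto simp: mult.assoc)
      finally show ?thesis .
    qed
    have "(\<integral>\<^sup>+v. ennreal (vweight \<gamma> v / ((N v)\<^sup>2 + (v \<bullet> \<xi>)\<^sup>2)) * (\<integral>\<^sup>+u. ennreal \<bar>k v u\<bar> * g u \<partial>lborel)\<^sup>2 \<partial>lborel)
      \<le> (\<integral>\<^sup>+v. \<integral>\<^sup>+u. ennreal (C1\<^sup>2 * C0 * K) * (ennreal (vweight \<gamma> u) * (g u)\<^sup>2 * (ennreal (sing \<beta> 4 (v - u)) * ennreal (1 / (1 + (v \<bullet> \<xi>)\<^sup>2)))) \<partial>lborel \<partial>lborel)"
    proof (intro nn_integral_mono)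
      fix v
      let ?d = "(N v)\<^sup>2 + (v \<bullet> \<xi>)\<^sup>2" and ?w = "vweight (\<gamma> - 1) v"
      have d0: "0 < ?d" using Npos[of v] by (auto intro!: add_pos_nonneg)
      have "ennreal (vweight \<gamma> v / ?d) * (\<integral>\<^sup>+u. ennreal \<bar>k v u\<bar> * g u \<partial>lborel)\<^sup>2
         \<le> ennreal (vweight \<gamma> v / ?d) * (ennreal (C1\<^sup>2 * ?w\<^sup>2 * C0) * (\<integral>\<^sup>+u. ?S v u * (g u)\<^sup>2 \<partial>lborel))"
        by (intro mult_left_mono cs) auto
      also have "\<dots> = ennreal (vweight \<gamma> v / ?d * (C1\<^sup>2 * ?w\<^sup>2 * C0)) * (\<integral>\<^sup>+u. ?S v u * (g u)\<^sup>2 \<partial>lborel)"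
        using d0 C0(1) vweight_pos[of \<gamma> v] by (subst ennreal_mult[of "vweight \<gamma> v / ?d"]) (auto simp: mult.assoc)
      also have "\<dots> = (\<integral>\<^sup>+u. ennreal (vweight \<gamma> v / ?d * (C1\<^sup>2 * ?w\<^sup>2 * C0)) * (?S v u * (g u)\<^sup>2) \<partial>lborel)"
        by (rule nn_integral_cmult[symmetric]) measurable
      also have "\<dots> \<le> (\<integral>\<^sup>+u. ennreal (C1\<^sup>2 * C0 * K) * (ennreal (vweight \<gamma> u) * (g u)\<^sup>2 * (ennreal (sing \<beta> 4 (v - u)) * ennreal (1 / (1 + (v \<bullet> \<xi>)\<^sup>2)))) \<partial>lborel)"
      proof (intro nn_integral_mono)
        fix u
        have "vweight \<gamma> v / ?d * (C1\<^sup>2 * ?w\<^sup>2 * C0) * sing \<beta> 8 (v - u) = (C1\<^sup>2 * C0) * ((?w\<^sup>2 / ?d) * (vweight \<gamma> v * sing \<beta> 8 (v - u)))"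
          by simp
        also have "\<dots> \<le> (C1\<^sup>2 * C0) * ((K / (1 + (v \<bullet> \<xi>)\<^sup>2)) * (vweight \<gamma> u * (1 + norm (v - u)) powr 4 * sing \<beta> 8 (v - u)))"
          using C0(1) K0 vweight_pos[of \<gamma> v] vweight_pos[of \<gamma> u] \<gamma>
          by (intro mult_left_mono mult_mono weight mult_right_mono vweight_le_shift) (auto simp: sing_nonneg intro!: add_nonneg_nonneg divide_nonneg_nonneg)
        also have "vweight \<gamma> u * (1 + norm (v - u)) powr 4 * sing \<beta> 8 (v - u) = vweight \<gamma> u * sing \<beta> 4 (v - u)"
          unfolding sing84[symmetric] by simp
        also have "(C1\<^sup>2 * C0) * ((K / (1 + (v \<bullet> \<xi>)\<^sup>2)) * (vweight \<gamma> u * sing \<beta> 4 (v - u)))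
           = (C1\<^sup>2 * C0 * K) * (vweight \<gamma> u * (sing \<beta> 4 (v - u) * (1 / (1 + (v \<bullet> \<xi>)\<^sup>2))))"
          by simp
        finally have "ennreal (vweight \<gamma> v / ?d * (C1\<^sup>2 * ?w\<^sup>2 * C0) * sing \<beta> 8 (v - u)) \<le> ennreal ((C1\<^sup>2 * C0 * K) * (vweight \<gamma> u * (sing \<beta> 4 (v - u) * (1 / (1 + (v \<bullet> \<xi>)\<^sup>2)))))"
          by (rule ennreal_leI)
        also have "\<dots> = ennreal (C1\<^sup>2 * C0 * K) * (ennreal (vweight \<gamma> u) * (ennreal (sing \<beta> 4 (v - u)) * ennreal (1 / (1 + (v \<bullet> \<xi>)\<^sup>2))))"
          using C0(1) K0 vweight_pos[of \<gamma> u] by (simp only: ennreal_mult sing_nonneg less_imp_le mult_nonneg_nonneg zero_le_power2 zero_le_divide_1_iff add_nonneg_nonneg zero_le_one)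
        finally have "ennreal (vweight \<gamma> v / ?d * (C1\<^sup>2 * ?w\<^sup>2 * C0) * sing \<beta> 8 (v - u)) * (g u)\<^sup>2 \<le> ennreal (C1\<^sup>2 * C0 * K) * (ennreal (vweight \<gamma> u) * (ennreal (sing \<beta> 4 (v - u)) * ennreal (1 / (1 + (v \<bullet> \<xi>)\<^sup>2)))) * (g u)\<^sup>2"
          by (rule mult_right_mono) simp
        moreover have "ennreal (vweight \<gamma> v / ?d * (C1\<^sup>2 * ?w\<^sup>2 * C0) * sing \<beta> 8 (v - u)) = ennreal (vweight \<gamma> v / ?d * (C1\<^sup>2 * ?w\<^sup>2 * C0)) * ?S v u"
          using d0 C0(1) vweight_pos[of \<gamma> v] by (intro ennreal_mult) (auto simp: sing_nonneg)
        ultimately show "ennreal (vweight \<gamma> v / ?d * (C1\<^sup>2 * ?w\<^sup>2 * C0)) * (?S v u * (g u)\<^sup>2)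
          \<le> ennreal (C1\<^sup>2 * C0 * K) * (ennreal (vweight \<gamma> u) * (g u)\<^sup>2 * (ennreal (sing \<beta> 4 (v - u)) * ennreal (1 / (1 + (v \<bullet> \<xi>)\<^sup>2))))"
          by (simp only: mult_ac)
      qed
      finally show "ennreal (vweight \<gamma> v / ?d) * (\<integral>\<^sup>+u. ennreal \<bar>k v u\<bar> * g u \<partial>lborel)\<^sup>2 \<le> \<dots>" .
    qed
    also have "\<dots> = (\<integral>\<^sup>+u. \<integral>\<^sup>+v. ennreal (C1\<^sup>2 * C0 * K) * (ennreal (vweight \<gamma> u) * (g u)\<^sup>2 * (ennreal (sing \<beta> 4 (v - u)) * ennreal (1 / (1 + (v \<bullet> \<xi>)\<^sup>2)))) \<partial>lborel \<partial>lborel)"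
      by (rule lborel_pair.Fubini') measurable
    also have "\<dots> = (\<integral>\<^sup>+u. ennreal (C1\<^sup>2 * C0 * K) * (ennreal (vweight \<gamma> u) * (g u)\<^sup>2 * (\<integral>\<^sup>+v. ennreal (sing \<beta> 4 (v - u)) * ennreal (1 / (1 + (v \<bullet> \<xi>)\<^sup>2)) \<partial>lborel)) \<partial>lborel)"
      by (intro nn_integral_cong) (simp add: nn_integral_cmult)
    also have "\<dots> \<le> (\<integral>\<^sup>+u. ennreal (C1\<^sup>2 * C0 * K) * (ennreal (vweight \<gamma> u) * (g u)\<^sup>2 * ennreal (C0 * (1 + (norm \<xi>)\<^sup>2) powr (- \<sigma>))) \<partial>lborel)"
      by (intro nn_integral_mono mult_left_mono C0) auto
    also have "\<dots> = ennreal (C1\<^sup>2 * C0 * K) * ((\<integral>\<^sup>+u. ennreal (vweight \<gamma> u) * (g u)\<^sup>2 \<partial>lborel) * ennreal (C0 * (1 + (norm \<xi>)\<^sup>2) powr (- \<sigma>)))"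
      by (simp add: nn_integral_cmult nn_integral_multc)
    also have "\<dots> = (ennreal (C1\<^sup>2 * C0 * K) * ennreal (C0 * (1 + (norm \<xi>)\<^sup>2) powr (- \<sigma>))) * (\<integral>\<^sup>+u. ennreal (vweight \<gamma> u) * (g u)\<^sup>2 \<partial>lborel)"
      by (simp only: mult_ac)
    also have "ennreal (C1\<^sup>2 * C0 * K) * ennreal (C0 * (1 + (norm \<xi>)\<^sup>2) powr (- \<sigma>)) = ennreal ((C1\<^sup>2 * C0 * K) * (C0 * (1 + (norm \<xi>)\<^sup>2) powr (- \<sigma>)))"
      using C0(1) K0 by (intro ennreal_mult[symmetric]) auto
    also have "(C1\<^sup>2 * C0 * K) * (C0 * (1 + (norm \<xi>)\<^sup>2) powr (- \<sigma>)) = C * (1 + (norm \<xi>)\<^sup>2) powr (- \<sigma>)"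
      by (simp add: C_def)
    finally show ?thesis .
  qed
  have "averaging_kernel k N \<gamma> \<sigma> C"
    by unfold_locales (use k_borel N_borel Npos avg \<beta> C0(1) K0 in \<open>auto simp: \<sigma> C_def\<close>)
  then show ?thesis ..
qed

subsection \<open>A Borel version of the kernel\<close>

text \<open>A Borel function equal to \<open>b\<close> almost everywhere need not obey the bounds on
  \<open>b\<close>. Clipping restores them at every point, and the exceptional set \<open>M\<close>
  is kept explicit so that it can be pulled back through the angles.\<close>

lemma angular_borel_version:
  fixes b :: "real \<Rightarrow> real"
  assumes b: "b \<in> borel_measurable (lebesgue_on {0<..<1})"
    and pos: "\<And>c. 0 < c \<Longrightarrow> c < 1 \<Longrightarrow> 0 < b c \<and> b c \<le> Cb * c"
  obtains b' M where "b' \<in> borel_measurable borel" "\<And>c. 0 \<le> b' c" "\<And>c. b' c \<le> \<bar>Cb\<bar> * \<bar>c\<bar>"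
    "negligible M" "M \<subseteq> {0<..<1}" "\<And>c. 0 < c \<Longrightarrow> c < 1 \<Longrightarrow> c \<notin> M \<Longrightarrow> b' c = b c"
proof -
  define b0 where "b0 c = (if c \<in> {0<..<1} then b c else 0)" for c
  have "b0 \<in> borel_measurable lebesgue"
    unfolding b0_def[abs_def] using b by (subst borel_measurable_if) auto
  then obtain g where g: "g \<in> borel_measurable lborel" and eq: "AE c in lborel. b0 c = g c"
    using completion_ex_borel_measurable_real by blast
  have [measurable]: "g \<in> borel_measurable borel" using g by simp
  define M where "M = {c \<in> {0<..<1}. b0 c \<noteq> g c}"
  have "AE c in lebesgue. b0 c = g c" unfolding AE_lebesgue_iff by (rule eq)
  then have "{c. b0 c \<noteq> g c} \<in> null_sets lebesgue"
    by (simp add: eventually_ae_filter) (metis (mono_tags, lifting) null_sets_completion_subset)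
  then have "negligible {c. b0 c \<noteq> g c}" by (simp add: negligible_iff_null_sets)
  then have M: "negligible M" by (rule negligible_subset) (auto simp: M_def)
  \<comment> \<open>Clipping changes nothing where \<open>g\<close> agrees with \<open>b\<close>,
    since there 0 < b c <= Cb c already.\<close>
  define b' where "b' c = (if c \<in> {0<..<1} then max 0 (min (g c) (Cb * c)) else 0)" for c
  show ?thesis
  proof (rule that[of b' M])
    show "b' \<in> borel_measurable borel" unfolding b'_def[abs_def] by measurable
    show "0 \<le> b' c" for c by (simp add: b'_def)
    show "b' c \<le> \<bar>Cb\<bar> * \<bar>c\<bar>" for c
      using abs_ge_self[of "Cb * c"] by (auto simp: b'_def abs_mult[symmetric])
    show "b' c = b c" if "0 < c" "c < 1" "c \<notin> M" for c
      using that pos[of c] by (auto simp: b'_def M_def b0_def)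
  qed (use M in \<open>auto simp: M_def\<close>)
qed

section \<open>Preimages of null sets of angles in the plane\<close>

lemma negligible_first_coordinate:
  fixes M :: "real set"
  assumes "negligible M"
  shows "negligible {w::real^2. w $ 1 \<in> M}"
proof -
  have "M \<in> null_sets lebesgue" using assms by (simp add: negligible_iff_null_sets)
  then obtain M' where M': "M' \<in> null_sets lborel" "M \<subseteq> M'"
    by (auto simp: null_sets_completion_iff2)
  have [measurable]: "M' \<in> sets borel" using M' by auto
  let ?e = "axis 1 1 :: real^2"
  have eB: "?e \<in> Basis" by (auto simp: axis_in_Basis_iff)
  have nth: "w $ 1 = w \<bullet> ?e" for w :: "real^2" by (simp add: inner_axis)
  have "emeasure lborel {w::real^2. w $ 1 \<in> M'} = (\<integral>\<^sup>+w. indicator {w. w $ 1 \<in> M'} (w::real^2) \<partial>lborel)"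
    by (subst nn_integral_indicator) (auto simp: nth)
  also have "\<dots> = (\<integral>\<^sup>+w. (\<Prod>i\<in>Basis. (if i = ?e then indicator M' (w \<bullet> i) else 1)) \<partial>lborel)"
    by (intro nn_integral_cong) (use eB in \<open>auto simp: nth prod.delta split: split_indicator\<close>)
  also have "\<dots> = (\<Prod>i\<in>(Basis :: (real^2) set). (\<integral>\<^sup>+t. (if i = ?e then indicator M' t else 1) \<partial>lborel))"
    by (rule nn_integral_lborel_prod) auto
  also have "\<dots> = 0"
    using eB null_setsD1[OF M'(1)] by (intro prod_zero bexI[of _ ?e]) auto
  finally have e0: "emeasure lborel {w::real^2. w $ 1 \<in> M'} = 0" .
  have "{w::real^2. w \<bullet> ?e \<in> M'} \<in> sets borel" by measurable
  then have "{w::real^2. w $ 1 \<in> M'} \<in> null_sets lborel"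
    using e0 by (auto simp: null_sets_def nth)
  then have "negligible {w::real^2. w $ 1 \<in> M'}"
    by (simp add: negligible_iff_null_sets null_sets_completionI)
  then show ?thesis by (rule negligible_subset) (use M'(2) in auto)
qed

text \<open>Polar coordinates as a differentiable map between planes: they map null sets to null sets.\<close>

lemma negligible_norm_vimage:
  fixes M :: "real set"
  assumes "negligible M"
  shows "negligible {y::real^2. norm y \<in> M}"
proof -
  define P :: "real^2 \<Rightarrow> real^2" where
    "P w = ((w \<bullet> axis 1 1) * cos (w \<bullet> axis 2 1)) *\<^sub>R axis 1 1 + ((w \<bullet> axis 1 1) * sin (w \<bullet> axis 2 1)) *\<^sub>R axis 2 1" for w
  have "P differentiable_on {w. w $ 1 \<in> M}"
    unfolding differentiable_on_def differentiable_def P_def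
    by (intro ballI exI) (rule derivative_eq_intros refl)+
  then have "negligible (P ` {w. w $ 1 \<in> M})"
    by (intro negligible_differentiable_image_negligible negligible_first_coordinate assms) auto
  moreover have "{y::real^2. norm y \<in> M} \<subseteq> P ` {w. w $ 1 \<in> M}"
  proof
    fix y :: "real^2" assume y: "y \<in> {y. norm y \<in> M}"
    have n: "(norm y)\<^sup>2 = (y $ 1)\<^sup>2 + (y $ 2)\<^sup>2"
      unfolding power2_norm_eq_inner by (simp add: inner_vec_def sum_2 power2_eq_square)
    obtain t where t: "y $ 1 = norm y * cos t" "y $ 2 = norm y * sin t"
    proof (cases "y = 0")
      case False
      then have "(y $ 1 / norm y)\<^sup>2 + (y $ 2 / norm y)\<^sup>2 = 1"
        by (simp add: power_divide add_divide_distrib[symmetric] n[symmetric])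
      then obtain t where "y $ 1 / norm y = cos t" "y $ 2 / norm y = sin t"
        using sincos_total_2pi by metis
      then show ?thesis using False by (intro that[of t]) (auto simp: field_simps)
    qed (use that in auto)
    define w where "w = (norm y) *\<^sub>R axis 1 1 + t *\<^sub>R (axis 2 1 :: real^2)"
    have "w $ 1 = norm y" "w $ 2 = t" by (simp_all add: w_def axis_def)
    moreover have "P w = y"
    proof -
      have "w \<bullet> axis 1 1 = norm y" "w \<bullet> axis 2 1 = t"
        using \<open>w $ 1 = norm y\<close> \<open>w $ 2 = t\<close> by (simp_all add: inner_axis)
      then show ?thesis using t by (simp add: P_def vec_eq_iff forall_2 axis_def)
    qed
    ultimately show "y \<in> P ` {w. w $ 1 \<in> M}" using y by (intro image_eqI[of _ _ w]) auto
  qed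
  ultimately show ?thesis by (rule negligible_subset)
qed

lemma one_minus_sq_quotient:
  fixes R x y :: real
  assumes "0 < R" "R\<^sup>2 = x\<^sup>2 + y\<^sup>2"
  shows "1 - (x / R)\<^sup>2 = (y / R)\<^sup>2"
proof -
  have "1 - (x / R)\<^sup>2 = (R\<^sup>2 - x\<^sup>2) / R\<^sup>2" using assms(1) by (simp add: power_divide diff_divide_distrib)
  also have "\<dots> = (y / R)\<^sup>2" using assms(2) by (simp add: power_divide)
  finally show ?thesis .
qed

text \<open>For fixed \<open>a\<close> the radius is a differentiable function of the cosine (the
  map \<open>f\<close>) and of the sine (the map \<open>g\<close>) on the open unit interval. Such
  maps preserve null sets, so a null set of angle values corresponds to a null set of radii and
  hence of points.\<close>

lemma negligible_angle_vimage:
  fixes M :: "real set"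
  assumes M: "negligible M" "M \<subseteq> {0<..<1}" and a: "a > 0"
  shows "negligible {y::real^2. a * (a\<^sup>2 + (norm y)\<^sup>2) powr (-1/2) \<in> M}" (is "negligible ?A")
    and "negligible {y::real^2. norm y * (a\<^sup>2 + (norm y)\<^sup>2) powr (-1/2) \<in> M}" (is "negligible ?B")
proof -
  have p: "(a\<^sup>2 + x\<^sup>2) powr (-1/2) = 1 / sqrt (a\<^sup>2 + x\<^sup>2)" for x
    using a by (simp add: powr_minus_divide powr_half_sqrt)
  have s0: "0 < a\<^sup>2 + x\<^sup>2" for x using a by (simp add: add_pos_nonneg)
  define f where "f c = a * (sqrt (1 - c\<^sup>2) / c)" for c
  define g where "g c = a * (c / sqrt (1 - c\<^sup>2))" for c
  have pos: "0 < 1 - c\<^sup>2" if "c \<in> M" for c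
    using M(2) that by (auto simp: power_less_one_iff abs_square_less_1)
  have "f differentiable_on M"
    unfolding differentiable_on_def f_def
  proof
    fix c assume c: "c \<in> M"
    have "((\<lambda>c. a * (sqrt (1 - c\<^sup>2) / c)) has_field_derivative (a * (((inverse (sqrt (1 - c\<^sup>2)) / 2) * (- (2 * c)) * c - sqrt (1 - c\<^sup>2) * 1) / (c * c)))) (at c within M)"
      using pos[OF c] M(2) c by (auto intro!: derivative_eq_intros simp: algebra_simps)
    then show "(\<lambda>c. a * (sqrt (1 - c\<^sup>2) / c)) differentiable at c within M"
      using field_differentiable_def field_differentiable_imp_differentiable by blast
  qed
  then have nf: "negligible (f ` M)" by (intro negligible_differentiable_image_negligible M) auto
  have "g differentiable_on M"
    unfolding differentiable_on_def g_def
  proof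
    fix c assume c: "c \<in> M"
    have "((\<lambda>c. a * (c / sqrt (1 - c\<^sup>2))) has_field_derivative (a * ((1 * sqrt (1 - c\<^sup>2) - c * ((inverse (sqrt (1 - c\<^sup>2)) / 2) * (- (2 * c)))) / (sqrt (1 - c\<^sup>2) * sqrt (1 - c\<^sup>2))))) (at c within M)"
      using pos[OF c] M(2) c by (auto intro!: derivative_eq_intros simp: algebra_simps)
    then show "(\<lambda>c. a * (c / sqrt (1 - c\<^sup>2))) differentiable at c within M"
      using field_differentiable_def field_differentiable_imp_differentiable by blast
  qed
  then have ng: "negligible (g ` M)" by (intro negligible_differentiable_image_negligible M) auto
  have "?A \<subseteq> {y. norm y \<in> f ` M}"
  proof
    fix y :: "real^2" assume y: "y \<in> ?A"
    let ?r = "sqrt (a\<^sup>2 + (norm y)\<^sup>2)"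
    have r: "0 < ?r" "?r\<^sup>2 = a\<^sup>2 + (norm y)\<^sup>2" using s0[of "norm y"] by simp_all
    define c where "c = a / ?r"
    have cM: "c \<in> M" using y unfolding mem_Collect_eq p c_def by simp
    have "1 - c\<^sup>2 = (norm y / ?r)\<^sup>2"
      unfolding c_def by (rule one_minus_sq_quotient[OF r])
    then have "sqrt (1 - c\<^sup>2) = norm y / ?r" using r by simp
    then have "f c = norm y" using r a by (simp add: f_def c_def)
    then show "y \<in> {y. norm y \<in> f ` M}" using cM by (auto intro!: image_eqI[of _ f c])
  qed
  then show "negligible ?A" using negligible_norm_vimage[OF nf] negligible_subset by blast
  have "?B \<subseteq> {y. norm y \<in> g ` M}"
  proof
    fix y :: "real^2" assume y: "y \<in> ?B"
    let ?r = "sqrt (a\<^sup>2 + (norm y)\<^sup>2)"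
    have r: "0 < ?r" "?r\<^sup>2 = a\<^sup>2 + (norm y)\<^sup>2" using s0[of "norm y"] by simp_all
    define c where "c = norm y / ?r"
    have cM: "c \<in> M" using y unfolding mem_Collect_eq p c_def by simp
    have "1 - c\<^sup>2 = (a / ?r)\<^sup>2"
      unfolding c_def by (rule one_minus_sq_quotient) (use r in auto)
    then have "sqrt (1 - c\<^sup>2) = a / ?r" using r a by simp
    then have "g c = norm y" using r a by (simp add: g_def c_def)
    then show "y \<in> {y. norm y \<in> g ` M}" using cM by (auto intro!: image_eqI[of _ g c])
  qed
  then show "negligible ?B" using negligible_norm_vimage[OF ng] negligible_subset by blast
qed

text \<open>\<open>plane_isometry\<close> is chosen without any regularity in the normal vector. It is replaced by
  an explicit frame that depends measurably on it.\<close>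

definition frame_a :: "r3 \<Rightarrow> r3" where
  "frame_a n = sgn (if n \<bullet> axis 1 1 = 0 \<and> n \<bullet> axis 2 1 = 0 then axis 1 1
     else (- (n \<bullet> axis 2 1)) *\<^sub>R axis 1 1 + (n \<bullet> axis 1 1) *\<^sub>R axis 2 1)"

definition frame_b :: "r3 \<Rightarrow> r3" where
  "frame_b n = sgn (cross3 n (frame_a n))"

definition frame :: "r3 \<Rightarrow> real^2 \<Rightarrow> r3" where
  "frame n y = (y $ 1) *\<^sub>R frame_a n + (y $ 2) *\<^sub>R frame_b n"

text \<open>A quarter turn of the horizontal part of \<open>n\<close> is orthogonal to
  \<open>n\<close>; for vertical \<open>n\<close> the first axis serves. The cross product supplies
  the third direction.\<close>

lemma frame_orthonormal:
  assumes n: "n \<noteq> 0"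
  shows "norm (frame_a n) = 1" "norm (frame_b n) = 1" "frame_a n \<bullet> frame_b n = 0" "frame_a n \<bullet> n = 0" "frame_b n \<bullet> n = 0"
proof -
  let ?w = "if n \<bullet> axis 1 1 = 0 \<and> n \<bullet> axis 2 1 = 0 then axis 1 1
     else (- (n \<bullet> axis 2 1)) *\<^sub>R axis 1 1 + (n \<bullet> axis 1 1) *\<^sub>R axis 2 1 :: r3"
  have "?w \<noteq> 0"
  proof (cases "n \<bullet> axis 1 1 = 0 \<and> n \<bullet> axis 2 1 = 0")
    case False
    let ?x = "(- (n \<bullet> axis 2 1)) *\<^sub>R axis 1 1 + (n \<bullet> axis 1 1) *\<^sub>R axis 2 1 :: r3"
    have "?x $ 1 = - (n \<bullet> axis 2 1)" "?x $ 2 = n \<bullet> axis 1 1" by (simp_all add: axis_def)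
    then have "?x \<noteq> 0" using False by (metis neg_equal_0_iff_equal zero_index)
    then show ?thesis using False by simp
  qed (simp add: axis_eq_0_iff)
  then show a1: "norm (frame_a n) = 1" by (simp add: frame_a_def norm_sgn)
  have "?w \<bullet> n = 0"
    by (auto simp: inner_add_left inner_diff_left inner_axis inner_axis')
  then show an: "frame_a n \<bullet> n = 0" by (simp add: frame_a_def sgn_div_norm)
  have "(norm (cross3 n (frame_a n)))\<^sup>2 = (norm n)\<^sup>2 * (norm (frame_a n))\<^sup>2 - (n \<bullet> frame_a n)\<^sup>2"
    by (rule norm_cross)
  then have "(norm (cross3 n (frame_a n)))\<^sup>2 = (norm n)\<^sup>2"
    using an by (simp add: a1 inner_commute)
  then have "cross3 n (frame_a n) \<noteq> 0" using n by auto
  then show "norm (frame_b n) = 1" by (simp add: frame_b_def norm_sgn)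
  show "frame_a n \<bullet> frame_b n = 0" "frame_b n \<bullet> n = 0"
    by (simp_all add: frame_b_def sgn_div_norm dot_cross_self inner_commute)
qed

lemma frame_isometry:
  assumes n: "n \<noteq> 0"
  shows "linear (frame n)" "norm (frame n y) = norm y" "range (frame n) = {w. w \<bullet> n = 0}"
    "w \<bullet> n = 0 \<Longrightarrow> frame n (\<chi> i. if i = 1 then w \<bullet> frame_a n else w \<bullet> frame_b n) = w"
proof -
  note f = frame_orthonormal[OF n]
  have ff: "frame_a n \<bullet> frame_a n = 1" "frame_b n \<bullet> frame_b n = 1"
    using f(1,2) by (simp_all add: norm_eq_1)
  show "linear (frame n)"
    by (rule linearI) (simp_all add: frame_def algebra_simps)
  have "(norm (frame n y))\<^sup>2 = (norm y)\<^sup>2"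
    using ff f(3) by (simp add: power2_norm_eq_inner frame_def inner_add_left inner_add_right inner_vec_def[of y y] sum_2 inner_commute[of "frame_b n" "frame_a n"])
  then show "norm (frame n y) = norm y" by simp
  have rep: "frame n (\<chi> i. if i = 1 then w \<bullet> frame_a n else w \<bullet> frame_b n) = w" if w: "w \<bullet> n = 0" for w
  proof -
    \<comment> \<open>The residual of the expansion in the frame. It is orthogonal to three
      independent vectors, which span the space, so it vanishes.\<close>
    let ?d = "w - ((w \<bullet> frame_a n) *\<^sub>R frame_a n + (w \<bullet> frame_b n) *\<^sub>R frame_b n)"
    let ?B = "{frame_a n, frame_b n, n}"
    have d: "?d \<bullet> x = 0" if "x \<in> ?B" for x
      using that ff f w by (auto simp: inner_diff_left inner_add_left inner_commute[of "frame_b n" "frame_a n"])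
    have ne: "frame_a n \<noteq> frame_b n" "frame_a n \<noteq> n" "frame_b n \<noteq> n"
      using ff f n by auto
    have "pairwise orthogonal ?B"
      using f by (auto simp: pairwise_def orthogonal_def inner_commute)
    then have "independent ?B"
      using ff n by (intro pairwise_orthogonal_independent) auto
    moreover have "card ?B = DIM(r3)" using ne by simp
    ultimately have "span ?B = UNIV"
      using card_ge_dim_independent[of ?B UNIV] by auto
    then have "?d \<in> span ?B" by simp
    then have "orthogonal ?d ?d"
      by (rule orthogonal_to_span) (use d in \<open>auto simp: orthogonal_def\<close>)
    then have "?d = 0" by (simp add: orthogonal_self)
    then show ?thesis by (simp add: frame_def)
  qed
  then show "w \<bullet> n = 0 \<Longrightarrow> frame n (\<chi> i. if i = 1 then w \<bullet> frame_a n else w \<bullet> frame_b n) = w" .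
  show "range (frame n) = {w. w \<bullet> n = 0}"
  proof
    show "range (frame n) \<subseteq> {w. w \<bullet> n = 0}" using f by (auto simp: frame_def inner_add_left)
    show "{w. w \<bullet> n = 0} \<subseteq> range (frame n)" 
    proof
      fix w assume "w \<in> {w. w \<bullet> n = 0}"
      then have "frame n (\<chi> i. if i = 1 then w \<bullet> frame_a n else w \<bullet> frame_b n) = w" by (intro rep) simp
      then show "w \<in> range (frame n)" by (rule range_eqI[OF sym])
    qed
  qed
qed

lemma plane_isometry_props:
  assumes n: "n \<noteq> 0"
  shows "linear (plane_isometry n)" "norm (plane_isometry n y) = norm y" "range (plane_isometry n) = {w. w \<bullet> n = 0}"
proof -
  let ?P = "\<lambda>L :: real^2 \<Rightarrow> r3. linear L \<and> (\<forall>y. norm (L y) = norm y) \<and> range L = {w. w \<bullet> n = 0}"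
  have "?P (frame n)"
    using frame_isometry[OF n] by blast
  then have "linear (plane_isometry n) \<and> (\<forall>y. norm (plane_isometry n y) = norm y) \<and> range (plane_isometry n) = {w. w \<bullet> n = 0}"
    unfolding plane_isometry_def by (rule someI[where P="?P"])
  then show "linear (plane_isometry n)" "norm (plane_isometry n y) = norm y" "range (plane_isometry n) = {w. w \<bullet> n = 0}"
    by blast+
qed

text \<open>Two isometries onto the same plane differ by an orthogonal map \<open>Q\<close> of the
  Euclidean plane, which preserves Lebesgue measure. The integrand \<open>f\<close> enters only
  through its almost everywhere agreement with the Borel function \<open>g\<close>.\<close>

lemma plane_integral_frame:
  fixes f g :: "r3 \<Rightarrow> real"
  assumes n: "n \<noteq> 0" and g [measurable]: "g \<in> borel_measurable borel"
    and eq: "AE y in lborel. f (plane_isometry n y) = g (plane_isometry n y)"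
  shows "plane_integral n f = (LINT y|lborel. g (frame n y))"
proof -
  let ?L = "plane_isometry n"
  note L = plane_isometry_props[OF n]
  define Q :: "real^2 \<Rightarrow> real^2" where "Q y = (\<chi> i. if i = 1 then ?L y \<bullet> frame_a n else ?L y \<bullet> frame_b n)" for y
  have FQ: "frame n (Q y) = ?L y" for y
    unfolding Q_def by (rule frame_isometry(4)[OF n]) (use L(3) in auto)
  have "linear Q"
  proof (rule linearI)
    show "Q (x + y) = Q x + Q y" for x y
      by (simp add: Q_def vec_eq_iff linear_add[OF L(1)] inner_add_left)
    show "Q (c *\<^sub>R x) = c *\<^sub>R Q x" for c x
      by (simp add: Q_def vec_eq_iff linear_cmul[OF L(1)])
  qed
  moreover have "norm (Q y) = norm y" for y
    using frame_isometry(2)[OF n, of "Q y"] L(2)[of y] by (simp add: FQ)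
  ultimately have Q: "orthogonal_transformation Q" by (simp add: orthogonal_transformation)
  have [measurable]: "?L \<in> borel_measurable borel" "frame n \<in> borel_measurable borel" "Q \<in> borel_measurable borel"
    using L(1) frame_isometry(1)[OF n] \<open>linear Q\<close>
    by (auto intro!: borel_measurable_continuous_onI linear_continuous_on simp: linear_conv_bounded_linear)
  have gm: "(\<lambda>y. g (?L y)) \<in> borel_measurable lebesgue" by (rule borel_imp_lebesgue) measurable
  have eq': "AE y in lebesgue. g (?L y) = f (?L y)"
    unfolding AE_lebesgue_iff using eq by (auto elim: eventually_mono)
  have "plane_integral n f = (LINT y|lebesgue. g (?L y))"
    unfolding plane_integral_def
    using eq' by (intro integral_cong_AE borel_measurable_AE[OF gm eq'] gm) (auto elim: eventually_mono)
  also have "\<dots> = (LINT y|lborel. g (?L y))" by (rule integral_completion) simp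
  also have "\<dots> = (LINT y|lborel. g (frame n (Q y)))" by (simp add: FQ)
  also have "\<dots> = (LINT y|distr lborel borel Q. g (frame n y))" by (subst integral_distr) auto
  finally show ?thesis by (simp add: lborel_distr_orthogonal[OF Q])
qed

lemma negligible_AE_notin:
  assumes "negligible A"
  shows "AE y in lborel. y \<notin> A"
  using assms unfolding AE_lebesgue_iff[symmetric] by (simp add: AE_not_in negligible_iff_null_sets)

subsection \<open>Bounds for the kernel and the collision frequency\<close>

lemma V1_inner: "v \<noteq> u \<Longrightarrow> V1 v u \<bullet> (v - u) = ((norm v)\<^sup>2 - (norm u)\<^sup>2) / 2"
  by (simp add: V1_def power2_norm_eq_inner)

lemma V2_inner: "V2 v u \<bullet> (v - u) = 0"
proof -
  have "(((v - u) \<bullet> v) *\<^sub>R u - ((v - u) \<bullet> u) *\<^sub>R v) \<bullet> (v - u) = 0"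
    by (simp add: inner_diff_left inner_diff_right inner_commute algebra_simps)
  then show ?thesis unfolding V2_def inner_scaleR_left by simp
qed

text \<open>Together with \<open>V2_inner\<close> this gives the geometry: \<open>V1\<close> and
  \<open>V2\<close> are the components of the midpoint of v and u parallel and orthogonal to v -
  u.\<close>

lemma V1_plus_V2:
  assumes "v \<noteq> u"
  shows "V1 v u + V2 v u = (1/2) *\<^sub>R (v + u)"
proof -
  let ?z = "v - u" and ?a = "(v - u) \<bullet> v" and ?c = "(v - u) \<bullet> u"
  have z: "(norm ?z)\<^sup>2 = ?a - ?c" "(norm v)\<^sup>2 - (norm u)\<^sup>2 = ?a + ?c"
    by (simp_all add: power2_norm_eq_inner inner_diff_left inner_diff_right inner_commute)
  have nz: "(norm ?z)\<^sup>2 \<noteq> 0" using assms by simp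
  have "(norm ?z)\<^sup>2 *\<^sub>R (V1 v u + V2 v u) = (1/2 * (?a + ?c)) *\<^sub>R ?z + (?a *\<^sub>R u - ?c *\<^sub>R v)"
    using nz by (simp add: V1_def V2_def scaleR_add_right z(2))
  also have "\<dots> = (1/2 * (?a - ?c)) *\<^sub>R (v + u)"
    by (simp add: vec_eq_iff algebra_simps)
  also have "\<dots> = (norm ?z)\<^sup>2 *\<^sub>R ((1/2) *\<^sub>R (v + u))" by (simp add: z(1) mult.commute)
  finally show ?thesis using nz by (simp only: scaleR_cancel_left) simp
qed

text \<open>From 1 + x <= exp x the exponent is at most q x - \<delta> x^2, whose maximum is q^2 /
  (4 \<delta>).\<close>

lemma gauss_poly_bound:
  fixes q \<delta> x :: real
  assumes "0 \<le> q" "0 < \<delta>" "0 \<le> x"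
  shows "(1 + x) powr q * exp (- \<delta> * x\<^sup>2) \<le> exp (q\<^sup>2 / (4 * \<delta>))"
proof -
  have "1 + x \<le> exp x" by (rule exp_ge_add_one_self)
  then have "(1 + x) powr q \<le> (exp x) powr q" using assms by (intro powr_mono2) auto
  also have "\<dots> = exp (q * x)" by (simp add: powr_def)
  finally have "(1 + x) powr q * exp (- \<delta> * x\<^sup>2) \<le> exp (q * x) * exp (- \<delta> * x\<^sup>2)"
    by (intro mult_right_mono) auto
  also have "\<dots> = exp (q * x - \<delta> * x\<^sup>2)" by (simp add: exp_add[symmetric])
  also have "q * x - \<delta> * x\<^sup>2 \<le> q\<^sup>2 / (4 * \<delta>)"
  proof -
    have "0 \<le> (q - 2 * \<delta> * x)\<^sup>2" by simp
    then have "4 * \<delta> * (q * x - \<delta> * x\<^sup>2) \<le> q\<^sup>2" by (simp add: power2_eq_square algebra_simps)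
    then show ?thesis using assms by (simp add: pos_le_divide_eq mult.commute)
  qed
  finally show ?thesis by simp
qed

lemma borel_measurable_cross3 [measurable (raw)]:
  assumes [measurable]: "f \<in> borel_measurable M" "g \<in> borel_measurable M"
  shows "(\<lambda>x. cross3 (f x) (g x)) \<in> borel_measurable M"
  by (rule borel_measurable_continuous_Pair[OF assms]) (intro continuous_on_cross continuous_intros)

lemma borel_measurable_frame [measurable (raw)]:
  assumes [measurable]: "f \<in> borel_measurable M" "g \<in> borel_measurable M"
  shows "(\<lambda>x. frame (f x) (g x)) \<in> borel_measurable M"
proof -
  have a [measurable (raw)]: "(\<lambda>x. frame_a (f x)) \<in> borel_measurable M"
    unfolding frame_a_def sgn_div_norm by measurable
  have [measurable (raw)]: "(\<lambda>x. frame_b (f x)) \<in> borel_measurable M"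
    unfolding frame_b_def sgn_div_norm by measurable
  have e: "frame (f x) (g x) = (g x \<bullet> axis 1 1) *\<^sub>R frame_a (f x) + (g x \<bullet> axis 2 1) *\<^sub>R frame_b (f x)" for x
    by (simp add: frame_def inner_axis)
  show ?thesis unfolding e by measurable
qed

definition k2_integrand :: "(real \<Rightarrow> real) \<Rightarrow> real \<Rightarrow> r3 \<Rightarrow> r3 \<Rightarrow> r3 \<Rightarrow> real" where
  "k2_integrand b \<gamma> v u w = exp (- (norm (w + V2 v u))\<^sup>2) *
       (((norm (v - u))\<^sup>2 + (norm w)\<^sup>2) powr (\<gamma>/2) / (norm w * norm (v - u))) *
       (b (cos_theta (v - u) w) * norm w + b (sin_theta (v - u) w) * norm (v - u))"

text \<open>The kernel \<open>k2\<close> with the chosen isometry replaced by the measurable frame,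
  and with integration over \<open>lborel\<close>; for Borel \<open>b\<close> it is jointly Borel in
  v and u.\<close>

definition k2_borel :: "(real \<Rightarrow> real) \<Rightarrow> real \<Rightarrow> r3 \<Rightarrow> r3 \<Rightarrow> real" where
  "k2_borel b \<gamma> v u =
     pi powr (-3/2) / norm (v - u) * exp (- (1/4) * (norm (v - u))\<^sup>2 - (norm (V1 v u))\<^sup>2) *
     (LINT y|lborel. k2_integrand b \<gamma> v u (frame (v - u) y))"

lemma k2_integrand_measurable [measurable (raw)]:
  assumes [measurable]: "b \<in> borel_measurable borel" "f \<in> borel_measurable M" "g \<in> borel_measurable M" "h \<in> borel_measurable M"
  shows "(\<lambda>x. k2_integrand b \<gamma> (f x) (g x) (h x)) \<in> borel_measurable M"
  unfolding k2_integrand_def V2_def cos_theta_def sin_theta_def by measurable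

lemma k2_borel_measurable [measurable (raw)]:
  assumes [measurable]: "b \<in> borel_measurable borel" "f \<in> borel_measurable M" "g \<in> borel_measurable M"
  shows "(\<lambda>x. k2_borel b \<gamma> (f x) (g x)) \<in> borel_measurable M"
  unfolding k2_borel_def V1_def by measurable

section \<open>Pointwise bounds for the two parts of the kernel\<close>

lemma hypot_pos: "z \<noteq> 0 \<Longrightarrow> 0 < (norm (z::r3))\<^sup>2 + (norm (w::r3))\<^sup>2"
  by (simp add: add_pos_nonneg)

lemma angle_hypot:
  fixes z w :: r3
  assumes "z \<noteq> 0"
  shows "cos_theta z w = norm z / sqrt ((norm z)\<^sup>2 + (norm w)\<^sup>2)" "sin_theta z w = norm w / sqrt ((norm z)\<^sup>2 + (norm w)\<^sup>2)"
  using hypot_pos[OF assms, of w] by (simp_all add: cos_theta_def sin_theta_def powr_minus_divide powr_half_sqrt)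

lemma angle_range:
  fixes z w :: r3
  assumes "z \<noteq> 0" "w \<noteq> 0"
  shows "0 < cos_theta z w" "cos_theta z w < 1" "0 < sin_theta z w" "sin_theta z w < 1"
proof -
  have p: "0 < sqrt ((norm z)\<^sup>2 + (norm w)\<^sup>2)" using hypot_pos[OF assms(1), of w] by simp
  have "norm z < sqrt ((norm z)\<^sup>2 + (norm w)\<^sup>2)" "norm w < sqrt ((norm z)\<^sup>2 + (norm w)\<^sup>2)"
    using assms by (auto intro!: real_less_rsqrt)
  then show "0 < cos_theta z w" "cos_theta z w < 1" "0 < sin_theta z w" "sin_theta z w < 1"
    using p assms by (simp_all add: angle_hypot)
qed

text \<open>For w different from 0 both angle values lie in the open unit interval, and for almost
  every w in the plane they avoid \<open>M\<close>. The identity thus holds for every pair off the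
  diagonal, with no exceptional set of velocities.\<close>

lemma k2_eq_borel:
  assumes b': "b' \<in> borel_measurable borel" and M: "negligible M" "M \<subseteq> {0<..<1}"
    and eq: "\<And>c. 0 < c \<Longrightarrow> c < 1 \<Longrightarrow> c \<notin> M \<Longrightarrow> b' c = b c" and vu: "v \<noteq> u"
  shows "k2 b \<gamma> v u = k2_borel b' \<gamma> v u"
proof -
  let ?z = "v - u"
  have z: "?z \<noteq> 0" using vu by simp
  note L = plane_isometry_props[OF z]
  have nz: "norm ?z > 0" using z by simp
  have "plane_integral ?z (k2_integrand b \<gamma> v u) = (LINT y|lborel. k2_integrand b' \<gamma> v u (frame ?z y))"
  proof (rule plane_integral_frame[OF z])
    show "k2_integrand b' \<gamma> v u \<in> borel_measurable borel" using b' by measurable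
    have "AE y::real^2 in lborel. y \<noteq> 0" by (rule AE_lborel_singleton)
    then show "AE y in lborel. k2_integrand b \<gamma> v u (plane_isometry ?z y) = k2_integrand b' \<gamma> v u (plane_isometry ?z y)"
      using negligible_AE_notin[OF negligible_angle_vimage(1)[OF M nz]] negligible_AE_notin[OF negligible_angle_vimage(2)[OF M nz]]
    proof eventually_elim
      case (elim y)
      let ?w = "plane_isometry ?z y"
      have w: "?w \<noteq> 0" using elim(1) L(2)[of y] by auto
      have "cos_theta ?z ?w \<notin> M" "sin_theta ?z ?w \<notin> M"
        using elim(2,3) by (simp_all add: cos_theta_def sin_theta_def L(2))
      then have "b' (cos_theta ?z ?w) = b (cos_theta ?z ?w)" "b' (sin_theta ?z ?w) = b (sin_theta ?z ?w)"
        using angle_range[OF z w] by (auto intro: eq)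
      then show ?case by (simp add: k2_integrand_def)
    qed
  qed
  then show ?thesis unfolding k2_def k2_borel_def k2_integrand_def[abs_def] by simp
qed

text \<open>The linear bound on \<open>b\<close> gives each of the two summands at most Cb |z| |w| /
  m, with z = v - u. This cancels the product |w| |z| in the denominator and leaves only the power
  \<gamma> - 1 of the hypotenuse m.\<close>

lemma k2_integrand_bounds:
  fixes v u w :: r3
  assumes b: "\<And>c. 0 \<le> b c" "\<And>c. b c \<le> Cb * \<bar>c\<bar>" and vu: "v \<noteq> u"
  defines "m \<equiv> sqrt ((norm (v - u))\<^sup>2 + (norm w)\<^sup>2)"
  shows "0 \<le> k2_integrand b \<gamma> v u w"
    and "k2_integrand b \<gamma> v u w \<le> 2 * Cb * (exp (- (norm (w + V2 v u))\<^sup>2) * m powr (\<gamma> - 1))"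
proof -
  let ?z = "v - u"
  have z: "?z \<noteq> 0" using vu by simp
  have m: "0 < m" using hypot_pos[OF z, of w] by (simp add: m_def)
  have Cb: "0 \<le> Cb" using order_trans[OF b(1) b(2)[of 1]] by simp
  show "0 \<le> k2_integrand b \<gamma> v u w"
    unfolding k2_integrand_def using b(1) by (intro mult_nonneg_nonneg add_nonneg_nonneg divide_nonneg_nonneg) auto
  show "k2_integrand b \<gamma> v u w \<le> 2 * Cb * (exp (- (norm (w + V2 v u))\<^sup>2) * m powr (\<gamma> - 1))"
  proof (cases "w = 0")
    \<comment> \<open>Division by zero makes the integrand 0 at w = 0.\<close>
    case True
    then show ?thesis using Cb by (simp add: k2_integrand_def)
  next
    case False
    have mp: "((norm ?z)\<^sup>2 + (norm w)\<^sup>2) powr (\<gamma>/2) = m powr \<gamma>"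
    proof -
      have "m = ((norm ?z)\<^sup>2 + (norm w)\<^sup>2) powr (1/2)" using hypot_pos[OF z, of w] by (simp add: m_def powr_half_sqrt)
      then show ?thesis by (simp add: powr_powr)
    qed
    have "b (cos_theta ?z w) * norm w + b (sin_theta ?z w) * norm ?z \<le> (Cb * (norm ?z / m)) * norm w + (Cb * (norm w / m)) * norm ?z"
      using b(2)[of "cos_theta ?z w"] b(2)[of "sin_theta ?z w"] m
      by (intro add_mono mult_right_mono) (auto simp: angle_hypot[OF z] m_def)
    also have "\<dots> = 2 * Cb * (norm ?z * norm w) / m" by (simp add: field_simps)
    finally have le: "b (cos_theta ?z w) * norm w + b (sin_theta ?z w) * norm ?z \<le> 2 * Cb * (norm ?z * norm w) / m" .
    have "k2_integrand b \<gamma> v u w \<le> exp (- (norm (w + V2 v u))\<^sup>2) * (m powr \<gamma> / (norm w * norm ?z)) * (2 * Cb * (norm ?z * norm w) / m)"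
      unfolding k2_integrand_def mp by (intro mult_left_mono le) auto
    also have "\<dots> = 2 * Cb * (exp (- (norm (w + V2 v u))\<^sup>2) * (m powr \<gamma> / m))"
      using False z by (simp add: field_simps)
    also have "m powr \<gamma> / m = m powr (\<gamma> - 1)" using m by (simp add: powr_diff)
    finally show ?thesis .
  qed
qed

text \<open>The decay \<open>(1 + norm v) powr (- p)\<close> comes from \<open>v = V\<^sub>1 + V\<^sub>2 + (v - u) / 2\<close>: a large \<open>v\<close> makes
  one of \<open>V\<^sub>1\<close>, \<open>w + V\<^sub>2\<close>, \<open>w\<close> and \<open>v - u\<close> large.\<close>

lemma integrand_weight_bound:
  fixes v u w :: r3
  assumes p: "0 \<le> p" "p \<le> \<beta> + 1" and vu: "v \<noteq> u"
  defines "z \<equiv> v - u"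
  defines "q \<equiv> norm (w + V2 v u)"
  shows "exp (- q\<^sup>2) * sqrt ((norm z)\<^sup>2 + (norm w)\<^sup>2) powr (- p)
    \<le> (1 + norm v) powr (- p) * ((1 + norm (V1 v u)) powr p * (1 + norm z) powr p * (exp ((p + 3)\<^sup>2 / 4) * 2 powr p)
       * (max q 1 powr (- 3) + max (norm w) (norm z) powr (- (\<beta> + 1))))"
proof -
  define m where "m = sqrt ((norm z)\<^sup>2 + (norm w)\<^sup>2)"
  have z0: "z \<noteq> 0" using vu by (simp add: z_def)
  have m0: "0 < m" using hypot_pos[OF z0, of w] by (simp add: m_def)
  have mw: "norm w \<le> m" "norm z \<le> m" by (simp_all add: m_def real_le_rsqrt)
  have q0: "0 \<le> q" by (simp add: q_def)
  let ?A = "1 + norm (V1 v u)" and ?B = "1 + norm z"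
  have e: "v = V1 v u + (w + V2 v u) - w + (1/2) *\<^sub>R z"
  proof -
    have "V1 v u + (w + V2 v u) - w + (1/2) *\<^sub>R z = (V1 v u + V2 v u) + (1/2) *\<^sub>R z" by simp
    also have "\<dots> = v" unfolding V1_plus_V2[OF vu] z_def
      by (simp add: vec_eq_iff field_simps)
    finally show ?thesis by simp
  qed
  have a: "norm v \<le> norm (V1 v u) + q + norm w + norm z"
  proof -
    have "norm v = norm (V1 v u + (w + V2 v u) - w + (1/2) *\<^sub>R z)" by (rule arg_cong[OF e])
    also have "\<dots> \<le> norm (V1 v u + (w + V2 v u) - w) + norm ((1/2) *\<^sub>R z)" by (rule norm_triangle_ineq)
    also have "norm (V1 v u + (w + V2 v u) - w) \<le> norm (V1 v u + (w + V2 v u)) + norm w" by (rule norm_triangle_ineq4)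
    also have "norm (V1 v u + (w + V2 v u)) \<le> norm (V1 v u) + q" unfolding q_def by (rule norm_triangle_ineq)
    finally have "norm v \<le> norm (V1 v u) + q + norm w + norm ((1/2) *\<^sub>R z)" by simp
    moreover have "norm ((1/2) *\<^sub>R z) \<le> norm z" by simp
    ultimately show ?thesis by linarith
  qed
  have nv: "1 + norm v \<le> ?A * ?B * (1 + q) * (1 + norm w)"
  proof -
    have "1 + norm (V1 v u) + norm z \<le> ?A * ?B" by (simp add: algebra_simps)
    moreover have "1 + q + norm w \<le> (1 + q) * (1 + norm w)" using q0 by (simp add: algebra_simps)
    moreover have "(1 + (norm (V1 v u) + norm z)) * (1 + (q + norm w)) \<le> (?A * ?B) * ((1 + q) * (1 + norm w))"
      using calculation q0 by (intro mult_mono) auto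
    moreover have "0 \<le> (norm (V1 v u) + norm z) * (q + norm w)" using q0 by simp
    moreover have "(1 + (norm (V1 v u) + norm z)) * (1 + (q + norm w)) = 1 + (norm (V1 v u) + norm z) + (q + norm w) + (norm (V1 v u) + norm z) * (q + norm w)"
      by (simp add: algebra_simps)
    ultimately show ?thesis using a by (simp only: mult.assoc)
  qed
  have step1: "(1 + norm v) powr p \<le> ?A powr p * ?B powr p * (1 + q) powr p * (1 + norm w) powr p"
  proof -
    have "(1 + norm v) powr p \<le> (?A * ?B * (1 + q) * (1 + norm w)) powr p"
      using nv p by (intro powr_mono2) auto
    then show ?thesis using q0 by (simp add: powr_mult)
  qed
  \<comment> \<open>The exponent 3 exceeds the dimension 2 of the plane, so this factor is
    integrable there; the Gaussian also absorbs the p powers of 1 + q.\<close>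
  have step2: "(1 + q) powr p * exp (- q\<^sup>2) \<le> exp ((p + 3)\<^sup>2 / 4) * max q 1 powr (- 3)"
  proof -
    have mq: "0 < max q 1" by simp
    have "max q 1 powr 3 \<le> (1 + q) powr 3" using q0 by (intro powr_mono2) auto
    then have "(1 + q) powr p * exp (- q\<^sup>2) * max q 1 powr 3 \<le> (1 + q) powr p * exp (- q\<^sup>2) * (1 + q) powr 3"
      by (intro mult_left_mono) auto
    also have "\<dots> = (1 + q) powr (p + 3) * exp (- 1 * q\<^sup>2)" by (simp only: powr_add) simp
    also have "\<dots> \<le> exp ((p + 3)\<^sup>2 / (4 * 1))" using p q0 by (intro gauss_poly_bound) auto
    finally have "(1 + q) powr p * exp (- q\<^sup>2) * max q 1 powr 3 \<le> exp ((p + 3)\<^sup>2 / 4)" by simp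
    then have "(1 + q) powr p * exp (- q\<^sup>2) * max q 1 powr 3 * max q 1 powr (- 3) \<le> exp ((p + 3)\<^sup>2 / 4) * max q 1 powr (- 3)"
      by (rule mult_right_mono) simp
    moreover have "max q 1 powr 3 * max q 1 powr (- 3) = 1"
      using mq by (simp only: powr_add[symmetric]) simp
    ultimately show ?thesis by (simp only: mult.assoc mult_1_right)
  qed
  \<comment> \<open>For m >= 1 the quotient (1+m)^p / m^p is at most 2^p. For m < 1 the assumption p
    <= \<beta> + 1 allows the singular power to be raised to \<beta> + 1, which fits the target
    singularity for every admissible \<gamma>.\<close>
  have step3: "(1 + norm w) powr p * m powr (- p) \<le> 2 powr p * (1 + max (norm w) (norm z) powr (- (\<beta> + 1)))"
  proof -
    have "(1 + norm w) powr p * m powr (- p) \<le> (1 + m) powr p * m powr (- p)"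
      using mw p by (intro mult_right_mono powr_mono2) auto
    also have "\<dots> \<le> 2 powr p * (1 + m powr (- (\<beta> + 1)))"
    proof (cases "1 \<le> m")
      case True
      have "(1 + m) powr p \<le> (2 * m) powr p" using True p by (intro powr_mono2) auto
      then have "(1 + m) powr p * m powr (- p) \<le> (2 * m) powr p * m powr (- p)" by (intro mult_right_mono) auto
      also have "\<dots> = 2 powr p * (m powr p * m powr (- p))" by (simp only: powr_mult mult.assoc)
      also have "m powr p * m powr (- p) = 1" using m0 by (simp only: powr_add[symmetric]) simp
      also have "2 powr p * 1 \<le> 2 powr p * (1 + m powr (- (\<beta> + 1)))" by (intro mult_left_mono) auto
      finally show ?thesis .
    next
      case False
      have "(1 + m) powr p \<le> 2 powr p" using False m0 p by (intro powr_mono2) auto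
      moreover have "m powr (- p) \<le> m powr (- (\<beta> + 1))" using False m0 p by (intro powr_mono') auto
      then have "m powr (- p) \<le> 1 + m powr (- (\<beta> + 1))" by simp
      ultimately show ?thesis by (intro mult_mono) auto
    qed
    also have "\<dots> \<le> 2 powr p * (1 + max (norm w) (norm z) powr (- (\<beta> + 1)))"
      using mw z0 p by (intro mult_left_mono add_left_mono powr_mono2') (auto simp: less_max_iff_disj)
    finally show ?thesis .
  qed
  have m3: "max q 1 powr (- 3) \<le> 1"
  proof -
    have "max q 1 powr (- 3) \<le> 1 powr (- 3)" by (intro powr_mono2') auto
    then show ?thesis by simp
  qed
  let ?E = "exp ((p + 3)\<^sup>2 / 4)" and ?T = "max (norm w) (norm z) powr (- (\<beta> + 1))"
  have "(1 + norm v) powr p * (exp (- q\<^sup>2) * m powr (- p))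
     \<le> (?A powr p * ?B powr p * (1 + q) powr p * (1 + norm w) powr p) * (exp (- q\<^sup>2) * m powr (- p))"
    by (intro mult_right_mono step1) auto
  also have "\<dots> = (?A powr p * ?B powr p) * (((1 + q) powr p * exp (- q\<^sup>2)) * ((1 + norm w) powr p * m powr (- p)))" by (simp only: mult_ac)
  also have "\<dots> \<le> (?A powr p * ?B powr p) * ((?E * max q 1 powr (- 3)) * (2 powr p * (1 + ?T)))"
    by (intro mult_left_mono mult_mono step2 step3) auto
  also have "\<dots> = (?A powr p * ?B powr p * (?E * 2 powr p)) * (max q 1 powr (- 3) * (1 + ?T))" by (simp only: mult_ac)
  also have "\<dots> \<le> (?A powr p * ?B powr p * (?E * 2 powr p)) * (max q 1 powr (- 3) + ?T)"
  proof (intro mult_left_mono)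
    have "max q 1 powr (- 3) * ?T \<le> 1 * ?T" by (intro mult_right_mono m3) auto
    then show "max q 1 powr (- 3) * (1 + ?T) \<le> max q 1 powr (- 3) + ?T" by (simp add: distrib_left)
  qed auto
  finally have main: "(1 + norm v) powr p * (exp (- q\<^sup>2) * m powr (- p)) \<le> ?A powr p * ?B powr p * (?E * 2 powr p) * (max q 1 powr (- 3) + ?T)" .
  have "(1 + norm v) powr (- p) * ((1 + norm v) powr p * (exp (- q\<^sup>2) * m powr (- p))) \<le> (1 + norm v) powr (- p) * (?A powr p * ?B powr p * (?E * 2 powr p) * (max q 1 powr (- 3) + ?T))"
    by (intro mult_left_mono main) auto
  moreover have "(1 + norm v) powr (- p) * (1 + norm v) powr p = 1"
  proof -
    have "1 + norm v > 0" by (simp add: add_pos_nonneg)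
    then show ?thesis by (simp only: powr_add[symmetric]) simp
  qed
  ultimately show ?thesis unfolding m_def by (simp only: mult.assoc[symmetric] mult_1_left)
qed

lemma integral_nonneg_le:
  fixes f :: "'a \<Rightarrow> real"
  assumes "f \<in> borel_measurable M" "\<And>x. 0 \<le> f x" "(\<integral>\<^sup>+x. ennreal (f x) \<partial>M) \<le> ennreal c" "0 \<le> c"
  shows "(LINT x|M. f x) \<le> c"
proof -
  have "(LINT x|M. f x) = enn2real (\<integral>\<^sup>+x. ennreal (f x) \<partial>M)"
    using assms by (intro integral_eq_nn_integral) auto
  also have "\<dots> \<le> c" using enn2real_mono[OF assms(3)] assms(4) by simp
  finally show ?thesis .
qed

text \<open>Of the two summands in \<open>integrand_weight_bound\<close>, the first integrates to a
  constant independent of the centre. The second gives |v-u|^(1-\<beta>), where \<beta> > 1 ensures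
  convergence at infinity in the plane.\<close>

lemma k2_plane_integral_le:
  assumes [measurable]: "b \<in> borel_measurable borel"
    and b: "\<And>c. 0 \<le> b c" "\<And>c. b c \<le> Cb * \<bar>c\<bar>"
    and \<gamma>: "\<gamma> \<le> 1" and \<beta>: "1 < \<beta>" "- \<gamma> \<le> \<beta>" and vu: "v \<noteq> u"
  defines "p \<equiv> 1 - \<gamma>"
  shows "(LINT y|lborel. k2_integrand b \<gamma> v u (frame (v - u) y))
    \<le> 2 * Cb * ((1 + norm v) powr (- p) * ((1 + norm (V1 v u)) powr p * (1 + norm (v - u)) powr p * (exp ((p + 3)\<^sup>2 / 4) * 2 powr p)
       * (unit_ball_vol 2 * 3 + unit_ball_vol 2 * ((\<beta> + 1) / (\<beta> - 1)) * norm (v - u) powr (1 - \<beta>))))" (is "_ \<le> ?R")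
proof (rule integral_nonneg_le)
  let ?z = "v - u"
  have z: "?z \<noteq> 0" using vu by simp
  have p: "0 \<le> p" "p \<le> \<beta> + 1" using \<gamma> \<beta> by (auto simp: p_def)
  have Cb: "0 \<le> Cb" using order_trans[OF b(1) b(2)[of 1]] by simp
  define D where "D = 2 * Cb * ((1 + norm v) powr (- p) * ((1 + norm (V1 v u)) powr p * (1 + norm ?z) powr p * (exp ((p + 3)\<^sup>2 / 4) * 2 powr p)))"
  have D: "0 \<le> D" unfolding D_def using Cb by simp
  \<comment> \<open>The coordinates of \<open>V2\<close>, which lies in the plane; they turn the
    shift by \<open>V2\<close> into a translation of the integration variable.\<close>
  define y0 :: "real^2" where "y0 = (\<chi> i. if i = 1 then V2 v u \<bullet> frame_a ?z else V2 v u \<bullet> frame_b ?z)"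
  have y0: "frame ?z y0 = V2 v u" unfolding y0_def by (rule frame_isometry(4)[OF z V2_inner])
  show "(\<lambda>y. k2_integrand b \<gamma> v u (frame ?z y)) \<in> borel_measurable lborel" by measurable
  show "0 \<le> k2_integrand b \<gamma> v u (frame ?z y)" for y by (rule k2_integrand_bounds(1)[OF b vu])
  have le: "k2_integrand b \<gamma> v u (frame ?z y) \<le> D * (max (norm (y - - y0)) 1 powr (- 3) + max (norm (y - 0)) (norm ?z) powr (- (\<beta> + 1)))" for y
  proof -
    let ?w = "frame ?z y"
    have n: "norm ?w = norm y" by (rule frame_isometry(2)[OF z])
    have "?w + V2 v u = frame ?z (y + y0)"
      unfolding y0[symmetric] by (rule linear_add[OF frame_isometry(1)[OF z], symmetric])
    then have q: "norm (?w + V2 v u) = norm (y - - y0)" by (simp add: frame_isometry(2)[OF z])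
    have "k2_integrand b \<gamma> v u ?w \<le> 2 * Cb * (exp (- (norm (?w + V2 v u))\<^sup>2) * sqrt ((norm ?z)\<^sup>2 + (norm ?w)\<^sup>2) powr (\<gamma> - 1))"
      by (rule k2_integrand_bounds(2)[OF b vu])
    also have "\<gamma> - 1 = - p" by (simp add: p_def)
    also have "2 * Cb * (exp (- (norm (?w + V2 v u))\<^sup>2) * sqrt ((norm ?z)\<^sup>2 + (norm ?w)\<^sup>2) powr (- p))
      \<le> 2 * Cb * ((1 + norm v) powr (- p) * ((1 + norm (V1 v u)) powr p * (1 + norm ?z) powr p * (exp ((p + 3)\<^sup>2 / 4) * 2 powr p)
       * (max (norm (?w + V2 v u)) 1 powr (- 3) + max (norm ?w) (norm ?z) powr (- (\<beta> + 1)))))"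
      using Cb by (intro mult_left_mono integrand_weight_bound[OF p vu]) auto
    finally show ?thesis unfolding D_def q n by (simp only: mult.assoc diff_zero)
  qed
  have I1: "(\<integral>\<^sup>+y. ennreal (max (norm (y - - y0)) 1 powr (- 3)) \<partial>lborel) \<le> ennreal (unit_ball_vol 2 * 3)"
    using nn_integral_max_powr[of 3 1 "- y0"] by simp
  have I2: "(\<integral>\<^sup>+y. ennreal (max (norm ((y::real^2) - 0)) (norm ?z) powr (- (\<beta> + 1))) \<partial>lborel) \<le> ennreal (unit_ball_vol 2 * ((\<beta> + 1) / (\<beta> - 1)) * norm ?z powr (1 - \<beta>))"
  proof -
    have "(\<integral>\<^sup>+y. ennreal (max (norm ((y::real^2) - 0)) (norm ?z) powr (- (\<beta> + 1))) \<partial>lborel)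
      \<le> ennreal (unit_ball_vol (real DIM(real^2)) * ((\<beta> + 1) / ((\<beta> + 1) - real DIM(real^2))) * norm ?z powr (real DIM(real^2) - (\<beta> + 1)))"
      using \<beta> z by (intro nn_integral_max_powr) auto
    also have "real DIM(real^2) = 2" by simp
    also have "(\<beta> + 1) - 2 = \<beta> - 1" by simp
    also have "2 - (\<beta> + 1) = 1 - \<beta>" by simp
    finally show ?thesis .
  qed
  let ?s = "unit_ball_vol 2 * 3" and ?t = "unit_ball_vol 2 * ((\<beta> + 1) / (\<beta> - 1)) * norm ?z powr (1 - \<beta>)"
  have st: "0 \<le> ?s" "0 \<le> ?t" using \<beta> by auto
  have "(\<integral>\<^sup>+y. ennreal (k2_integrand b \<gamma> v u (frame ?z y)) \<partial>lborel)
    \<le> (\<integral>\<^sup>+y. ennreal D * (ennreal (max (norm (y - - y0)) 1 powr (- 3)) + ennreal (max (norm (y - 0)) (norm ?z) powr (- (\<beta> + 1)))) \<partial>lborel)"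
  proof (intro nn_integral_mono)
    fix y :: "real^2"
    have "ennreal (k2_integrand b \<gamma> v u (frame ?z y)) \<le> ennreal (D * (max (norm (y - - y0)) 1 powr (- 3) + max (norm (y - 0)) (norm ?z) powr (- (\<beta> + 1))))"
      by (intro ennreal_leI le)
    also have "\<dots> = ennreal D * ennreal (max (norm (y - - y0)) 1 powr (- 3) + max (norm (y - 0)) (norm ?z) powr (- (\<beta> + 1)))"
      by (rule ennreal_mult[OF D]) simp
    also have "ennreal (max (norm (y - - y0)) 1 powr (- 3) + max (norm (y - 0)) (norm ?z) powr (- (\<beta> + 1)))
       = ennreal (max (norm (y - - y0)) 1 powr (- 3)) + ennreal (max (norm (y - 0)) (norm ?z) powr (- (\<beta> + 1)))"
      by (rule ennreal_plus) auto
    finally show "ennreal (k2_integrand b \<gamma> v u (frame ?z y)) \<le> ennreal D * (ennreal (max (norm (y - - y0)) 1 powr (- 3)) + ennreal (max (norm (y - 0)) (norm ?z) powr (- (\<beta> + 1))))" .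
  qed
  also have "\<dots> = ennreal D * (\<integral>\<^sup>+y. ennreal (max (norm (y - - y0)) 1 powr (- 3)) + ennreal (max (norm (y - 0)) (norm ?z) powr (- (\<beta> + 1))) \<partial>lborel)"
    by (rule nn_integral_cmult) measurable
  also have "(\<integral>\<^sup>+y. ennreal (max (norm (y - - y0)) 1 powr (- 3)) + ennreal (max (norm (y - 0)) (norm ?z) powr (- (\<beta> + 1))) \<partial>lborel)
     = (\<integral>\<^sup>+y. ennreal (max (norm (y - - y0)) 1 powr (- 3)) \<partial>lborel) + (\<integral>\<^sup>+y. ennreal (max (norm ((y::real^2) - 0)) (norm ?z) powr (- (\<beta> + 1))) \<partial>lborel)"
    by (rule nn_integral_add) measurable
  also have "ennreal D * ((\<integral>\<^sup>+y. ennreal (max (norm (y - - y0)) 1 powr (- 3)) \<partial>lborel) + (\<integral>\<^sup>+y. ennreal (max (norm ((y::real^2) - 0)) (norm ?z) powr (- (\<beta> + 1))) \<partial>lborel))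
     \<le> ennreal D * (ennreal ?s + ennreal ?t)"
    by (intro mult_left_mono add_mono I1 I2) auto
  also have "\<dots> = ennreal (D * (?s + ?t))"
    unfolding ennreal_plus[OF st, symmetric] by (rule ennreal_mult[symmetric]) (use D st in auto)
  also have DR: "D * (?s + ?t) = ?R" unfolding D_def by (simp only: mult.assoc)
  finally show "(\<integral>\<^sup>+y. ennreal (k2_integrand b \<gamma> v u (frame ?z y)) \<partial>lborel) \<le> ennreal ?R" .
  show "0 \<le> ?R" unfolding DR[symmetric] by (rule mult_nonneg_nonneg[OF D add_nonneg_nonneg[OF st]])
qed

text \<open>Since |v|^2 - |u|^2 is twice the inner product of \<open>V1\<close> with v - u, the
  exponential weights cost at most 2\<alpha>(|V1|^2 + |v-u|^2/4). That is the fraction 2\<alpha> of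
  the available Gaussian exponent.\<close>

lemma alpha_exponent_le:
  fixes v u :: r3
  assumes \<alpha>: "0 \<le> \<alpha>" and vu: "v \<noteq> u"
  shows "\<alpha> * (norm v)\<^sup>2 + (- (1/4) * (norm (v - u))\<^sup>2 - (norm (V1 v u))\<^sup>2) + (- \<alpha> * (norm u)\<^sup>2)
    \<le> - ((1 - 2 * \<alpha>) / 4) * (norm (v - u))\<^sup>2 + - (1 - 2 * \<alpha>) * (norm (V1 v u))\<^sup>2"
proof -
  let ?a = "norm (V1 v u)" and ?z = "norm (v - u)"
  have "((norm v)\<^sup>2 - (norm u)\<^sup>2) / 2 \<le> ?a * ?z"
    unfolding V1_inner[OF vu, symmetric] by (rule norm_cauchy_schwarz)
  moreover have "0 \<le> (?a - ?z / 2)\<^sup>2" by simp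
  then have "?a * ?z \<le> ?a\<^sup>2 + ?z\<^sup>2 / 4" by (simp add: power2_eq_square algebra_simps)
  ultimately have "(norm v)\<^sup>2 - (norm u)\<^sup>2 \<le> 2 * (?a\<^sup>2 + ?z\<^sup>2 / 4)" by simp
  then have "\<alpha> * ((norm v)\<^sup>2 - (norm u)\<^sup>2) \<le> \<alpha> * (2 * (?a\<^sup>2 + ?z\<^sup>2 / 4))"
    by (rule mult_left_mono[OF _ \<alpha>])
  moreover have "\<alpha> * ((norm v)\<^sup>2 - (norm u)\<^sup>2) = \<alpha> * (norm v)\<^sup>2 - \<alpha> * (norm u)\<^sup>2"
    "\<alpha> * (2 * (?a\<^sup>2 + ?z\<^sup>2 / 4)) = 2 * (\<alpha> * ?a\<^sup>2) + \<alpha> * ?z\<^sup>2 / 2"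
    "- ((1 - 2 * \<alpha>) / 4) * ?z\<^sup>2 = \<alpha> * ?z\<^sup>2 / 2 - ?z\<^sup>2 / 4"
    "- (1 - 2 * \<alpha>) * ?a\<^sup>2 = 2 * (\<alpha> * ?a\<^sup>2) - ?a\<^sup>2"
    by (simp_all add: field_simps)
  ultimately show ?thesis by linarith
qed

text \<open>For \<alpha> < 1/2 Gaussian decay remains both in \<open>V1\<close> and in v - u; it
  absorbs the polynomial factors left by the plane integral. The prefactor 1/|v-u| raises the
  singularity |v-u|^(1-\<beta>) to order \<beta>.\<close>

lemma k2_part_bound:
  assumes bm: "b \<in> borel_measurable borel"
    and b: "\<And>c. 0 \<le> b c" "\<And>c. b c \<le> Cb * \<bar>c\<bar>"
    and \<gamma>: "\<gamma> \<le> 1" and \<beta>: "1 < \<beta>" "- \<gamma> \<le> \<beta>" and \<alpha>: "0 \<le> \<alpha>" "\<alpha> < 1/2"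
  obtains C where "0 \<le> C"
    "\<And>v u. v \<noteq> u \<Longrightarrow> \<bar>exp (\<alpha> * (norm v)\<^sup>2) * k2_borel b \<gamma> v u * exp (- \<alpha> * (norm u)\<^sup>2)\<bar> \<le> C * vweight (\<gamma> - 1) v * sing \<beta> 8 (v - u)"
proof -
  define p where "p = 1 - \<gamma>"
  define \<delta> where "\<delta> = (1 - 2 * \<alpha>) / 4"
  define A1 where "A1 = unit_ball_vol 2 * (3::real)"
  define A2 where "A2 = unit_ball_vol 2 * ((\<beta> + 1) / (\<beta> - 1))"
  define G where "G = exp ((p + 3)\<^sup>2 / 4) * 2 powr p"
  \<comment> \<open>The exponent p + \<beta> + 8 collects p powers from the weight, \<beta> from
    rewriting 1/|v-u| with the singularity \<beta>, and 8 to create the decay of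
    \<open>sing\<close>. \<open>E2\<close> plays the same role for \<open>V1\<close>, where the
    Gaussian rate is 4\<delta>.\<close>
  define E1 where "E1 = exp ((p + \<beta> + 8)\<^sup>2 / (4 * \<delta>))"
  define E2 where "E2 = exp (p\<^sup>2 / (4 * (4 * \<delta>)))"
  define C where "C = pi powr (-3/2) * (2 * Cb) * G * (A1 + A2) * E1 * E2"
  have p: "0 \<le> p" using \<gamma> by (simp add: p_def)
  have \<delta>: "0 < \<delta>" using \<alpha> by (simp add: \<delta>_def)
  have Cb: "0 \<le> Cb" using order_trans[OF b(1) b(2)[of 1]] by simp
  have A: "0 \<le> A1" "0 \<le> A2" using \<beta> by (auto simp: A1_def A2_def)
  have G: "0 \<le> G" by (simp add: G_def)
  show ?thesis
  proof (rule that)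
    show "0 \<le> C" using Cb A G by (simp add: C_def E1_def E2_def)
    fix v u :: r3 assume vu: "v \<noteq> u"
    let ?z = "norm (v - u)" and ?a = "norm (V1 v u)" and ?P = "LINT y|lborel. k2_integrand b \<gamma> v u (frame (v - u) y)"
    have z: "0 < ?z" using vu by simp
    have P0: "0 \<le> ?P" by (intro Bochner_Integration.integral_nonneg k2_integrand_bounds(1)[OF b vu])
    have PL: "?P \<le> 2 * Cb * ((1 + norm v) powr (- p) * ((1 + ?a) powr p * (1 + ?z) powr p * G * (A1 + A2 * ?z powr (1 - \<beta>))))"
      unfolding p_def G_def A1_def A2_def by (rule k2_plane_integral_le[OF bm b \<gamma> \<beta> vu])
    have eq: "exp (\<alpha> * (norm v)\<^sup>2) * k2_borel b \<gamma> v u * exp (- \<alpha> * (norm u)\<^sup>2)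
      = pi powr (-3/2) / ?z * exp (\<alpha> * (norm v)\<^sup>2 + (- (1/4) * ?z\<^sup>2 - ?a\<^sup>2) + (- \<alpha> * (norm u)\<^sup>2)) * ?P"
      unfolding k2_borel_def exp_add by (simp only: mult_ac)
    have ex: "exp (\<alpha> * (norm v)\<^sup>2 + (- (1/4) * ?z\<^sup>2 - ?a\<^sup>2) + (- \<alpha> * (norm u)\<^sup>2)) \<le> exp (- \<delta> * ?z\<^sup>2) * exp (- (4 * \<delta>) * ?a\<^sup>2)"
    proof -
      have "- (1 - 2 * \<alpha>) = - (4 * \<delta>)" "- ((1 - 2 * \<alpha>) / 4) = - \<delta>" by (simp_all add: \<delta>_def field_simps)
      then show ?thesis
        using alpha_exponent_le[OF \<alpha>(1) vu] by (simp only: exp_add[symmetric] exp_le_cancel_iff)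
    qed
    have "\<bar>exp (\<alpha> * (norm v)\<^sup>2) * k2_borel b \<gamma> v u * exp (- \<alpha> * (norm u)\<^sup>2)\<bar>
      = pi powr (-3/2) / ?z * exp (\<alpha> * (norm v)\<^sup>2 + (- (1/4) * ?z\<^sup>2 - ?a\<^sup>2) + (- \<alpha> * (norm u)\<^sup>2)) * ?P"
      unfolding eq using P0 z by (intro abs_of_nonneg mult_nonneg_nonneg) auto
    also have "\<dots> \<le> pi powr (-3/2) / ?z * (exp (- \<delta> * ?z\<^sup>2) * exp (- (4 * \<delta>) * ?a\<^sup>2))
        * (2 * Cb * ((1 + norm v) powr (- p) * ((1 + ?a) powr p * (1 + ?z) powr p * G * (A1 + A2 * ?z powr (1 - \<beta>)))))"
      by (rule mult_mono[OF mult_left_mono[OF ex] PL]) (use z P0 in \<open>auto intro!: mult_nonneg_nonneg\<close>)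
    also have "\<dots> = pi powr (-3/2) * (2 * Cb) * G * (1 + norm v) powr (- p) * ((1 + ?a) powr p * exp (- (4 * \<delta>) * ?a\<^sup>2))
        * ((1 / ?z * (A1 + A2 * ?z powr (1 - \<beta>))) * ((1 + ?z) powr p * exp (- \<delta> * ?z\<^sup>2)))"
      by (simp add: mult_ac)
    also have "\<dots> \<le> pi powr (-3/2) * (2 * Cb) * G * (1 + norm v) powr (- p) * E2
        * (((A1 + A2) * (?z powr (- \<beta>) * (1 + ?z) powr \<beta>)) * ((1 + ?z) powr p * exp (- \<delta> * ?z\<^sup>2)))"
    proof -
      have f1: "(1 + ?a) powr p * exp (- (4 * \<delta>) * ?a\<^sup>2) \<le> E2"
        unfolding E2_def using p \<delta> by (intro gauss_poly_bound) auto
      \<comment> \<open>The bounded and the singular part of the plane integral are brought to the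
        common form |v-u|^(-\<beta>) times a power of 1 + |v-u|.\<close>
      have z1: "1 / ?z = ?z powr (- \<beta>) * ?z powr (\<beta> - 1)"
      proof -
        have "?z powr (- \<beta>) * ?z powr (\<beta> - 1) = ?z powr (- 1)" by (simp only: powr_add[symmetric]) simp
        then show ?thesis using z by (simp add: powr_minus_divide)
      qed
      have z2: "?z powr (\<beta> - 1) * ?z powr (1 - \<beta>) = 1" using z by (simp only: powr_add[symmetric]) simp
      have b1: "?z powr (\<beta> - 1) \<le> (1 + ?z) powr \<beta>"
      proof -
        have "?z powr (\<beta> - 1) \<le> (1 + ?z) powr (\<beta> - 1)" using \<beta> by (intro powr_mono2) auto
        also have "\<dots> \<le> (1 + ?z) powr \<beta>" by (intro powr_mono) auto
        finally show ?thesis .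
      qed
      have b2: "1 \<le> (1 + ?z) powr \<beta>" using \<beta> by (intro ge_one_powr_ge_zero) auto
      have "1 / ?z * (A1 + A2 * ?z powr (1 - \<beta>)) = ?z powr (- \<beta>) * (A1 * ?z powr (\<beta> - 1) + A2 * (?z powr (\<beta> - 1) * ?z powr (1 - \<beta>)))"
        unfolding z1 by (simp only: distrib_left mult_ac)
      also have "\<dots> \<le> ?z powr (- \<beta>) * (A1 * (1 + ?z) powr \<beta> + A2 * (1 + ?z) powr \<beta>)"
        unfolding z2 using A b1 b2 by (intro mult_left_mono add_mono) auto
      also have "\<dots> = (A1 + A2) * (?z powr (- \<beta>) * (1 + ?z) powr \<beta>)" by (simp add: algebra_simps)
      finally have f2: "1 / ?z * (A1 + A2 * ?z powr (1 - \<beta>)) \<le> (A1 + A2) * (?z powr (- \<beta>) * (1 + ?z) powr \<beta>)" .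
      show ?thesis
        by (rule mult_mono[OF mult_left_mono[OF f1] mult_right_mono[OF f2]])
          (use Cb A G z in \<open>auto simp: E2_def intro!: mult_nonneg_nonneg add_nonneg_nonneg divide_nonneg_nonneg\<close>)
    qed
    also have "((A1 + A2) * (?z powr (- \<beta>) * (1 + ?z) powr \<beta>)) * ((1 + ?z) powr p * exp (- \<delta> * ?z\<^sup>2))
      = (A1 + A2) * (sing \<beta> 8 (v - u) * ((1 + ?z) powr (p + \<beta> + 8) * exp (- \<delta> * ?z\<^sup>2)))"
    proof -
      have "(1 + ?z) powr \<beta> * (1 + ?z) powr p = (1 + ?z) powr (- 8) * (1 + ?z) powr (p + \<beta> + 8)"
        unfolding powr_add[symmetric] by (rule arg_cong[where f="\<lambda>t. (1 + ?z) powr t"]) simp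
      then have "?z powr (- \<beta>) * ((1 + ?z) powr \<beta> * (1 + ?z) powr p) * exp (- \<delta> * ?z\<^sup>2) = sing \<beta> 8 (v - u) * ((1 + ?z) powr (p + \<beta> + 8) * exp (- \<delta> * ?z\<^sup>2))"
        unfolding sing_def by (simp only: mult.assoc)
      then show ?thesis by (simp only: mult.assoc)
    qed
    also have "pi powr (-3/2) * (2 * Cb) * G * (1 + norm v) powr (- p) * E2 * ((A1 + A2) * (sing \<beta> 8 (v - u) * ((1 + ?z) powr (p + \<beta> + 8) * exp (- \<delta> * ?z\<^sup>2))))
      \<le> pi powr (-3/2) * (2 * Cb) * G * (1 + norm v) powr (- p) * E2 * ((A1 + A2) * (sing \<beta> 8 (v - u) * E1))"
      unfolding E1_def using p \<beta> \<delta> Cb A G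
      by (intro mult_left_mono gauss_poly_bound) (auto simp: E2_def sing_nonneg intro!: mult_nonneg_nonneg add_nonneg_nonneg)
    also have "\<dots> = C * vweight (\<gamma> - 1) v * sing \<beta> 8 (v - u)"
    proof -
      have "(1 + norm v) powr (- p) = vweight (\<gamma> - 1) v" by (simp add: vweight_def p_def)
      then show ?thesis unfolding C_def by (simp only: mult_ac)
    qed
    finally show "\<bar>exp (\<alpha> * (norm v)\<^sup>2) * k2_borel b \<gamma> v u * exp (- \<alpha> * (norm u)\<^sup>2)\<bar> \<le> C * vweight (\<gamma> - 1) v * sing \<beta> 8 (v - u)" .
  qed
qed

text \<open>The excess \<gamma> + \<beta> over the singularity is nonnegative, so it only produces
  growth, and growth in v - u is at most growth in v times growth in u. On the diagonal both sides
  are 0.\<close>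

lemma norm_powr_le_sing:
  fixes v u :: r3
  assumes \<beta>: "- \<gamma> \<le> \<beta>" and m: "0 \<le> m"
  shows "norm (v - u) powr \<gamma> \<le> sing \<beta> m (v - u) * ((1 + norm v) powr (\<gamma> + \<beta> + m) * (1 + norm u) powr (\<gamma> + \<beta> + m))"
proof -
  let ?z = "norm (v - u)"
  have zle: "1 + ?z \<le> (1 + norm v) * (1 + norm u)"
  proof -
    have "(1 + norm v) * (1 + norm u) = 1 + norm v + norm u + norm v * norm u" by (simp add: algebra_simps)
    moreover have "0 \<le> norm v * norm u" by simp
    ultimately show ?thesis using norm_triangle_ineq4[of v u] by linarith
  qed
  have "?z powr \<gamma> = ?z powr (- \<beta>) * ?z powr (\<gamma> + \<beta>)" by (simp add: powr_add[symmetric])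
  also have "\<dots> \<le> ?z powr (- \<beta>) * (1 + ?z) powr (\<gamma> + \<beta>)"
    using \<beta> by (intro mult_left_mono powr_mono2) auto
  also have "(1 + ?z) powr (\<gamma> + \<beta>) = (1 + ?z) powr (- m) * (1 + ?z) powr (\<gamma> + \<beta> + m)"
    by (simp add: powr_add[symmetric])
  also have "(1 + ?z) powr (\<gamma> + \<beta> + m) \<le> ((1 + norm v) * (1 + norm u)) powr (\<gamma> + \<beta> + m)"
    using zle \<beta> m by (intro powr_mono2) auto
  also have "\<dots> = (1 + norm v) powr (\<gamma> + \<beta> + m) * (1 + norm u) powr (\<gamma> + \<beta> + m)" by (rule powr_mult)
  finally show ?thesis by (simp add: sing_def mult.assoc mult_left_mono)
qed

text \<open>Here the Gaussians are in v and u separately and absorb all the growth from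
  \<open>norm_powr_le_sing\<close>; the one in v also pays for the factor
  \<open>vweight (\<gamma> - 1) v\<close>.\<close>

lemma k1_part_bound:
  assumes B: "0 \<le> B0 b" and \<gamma>: "\<gamma> \<le> 1" and \<beta>: "- \<gamma> \<le> \<beta>" and \<alpha>: "0 \<le> \<alpha>" "\<alpha> < 1/2"
  obtains C where "0 \<le> C"
    "\<And>v u. \<bar>exp (\<alpha> * (norm v)\<^sup>2) * k1 b \<gamma> v u * exp (- \<alpha> * (norm u)\<^sup>2)\<bar> \<le> C * vweight (\<gamma> - 1) v * sing \<beta> 8 (v - u)"
proof -
  define p where "p = 1 - \<gamma>"
  define \<delta> where "\<delta> = 1/2 - \<alpha>"
  define r where "r = \<gamma> + \<beta> + 8"
  define K where "K = pi powr (-3/2) * B0 b"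
  define C where "C = K * exp ((p + r)\<^sup>2 / (4 * \<delta>)) * exp (r\<^sup>2 / (4 * \<delta>))"
  have p: "0 \<le> p" "0 \<le> r" "0 < \<delta>" "0 \<le> K" using \<gamma> \<beta> \<alpha> B by (auto simp: p_def r_def \<delta>_def K_def)
  show ?thesis
  proof (rule that)
    show "0 \<le> C" using p by (simp add: C_def)
    fix v u :: r3
    let ?V = "1 + norm v" and ?U = "1 + norm u" and ?z = "norm (v - u)"
    have eq: "exp (\<alpha> * (norm v)\<^sup>2) * k1 b \<gamma> v u * exp (- \<alpha> * (norm u)\<^sup>2)
      = K * ?z powr \<gamma> * exp (\<alpha> * (norm v)\<^sup>2 + (- (1/2) * ((norm v)\<^sup>2 + (norm u)\<^sup>2)) + (- \<alpha> * (norm u)\<^sup>2))"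
      unfolding k1_def K_def exp_add by (simp only: mult_ac)
    \<comment> \<open>The exact coefficients are -(1/2 - \<alpha>) for v and -(1/2 + \<alpha>) for
      u; both are at most -\<delta>.\<close>
    have "\<alpha> * (norm v)\<^sup>2 + (- (1/2) * ((norm v)\<^sup>2 + (norm u)\<^sup>2)) + (- \<alpha> * (norm u)\<^sup>2) \<le> - \<delta> * (norm v)\<^sup>2 + - \<delta> * (norm u)\<^sup>2"
      using mult_nonneg_nonneg[OF \<alpha>(1), of "(norm u)\<^sup>2"] by (simp add: \<delta>_def algebra_simps)
    then have ex: "exp (\<alpha> * (norm v)\<^sup>2 + (- (1/2) * ((norm v)\<^sup>2 + (norm u)\<^sup>2)) + (- \<alpha> * (norm u)\<^sup>2)) \<le> exp (- \<delta> * (norm v)\<^sup>2) * exp (- \<delta> * (norm u)\<^sup>2)"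
      by (simp only: exp_add[symmetric] exp_le_cancel_iff)
    have "\<bar>exp (\<alpha> * (norm v)\<^sup>2) * k1 b \<gamma> v u * exp (- \<alpha> * (norm u)\<^sup>2)\<bar>
      = K * ?z powr \<gamma> * exp (\<alpha> * (norm v)\<^sup>2 + (- (1/2) * ((norm v)\<^sup>2 + (norm u)\<^sup>2)) + (- \<alpha> * (norm u)\<^sup>2))"
      unfolding eq using p by (intro abs_of_nonneg mult_nonneg_nonneg) auto
    also have "\<dots> \<le> K * (sing \<beta> 8 (v - u) * (?V powr r * ?U powr r)) * (exp (- \<delta> * (norm v)\<^sup>2) * exp (- \<delta> * (norm u)\<^sup>2))"
      unfolding r_def using p \<beta> by (intro mult_mono mult_left_mono norm_powr_le_sing ex) (auto simp: sing_nonneg)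
    also have "\<dots> = K * (sing \<beta> 8 (v - u)) * ((?V powr r * exp (- \<delta> * (norm v)\<^sup>2)) * (?U powr r * exp (- \<delta> * (norm u)\<^sup>2)))"
      by (simp only: mult_ac)
    also have "\<dots> \<le> K * (sing \<beta> 8 (v - u)) * ((?V powr (- p) * exp ((p + r)\<^sup>2 / (4 * \<delta>))) * exp (r\<^sup>2 / (4 * \<delta>)))"
    proof -
      have f1: "?U powr r * exp (- \<delta> * (norm u)\<^sup>2) \<le> exp (r\<^sup>2 / (4 * \<delta>))"
        using p by (intro gauss_poly_bound) auto
      have "?V powr r = ?V powr (- p) * ?V powr (p + r)" by (simp add: powr_add[symmetric])
      then have "?V powr r * exp (- \<delta> * (norm v)\<^sup>2) = ?V powr (- p) * (?V powr (p + r) * exp (- \<delta> * (norm v)\<^sup>2))" by simp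
      also have "\<dots> \<le> ?V powr (- p) * exp ((p + r)\<^sup>2 / (4 * \<delta>))"
        using p by (intro mult_left_mono gauss_poly_bound) auto
      finally have f2: "?V powr r * exp (- \<delta> * (norm v)\<^sup>2) \<le> ?V powr (- p) * exp ((p + r)\<^sup>2 / (4 * \<delta>))" .
      show ?thesis
        by (rule mult_left_mono[OF mult_mono[OF f2 f1]]) (use p in \<open>auto simp: sing_nonneg\<close>)
    qed
    also have "\<dots> = C * vweight (\<gamma> - 1) v * sing \<beta> 8 (v - u)"
    proof -
      have "?V powr (- p) = vweight (\<gamma> - 1) v" by (simp add: vweight_def p_def)
      then show ?thesis unfolding C_def by (simp only: mult_ac)
    qed
    finally show "\<bar>exp (\<alpha> * (norm v)\<^sup>2) * k1 b \<gamma> v u * exp (- \<alpha> * (norm u)\<^sup>2)\<bar> \<le> C * vweight (\<gamma> - 1) v * sing \<beta> 8 (v - u)" .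
  qed
qed

text \<open>Without positivity the collision frequency would have no lower bound. Since
  \<open>B0\<close> is a Bochner integral, which is 0 when it does not converge, integrability must
  be established as well; it follows from the bound on \<open>b'\<close>.\<close>

lemma B0_pos:
  assumes b'm: "b' \<in> borel_measurable borel" and b': "\<And>c. b' c \<le> Cb * \<bar>c\<bar>" "\<And>c. 0 \<le> b' c"
    and M: "negligible M" "M \<subseteq> {0<..<1}" and eq: "\<And>c. 0 < c \<Longrightarrow> c < 1 \<Longrightarrow> c \<notin> M \<Longrightarrow> b' c = b c"
    and pos: "\<And>c. 0 < c \<Longrightarrow> c < 1 \<Longrightarrow> 0 < b c"
  shows "0 < B0 b"
proof -
  note [measurable] = b'm
  have Cb: "0 \<le> Cb" using order_trans[OF b'(2) b'(1)[of 1]] by simp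
  let ?f = "\<lambda>\<theta>. indicator {0<..<pi/2} \<theta> *\<^sub>R (b (cos \<theta>) * sin \<theta>)"
  let ?g = "\<lambda>\<theta>. indicator {0<..<pi/2} \<theta> *\<^sub>R (b' (cos \<theta>) * sin \<theta>)"
  have "arccos differentiable_on M"
    unfolding differentiable_on_def
  proof
    fix c assume c: "c \<in> M"
    then have "(arccos has_field_derivative inverse (- sqrt (1 - c\<^sup>2))) (at c)"
      using M(2) by (intro DERIV_arccos) auto
    then show "arccos differentiable at c within M"
      using differentiable_at_withinI field_differentiable_def field_differentiable_imp_differentiable by blast
  qed
  \<comment> \<open>The exceptional set of cosines is pulled back to angles by the differentiable
    inverse \<open>arccos\<close>.\<close>
  then have "negligible (arccos ` M)" by (intro negligible_differentiable_image_negligible M) auto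
  then have nin: "AE \<theta> in lborel. \<theta> \<notin> arccos ` M" by (rule negligible_AE_notin)
  have cosr: "0 < cos \<theta>" "cos \<theta> < 1" "0 < sin \<theta>" "arccos (cos \<theta>) = \<theta>" if "0 < \<theta>" "\<theta> < pi / 2" for \<theta>
  proof -
    show "0 < cos \<theta>" using that by (intro cos_gt_zero_pi) auto
    show "cos \<theta> < 1" using that cos_monotone_0_pi[of 0 \<theta>] by simp
    show "0 < sin \<theta>" using that by (intro sin_gt_zero) auto
    show "arccos (cos \<theta>) = \<theta>" using that by (intro arccos_cos) auto
  qed
  have fg: "AE \<theta> in lborel. ?f \<theta> = ?g \<theta>"
    using nin
  proof eventually_elim
    case (elim \<theta>)
    show ?case
    proof (cases "0 < \<theta> \<and> \<theta> < pi/2")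
      case True
      then have "cos \<theta> \<notin> M" using elim cosr(4)[of \<theta>] by (metis imageI)
      then show ?thesis using True cosr[of \<theta>] eq[of "cos \<theta>"] by simp
    qed auto
  qed
  have gm: "?g \<in> borel_measurable borel" by measurable
  have fm: "?f \<in> borel_measurable lebesgue"
  proof (rule borel_measurable_AE[OF borel_imp_lebesgue[OF gm]])
    show "AE \<theta> in lebesgue. ?g \<theta> = ?f \<theta>"
      unfolding AE_lebesgue_iff using fg by eventually_elim (rule sym)
  qed
  have "(LINT \<theta>|lebesgue. ?f \<theta>) = (LINT \<theta>|lebesgue. ?g \<theta>)"
    using fg by (intro integral_cong_AE fm borel_imp_lebesgue gm) (simp add: AE_lebesgue_iff)
  also have "\<dots> = (LINT \<theta>|lborel. ?g \<theta>)" by (rule integral_completion) (use gm in simp)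
  also have "0 < \<dots>"
  proof -
    have gi: "integrable lborel ?g"
    proof (rule Bochner_Integration.integrable_bound)
      show "integrable lborel (\<lambda>\<theta>. indicator {0<..<pi/2} \<theta> *\<^sub>R Cb)"
        by (intro integrable_scaleR_left integrable_real_indicator) auto
      show "AE \<theta> in lborel. norm (?g \<theta>) \<le> norm (indicator {0<..<pi/2} \<theta> *\<^sub>R Cb)"
      proof (intro AE_I2)
        fix \<theta> :: real
        have "b' (cos \<theta>) \<le> Cb * 1"
          using b'(1)[of "cos \<theta>"] mult_left_mono[OF abs_cos_le_one Cb, of \<theta>] by linarith
        then have "b' (cos \<theta>) * \<bar>sin \<theta>\<bar> \<le> (Cb * 1) * 1"
          by (rule mult_mono) (use Cb in auto)
        then show "norm (?g \<theta>) \<le> norm (indicator {0<..<pi/2} \<theta> *\<^sub>R Cb)"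
          using Cb b'(2)[of "cos \<theta>"] by (auto simp: abs_mult split: split_indicator)
      qed
    qed (use gm in simp)
    have g0: "AE \<theta> in lborel. 0 \<le> ?g \<theta>"
    proof (intro AE_I2)
      fix \<theta> :: real
      show "0 \<le> ?g \<theta>" using b'(2)[of "cos \<theta>"] cosr(3)[of \<theta>] by (auto split: split_indicator)
    qed
    have "(LINT \<theta>|lborel. ?g \<theta>) \<noteq> 0"
    proof
      assume "(LINT \<theta>|lborel. ?g \<theta>) = 0"
      then have "AE \<theta> in lborel. ?g \<theta> = 0"
        using integral_nonneg_eq_0_iff_AE[OF gi g0] by simp
      then have "AE \<theta> in lborel. \<theta> \<notin> {0<..<pi/2}"
        using nin
      proof eventually_elim
        case (elim \<theta>)
        show ?case
        proof
          assume \<theta>: "\<theta> \<in> {0<..<pi/2}"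
          then have "cos \<theta> \<notin> M" using elim(2) cosr(4)[of \<theta>] by (metis greaterThanLessThan_iff imageI)
          then have "b' (cos \<theta>) = b (cos \<theta>)" using \<theta> cosr[of \<theta>] by (intro eq) auto
          then have "?g \<theta> > 0" using \<theta> cosr[of \<theta>] pos[of "cos \<theta>"] by simp
          then show False using elim(1) by linarith
        qed
      qed
      then have "emeasure lborel {0<..<pi/2} = 0"
        by (intro iffD1[OF AE_iff_measurable[of "{0<..<pi/2}" lborel "\<lambda>\<theta>. \<theta> \<notin> {0<..<pi/2}"]]) auto
      then show False by simp
    qed
    moreover have "0 \<le> (LINT \<theta>|lborel. ?g \<theta>)" using g0 by (rule integral_nonneg_AE)
    ultimately show ?thesis by simp
  qed
  finally show ?thesis by (simp add: B0_def set_lebesgue_integral_def)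
qed

section \<open>The collision frequency\<close>

lemma nu_lborel: "nu b \<gamma> v = pi powr (-3/2) * B0 b * (LINT u|lborel. norm (v - u) powr \<gamma> * exp (- (norm u)\<^sup>2))"
  unfolding nu_def by (subst integral_completion) auto

lemma nu_measurable: "nu b \<gamma> \<in> borel_measurable borel"
  unfolding nu_lborel[abs_def] by measurable

text \<open>\<open>norm_powr_le_sing\<close> isolates the singularity at u = v; the Gaussian absorbs
  the growth in u, and \<beta> < 3 makes the rest integrable.\<close>

lemma nu_integrable:
  assumes \<beta>: "0 < \<beta>" "\<beta> < 3" "- \<gamma> \<le> \<beta>"
  shows "integrable lborel (\<lambda>u::r3. norm (v - u) powr \<gamma> * exp (- (norm u)\<^sup>2))"
proof (rule integrableI_bounded)
  define r where "r = \<gamma> + \<beta> + 4"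
  have r: "0 \<le> r" using \<beta> by (simp add: r_def)
  define K where "K = (1 + norm v) powr r * exp (r\<^sup>2 / (4 * 1))"
  have "(\<integral>\<^sup>+u. ennreal (norm (norm (v - u) powr \<gamma> * exp (- (norm u)\<^sup>2))) \<partial>lborel) \<le> (\<integral>\<^sup>+u. ennreal K * (ennreal (sing \<beta> 4 (u - v)) * ennreal 1) \<partial>lborel)"
  proof (intro nn_integral_mono)
    fix u :: r3
    have "norm (v - u) powr \<gamma> * exp (- (norm u)\<^sup>2) \<le> sing \<beta> 4 (v - u) * ((1 + norm v) powr r * (1 + norm u) powr r) * exp (- 1 * (norm u)\<^sup>2)"
      unfolding r_def using \<beta> norm_powr_le_sing[of \<gamma> \<beta> 4 v u] by (simp add: mult_right_mono)
    also have "\<dots> = sing \<beta> 4 (v - u) * (1 + norm v) powr r * ((1 + norm u) powr r * exp (- 1 * (norm u)\<^sup>2))" by (simp only: mult_ac)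
    also have "\<dots> \<le> sing \<beta> 4 (v - u) * (1 + norm v) powr r * exp (r\<^sup>2 / (4 * 1))"
      using r by (intro mult_left_mono gauss_poly_bound) (auto simp: sing_nonneg)
    also have "\<dots> = K * sing \<beta> 4 (u - v)" by (simp add: K_def sing_def norm_minus_commute mult_ac)
    finally show "ennreal (norm (norm (v - u) powr \<gamma> * exp (- (norm u)\<^sup>2))) \<le> ennreal K * (ennreal (sing \<beta> 4 (u - v)) * ennreal 1)"
      by (simp add: ennreal_mult[symmetric] sing_nonneg K_def ennreal_leI)
  qed
  also have "\<dots> = ennreal K * (\<integral>\<^sup>+u. ennreal (sing \<beta> 4 (u - v)) * ennreal 1 \<partial>lborel)"
    by (rule nn_integral_cmult) measurable
  also have "(\<integral>\<^sup>+u. ennreal (sing \<beta> 4 (u - v)) * ennreal 1 \<partial>lborel) \<le> ennreal (2 powr (\<beta> + 4 + 1) * (1 / (3 - \<beta>) + 1 / (\<beta> + 4 - 3)) * unit_ball_vol 3)"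
    by (rule sing_integral_powr) (use \<beta> ball_volume_bound[of _ "\<lambda>_. 1"] in auto)
  also have "ennreal K * \<dots> < \<infinity>" by (simp add: ennreal_mult_less_top)
  finally show "(\<integral>\<^sup>+u. ennreal (norm (norm (v - u) powr \<gamma> * exp (- (norm u)\<^sup>2))) \<partial>lborel) < \<infinity>"
    by (simp add: mult_left_mono)
qed measurable

text \<open>The integrand is bounded below on a set of volume at least that of the unit ball. For
  \<gamma> < 0 this is the unit ball around 0, where |v-u| <= 1 + |v|; for \<gamma> >= 0 it must
  stay away from v, and only the constant 1 is claimed. This is the origin of the minimum.\<close>

lemma nu_lower_bound:
  assumes \<beta>: "0 < \<beta>" "\<beta> < 3" "- \<gamma> \<le> \<beta>" and B: "0 < B0 b"
  obtains c where "0 < c" "\<And>v. c * min 1 (vweight \<gamma> v) \<le> nu b \<gamma> v"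
proof -
  define \<omega> where "\<omega> = unit_ball_vol (3::real)"
  have \<omega>: "0 < \<omega>" by (simp add: \<omega>_def)
  have vol: "measure lborel (ball (x::r3) r) = \<omega> * r ^ 3" if "0 \<le> r" for x r
    using content_ball[of r x] that by (simp add: \<omega>_def)
  have low: "exp (- 4) * \<omega> * min 1 (vweight \<gamma> v) \<le> (LINT u|lborel. norm (v - u) powr \<gamma> * exp (- (norm u)\<^sup>2))" for v :: r3
  proof -
    note int = nu_integrable[OF \<beta>, of v]
    obtain S where S: "S \<in> sets borel" "emeasure lborel S < \<infinity>" "\<omega> \<le> measure lborel S"
      "\<And>u. u \<in> S \<Longrightarrow> u \<noteq> v \<Longrightarrow> exp (- 4) * min 1 (vweight \<gamma> v) \<le> norm (v - u) powr \<gamma> * exp (- (norm u)\<^sup>2)"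
    proof (cases "\<gamma> < 0")
      case True
      show ?thesis
      proof (rule that[of "ball 0 1"])
        show "emeasure lborel (ball (0::r3) 1) < \<infinity>" by (rule emeasure_lborel_ball_finite)
        show "\<omega> \<le> measure lborel (ball (0::r3) 1)" by (simp add: vol)
        fix u :: r3 assume u: "u \<in> ball 0 1" "u \<noteq> v"
        then have "norm (v - u) \<le> 1 + norm v" using norm_triangle_ineq4[of v u] by simp
        then have "vweight \<gamma> v \<le> norm (v - u) powr \<gamma>"
          unfolding vweight_def using True u by (intro powr_mono2') auto
        moreover have "(norm u)\<^sup>2 \<le> 4" using u power_mono[of "norm u" 2 2] by simp
        then have "exp (- 4) \<le> exp (- (norm u)\<^sup>2)" by simp
        ultimately have "vweight \<gamma> v * exp (- 4) \<le> norm (v - u) powr \<gamma> * exp (- (norm u)\<^sup>2)"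
          by (intro mult_mono) auto
        moreover have "exp (- 4) * min 1 (vweight \<gamma> v) \<le> vweight \<gamma> v * exp (- 4)"
          unfolding mult.commute[of "exp (- 4)"] by (intro mult_right_mono) auto
        ultimately show "exp (- 4) * min 1 (vweight \<gamma> v) \<le> norm (v - u) powr \<gamma> * exp (- (norm u)\<^sup>2)" by (rule order_trans[rotated])
      qed simp
    next
      case False
      show ?thesis
      \<comment> \<open>Removing the unit ball around v leaves volume at least (8 - 1) times that of
        the unit ball, wherever v is, and distance at least 1 from v. Points have norm below 2,
        hence exp(-4).\<close>
      proof (rule that[of "ball 0 2 - ball v 1"])
        have f: "emeasure lborel (ball (x::r3) r) < \<infinity>" for x r by (rule emeasure_lborel_ball_finite)
        show "emeasure lborel (ball 0 2 - ball v 1) < \<infinity>"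
          using emeasure_mono[of "ball 0 2 - ball v 1" "ball 0 2" lborel] f[of 0 2] by (auto elim: order_le_less_trans)
        have fm: "ball (x::r3) r \<in> fmeasurable lborel" for x r using f[of x r] by (intro fmeasurableI) auto
        have "measure lborel (ball (0::r3) 2) - measure lborel (ball v 1) \<le> measure lborel (ball 0 2 - ball v 1)"
        proof -
          have "measure lborel (ball (0::r3) 2) \<le> measure lborel ((ball 0 2 - ball v 1) \<union> ball v 1)"
            by (rule measure_mono_fmeasurable) (auto intro!: fmeasurable.Un fmeasurable_Diff fm)
          also have "\<dots> \<le> measure lborel (ball 0 2 - ball v 1) + measure lborel (ball v 1)"
            by (intro measure_Un_le) auto
          finally show ?thesis by simp
        qed
        then show "\<omega> \<le> measure lborel (ball 0 2 - ball v 1)" using \<omega> by (simp add: vol)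
        fix u :: r3 assume u: "u \<in> ball 0 2 - ball v 1" "u \<noteq> v"
        then have "1 \<le> norm (v - u)" by (simp add: dist_norm)
        then have "1 \<le> norm (v - u) powr \<gamma>" using False by (intro ge_one_powr_ge_zero) auto
        moreover have "(norm u)\<^sup>2 \<le> 4" using u power_mono[of "norm u" 2 2] by simp
        then have "exp (- 4) \<le> exp (- (norm u)\<^sup>2)" by simp
        ultimately have "1 * exp (- 4) \<le> norm (v - u) powr \<gamma> * exp (- (norm u)\<^sup>2)"
          by (intro mult_mono) auto
        moreover have "exp (- 4) * min 1 (vweight \<gamma> v) \<le> exp (- 4) * 1" by (intro mult_left_mono) auto
        ultimately show "exp (- 4) * min 1 (vweight \<gamma> v) \<le> norm (v - u) powr \<gamma> * exp (- (norm u)\<^sup>2)" by linarith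
      qed simp
    qed
    let ?k = "exp (- 4) * min 1 (vweight \<gamma> v)"
    have k0: "0 \<le> ?k" using vweight_pos[of \<gamma> v] by (simp add: less_imp_le)
    have "exp (- 4) * \<omega> * min 1 (vweight \<gamma> v) = ?k * \<omega>" by simp
    also have "\<dots> \<le> ?k * measure lborel S" using k0 S(3) by (intro mult_left_mono)
    also have "\<dots> = (LINT u|lborel. indicator S u *\<^sub>R ?k)"
      using S(1,2) by simp
    also have "\<dots> \<le> (LINT u|lborel. norm (v - u) powr \<gamma> * exp (- (norm u)\<^sup>2))"
    proof (rule integral_mono_AE[OF _ int])
      show "integrable lborel (\<lambda>u. indicator S u *\<^sub>R ?k)"
        using S by (intro integrable_scaleR_left integrable_real_indicator) auto
      show "AE u in lborel. indicator S u *\<^sub>R ?k \<le> norm (v - u) powr \<gamma> * exp (- (norm u)\<^sup>2)"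
        using AE_lborel_singleton[of v]
        by eventually_elim (use S(4) in \<open>auto split: split_indicator\<close>)
    qed
    finally show ?thesis .
  qed
  show ?thesis
  proof (rule that[of "pi powr (-3/2) * B0 b * (exp (- 4) * \<omega>)"])
    show "0 < pi powr (-3/2) * B0 b * (exp (- 4) * \<omega>)" using B \<omega> by simp
    fix v
    show "pi powr (-3/2) * B0 b * (exp (- 4) * \<omega>) * min 1 (vweight \<gamma> v) \<le> nu b \<gamma> v"
      unfolding nu_lborel using mult_left_mono[OF low[of v], of "pi powr (-3/2) * B0 b"] B
      by (simp add: mult.assoc)
  qed
qed

theorem lemma3p1:
  fixes b :: "real \<Rightarrow> real" and C\<^sub>b \<alpha> \<gamma> \<epsilon> s :: real
  assumes "b \<in> borel_measurable (lebesgue_on {0<..<1})"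
    and "C\<^sub>b > 0"
    and "\<And>\<theta>. 0 < \<theta> \<Longrightarrow> \<theta> < pi/2 \<Longrightarrow> 0 < b (cos \<theta>) \<and> b (cos \<theta>) \<le> C\<^sub>b * cos \<theta>"
    and "0 \<le> \<alpha>" and "\<alpha> < 1/2"
    and "-3 < \<gamma>" and "\<gamma> \<le> 1"
    and "0 < \<epsilon>" and "\<epsilon> < 1/2"
    and "0 \<le> s"
  shows
    "(\<forall>h\<in>L2Hs \<gamma> s.
        (AE p in lebesgue. integrable lebesgue (K_integrand b \<gamma> \<alpha> h p)) \<and>
        (AE p in lebesgue. set_integrable lebesgue {0<..} (S_integrand b \<gamma> (K_op b \<gamma> \<alpha> h) p))) \<and>
     bounded_L2Hs_operator \<gamma> s (s + s2 \<epsilon> \<gamma>) (\<lambda>h. S_op b \<gamma> (K_op b \<gamma> \<alpha> h))"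
proof -
  \<comment> \<open>The hypothesis on \<open>b\<close> is stated in terms of angles;
    \<open>arccos\<close> restates it for every argument between 0 and 1.\<close>
  have pos: "0 < b c \<and> b c \<le> C\<^sub>b * c" if c: "0 < c" "c < 1" for c
  proof -
    have "0 < arccos c" "arccos c < pi / 2"
      using c arccos_less_mono[of 1 c] arccos_less_mono[of c 0] by auto
    from assms(3)[OF this] show ?thesis using c by simp
  qed
  obtain b' M where b'm [measurable]: "b' \<in> borel_measurable borel" and b'0: "\<And>c. 0 \<le> b' c" and b'le: "\<And>c. b' c \<le> \<bar>C\<^sub>b\<bar> * \<bar>c\<bar>"
    and M: "negligible M" "M \<subseteq> {0<..<1}" and eq: "\<And>c. 0 < c \<Longrightarrow> c < 1 \<Longrightarrow> c \<notin> M \<Longrightarrow> b' c = b c"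
    using angular_borel_version[OF assms(1) pos] by blast
  have B: "0 < B0 b" by (rule B0_pos[OF b'm b'le b'0 M eq]) (use pos in auto)
  \<comment> \<open>The singularity is at least \<open>- \<gamma>\<close>. The exponent 2 is avoided because the averaging estimate
    has a logarithmic loss there; this is where \<open>\<epsilon>\<close> enters.\<close>
  define \<beta> where "\<beta> = (if -2 < \<gamma> then max (- \<gamma>) (3/2) else if \<gamma> = -2 then 2 + 2 * \<epsilon> else - \<gamma>)"
  have \<beta>: "1 < \<beta>" "\<beta> < 3" "\<beta> \<noteq> 2" "- \<gamma> \<le> \<beta>"
    using assms by (auto simp: \<beta>_def)
  \<comment> \<open>For \<gamma> > -2 the value of \<beta> is below 2 and the minimum is 1/2; at
    \<gamma> = -2 it is (3 - 2 - 2\<epsilon>)/2 = 1/2 - \<epsilon>; below that it is (3 +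
    \<gamma>)/2.\<close>
  have \<sigma>: "s2 \<epsilon> \<gamma> = min (1/2) ((3 - \<beta>) / 2)"
    using assms by (auto simp: \<beta>_def s2_def min_def field_simps)
  obtain K2 where K2: "0 \<le> K2"
    "\<And>v u. v \<noteq> u \<Longrightarrow> \<bar>exp (\<alpha> * (norm v)\<^sup>2) * k2_borel b' \<gamma> v u * exp (- \<alpha> * (norm u)\<^sup>2)\<bar> \<le> K2 * vweight (\<gamma> - 1) v * sing \<beta> 8 (v - u)"
    using k2_part_bound[OF b'm b'0 b'le assms(7) \<beta>(1,4) assms(4,5)] by blast
  obtain K1 where K1: "0 \<le> K1"
    "\<And>v u. \<bar>exp (\<alpha> * (norm v)\<^sup>2) * k1 b \<gamma> v u * exp (- \<alpha> * (norm u)\<^sup>2)\<bar> \<le> K1 * vweight (\<gamma> - 1) v * sing \<beta> 8 (v - u)"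
    using k1_part_bound[of b \<gamma> \<beta> \<alpha>] B assms \<beta> by (metis less_imp_le)
  \<comment> \<open>The value 0 on the diagonal matches that of \<open>sing\<close>, so the kernel
    bound holds for all pairs of velocities.\<close>
  define k where "k v u = (if v = u then 0 else exp (\<alpha> * (norm v)\<^sup>2) * (k2_borel b' \<gamma> v u - k1 b \<gamma> v u) * exp (- \<alpha> * (norm u)\<^sup>2))" for v u
  obtain c where c: "0 < c" "\<And>v. c * min 1 (vweight \<gamma> v) \<le> nu b \<gamma> v"
    using nu_lower_bound[OF _ \<beta>(2,4) B] \<beta>(1) by auto
  have "\<exists>C. averaging_kernel k (nu b \<gamma>) \<gamma> (s2 \<epsilon> \<gamma>) C"
  proof (rule averaging_kernelI[where ?C1.0 = "K1 + K2" and \<beta> = \<beta> and c = c, OF _ nu_measurable _ \<beta>(2,3) _ assms(7) \<sigma> c])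
    show "(\<lambda>p. k (fst p) (snd p)) \<in> borel_measurable (borel \<Otimes>\<^sub>M borel)"
      unfolding k_def k1_def by measurable
    show "\<bar>k v u\<bar> \<le> (K1 + K2) * vweight (\<gamma> - 1) v * sing \<beta> 8 (v - u)" for v u
    proof (cases "v = u")
      case True
      then show ?thesis using K1(1) K2(1) vweight_pos[of "\<gamma> - 1" v] by (simp add: k_def sing_nonneg)
    next
      case False
      have "k v u = exp (\<alpha> * (norm v)\<^sup>2) * k2_borel b' \<gamma> v u * exp (- \<alpha> * (norm u)\<^sup>2) - exp (\<alpha> * (norm v)\<^sup>2) * k1 b \<gamma> v u * exp (- \<alpha> * (norm u)\<^sup>2)"
        using False by (simp add: k_def algebra_simps)
      then have "\<bar>k v u\<bar> \<le> K2 * vweight (\<gamma> - 1) v * sing \<beta> 8 (v - u) + K1 * vweight (\<gamma> - 1) v * sing \<beta> 8 (v - u)"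
        using K2(2)[OF False] K1(2)[of v u] by linarith
      then show ?thesis by (simp add: algebra_simps)
    qed
  qed (use \<beta> K1 K2 assms in auto)
  then obtain C where "averaging_kernel k (nu b \<gamma>) \<gamma> (s2 \<epsilon> \<gamma>) C" ..
  then interpret averaging_kernel k "nu b \<gamma>" \<gamma> "s2 \<epsilon> \<gamma>" C .
  interpret collision_kernel k "nu b \<gamma>" \<gamma> "s2 \<epsilon> \<gamma>" C b \<alpha>
    by unfold_locales (simp_all add: k_alpha_def k_def k2_eq_borel[OF b'm M eq])
  show ?thesis by (rule SK_bounded[OF assms(10)])
qed

end
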